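(* Let $(\Gamma,Z,\Omega)$ be a refined BPS structure which is finite, uncoupled, palindromic and integral, with a quadratic refinement $\sigma$ such that $\Omega_n(\gamma)\ne0\Rightarrow\sigma(\gamma)=(-1)^{n+1}$, and a fixed decomposition $\Gamma=\Gamma_e\oplus\Gamma_m$ such that $\Omega(\gamma)=0$ unless $\gamma\in\Gamma_e$ and the form $\langle-,-\rangle$ vanishes on $\Gamma_e$ and on $\Gamma_m$. For each non-active ray $r\subset\mathbb{C}^*$, with $\mathbb{H}_r$ the open half-plane centred on $r$, and each $t\in\mathbb{H}_r$, let $\Psi_r(t)$ be the automorphism of $\widehat{\mathbb{C}_q[\mathbb{T}]}$ which acts trivially on the zeroth graded piece and satisfies, for $\beta\in\Gamma_m$, $$\Psi_r(t)(y_\beta)=\prod_{Z(\gamma)\in i\mathbb{H}_r}\ \prod_{\lambda\in\kappa(\beta,\gamma)}\ \prod_{n\in\mathbb{Z}}\Lambda\Big(\frac{Z(\gamma)}{2\pi it},\ \frac{1+n}{2}-\theta(\gamma)-\tfrac12(\lambda+n)\tau\ \Big|\ 1\Big)^{(-1)^n\,\Omega_n(\gamma)\,\epsilon(\beta,\gamma)}\cdot y_\beta,$$ where the outer product is over the finitely many active classes $\gamma\in\Gamma_e$ (i.e. $\Omega(\gamma)\neq0$) with $Z(\gamma)\in i\mathbb{H}_r$. Then the functions $\Phi_r(t)=\Psi_r(t)\circ\epsilon_Z(t)^{-1}$ form a solution to the quantum Riemann–Hilbert problem associated to $(\Gamma,Z,\Omega)$; that is, the maps $\Phi_r\colon\mathbb{H}_r\to\operatorname{Aut}\widehat{\mathbb{C}_q[\mathbb{T}]}$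 are meromorphic and: (i) if $\ell$ is an active ray and $r_+$ (respectively $r_-$) is a sufficiently small clockwise (respectively anti-clockwise) perturbation of $\ell$, then $\Phi_{r_+}(t)=\Phi_{r_-}(t)\circ\mathbb{S}_q(\ell)$ for $t\in\mathbb{H}_{r_+}\cap\mathbb{H}_{r_-}$; and if $r_1,r_2$ are non-active rays bounding a sector of angle less than $\pi$ which contains no active rays, then $\Phi_{r_1}=\Phi_{r_2}$ on $\mathbb{H}_{r_1}\cap\mathbb{H}_{r_2}$; (ii) as $t\to0$ in $\mathbb{H}_r$, $\Phi_r(t)\circ\epsilon_Z(t)\to\operatorname{id}$; (iii) $\Phi_r(t)$ has bounded growth at infinity in $\mathbb{H}_r$.
   Context: A refined BPS structure $(\Gamma,Z,\Omega)$ consists of a finite-rank free abelian group $\Gamma$ with a skew-symmetric form $\langle-,-\rangle\colon\Gamma\times\Gamma\to\mathbb{Z}$, a homomorphism $Z\colon\Gamma\to\mathbb{C}$, and a map $\Omega\colon\Gamma\to\mathbb{Q}[\mathbb{L}^{\pm1/2}]$, $\Omega(\gamma)=\sum_n\Omega_n(\gamma)(\mathbb{L}^{1/2})^n$, with $\Omega(-\gamma)=\Omega(\gamma)$, $\Omega(0)=0$, and the support property: for a norm $\|\cdot\|$ on $\Gamma\otimes\mathbb{R}$ there is $C>0$ with $\Omega(\gamma)\ne0\Rightarrow|Z(\gamma)|>C\|\gamma\|$. It is finite if $\Omega(\gamma)=0$ for all but finitely many $\gamma$; uncoupled if $\Omega(\gamma_1)\ne0\ne\Omega(\gamma_2)\Rightarrow\langle\gamma_1,\gamma_2\rangle=0$;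 palindromic if $\Omega_n(\gamma)=\Omega_{-n}(\gamma)$; integral if all $\Omega_n(\gamma)\in\mathbb{Z}$. A ray is a set $\mathbb{R}_{>0}\cdot c$, $c\in\mathbb{C}^*$; active rays are $\mathbb{R}_{>0}Z(\gamma)$ with $\Omega(\gamma)\ne0$. A quadratic refinement is a map $\sigma\colon\Gamma\to\{\pm1\}$ with $\sigma(\gamma_1+\gamma_2)=(-1)^{\langle\gamma_1,\gamma_2\rangle}\sigma(\gamma_1)\sigma(\gamma_2)$. Extended quantum torus: let $\mathcal{H}$ be the open upper half-plane, $V_e=\operatorname{Hom}_{\mathbb{Z}}(\Gamma_e,\mathbb{C})$ with typical element $\theta$, $\mathcal{M}(\mathcal{H}\times V_e)$ the field of meromorphic functions $f(\tau,\theta)$, and $\widehat{\mathbb{C}_q[\mathbb{T}]}=\bigoplus_{\delta\in\Gamma_m}\mathcal{M}(\mathcal{H}\times V_e)\cdot y_\delta$ with product $(f_1(\tau,\theta)y_{\delta_1})*(f_2(\tau,\theta)y_{\delta_2})=f_1(\tau,\theta)f_2(\tau,\theta+\tau\langle\delta_1,-\rangle)\,y_{\delta_1+\delta_2}$. It is graded by $\Gamma_m$; the zeroth graded piece is $\mathcal{M}(\mathcal{H}\times V_e)\cdot1$. One identifies $q^{1/2}=e^{\pi i\tau}$ and $y_\gamma=e^{2\pi i\theta(\gamma)}$ for $\gamma\in\Gamma_e$. (These correspond to generators of the quantum torus $x_{\gamma_1}*x_{\gamma_2}=\mathbb{L}^{\frac12\langle\gamma_1,\gamma_2\rangle}x_{\gamma_1+\gamma_2}$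 via $q^{1/2}=-\mathbb{L}^{1/2}$, $y_\gamma=\sigma(\gamma)x_\gamma$.) The automorphism $\epsilon_Z(t)$ is $f(\tau,\theta)\,y_\delta\mapsto e^{Z(\delta)/t}f\big(\tau,\theta+\tfrac{1}{2\pi it}Z|_{\Gamma_e}\big)\,y_\delta$. With $\mathbb{E}_q(x)=\prod_{k\ge0}(1-q^kx)$ $(|q|<1)$, set for each active ray $\ell$ $$\mathrm{DT}_q(\ell)=\prod_{Z(\gamma)\in\ell}\prod_{n\in\mathbb{Z}}\mathbb{E}_q\big((-q^{1/2})^{n+1}y_\gamma\big)^{(-1)^{n-1}\Omega_n(\gamma)},\qquad\mathbb{S}_q(\ell)=\operatorname{Ad}_{\mathrm{DT}_q(\ell)},\quad\operatorname{Ad}_g(a)=g*a*g^{-1},$$ the product being over active classes $\gamma$. For $\beta,\gamma\in\Gamma$, $\epsilon(\beta,\gamma)\in\{\pm1\}$ is the sign of $\langle\beta,\gamma\rangle$ and $\kappa(\beta,\gamma)=\{\epsilon(\beta,\gamma)(2j+1):0\le j<|\langle\beta,\gamma\rangle|\}$ (empty if $\langle\beta,\gamma\rangle=0$). For $w\in\mathbb{C}^*\setminus\mathbb{R}_{<0}$, $\eta\in\mathbb{C}$: $\Lambda(w,\eta|1)=\Gamma(w+\eta)e^w(2\pi)^{-1/2}w^{\frac12-\eta-w}$ (principal branch). Maps. For a domain $D\subset\mathbb{C}$, a meromorphic map $f\colon D\to\widehat{\mathbb{C}_q[\mathbb{T}]}$ is a finite sum $\sum_\delta f_\delta(\tau,\theta,t)y_\delta$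 with $f_\delta$ meromorphic on $\mathcal{H}\times V_e\times D$. For $t_0\in\overline D$, $f(t)\to g=\sum_\delta g_\delta y_\delta$ as $t\to t_0$ means $f_\delta(\tau,\theta,t)\to g_\delta(\tau,\theta)$ for every $\delta$ and every $(\tau,\theta)$ at which $g_\delta$ is holomorphic. If $D$ is unbounded, $f$ has bounded growth at infinity if for every $\delta$ and $(\tau,\theta)$ such that $\{(\tau,\theta)\}\times D$ is not contained in the polar set of $f_\delta$ and $f_\delta(\tau,\theta,\cdot)\not\equiv0$ there is $k>0$ with $|t|^{-k}<|f_\delta(\tau,\theta,t)|<|t|^k$ for $t\in D$, $|t|\gg0$. A map $\phi\colon D\to\operatorname{Aut}\widehat{\mathbb{C}_q[\mathbb{T}]}$ has one of these properties if $t\mapsto\phi(t)(a)$ does for every $a\in\widehat{\mathbb{C}_q[\mathbb{T}]}$ (for limits, with limit the image of $a$ under the limiting automorphism). *)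

theory Defs
  imports "HOL-Complex_Analysis.Complex_Analysis" "HOL-Library.Poly_Mapping"
begin

section \<open>Complex normed spaces and holomorphic functions of several variables\<close>

class complex_normed_space = real_normed_vector +
  fixes scaleC :: "complex \<Rightarrow> 'a \<Rightarrow> 'a"
  assumes scaleC_add_right: "scaleC a (x + y) = scaleC a x + scaleC a y"
    and scaleC_add_left: "scaleC (a + b) x = scaleC a x + scaleC b x"
    and scaleC_scaleC: "scaleC a (scaleC b x) = scaleC (a * b) x"
    and scaleC_of_real: "scaleC (complex_of_real r) x = scaleR r x"
    and norm_scaleC: "norm (scaleC a x) = cmod a * norm x"

instantiation complex :: complex_normed_space
begin

definition scaleC_complex :: "complex \<Rightarrow> complex \<Rightarrow> complex"
  where "scaleC_complex a x = a * x"

instance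
  by standard (auto simp: scaleC_complex_def algebra_simps norm_mult scaleR_conv_of_real)

end

instantiation prod :: (complex_normed_space, complex_normed_space) complex_normed_space
begin

definition scaleC_prod :: "complex \<Rightarrow> 'a \<times> 'b \<Rightarrow> 'a \<times> 'b"
  where "scaleC_prod a p = (scaleC a (fst p), scaleC a (snd p))"

instance
proof
  fix a :: complex and x :: "'a \<times> 'b"
  have "(cmod a * norm (fst x))\<^sup>2 + (cmod a * norm (snd x))\<^sup>2
      = (cmod a)\<^sup>2 * ((norm (fst x))\<^sup>2 + (norm (snd x))\<^sup>2)"
    by (simp add: algebra_simps power_mult_distrib)
  then show "norm (scaleC a x) = cmod a * norm x"
    by (simp add: scaleC_prod_def norm_prod_def norm_scaleC real_sqrt_mult)
qed (auto simp: scaleC_prod_def scaleC_add_right scaleC_add_left scaleC_scaleC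
       scaleC_of_real scaleR_prod_def)

end

definition holo_on :: "'a::complex_normed_space set \<Rightarrow> ('a \<Rightarrow> complex) \<Rightarrow> bool"
  where "holo_on S f \<longleftrightarrow> open S \<and>
    (\<forall>x\<in>S. \<exists>D. (f has_derivative D) (at x) \<and> (\<forall>c v. D (scaleC c v) = c * D v))"

definition nowhere_dense :: "'a::topological_space set \<Rightarrow> bool"
  where "nowhere_dense N \<longleftrightarrow> interior (closure N) = {}"

text \<open>Meromorphic functions on \<open>S\<close> are represented by total functions, whose values on the zero
  sets of the local denominators are arbitrary; two representatives denote the same meromorphic
  function iff they differ on a nowhere dense set only.\<close>

definition mero_on :: "'a::complex_normed_space set \<Rightarrow> ('a \<Rightarrow> complex) \<Rightarrow> bool"
  where "mero_on S f \<longleftrightarrow> (\<forall>p\<in>S. \<exists>U g h. p \<in> U \<and> U \<subseteq> S \<and> holo_on U g \<and> holo_on U h \<and>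
    nowhere_dense {x\<in>U. h x = 0} \<and> (\<forall>x\<in>U. h x \<noteq> 0 \<longrightarrow> f x = g x / h x))"

definition extends_at :: "('a::complex_normed_space \<Rightarrow> complex) \<Rightarrow> 'a \<Rightarrow> complex \<Rightarrow> bool"
  where "extends_at f p c \<longleftrightarrow>
    (\<exists>U g. p \<in> U \<and> holo_on U g \<and> nowhere_dense {x\<in>U. f x \<noteq> g x} \<and> g p = c)"

text \<open>\<open>regular_at f p\<close>: the meromorphic function represented by \<open>f\<close> is holomorphic at \<open>p\<close>, i.e.
  \<open>p\<close> is not in its polar set; \<open>value_at f p\<close> is then its value there.\<close>

definition regular_at :: "('a::complex_normed_space \<Rightarrow> complex) \<Rightarrow> 'a \<Rightarrow> bool"
  where "regular_at f p \<longleftrightarrow> (\<exists>c. extends_at f p c)"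

definition value_at :: "('a::complex_normed_space \<Rightarrow> complex) \<Rightarrow> 'a \<Rightarrow> complex"
  where "value_at f p = (THE c. extends_at f p c)"


subsection \<open>Basic facts\<close>

lemma nowhere_dense_iff:
  "nowhere_dense N \<longleftrightarrow> (\<forall>W. open W \<and> W \<noteq> {} \<longrightarrow> (\<exists>V. open V \<and> V \<noteq> {} \<and> V \<subseteq> W \<and> V \<inter> N = {}))"
proof
  assume N: "nowhere_dense N"
  show "\<forall>W. open W \<and> W \<noteq> {} \<longrightarrow> (\<exists>V. open V \<and> V \<noteq> {} \<and> V \<subseteq> W \<and> V \<inter> N = {})"
  proof (intro allI impI)
    fix W :: "'a set" assume W: "open W \<and> W \<noteq> {}"
    have "\<not> W \<subseteq> closure N"
      using N W interior_maximal[of W "closure N"] by (auto simp: nowhere_dense_def)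
    then show "\<exists>V. open V \<and> V \<noteq> {} \<and> V \<subseteq> W \<and> V \<inter> N = {}"
      using W closure_subset[of N] by (intro exI[of _ "W - closure N"]) auto
  qed
next
  assume *: "\<forall>W. open W \<and> W \<noteq> {} \<longrightarrow> (\<exists>V. open V \<and> V \<noteq> {} \<and> V \<subseteq> W \<and> V \<inter> N = {})"
  show "nowhere_dense N"
    unfolding nowhere_dense_def
  proof (rule ccontr)
    assume "interior (closure N) \<noteq> {}"
    with * obtain V where V: "open V" "V \<noteq> {}" "V \<subseteq> interior (closure N)" "V \<inter> N = {}"
      by (meson open_interior)
    then have "V \<inter> closure N = {}"
      by (simp add: open_Int_closure_eq_empty)
    with V interior_subset[of "closure N"] show False by blast
  qed
qed

lemma nowhere_dense_empty [simp]: "nowhere_dense {}"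
  by (simp add: nowhere_dense_def)

lemma nowhere_dense_subset: "nowhere_dense N \<Longrightarrow> M \<subseteq> N \<Longrightarrow> nowhere_dense M"
  unfolding nowhere_dense_iff by (meson disjoint_iff subsetD)

lemma nowhere_dense_Un: "nowhere_dense M \<Longrightarrow> nowhere_dense N \<Longrightarrow> nowhere_dense (M \<union> N)"
  unfolding nowhere_dense_def
  by (simp add: closure_Un interior_closed_Un_empty_interior)

lemma nowhere_dense_open:
  assumes "nowhere_dense N" "open W" "W \<subseteq> N" shows "W = {}"
  using assms unfolding nowhere_dense_iff by (metis Int_absorb2 subset_trans)

lemma nowhere_dense_local:
  assumes "\<And>p. p \<in> N \<Longrightarrow> \<exists>U. open U \<and> p \<in> U \<and> nowhere_dense (N \<inter> U)"
  shows "nowhere_dense N"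
  unfolding nowhere_dense_iff
proof (intro allI impI)
  fix W :: "'a set" assume W: "open W \<and> W \<noteq> {}"
  show "\<exists>V. open V \<and> V \<noteq> {} \<and> V \<subseteq> W \<and> V \<inter> N = {}"
  proof (cases "W \<inter> N = {}")
    case True
    then show ?thesis using W by blast
  next
    case False
    then obtain p where p: "p \<in> W" "p \<in> N" by blast
    obtain U where U: "open U" "p \<in> U" "nowhere_dense (N \<inter> U)" using assms p by blast
    have "open (W \<inter> U)" "W \<inter> U \<noteq> {}" using W U p by auto
    then obtain V where "open V" "V \<noteq> {}" "V \<subseteq> W \<inter> U" "V \<inter> (N \<inter> U) = {}"
      using U(3) unfolding nowhere_dense_iff by metis
    then show ?thesis by (intro exI[of _ V]) auto
  qed
qed

lemma nowhere_dense_vimage: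
  fixes T :: "'a::topological_space \<Rightarrow> 'b::topological_space"
  assumes N: "nowhere_dense N" and T: "continuous_on UNIV T" and R: "continuous_on UNIV R"
    and TR: "\<And>x. T (R x) = x" and RT: "\<And>x. R (T x) = x"
  shows "nowhere_dense (T -` N)"
  unfolding nowhere_dense_iff
proof (intro allI impI)
  fix W :: "'a set" assume W: "open W \<and> W \<noteq> {}"
  have "open (R -` W)" using R W by (simp add: open_vimage)
  moreover have "R -` W \<noteq> {}" using W RT by force
  ultimately obtain V where V: "open V" "V \<noteq> {}" "V \<subseteq> R -` W" "V \<inter> N = {}"
    using N unfolding nowhere_dense_iff by metis
  have "open (T -` V)" using T V by (simp add: open_vimage)
  moreover have "T -` V \<noteq> {}" using V(2) TR by (metis all_not_in_conv vimageI)
  moreover have "T -` V \<subseteq> W" using V(3) RT by force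
  ultimately show "\<exists>V. open V \<and> V \<noteq> {} \<and> V \<subseteq> W \<and> V \<inter> T -` N = {}"
    using V(4) by (intro exI[of _ "T -` V"]) auto
qed

lemma scaleC_zero_left [simp]: "scaleC 0 x = 0" for x :: "'a::complex_normed_space"
  using norm_scaleC[of 0 x] by simp

lemma scaleC_one [simp]: "scaleC 1 x = x" for x :: "'a::complex_normed_space"
  using scaleC_of_real[of 1 x] by simp

lemma scaleC_zero_right [simp]: "scaleC c 0 = (0::'a::complex_normed_space)"
  using norm_scaleC[of c "0::'a"] by simp

lemma bounded_linear_scaleC_left: "bounded_linear (\<lambda>z. scaleC z (v::'a::complex_normed_space))"
  by (rule bounded_linear_intro[where K = "norm v"])
     (simp_all add: scaleC_add_left norm_scaleC scaleR_conv_of_real scaleC_scaleC[symmetric]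
        scaleC_of_real)

lemma holo_on_open: "holo_on S f \<Longrightarrow> open S"
  by (simp add: holo_on_def)

lemma holo_on_subset: "holo_on S f \<Longrightarrow> open T \<Longrightarrow> T \<subseteq> S \<Longrightarrow> holo_on T f"
  unfolding holo_on_def by blast

lemma holo_on_continuous: "holo_on S f \<Longrightarrow> continuous_on S f"
  unfolding holo_on_def
  by (meson continuous_at_imp_continuous_on has_derivative_continuous)

lemma holo_on_const: "open S \<Longrightarrow> holo_on S (\<lambda>x. c)"
  unfolding holo_on_def by (auto intro!: exI[of _ "\<lambda>x. 0"])

lemma holo_on_add: "holo_on S f \<Longrightarrow> holo_on S g \<Longrightarrow> holo_on S (\<lambda>x. f x + g x)"
  unfolding holo_on_def
proof (intro conjI ballI; (elim conjE)?)
  fix x assume "\<forall>x\<in>S. \<exists>D. (f has_derivative D) (at x) \<and> (\<forall>c v. D (scaleC c v) = c * D v)"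
    "\<forall>x\<in>S. \<exists>D. (g has_derivative D) (at x) \<and> (\<forall>c v. D (scaleC c v) = c * D v)" "x \<in> S"
  then obtain D E where D: "(f has_derivative D) (at x)" "\<And>c v. D (scaleC c v) = c * D v"
    and E: "(g has_derivative E) (at x)" "\<And>c v. E (scaleC c v) = c * E v" by meson
  show "\<exists>D. ((\<lambda>x. f x + g x) has_derivative D) (at x) \<and> (\<forall>c v. D (scaleC c v) = c * D v)"
    using D E by (intro exI[of _ "\<lambda>v. D v + E v"]) (auto intro: has_derivative_add simp: algebra_simps)
qed

lemma holo_on_mult: "holo_on S f \<Longrightarrow> holo_on S g \<Longrightarrow> holo_on S (\<lambda>x. f x * g x)"
  unfolding holo_on_def
proof (intro conjI ballI; (elim conjE)?)
  fix x assume "\<forall>x\<in>S. \<exists>D. (f has_derivative D) (at x) \<and> (\<forall>c v. D (scaleC c v) = c * D v)"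
    "\<forall>x\<in>S. \<exists>D. (g has_derivative D) (at x) \<and> (\<forall>c v. D (scaleC c v) = c * D v)" "x \<in> S"
  then obtain D E where D: "(f has_derivative D) (at x)" "\<And>c v. D (scaleC c v) = c * D v"
    and E: "(g has_derivative E) (at x)" "\<And>c v. E (scaleC c v) = c * E v" by meson
  show "\<exists>D. ((\<lambda>x. f x * g x) has_derivative D) (at x) \<and> (\<forall>c v. D (scaleC c v) = c * D v)"
    using has_derivative_mult[OF D(1) E(1)] D(2) E(2)
    by (intro exI[of _ "\<lambda>v. f x * E v + D v * g x"]) (simp add: distrib_left mult.assoc mult.left_commute)
qed

lemma holo_on_comp:
  assumes g: "holo_on S g" and V: "open V" and TV: "\<And>x. x \<in> V \<Longrightarrow> T x \<in> S"
    and T: "\<And>x. x \<in> V \<Longrightarrow> \<exists>D. (T has_derivative D) (at x) \<and> (\<forall>c v. D (scaleC c v) = scaleC c (D v))"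
  shows "holo_on V (\<lambda>x. g (T x))"
  unfolding holo_on_def
proof (intro conjI ballI)
  fix x assume x: "x \<in> V"
  obtain D where D: "(T has_derivative D) (at x)" "\<And>c v. D (scaleC c v) = scaleC c (D v)"
    using T[OF x] by blast
  obtain E where E: "(g has_derivative E) (at (T x))" "\<And>c v. E (scaleC c v) = c * E v"
    using g TV[OF x] unfolding holo_on_def by blast
  show "\<exists>D. ((\<lambda>x. g (T x)) has_derivative D) (at x) \<and> (\<forall>c v. D (scaleC c v) = c * D v)"
    using has_derivative_compose[OF D(1) E(1)] D(2) E(2) by (intro exI[of _ "\<lambda>v. E (D v)"]) auto
qed (fact V)

lemma holo_on_complex: "holo_on S f \<longleftrightarrow> open S \<and> f holomorphic_on S"
proof (cases "open S")
  case True
  have "(\<exists>D. (f has_derivative D) (at x) \<and> (\<forall>c v. D (scaleC c v) = c * D v))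
      \<longleftrightarrow> f field_differentiable (at x)" for x
  proof
    assume "\<exists>D. (f has_derivative D) (at x) \<and> (\<forall>c v. D (scaleC c v) = c * D v)"
    then obtain D where D: "(f has_derivative D) (at x)" "\<And>c v. D (scaleC c v) = c * D v" by blast
    have "D c = D 1 * c" for c
      using D(2)[of c 1] unfolding scaleC_complex_def by (metis mult.commute mult.right_neutral)
    then have "D = (*) (D 1)" by blast
    with D(1) show "f field_differentiable (at x)"
      by (metis field_differentiable_def has_field_derivative_def)
  next
    assume "f field_differentiable (at x)"
    then obtain d where "(f has_derivative (*) d) (at x)"
      by (auto simp: field_differentiable_def has_field_derivative_def)
    then show "\<exists>D. (f has_derivative D) (at x) \<and> (\<forall>c v. D (scaleC c v) = c * D v)"
      by (intro exI[of _ "(*) d"]) (simp add: scaleC_complex_def mult.left_commute)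
  qed
  then show ?thesis
    using True unfolding holo_on_def holomorphic_on_def
    by (metis at_within_open)
qed (simp add: holo_on_def)

lemma holo_on_convex_identity:
  assumes g: "holo_on B g" and B: "convex B" and W: "open W" "W \<noteq> {}" "W \<subseteq> B"
    and zero: "\<And>x. x \<in> W \<Longrightarrow> g x = 0" and y: "y \<in> B"
  shows "g y = 0"
proof -
  obtain w where w: "w \<in> W" using W by blast
  define T where "T = (\<lambda>z. w + scaleC z (y - w))"
  define P where "P = T -` B"
  have lin: "bounded_linear (\<lambda>z. scaleC z (y - w))" by (rule bounded_linear_scaleC_left)
  have Tc: "continuous_on UNIV T"
    unfolding T_def by (intro continuous_intros linear_continuous_on lin)
  have P: "open P" unfolding P_def using Tc holo_on_open[OF g] by (simp add: open_vimage)
  have "convex P"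
    unfolding convex_def
  proof (intro ballI allI impI)
    fix a b and u v :: real assume ab: "a \<in> P" "b \<in> P" and uv: "0 \<le> u" "0 \<le> v" "u + v = 1"
    have w: "u *\<^sub>R w + v *\<^sub>R w = w" using uv by (simp flip: scaleR_add_left)
    have sc: "scaleC (r *\<^sub>R z) x = r *\<^sub>R scaleC z x" for r z and x :: 'a
      by (metis scaleC_of_real scaleC_scaleC scaleR_conv_of_real)
    have "u *\<^sub>R T a + v *\<^sub>R T b
        = (u *\<^sub>R w + v *\<^sub>R w) + (u *\<^sub>R scaleC a (y - w) + v *\<^sub>R scaleC b (y - w))"
      by (simp add: T_def scaleR_add_right algebra_simps)
    then have "T (u *\<^sub>R a + v *\<^sub>R b) = u *\<^sub>R T a + v *\<^sub>R T b"
      unfolding w by (simp add: T_def scaleC_add_left sc)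
    then show "u *\<^sub>R a + v *\<^sub>R b \<in> P"
      using ab uv B unfolding P_def convex_def by auto
  qed
  then have con: "connected P" by (rule convex_connected)
  have "holo_on P (\<lambda>z. g (T z))"
  proof (rule holo_on_comp[OF g P])
    fix z
    have "((\<lambda>z. w + scaleC z (y - w)) has_derivative (\<lambda>z. 0 + scaleC z (y - w))) (at z)"
      by (intro has_derivative_add has_derivative_const bounded_linear_imp_has_derivative lin)
    then show "\<exists>D. (T has_derivative D) (at z) \<and> (\<forall>c v. D (scaleC c v) = scaleC c (D v))"
      unfolding T_def
      by (intro exI[of _ "\<lambda>z. scaleC z (y - w)"]) (simp add: scaleC_complex_def scaleC_scaleC)
  qed (simp add: P_def)
  then have hol: "(\<lambda>z. g (T z)) holomorphic_on P" by (simp add: holo_on_complex)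
  have O: "open (T -` W)" using Tc W by (simp add: open_vimage)
  have "0 \<in> T -` W" using w by (simp add: T_def)
  then have ne: "T -` W \<noteq> {}" by blast
  have sub: "T -` W \<subseteq> P" using W by (auto simp: P_def)
  have "1 \<in> P" using y by (simp add: P_def T_def)
  have "g (T 1) = 0"
  proof (rule analytic_continuation_open[OF O P ne con sub hol holomorphic_on_const[of 0]])
    show "g (T z) = 0" if "z \<in> T -` W" for z using that zero by blast
  qed fact
  then show ?thesis by (simp add: T_def)
qed

lemma holo_on_ball_dichotomy:
  assumes g: "holo_on B g" and B: "convex B"
  shows "(\<forall>x\<in>B. g x = 0) \<or> nowhere_dense {x\<in>B. g x = 0}"
proof (rule disjCI)
  assume nd: "\<not> nowhere_dense {x\<in>B. g x = 0}"
  define N where "N = {x\<in>B. g x = 0}"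
  have oB: "open B" using g by (rule holo_on_open)
  define W where "W = interior (closure N)"
  have W: "open W" "W \<noteq> {}" "W \<subseteq> closure N"
    using nd interior_subset[of "closure N"] by (auto simp: nowhere_dense_def N_def W_def)
  have "W \<inter> N \<noteq> {}"
  proof
    assume "W \<inter> N = {}"
    then have "W \<inter> closure N = {}" using W(1) by (simp add: open_Int_closure_eq_empty)
    then show False using W(2,3) by blast
  qed
  then have ne: "W \<inter> B \<noteq> {}" by (auto simp: N_def)
  have zero: "g x = 0" if x: "x \<in> W \<inter> B" for x
  proof (rule ccontr)
    assume gx: "g x \<noteq> 0"
    define V where "V = W \<inter> (B \<inter> g -` (- {0}))"
    have "open (B \<inter> g -` (- {0}))"
      by (intro continuous_open_preimage holo_on_continuous g oB) auto
    then have "open V" using W(1) by (auto simp: V_def)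
    moreover have "V \<inter> N = {}" by (auto simp: V_def N_def)
    ultimately have "V \<inter> closure N = {}" by (simp add: open_Int_closure_eq_empty)
    moreover have "x \<in> V" using x gx by (auto simp: V_def)
    ultimately show False using W(3) x by auto
  qed
  show "\<forall>x\<in>B. g x = 0"
  proof
    fix y assume y: "y \<in> B"
    show "g y = 0"
      by (rule holo_on_convex_identity[OF g B _ ne _ zero y]) (use W(1) oB in auto)
  qed
qed

lemma mero_onE:
  assumes "mero_on S f" "p \<in> S"
  obtains U g h where "p \<in> U" "U \<subseteq> S" "convex U" "holo_on U g" "holo_on U h"
    "nowhere_dense {x\<in>U. h x = 0}" "\<And>x. x \<in> U \<Longrightarrow> h x \<noteq> 0 \<Longrightarrow> f x = g x / h x"
proof -
  obtain U g h where U: "p \<in> U" "U \<subseteq> S" "holo_on U g" "holo_on U h"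
    "nowhere_dense {x\<in>U. h x = 0}" "\<And>x. x \<in> U \<Longrightarrow> h x \<noteq> 0 \<Longrightarrow> f x = g x / h x"
    using assms unfolding mero_on_def by meson
  obtain e where e: "e > 0" "ball p e \<subseteq> U"
    using holo_on_open[OF U(3)] U(1) open_contains_ball by blast
  show ?thesis
  proof (rule that)
    show "p \<in> ball p e" "ball p e \<subseteq> S" using e U by auto
    show "holo_on (ball p e) g" "holo_on (ball p e) h"
      using holo_on_subset[OF _ open_ball e(2)] U by auto
    show "nowhere_dense {x\<in>ball p e. h x = 0}"
      by (rule nowhere_dense_subset[OF U(5)]) (use e in auto)
    show "\<And>x. x \<in> ball p e \<Longrightarrow> h x \<noteq> 0 \<Longrightarrow> f x = g x / h x"
      using U(6) e by blast
  qed simp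
qed

lemma mero_onI:
  assumes "\<And>p. p \<in> S \<Longrightarrow> \<exists>U g h. p \<in> U \<and> U \<subseteq> S \<and> holo_on U g \<and> holo_on U h \<and>
    nowhere_dense {x\<in>U. h x = 0} \<and> (\<forall>x\<in>U. h x \<noteq> 0 \<longrightarrow> f x = g x / h x)"
  shows "mero_on S f"
  using assms unfolding mero_on_def by blast

lemma mero_on_const: "open S \<Longrightarrow> mero_on S (\<lambda>x. c)"
  by (rule mero_onI, rule exI[of _ S], rule exI[of _ "\<lambda>x. c"], rule exI[of _ "\<lambda>x. 1"])
     (simp add: holo_on_const)

lemma mero_on_binop:
  fixes S :: "'a::complex_normed_space set"
  assumes f: "mero_on S f" "mero_on S f'"
    and H: "\<And>(U :: 'a set) g h g' h'. holo_on U g \<Longrightarrow> holo_on U h \<Longrightarrow> holo_on U g' \<Longrightarrow> holo_on U h' \<Longrightarrow>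
        \<exists>k. holo_on U k \<and> (\<forall>x\<in>U. h x \<noteq> 0 \<longrightarrow> h' x \<noteq> 0 \<longrightarrow>
          G (g x / h x) (g' x / h' x) = k x / (h x * h' x))"
  shows "mero_on S (\<lambda>x. G (f x) (f' x))"
proof (rule mero_onI)
  fix p assume p: "p \<in> S"
  obtain U g h where U: "p \<in> U" "U \<subseteq> S" "convex U" "holo_on U g" "holo_on U h"
    "nowhere_dense {x\<in>U. h x = 0}" "\<And>x. x \<in> U \<Longrightarrow> h x \<noteq> 0 \<Longrightarrow> f x = g x / h x"
    using mero_onE[OF f(1) p] by blast
  obtain U' g' h' where U': "p \<in> U'" "U' \<subseteq> S" "convex U'" "holo_on U' g'" "holo_on U' h'"
    "nowhere_dense {x\<in>U'. h' x = 0}" "\<And>x. x \<in> U' \<Longrightarrow> h' x \<noteq> 0 \<Longrightarrow> f' x = g' x / h' x"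
    using mero_onE[OF f(2) p] by blast
  have o: "open (U \<inter> U')" using U U' holo_on_open by blast
  note hh = holo_on_subset[OF U(4) o Int_lower1] holo_on_subset[OF U(5) o Int_lower1]
    holo_on_subset[OF U'(4) o Int_lower2] holo_on_subset[OF U'(5) o Int_lower2]
  obtain k where k: "holo_on (U \<inter> U') k" "\<forall>x\<in>U \<inter> U'. h x \<noteq> 0 \<longrightarrow> h' x \<noteq> 0 \<longrightarrow>
          G (g x / h x) (g' x / h' x) = k x / (h x * h' x)"
    using H[OF hh] by blast
  have "nowhere_dense {x \<in> U \<inter> U'. h x * h' x = 0}"
    by (rule nowhere_dense_subset[OF nowhere_dense_Un[OF U(6) U'(6)]]) auto
  moreover have "U \<inter> U' \<subseteq> S" using U(2) by blast
  moreover have "G (f x) (f' x) = k x / (h x * h' x)" if "x \<in> U \<inter> U'" "h x * h' x \<noteq> 0" for x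
  proof -
    have "x \<in> U" "x \<in> U'" "h x \<noteq> 0" "h' x \<noteq> 0" using that by auto
    then show ?thesis using U(7)[of x] U'(7)[of x] k(2)[rule_format, of x] by simp
  qed
  ultimately show "\<exists>U g h. p \<in> U \<and> U \<subseteq> S \<and> holo_on U g \<and> holo_on U h \<and>
    nowhere_dense {x\<in>U. h x = 0} \<and> (\<forall>x\<in>U. h x \<noteq> 0 \<longrightarrow> G (f x) (f' x) = g x / h x)"
    using U(1) U'(1) k(1) holo_on_mult[OF hh(2) hh(4)]
    by - (rule exI[of _ "U \<inter> U'"], rule exI[of _ k], rule exI[of _ "\<lambda>x. h x * h' x"], simp)
qed

lemma mero_on_add:
  assumes "mero_on S f" "mero_on S f'" shows "mero_on S (\<lambda>x. f x + f' x)"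
proof (rule mero_on_binop[OF assms])
  fix U and g h g' h' :: "'a \<Rightarrow> complex"
  assume "holo_on U g" "holo_on U h" "holo_on U g'" "holo_on U h'"
  then have "holo_on U (\<lambda>x. g x * h' x + g' x * h x)" by (intro holo_on_add holo_on_mult)
  then show "\<exists>k. holo_on U k \<and> (\<forall>x\<in>U. h x \<noteq> 0 \<longrightarrow> h' x \<noteq> 0 \<longrightarrow>
      g x / h x + g' x / h' x = k x / (h x * h' x))"
    using add_frac_eq by blast
qed

lemma mero_on_mult:
  assumes "mero_on S f" "mero_on S f'" shows "mero_on S (\<lambda>x. f x * f' x)"
proof (rule mero_on_binop[OF assms])
  fix U and g h g' h' :: "'a \<Rightarrow> complex"
  assume "holo_on U g" "holo_on U h" "holo_on U g'" "holo_on U h'"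
  then have "holo_on U (\<lambda>x. g x * g' x)" by (intro holo_on_mult)
  then show "\<exists>k. holo_on U k \<and> (\<forall>x\<in>U. h x \<noteq> 0 \<longrightarrow> h' x \<noteq> 0 \<longrightarrow>
      (g x / h x) * (g' x / h' x) = k x / (h x * h' x))"
    using times_divide_times_eq by blast
qed

lemma mero_on_uminus:
  assumes "open S" "mero_on S f" shows "mero_on S (\<lambda>x. - f x)"
  using mero_on_mult[OF mero_on_const[OF assms(1), of "-1"] assms(2)] by simp

lemma mero_on_dichotomy:
  assumes f: "mero_on S f" and S: "open S" "connected S"
  shows "nowhere_dense {x\<in>S. f x \<noteq> 0} \<or> nowhere_dense {x\<in>S. f x = 0}"
proof -
  define A where "A = \<Union>{U. open U \<and> U \<subseteq> S \<and> nowhere_dense {x\<in>U. f x \<noteq> 0}}"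
  define B where "B = \<Union>{U. open U \<and> U \<subseteq> S \<and> nowhere_dense {x\<in>U. f x = 0}}"
  have "open A" "open B" unfolding A_def B_def by auto
  have "A \<inter> B = {}"
  proof (rule ccontr)
    assume "A \<inter> B \<noteq> {}"
    then obtain p U V where *: "p \<in> U \<inter> V" "open U" "open V"
      "nowhere_dense {x\<in>U. f x \<noteq> 0}" "nowhere_dense {x\<in>V. f x = 0}"
      unfolding A_def B_def by blast
    have "U \<inter> V = {}"
      by (rule nowhere_dense_open[OF nowhere_dense_Un[OF *(4,5)]]) (use * in auto)
    with * show False by blast
  qed
  have "S \<subseteq> A \<union> B"
  proof
    fix p assume p: "p \<in> S"
    obtain U g h where U: "p \<in> U" "U \<subseteq> S" "convex U" "holo_on U g" "holo_on U h"
      "nowhere_dense {x\<in>U. h x = 0}" "\<And>x. x \<in> U \<Longrightarrow> h x \<noteq> 0 \<Longrightarrow> f x = g x / h x"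
      using mero_onE[OF f p] by blast
    consider "\<forall>x\<in>U. g x = 0" | "nowhere_dense {x\<in>U. g x = 0}"
      using holo_on_ball_dichotomy[OF U(4,3)] by blast
    then show "p \<in> A \<union> B"
    proof cases
      case 1
      then have "nowhere_dense {x\<in>U. f x \<noteq> 0}"
        by (intro nowhere_dense_subset[OF U(6)]) (use U in auto)
      then show ?thesis using U holo_on_open unfolding A_def by blast
    next
      case 2
      have "nowhere_dense {x\<in>U. f x = 0}"
        by (rule nowhere_dense_subset[OF nowhere_dense_Un[OF U(6) 2]]) (use U(7) in force)
      then show ?thesis using U holo_on_open unfolding B_def by blast
    qed
  qed
  then consider "S \<subseteq> A" | "S \<subseteq> B"
    using connectedD[OF S(2) \<open>open A\<close> \<open>open B\<close>] \<open>A \<inter> B = {}\<close> by blast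
  then show ?thesis
  proof cases
    case 1
    have "nowhere_dense {x\<in>S. f x \<noteq> 0}"
    proof (rule nowhere_dense_local)
      fix p assume "p \<in> {x\<in>S. f x \<noteq> 0}"
      then obtain U where U: "p \<in> U" "open U" "U \<subseteq> S" "nowhere_dense {x\<in>U. f x \<noteq> 0}"
        using 1 unfolding A_def by blast
      moreover have "{x\<in>S. f x \<noteq> 0} \<inter> U = {x\<in>U. f x \<noteq> 0}" using U by blast
      ultimately show "\<exists>U. open U \<and> p \<in> U \<and> nowhere_dense ({x\<in>S. f x \<noteq> 0} \<inter> U)" by auto
    qed
    then show ?thesis ..
  next
    case 2
    have "nowhere_dense {x\<in>S. f x = 0}"
    proof (rule nowhere_dense_local)
      fix p assume "p \<in> {x\<in>S. f x = 0}"
      then obtain U where U: "p \<in> U" "open U" "U \<subseteq> S" "nowhere_dense {x\<in>U. f x = 0}"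
        using 2 unfolding B_def by blast
      moreover have "{x\<in>S. f x = 0} \<inter> U = {x\<in>U. f x = 0}" using U by blast
      ultimately show "\<exists>U. open U \<and> p \<in> U \<and> nowhere_dense ({x\<in>S. f x = 0} \<inter> U)" by auto
    qed
    then show ?thesis ..
  qed
qed

lemma mero_on_inverse_zero:
  assumes f: "mero_on S f" and nd: "nowhere_dense {x\<in>S. f x \<noteq> 0}"
  shows "mero_on S (\<lambda>x. inverse (f x))"
proof (rule mero_onI)
  fix p assume p: "p \<in> S"
  obtain U g h where U: "p \<in> U" "U \<subseteq> S" "convex U" "holo_on U g" "holo_on U h"
    "nowhere_dense {x\<in>U. h x = 0}" "\<And>x. x \<in> U \<Longrightarrow> h x \<noteq> 0 \<Longrightarrow> f x = g x / h x"
    using mero_onE[OF f p] by blast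
  have o: "open U" using U holo_on_open by blast
  have *: "f x = 0" if x: "x \<in> U" "h x \<noteq> 0" for x
  proof (rule ccontr)
    assume "f x \<noteq> 0"
    then have gx: "g x * h x \<noteq> 0" using x U by auto
    have "holo_on U (\<lambda>x. g x * h x)" using U by (intro holo_on_mult)
    then have "open (U \<inter> (\<lambda>x. g x * h x) -` (- {0}))"
      using o by (intro continuous_open_preimage holo_on_continuous) auto
    moreover have "U \<inter> (\<lambda>x. g x * h x) -` (- {0}) \<subseteq> {x\<in>S. f x \<noteq> 0}" using U by auto
    ultimately have "U \<inter> (\<lambda>x. g x * h x) -` (- {0}) = {}" by (rule nowhere_dense_open[OF nd])
    with gx x show False by auto
  qed
  show "\<exists>U g h. p \<in> U \<and> U \<subseteq> S \<and> holo_on U g \<and> holo_on U h \<and>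
    nowhere_dense {x\<in>U. h x = 0} \<and> (\<forall>x\<in>U. h x \<noteq> 0 \<longrightarrow> inverse (f x) = g x / h x)"
    using U o * by (intro exI[of _ U] exI[of _ "\<lambda>x. 0"] exI[of _ h]) (auto intro: holo_on_const)
qed

lemma mero_on_inverse:
  assumes f: "mero_on S f" and S: "open S" "connected S"
  shows "mero_on S (\<lambda>x. inverse (f x))"
proof (cases "nowhere_dense {x\<in>S. f x \<noteq> 0}")
  case True
  then show ?thesis by (rule mero_on_inverse_zero[OF f])
next
  case False
  then have nd: "nowhere_dense {x\<in>S. f x = 0}" using mero_on_dichotomy[OF assms] by blast
  show ?thesis
  proof (rule mero_onI)
    fix p assume p: "p \<in> S"
    obtain U g h where U: "p \<in> U" "U \<subseteq> S" "convex U" "holo_on U g" "holo_on U h"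
      "nowhere_dense {x\<in>U. h x = 0}" "\<And>x. x \<in> U \<Longrightarrow> h x \<noteq> 0 \<Longrightarrow> f x = g x / h x"
      using mero_onE[OF f p] by blast
    have "nowhere_dense {x \<in> U. g x * h x = 0}"
      by (rule nowhere_dense_subset[OF nowhere_dense_Un[OF U(6) nd]]) (use U in force)
    then show "\<exists>U g h. p \<in> U \<and> U \<subseteq> S \<and> holo_on U g \<and> holo_on U h \<and>
      nowhere_dense {x\<in>U. h x = 0} \<and> (\<forall>x\<in>U. h x \<noteq> 0 \<longrightarrow> inverse (f x) = g x / h x)"
      using U by (intro exI[of _ U] exI[of _ "\<lambda>x. h x * h x"] exI[of _ "\<lambda>x. g x * h x"])
        (auto intro!: holo_on_mult)
  qed
qed

lemma extends_at_cong:
  assumes "nowhere_dense {x\<in>S. f x \<noteq> f' x}" "open S" "p \<in> S" "extends_at f p c"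
  shows "extends_at f' p c"
proof -
  obtain U g where U: "p \<in> U" "holo_on U g" "nowhere_dense {x\<in>U. f x \<noteq> g x}" "g p = c"
    using assms(4) unfolding extends_at_def by blast
  have o: "open (U \<inter> S)" using U assms holo_on_open by blast
  have "nowhere_dense {x\<in>U \<inter> S. f' x \<noteq> g x}"
    by (rule nowhere_dense_subset[OF nowhere_dense_Un[OF U(3) assms(1)]]) auto
  then show ?thesis
    unfolding extends_at_def using U assms holo_on_subset[OF U(2) o] by (intro exI[of _ "U \<inter> S"] exI[of _ g]) auto
qed


section \<open>Free abelian groups of finite rank\<close>

class free_abelian_group = ab_group_add +
  assumes ex_coords: "\<exists>(n::nat) (c :: 'a \<Rightarrow> nat \<Rightarrow> int).
    (\<forall>x y i. c (x + y) i = c x i + c y i) \<and> bij_betw c UNIV {v. \<forall>i\<ge>n. v i = 0}"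

definition coord_system :: "nat \<Rightarrow> ('a::free_abelian_group \<Rightarrow> nat \<Rightarrow> int) \<Rightarrow> bool"
  where "coord_system n c \<longleftrightarrow> (\<forall>x y i. c (x + y) i = c x i + c y i) \<and>
    bij_betw c UNIV {v. \<forall>i\<ge>n. v i = 0}"

definition std_coords :: "'a::free_abelian_group \<Rightarrow> nat \<Rightarrow> int"
  where "std_coords = (SOME c. \<exists>n. coord_system n c)"

definition std_basis :: "'a::free_abelian_group set"
  where "std_basis = {b. \<exists>i. std_coords b = (\<lambda>j. if j = i then 1 else 0)}"

text \<open>The restriction to the lattice of the \<open>\<ell>\<^sup>1\<close>-norm on its real span; all norms on a
  finite-dimensional real vector space are equivalent.\<close>

definition lattice_norm :: "'a::free_abelian_group \<Rightarrow> real"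
  where "lattice_norm x = (\<Sum>i | std_coords x i \<noteq> 0. real_of_int \<bar>std_coords x i\<bar>)"

lemma std_coords_ex:
  obtains n where "\<And>(x::'a::free_abelian_group) y i. std_coords (x + y) i = std_coords x i + std_coords y i"
    "bij_betw (std_coords :: 'a \<Rightarrow> _) UNIV {v. \<forall>i\<ge>n. v i = 0}"
proof -
  have "\<exists>n. coord_system n (std_coords :: 'a \<Rightarrow> _)"
    unfolding std_coords_def
  proof (rule someI_ex[of "\<lambda>c. \<exists>n. coord_system n c"])
    show "\<exists>c n. coord_system n (c :: 'a \<Rightarrow> nat \<Rightarrow> int)"
      using ex_coords[where 'a = 'a] unfolding coord_system_def by (elim exE) (rule exI, rule exI)
  qed
  then obtain n where "coord_system n (std_coords :: 'a \<Rightarrow> _)" ..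
  then show ?thesis using that unfolding coord_system_def by (elim conjE) simp
qed

lemma std_coords_add: "std_coords (x + y) i = std_coords x i + std_coords y i"
  for x y :: "'a::free_abelian_group"
  by (rule std_coords_ex[where 'a = 'a]) simp

lemma std_coords_inj:
  fixes x y :: "'a::free_abelian_group"
  assumes "std_coords x = std_coords y" shows "x = y"
  by (rule std_coords_ex[where 'a = 'a], drule bij_betw_imp_inj_on, erule injD, rule assms)

lemma std_coords_rank:
  "\<exists>n. (\<forall>(x::'a::free_abelian_group) i. i \<ge> n \<longrightarrow> std_coords x i = 0) \<and>
    (\<forall>v. (\<forall>i\<ge>n. v i = 0) \<longrightarrow> (\<exists>x::'a. std_coords x = v))"
proof -
  obtain n where n: "bij_betw (std_coords :: 'a \<Rightarrow> _) UNIV {v. \<forall>i\<ge>n. v i = 0}"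
    by (rule std_coords_ex)
  have r: "range (std_coords :: 'a \<Rightarrow> _) = {v. \<forall>i\<ge>n. v i = 0}"
    using n by (rule bij_betw_imp_surj_on)
  show ?thesis
  proof (intro exI[of _ n] conjI allI impI)
    fix x :: 'a and i assume "n \<le> i"
    moreover have "std_coords x \<in> {v. \<forall>i\<ge>n. v i = 0}" unfolding r[symmetric] by (rule rangeI)
    ultimately show "std_coords x i = 0" by simp
  next
    fix v :: "nat \<Rightarrow> int" assume "\<forall>i\<ge>n. v i = 0"
    then have "v \<in> range (std_coords :: 'a \<Rightarrow> _)" unfolding r by simp
    then obtain x :: 'a where "v = std_coords x" by (rule rangeE)
    then show "\<exists>x::'a. std_coords x = v" by (intro exI[of _ x]) simp
  qed
qed

lemma std_coords_zero [simp]: "std_coords 0 i = 0"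
  using std_coords_add[of 0 0 i] by simp

lemma std_coords_uminus: "std_coords (- x) i = - std_coords x i"
  using std_coords_add[of x "- x" i] by simp

lemma finite_std_basis: "finite (std_basis :: 'a::free_abelian_group set)"
proof -
  obtain n where n: "\<And>(x::'a) i. i \<ge> n \<Longrightarrow> std_coords x i = 0"
    using std_coords_rank[where 'a = 'a] by metis
  have "std_coords ` (std_basis :: 'a set) \<subseteq> (\<lambda>i j. if j = i then 1 else 0) ` {..<n}"
  proof (clarsimp simp: std_basis_def)
    fix b :: 'a and i assume b: "std_coords b = (\<lambda>j. if j = i then 1 else 0)"
    have "i < n" using n[of i b] b by (cases "i < n") auto
    with b show "(\<lambda>j. if j = i then 1 else 0) \<in> (\<lambda>i j. if j = i then 1 else 0) ` {..<n}"
      by blast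
  qed
  then have "finite (std_coords ` (std_basis :: 'a set))" by (rule finite_subset) simp
  then show ?thesis by (rule finite_imageD) (auto intro: inj_onI std_coords_inj)
qed

lemma additive_eq_zero:
  fixes f :: "'a::free_abelian_group \<Rightarrow> 'b::ab_group_add"
  assumes add: "\<And>x y. f (x + y) = f x + f y" and zero: "\<And>b. b \<in> std_basis \<Longrightarrow> f b = 0"
  shows "f x = 0"
proof -
  obtain n where n: "\<And>(x::'a) i. i \<ge> n \<Longrightarrow> std_coords x i = 0"
    "\<And>v. (\<And>i. i \<ge> n \<Longrightarrow> v i = 0) \<Longrightarrow> \<exists>x::'a. std_coords x = v"
    using std_coords_rank[where 'a = 'a] by metis
  have f0: "f 0 = 0" using add[of 0 0] by simp
  show ?thesis
  proof (induction "\<Sum>i<n. nat \<bar>std_coords x i\<bar>" arbitrary: x rule: less_induct)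
    case less
    show ?case
    proof (cases "\<forall>i. std_coords x i = 0")
      case True
      then have "x = 0" by (intro std_coords_inj) auto
      then show ?thesis using f0 by simp
    next
      case False
      then obtain i where i: "std_coords x i \<noteq> 0" by blast
      then have "i < n" using n(1)[of i x] by (cases "i < n") auto
      then obtain b :: 'a where b: "std_coords b = (\<lambda>j. if j = i then 1 else 0)"
        using n(2)[of "\<lambda>j. if j = i then 1 else 0"] by auto
      have fb: "f b = 0" using b by (intro zero) (auto simp: std_basis_def)
      define y where "y = (if std_coords x i > 0 then x + - b else x + b)"
      have "(\<Sum>j<n. nat \<bar>std_coords y j\<bar>) < (\<Sum>j<n. nat \<bar>std_coords x j\<bar>)"
      proof (rule sum_strict_mono_ex1)
        have y: "std_coords y j = std_coords x j
            - (if j = i then if std_coords x i > 0 then 1 else -1 else 0)" for j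
          by (simp add: y_def std_coords_add std_coords_uminus b del: add_uminus_conv_diff)
        show "\<forall>j\<in>{..<n}. nat \<bar>std_coords y j\<bar> \<le> nat \<bar>std_coords x j\<bar>"
          using i by (auto simp: y)
        show "\<exists>j\<in>{..<n}. nat \<bar>std_coords y j\<bar> < nat \<bar>std_coords x j\<bar>"
          using i \<open>i < n\<close> by (intro bexI[of _ i]) (auto simp: y)
      qed simp
      then have "f y = 0" by (rule less)
      moreover have "f (- b) = 0" using add[of b "- b"] fb f0 by simp
      moreover have "f y = f x + (if std_coords x i > 0 then f (- b) else f b)"
        by (simp add: y_def add del: add_uminus_conv_diff)
      ultimately show ?thesis using fb by (simp split: if_splits)
    qed
  qed
qed

instantiation prod :: (free_abelian_group, free_abelian_group) free_abelian_group
begin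

instance
proof
  obtain n where n: "\<And>(x::'a) i. i \<ge> n \<Longrightarrow> std_coords x i = 0"
    "\<And>v. (\<And>i. i \<ge> n \<Longrightarrow> v i = 0) \<Longrightarrow> \<exists>x::'a. std_coords x = v"
    using std_coords_rank[where 'a = 'a] by metis
  obtain m where m: "\<And>(x::'b) i. i \<ge> m \<Longrightarrow> std_coords x i = 0"
    "\<And>v. (\<And>i. i \<ge> m \<Longrightarrow> v i = 0) \<Longrightarrow> \<exists>x::'b. std_coords x = v"
    using std_coords_rank[where 'a = 'b] by metis
  define c :: "'a \<times> 'b \<Rightarrow> nat \<Rightarrow> int"
    where "c p i = (if i < n then std_coords (fst p) i else std_coords (snd p) (i - n))" for p i
  have "c (p + q) i = c p i + c q i" for p q i by (simp add: c_def std_coords_add)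
  moreover have "bij_betw c UNIV {v. \<forall>i\<ge>n + m. v i = 0}"
    unfolding bij_betw_def
  proof
    show "inj c"
    proof (rule injI)
      fix p q assume pq: "c p = c q"
      have "std_coords (fst p) i = std_coords (fst q) i" for i
        using fun_cong[OF pq, of i] n(1) by (cases "i < n") (auto simp: c_def)
      moreover have "std_coords (snd p) i = std_coords (snd q) i" for i
        using fun_cong[OF pq, of "n + i"] by (simp add: c_def)
      ultimately show "p = q" by (intro prod_eqI std_coords_inj ext)
    qed
    show "range c = {v. \<forall>i\<ge>n + m. v i = 0}"
    proof (intro equalityI subsetI)
      fix v assume "v \<in> range c"
      then show "v \<in> {v. \<forall>i\<ge>n + m. v i = 0}" using m(1) by (auto simp: c_def)
    next
      fix v :: "nat \<Rightarrow> int" assume v: "v \<in> {v. \<forall>i\<ge>n + m. v i = 0}"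
      obtain x :: 'a where x: "std_coords x = (\<lambda>i. if i < n then v i else 0)"
        using n(2)[of "\<lambda>i. if i < n then v i else 0"] by auto
      obtain y :: 'b where y: "std_coords y = (\<lambda>i. v (n + i))"
        using m(2)[of "\<lambda>i. v (n + i)"] v by auto
      have "c (x, y) = v" by (auto simp: c_def x y)
      then show "v \<in> range c" by blast
    qed
  qed
  ultimately show "\<exists>(n::nat) (c :: 'a \<times> 'b \<Rightarrow> nat \<Rightarrow> int).
    (\<forall>x y i. c (x + y) i = c x i + c y i) \<and> bij_betw c UNIV {v. \<forall>i\<ge>n. v i = 0}"
    by (intro exI[of _ "n + m"] exI[of _ c]) simp
qed

end


section \<open>The space of homomorphisms to the complex numbers\<close>

typedef (overloaded) 'a cdual = "{\<theta> :: 'a::ab_group_add \<Rightarrow> complex. \<forall>x y. \<theta> (x + y) = \<theta> x + \<theta> y}"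
  morphisms cdual_apply Abs_cdual
  by (rule exI[of _ "\<lambda>x. 0"]) simp

setup_lifting type_definition_cdual

lemma cdual_apply_add: "cdual_apply \<theta> (x + y) = cdual_apply \<theta> x + cdual_apply \<theta> y"
  using cdual_apply[of \<theta>] by blast

lemma cdual_eqI: "(\<And>x. cdual_apply \<theta> x = cdual_apply \<eta> x) \<Longrightarrow> \<theta> = \<eta>"
  by (metis cdual_apply_inject ext)

instantiation cdual :: (free_abelian_group) real_normed_vector
begin

lift_definition zero_cdual :: "'a cdual" is "\<lambda>x. 0" by simp
lift_definition plus_cdual :: "'a cdual \<Rightarrow> 'a cdual \<Rightarrow> 'a cdual" is "\<lambda>f g x. f x + g x" by simp
lift_definition uminus_cdual :: "'a cdual \<Rightarrow> 'a cdual" is "\<lambda>f x. - f x" by simp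
lift_definition minus_cdual :: "'a cdual \<Rightarrow> 'a cdual \<Rightarrow> 'a cdual" is "\<lambda>f g x. f x - g x" by simp
lift_definition scaleR_cdual :: "real \<Rightarrow> 'a cdual \<Rightarrow> 'a cdual" is "\<lambda>r f x. complex_of_real r * f x"
  by (simp add: algebra_simps)

definition norm_cdual :: "'a cdual \<Rightarrow> real"
  where "norm_cdual \<theta> = (\<Sum>b\<in>std_basis. cmod (cdual_apply \<theta> b))"
definition dist_cdual :: "'a cdual \<Rightarrow> 'a cdual \<Rightarrow> real"
  where "dist_cdual \<theta> \<eta> = norm (\<theta> - \<eta>)"
definition sgn_cdual :: "'a cdual \<Rightarrow> 'a cdual"
  where "sgn_cdual \<theta> = scaleR (inverse (norm \<theta>)) \<theta>"
definition uniformity_cdual :: "('a cdual \<times> 'a cdual) filter"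
  where "uniformity_cdual = (INF e\<in>{0<..}. principal {(x, y). dist x y < e})"
definition open_cdual :: "'a cdual set \<Rightarrow> bool"
  where "open_cdual S = (\<forall>x\<in>S. \<forall>\<^sub>F (x', y) in uniformity. x' = x \<longrightarrow> y \<in> S)"

instance
proof
  fix a b c :: "'a cdual" and r s :: real
  show "a + b + c = a + (b + c)" "a + b = b + a" "0 + a = a" "- a + a = 0" "a - b = a + - b"
    by (rule cdual_eqI, simp add: plus_cdual.rep_eq zero_cdual.rep_eq uminus_cdual.rep_eq
        minus_cdual.rep_eq)+
  show "r *\<^sub>R (a + b) = r *\<^sub>R a + r *\<^sub>R b" "(r + s) *\<^sub>R a = r *\<^sub>R a + s *\<^sub>R a"
    "r *\<^sub>R s *\<^sub>R a = (r * s) *\<^sub>R a" "1 *\<^sub>R a = a"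
    by (rule cdual_eqI, simp add: plus_cdual.rep_eq scaleR_cdual.rep_eq distrib_left distrib_right)+
  show "dist a b = norm (a - b)" "sgn a = scaleR (inverse (norm a)) a"
    "(uniformity :: ('a cdual \<times> 'a cdual) filter) = (INF e\<in>{0<..}. principal {(x, y). dist x y < e})"
    by (simp_all add: dist_cdual_def sgn_cdual_def uniformity_cdual_def)
  show "open U \<longleftrightarrow> (\<forall>x\<in>U. \<forall>\<^sub>F (x', y) in uniformity. x' = x \<longrightarrow> y \<in> U)" for U :: "'a cdual set"
    by (simp add: open_cdual_def)
  have nonneg: "norm a \<ge> 0" by (simp add: norm_cdual_def sum_nonneg)
  show "norm a = 0 \<longleftrightarrow> a = 0"
  proof
    assume "norm a = 0"
    then have "cdual_apply a b = 0" if "b \<in> std_basis" for b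
      using that finite_std_basis[where 'a = 'a] by (simp add: norm_cdual_def sum_nonneg_eq_0_iff)
    from additive_eq_zero[OF cdual_apply_add this] have "cdual_apply a x = 0" for x
      .
    then show "a = 0" by (intro cdual_eqI) (simp add: zero_cdual.rep_eq)
  next
    assume "a = 0" then show "norm a = 0" by (simp add: norm_cdual_def zero_cdual.rep_eq)
  qed
  show "norm (a + b) \<le> norm a + norm b"
    unfolding norm_cdual_def sum.distrib[symmetric] plus_cdual.rep_eq
    by (rule sum_mono) (rule norm_triangle_ineq)
  show "norm (r *\<^sub>R a) = \<bar>r\<bar> * norm a"
    by (simp add: norm_cdual_def scaleR_cdual.rep_eq norm_mult sum_distrib_left)
qed

end

instantiation cdual :: (free_abelian_group) complex_normed_space
begin

lift_definition scaleC_cdual :: "complex \<Rightarrow> 'a cdual \<Rightarrow> 'a cdual" is "\<lambda>c f x. c * f x"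
  by (simp add: algebra_simps)

instance
proof
  fix a b :: complex and x y :: "'a cdual" and r :: real
  show "scaleC a (x + y) = scaleC a x + scaleC a y" "scaleC (a + b) x = scaleC a x + scaleC b x"
    "scaleC a (scaleC b x) = scaleC (a * b) x" "scaleC (complex_of_real r) x = r *\<^sub>R x"
    by (rule cdual_eqI, simp add: plus_cdual.rep_eq scaleC_cdual.rep_eq scaleR_cdual.rep_eq
        distrib_left distrib_right)+
  show "norm (scaleC a x) = cmod a * norm x"
    by (simp add: norm_cdual_def scaleC_cdual.rep_eq norm_mult sum_distrib_left)
qed

end


section \<open>The field of meromorphic functions on the product of the upper half-plane and \<open>V\<^sub>e\<close>\<close>

definition upper_half_plane :: "complex set"
  where "upper_half_plane = {\<tau>. 0 < Im \<tau>}"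

abbreviation mero_dom :: "(complex \<times> 'e::free_abelian_group cdual) set"
  where "mero_dom \<equiv> upper_half_plane \<times> UNIV"

definition mero_eq ::
    "(complex \<times> 'e::free_abelian_group cdual \<Rightarrow> complex) \<Rightarrow> (complex \<times> 'e cdual \<Rightarrow> complex) \<Rightarrow> bool"
  where "mero_eq f g \<longleftrightarrow> mero_on mero_dom f \<and> mero_on mero_dom g \<and>
    nowhere_dense {p\<in>mero_dom. f p \<noteq> g p}"

lemma open_mero_dom: "open mero_dom"
  unfolding upper_half_plane_def by (rule open_Times[OF open_halfspace_Im_gt open_UNIV])

lemma connected_mero_dom: "connected mero_dom"
proof (rule connected_Times)
  show "connected upper_half_plane"
    unfolding upper_half_plane_def by (rule convex_connected[OF convex_halfspace_Im_gt])
  show "connected (UNIV :: 'a cdual set)"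
    by (rule convex_connected[OF convex_UNIV])
qed

lemma mero_dom_not_nowhere_dense: "\<not> nowhere_dense mero_dom"
proof
  assume "nowhere_dense (mero_dom :: (complex \<times> 'a cdual) set)"
  then have "(mero_dom :: (complex \<times> 'a cdual) set) = {}"
    by (rule nowhere_dense_open[OF _ open_mero_dom order_refl])
  moreover have "(\<i>, 0) \<in> (mero_dom :: (complex \<times> 'a cdual) set)"
    by (simp add: upper_half_plane_def)
  ultimately show False by simp
qed

lemma mero_eq_sym: assumes "mero_eq f g" shows "mero_eq g f"
proof -
  have "{p\<in>mero_dom. f p \<noteq> g p} = {p\<in>mero_dom. g p \<noteq> f p}" by auto
  with assms show ?thesis by (simp add: mero_eq_def)
qed

lemma mero_eq_refl: "mero_on mero_dom f \<Longrightarrow> mero_eq f f"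
  by (simp add: mero_eq_def)

quotient_type (overloaded) 'e mero = "complex \<times> 'e::free_abelian_group cdual \<Rightarrow> complex"
  / partial: mero_eq
  morphisms rep_mero mero_of
proof (rule part_equivpI)
  show "\<exists>f :: complex \<times> 'e cdual \<Rightarrow> complex. mero_eq f f"
    by (rule exI, rule mero_eq_refl, rule mero_on_const[OF open_mero_dom])
  show "symp (mero_eq :: (complex \<times> 'e cdual \<Rightarrow> complex) \<Rightarrow> _)"
    by (rule sympI) (rule mero_eq_sym)
  show "transp (mero_eq :: (complex \<times> 'e cdual \<Rightarrow> complex) \<Rightarrow> _)"
  proof (rule transpI)
    fix f g h :: "complex \<times> 'e cdual \<Rightarrow> complex" assume *: "mero_eq f g" "mero_eq g h"
    have "nowhere_dense {p\<in>mero_dom. f p \<noteq> h p}"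
    proof (rule nowhere_dense_subset)
      show "nowhere_dense ({p\<in>mero_dom. f p \<noteq> g p} \<union> {p\<in>mero_dom. g p \<noteq> h p})"
        using * by (intro nowhere_dense_Un) (simp_all add: mero_eq_def)
    next
      show "{p\<in>mero_dom. f p \<noteq> h p} \<subseteq> {p\<in>mero_dom. f p \<noteq> g p} \<union> {p\<in>mero_dom. g p \<noteq> h p}"
        by auto
    qed
    with * show "mero_eq f h" by (simp add: mero_eq_def)
  qed
qed

lemma mero_eq_binop:
  assumes "mero_eq f f'" "mero_eq g g'"
    and "mero_on mero_dom (\<lambda>p. G (f p) (g p))" "mero_on mero_dom (\<lambda>p. G (f' p) (g' p))"
  shows "mero_eq (\<lambda>p. G (f p) (g p)) (\<lambda>p. G (f' p) (g' p))"
proof -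
  have nd: "nowhere_dense {p\<in>mero_dom. f p \<noteq> f' p}" "nowhere_dense {p\<in>mero_dom. g p \<noteq> g' p}"
    using assms by (auto simp: mero_eq_def)
  have "nowhere_dense {p\<in>mero_dom. G (f p) (g p) \<noteq> G (f' p) (g' p)}"
    by (rule nowhere_dense_subset[OF nowhere_dense_Un[OF nd]]) auto
  with assms show ?thesis by (simp add: mero_eq_def)
qed

lemma mero_eqD: "mero_eq f g \<Longrightarrow> mero_on mero_dom f" "mero_eq f g \<Longrightarrow> mero_on mero_dom g"
  by (simp_all add: mero_eq_def)

lemma mero_eqI_pointwise:
  assumes "mero_on mero_dom f" "f = g" shows "mero_eq f g"
  using assms by (simp add: mero_eq_refl)

lift_definition mero_const :: "complex \<Rightarrow> 'e::free_abelian_group mero" is "\<lambda>c p. c"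
  by (rule mero_eq_refl[OF mero_on_const[OF open_mero_dom]])

instantiation mero :: (free_abelian_group) field
begin

lift_definition zero_mero :: "'a mero" is "\<lambda>p. 0"
  by (rule mero_eq_refl[OF mero_on_const[OF open_mero_dom]])

lift_definition one_mero :: "'a mero" is "\<lambda>p. 1"
  by (rule mero_eq_refl[OF mero_on_const[OF open_mero_dom]])

lift_definition plus_mero :: "'a mero \<Rightarrow> 'a mero \<Rightarrow> 'a mero" is "\<lambda>f g p. f p + g p"
proof -
  fix f f' g g' :: "complex \<times> 'a cdual \<Rightarrow> complex" assume *: "mero_eq f f'" "mero_eq g g'"
  show "mero_eq (\<lambda>p. f p + g p) (\<lambda>p. f' p + g' p)"
    by (rule mero_eq_binop[OF *, of "(+)"]; intro mero_on_add mero_eqD[OF *(1)] mero_eqD[OF *(2)])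
qed

lift_definition times_mero :: "'a mero \<Rightarrow> 'a mero \<Rightarrow> 'a mero" is "\<lambda>f g p. f p * g p"
proof -
  fix f f' g g' :: "complex \<times> 'a cdual \<Rightarrow> complex" assume *: "mero_eq f f'" "mero_eq g g'"
  show "mero_eq (\<lambda>p. f p * g p) (\<lambda>p. f' p * g' p)"
    by (rule mero_eq_binop[OF *, of "(*)"]; intro mero_on_mult mero_eqD[OF *(1)] mero_eqD[OF *(2)])
qed

lift_definition uminus_mero :: "'a mero \<Rightarrow> 'a mero" is "\<lambda>f p. - f p"
proof -
  fix f g :: "complex \<times> 'a cdual \<Rightarrow> complex" assume *: "mero_eq f g"
  show "mero_eq (\<lambda>p. - f p) (\<lambda>p. - g p)"
    by (rule mero_eq_binop[OF * *, of "\<lambda>x y. - x"];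
        intro mero_on_uminus open_mero_dom mero_eqD[OF *])
qed

lift_definition inverse_mero :: "'a mero \<Rightarrow> 'a mero" is "\<lambda>f p. inverse (f p)"
proof -
  fix f g :: "complex \<times> 'a cdual \<Rightarrow> complex" assume *: "mero_eq f g"
  show "mero_eq (\<lambda>p. inverse (f p)) (\<lambda>p. inverse (g p))"
    by (rule mero_eq_binop[OF * *, of "\<lambda>x y. inverse x"];
        intro mero_on_inverse open_mero_dom connected_mero_dom mero_eqD[OF *])
qed

definition minus_mero :: "'a mero \<Rightarrow> 'a mero \<Rightarrow> 'a mero" where "minus_mero f g = f + - g"
definition divide_mero :: "'a mero \<Rightarrow> 'a mero \<Rightarrow> 'a mero" where "divide_mero f g = f * inverse g"

instance
proof
  fix a b c :: "'a mero"
  show "a - b = a + - b" "a div b = a * inverse b"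
    by (simp_all add: minus_mero_def divide_mero_def)
  show "a * b * c = a * (b * c)"
    by (transfer, rule mero_eqI_pointwise, intro mero_on_mult; (erule mero_eqD(1) | simp add: mult.assoc))
  show "a * b = b * a"
    by (transfer, rule mero_eqI_pointwise, intro mero_on_mult; (erule mero_eqD(1) | simp add: mult.commute))
  show "1 * a = a"
    by transfer simp
  show "a + b + c = a + (b + c)"
    by (transfer, rule mero_eqI_pointwise, intro mero_on_add; (erule mero_eqD(1) | simp add: add.assoc))
  show "a + b = b + a"
    by (transfer, rule mero_eqI_pointwise, intro mero_on_add; (erule mero_eqD(1) | simp add: add.commute))
  show "0 + a = a"
    by transfer simp
  show "- a + a = 0"
    by transfer (simp add: mero_eq_refl mero_on_const[OF open_mero_dom])
  show "(a + b) * c = a * c + b * c"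
    by (transfer, rule mero_eqI_pointwise, intro mero_on_add mero_on_mult;
        (erule mero_eqD(1) | simp add: distrib_right))
  show "(0::'a mero) \<noteq> 1"
    by transfer (simp add: mero_eq_def mero_dom_not_nowhere_dense)
  show "inverse (0::'a mero) = 0"
    by transfer (simp add: mero_eq_refl mero_on_const[OF open_mero_dom])
  show "a \<noteq> 0 \<Longrightarrow> inverse a * a = 1"
  proof transfer
    fix f :: "complex \<times> 'a cdual \<Rightarrow> complex"
    assume f: "mero_eq f f" "\<not> mero_eq f (\<lambda>p. 0)"
    note m = mero_eqD(1)[OF f(1)]
    have "\<not> nowhere_dense {p\<in>mero_dom. f p \<noteq> 0}"
      using f(2) m by (simp add: mero_eq_def mero_on_const[OF open_mero_dom])
    then have nd: "nowhere_dense {p\<in>mero_dom. f p = 0}"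
      using mero_on_dichotomy[OF m open_mero_dom connected_mero_dom] by simp
    have "nowhere_dense {p\<in>mero_dom. inverse (f p) * f p \<noteq> 1}"
    proof (rule nowhere_dense_subset[OF nd], rule subsetI)
      fix p assume p: "p \<in> {p\<in>mero_dom. inverse (f p) * f p \<noteq> 1}"
      then have "f p = 0" using left_inverse[of "f p"] by blast
      with p show "p \<in> {p\<in>mero_dom. f p = 0}" by blast
    qed
    moreover have "mero_on mero_dom (\<lambda>p. inverse (f p) * f p)"
      by (intro mero_on_mult mero_on_inverse m open_mero_dom connected_mero_dom)
    ultimately show "mero_eq (\<lambda>p. inverse (f p) * f p) (\<lambda>p. 1)"
      by (simp add: mero_eq_def mero_on_const[OF open_mero_dom])
  qed
qed

end

definition shear :: "'e::free_abelian_group cdual \<Rightarrow> 'e cdual \<Rightarrow> complex \<times> 'e cdual \<Rightarrow> complex \<times> 'e cdual"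
  where "shear u v p = (fst p, snd p + u + scaleC (fst p) v)"

lemma shear_inverse: "shear (- u) (- v) (shear u v p) = p" "shear u v (shear (- u) (- v) p) = p"
proof -
  have "scaleC c v + scaleC c (- v) = 0" for c
    using scaleC_add_right[of c v "- v"] by simp
  then have "scaleC c (- v) = - scaleC c v" for c
    by (rule minus_unique[symmetric])
  then show "shear (- u) (- v) (shear u v p) = p" "shear u v (shear (- u) (- v) p) = p"
    by (simp_all add: shear_def prod_eq_iff)
qed

lemma shear_in_dom [simp]: "shear u v p \<in> mero_dom \<longleftrightarrow> p \<in> mero_dom"
  by (cases p) (simp add: shear_def)

lemma shear_has_derivative:
  "(shear u v has_derivative (\<lambda>d. (fst d, snd d + scaleC (fst d) v))) (at p)"
proof -
  have s: "((\<lambda>p. scaleC (fst p) v) has_derivative (\<lambda>d. scaleC (fst d) v)) (at p)"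
    by (rule bounded_linear_imp_has_derivative)
       (rule bounded_linear_compose[OF bounded_linear_scaleC_left bounded_linear_fst])
  have "((\<lambda>p. snd p + u + scaleC (fst p) v) has_derivative (\<lambda>d. snd d + 0 + scaleC (fst d) v)) (at p)"
    by (intro has_derivative_add s has_derivative_const
        bounded_linear_imp_has_derivative[OF bounded_linear_snd])
  from has_derivative_Pair[OF bounded_linear_imp_has_derivative[OF bounded_linear_fst] this]
  show ?thesis by (simp add: shear_def[abs_def])
qed

lemma continuous_shear: "continuous_on UNIV (shear u v)"
  by (rule continuous_at_imp_continuous_on, rule ballI,
      rule has_derivative_continuous[OF shear_has_derivative])

lemma nowhere_dense_shear: "nowhere_dense N \<Longrightarrow> nowhere_dense (shear u v -` N)"
  by (rule nowhere_dense_vimage[OF _ continuous_shear continuous_shear[of "- u" "- v"]])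
     (simp_all add: shear_inverse)

lemma holo_on_shear:
  assumes "holo_on U g" shows "holo_on (shear u v -` U) (\<lambda>p. g (shear u v p))"
proof (rule holo_on_comp[OF assms])
  show "open (shear u v -` U)"
    by (rule open_vimage[OF holo_on_open[OF assms] continuous_shear])
  fix p
  show "\<exists>D. (shear u v has_derivative D) (at p) \<and> (\<forall>c w. D (scaleC c w) = scaleC c (D w))"
    by (rule exI, rule conjI, rule shear_has_derivative)
       (simp add: scaleC_prod_def scaleC_complex_def scaleC_add_right scaleC_scaleC)
qed simp

lemma mero_on_shear:
  assumes "mero_on mero_dom f" shows "mero_on mero_dom (\<lambda>p. f (shear u v p))"
proof (rule mero_onI)
  fix p :: "complex \<times> 'a cdual" assume "p \<in> mero_dom"
  then have sp: "shear u v p \<in> mero_dom" by (simp only: shear_in_dom)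
  have "\<exists>U g h. shear u v p \<in> U \<and> U \<subseteq> mero_dom \<and> holo_on U g \<and> holo_on U h \<and>
      nowhere_dense {x\<in>U. h x = 0} \<and> (\<forall>x\<in>U. h x \<noteq> 0 \<longrightarrow> f x = g x / h x)"
    using assms[unfolded mero_on_def] sp by (rule bspec)
  then obtain U g h where U: "shear u v p \<in> U" "U \<subseteq> mero_dom" "holo_on U g" "holo_on U h"
    "nowhere_dense {x\<in>U. h x = 0}" "\<forall>x\<in>U. h x \<noteq> 0 \<longrightarrow> f x = g x / h x"
    by (elim exE conjE) (rule that)
  have "nowhere_dense {x \<in> shear u v -` U. h (shear u v x) = 0}"
    by (rule nowhere_dense_subset[OF nowhere_dense_shear[OF U(5), of u v]]) (rule subsetI, simp)
  moreover have "shear u v -` U \<subseteq> mero_dom"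
  proof
    fix x assume "x \<in> shear u v -` U"
    then have "shear u v x \<in> mero_dom" using U(2) by blast
    then show "x \<in> mero_dom" by (simp only: shear_in_dom)
  qed
  moreover have "\<forall>x\<in>shear u v -` U. h (shear u v x) \<noteq> 0 \<longrightarrow>
      f (shear u v x) = g (shear u v x) / h (shear u v x)"
    using U(6) by blast
  moreover have "p \<in> shear u v -` U" using U(1) by (rule vimageI2)
  ultimately show "\<exists>U g h. p \<in> U \<and> U \<subseteq> mero_dom \<and> holo_on U g \<and> holo_on U h \<and>
    nowhere_dense {x\<in>U. h x = 0} \<and> (\<forall>x\<in>U. h x \<noteq> 0 \<longrightarrow> f (shear u v x) = g x / h x)"
    using holo_on_shear[OF U(3), of u v] holo_on_shear[OF U(4), of u v]
    by - (rule exI[of _ "shear u v -` U"], rule exI[of _ "\<lambda>x. g (shear u v x)"],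
        rule exI[of _ "\<lambda>x. h (shear u v x)"], intro conjI)
qed

text \<open>\<open>mero_shear u v f\<close> is the function \<open>(\<tau>, \<theta>) \<mapsto> f (\<tau>, \<theta> + u + \<tau> v)\<close>.\<close>

lift_definition mero_shear ::
    "'e::free_abelian_group cdual \<Rightarrow> 'e cdual \<Rightarrow> 'e mero \<Rightarrow> 'e mero"
  is "\<lambda>u v f p. f (shear u v p)"
proof -
  fix u v :: "'e cdual" and f g :: "complex \<times> 'e cdual \<Rightarrow> complex" assume *: "mero_eq f g"
  then have nd: "nowhere_dense {p\<in>mero_dom. f p \<noteq> g p}" by (simp add: mero_eq_def)
  have "nowhere_dense {p\<in>mero_dom. f (shear u v p) \<noteq> g (shear u v p)}"
  proof (rule nowhere_dense_subset[OF nowhere_dense_shear[OF nd, of u v]], rule subsetI)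
    fix p assume "p \<in> {p\<in>mero_dom. f (shear u v p) \<noteq> g (shear u v p)}"
    then have "p \<in> mero_dom" "f (shear u v p) \<noteq> g (shear u v p)" by blast+
    then show "p \<in> shear u v -` {p\<in>mero_dom. f p \<noteq> g p}"
      unfolding vimage_eq mem_Collect_eq shear_in_dom by (rule conjI)
  qed
  then show "mero_eq (\<lambda>p. f (shear u v p)) (\<lambda>p. g (shear u v p))"
    unfolding mero_eq_def using mero_on_shear[OF mero_eqD(1)[OF *]] mero_on_shear[OF mero_eqD(2)[OF *]]
    by (intro conjI)
qed

lemma extends_at_mero_eq:
  assumes "mero_eq f g" "p \<in> mero_dom" shows "extends_at f p = extends_at g p"
proof (rule ext, rule iffI)
  fix c
  show "extends_at f p c \<Longrightarrow> extends_at g p c"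
    using assms(1) unfolding mero_eq_def
    by (elim conjE) (rule extends_at_cong[OF _ open_mero_dom assms(2)])
  show "extends_at g p c \<Longrightarrow> extends_at f p c"
    using mero_eq_sym[OF assms(1)] unfolding mero_eq_def
    by (elim conjE) (rule extends_at_cong[OF _ open_mero_dom assms(2)])
qed

lift_definition mero_regular :: "'e::free_abelian_group mero \<Rightarrow> complex \<times> 'e cdual \<Rightarrow> bool"
  is "\<lambda>f p. p \<in> mero_dom \<and> regular_at f p"
proof (rule ext, rule conj_cong[OF refl])
  fix f g :: "complex \<times> 'e cdual \<Rightarrow> complex" and p :: "complex \<times> 'e cdual"
  assume "mero_eq f g" "p \<in> mero_dom"
  from extends_at_mero_eq[OF this] show "regular_at f p = regular_at g p"
    unfolding regular_at_def by (rule arg_cong)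
qed

lift_definition mero_val :: "'e::free_abelian_group mero \<Rightarrow> complex \<times> 'e cdual \<Rightarrow> complex"
  is "\<lambda>f p. if p \<in> mero_dom then value_at f p else 0"
proof (rule ext, rule if_cong[OF refl _ refl])
  fix f g :: "complex \<times> 'e cdual \<Rightarrow> complex" and p :: "complex \<times> 'e cdual"
  assume "mero_eq f g" "p \<in> mero_dom"
  from extends_at_mero_eq[OF this] show "value_at f p = value_at g p"
    unfolding value_at_def by (rule arg_cong)
qed


section \<open>Refined BPS structures\<close>

text \<open>Laurent polynomials in \<open>L\<^bsup>1/2\<^esup>\<close> with rational coefficients are finitely supported functions
  \<open>int \<Rightarrow>\<^sub>0 rat\<close>: \<open>Poly_Mapping.lookup (\<Omega> \<gamma>) n\<close> is the coefficient \<open>\<Omega>\<^sub>n(\<gamma>)\<close> of \<open>(L\<^bsup>1/2\<^esup>)\<^bsup>n\<^esup>\<close>.\<close>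

type_synonym 'g pairing = "'g \<Rightarrow> 'g \<Rightarrow> int"
type_synonym 'g charge = "'g \<Rightarrow> complex"
type_synonym 'g invariants = "'g \<Rightarrow> (int \<Rightarrow>\<^sub>0 rat)"

definition refined_BPS_structure ::
    "'g::free_abelian_group pairing \<Rightarrow> 'g charge \<Rightarrow> 'g invariants \<Rightarrow> bool"
  where "refined_BPS_structure form Z \<Omega> \<longleftrightarrow>
    (\<forall>x y z. form (x + y) z = form x z + form y z) \<and>
    (\<forall>x y z. form x (y + z) = form x y + form x z) \<and>
    (\<forall>x y. form y x = - form x y) \<and>
    (\<forall>x y. Z (x + y) = Z x + Z y) \<and>
    (\<forall>\<gamma>. \<Omega> (- \<gamma>) = \<Omega> \<gamma>) \<and> \<Omega> 0 = 0 \<and>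
    (\<exists>C>0. \<forall>\<gamma>. \<Omega> \<gamma> \<noteq> 0 \<longrightarrow> cmod (Z \<gamma>) > C * lattice_norm \<gamma>)"

definition BPS_finite :: "'g invariants \<Rightarrow> bool"
  where "BPS_finite \<Omega> \<longleftrightarrow> finite {\<gamma>. \<Omega> \<gamma> \<noteq> 0}"

definition BPS_uncoupled :: "'g pairing \<Rightarrow> 'g invariants \<Rightarrow> bool"
  where "BPS_uncoupled form \<Omega> \<longleftrightarrow> (\<forall>\<gamma>\<^sub>1 \<gamma>\<^sub>2. \<Omega> \<gamma>\<^sub>1 \<noteq> 0 \<longrightarrow> \<Omega> \<gamma>\<^sub>2 \<noteq> 0 \<longrightarrow> form \<gamma>\<^sub>1 \<gamma>\<^sub>2 = 0)"

definition BPS_palindromic :: "'g invariants \<Rightarrow> bool"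
  where "BPS_palindromic \<Omega> \<longleftrightarrow> (\<forall>\<gamma> n. Poly_Mapping.lookup (\<Omega> \<gamma>) n = Poly_Mapping.lookup (\<Omega> \<gamma>) (- n))"

definition BPS_integral :: "'g invariants \<Rightarrow> bool"
  where "BPS_integral \<Omega> \<longleftrightarrow> (\<forall>\<gamma> n. Poly_Mapping.lookup (\<Omega> \<gamma>) n \<in> \<int>)"

definition quadratic_refinement :: "'g::ab_group_add pairing \<Rightarrow> ('g \<Rightarrow> int) \<Rightarrow> bool"
  where "quadratic_refinement form \<sigma> \<longleftrightarrow> (\<forall>\<gamma>. \<sigma> \<gamma> \<in> {1, - 1}) \<and>
    (\<forall>\<gamma>\<^sub>1 \<gamma>\<^sub>2. \<sigma> (\<gamma>\<^sub>1 + \<gamma>\<^sub>2) = (- 1) ^ nat \<bar>form \<gamma>\<^sub>1 \<gamma>\<^sub>2\<bar> * \<sigma> \<gamma>\<^sub>1 * \<sigma> \<gamma>\<^sub>2)"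

definition is_ray :: "complex set \<Rightarrow> bool"
  where "is_ray r \<longleftrightarrow> (\<exists>c. c \<noteq> 0 \<and> r = {complex_of_real x * c | x. x > 0})"

definition active_ray :: "'g charge \<Rightarrow> 'g invariants \<Rightarrow> complex set \<Rightarrow> bool"
  where "active_ray Z \<Omega> r \<longleftrightarrow> is_ray r \<and> (\<exists>\<gamma>. \<Omega> \<gamma> \<noteq> 0 \<and> r = {complex_of_real x * Z \<gamma> | x. x > 0})"

definition nonactive_ray :: "'g charge \<Rightarrow> 'g invariants \<Rightarrow> complex set \<Rightarrow> bool"
  where "nonactive_ray Z \<Omega> r \<longleftrightarrow> is_ray r \<and> \<not> active_ray Z \<Omega> r"

definition half_plane :: "complex set \<Rightarrow> complex set"
  where "half_plane r = {t. \<exists>c\<in>r. Re (t / c) > 0}"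

text \<open>Anticlockwise rotation of a ray by the angle \<open>\<phi>\<close>.\<close>

definition rotate_ray :: "real \<Rightarrow> complex set \<Rightarrow> complex set"
  where "rotate_ray \<phi> r = (\<lambda>z. cis \<phi> * z) ` r"


section \<open>The extended quantum torus\<close>

text \<open>From here on \<open>\<Gamma>\<close> is the direct sum \<open>'e \<times> 'm\<close> of \<open>\<Gamma>\<^sub>e = 'e\<close> and \<open>\<Gamma>\<^sub>m = 'm\<close>; the classes
  \<open>(x, 0)\<close> are those of \<open>\<Gamma>\<^sub>e\<close>, the classes \<open>(0, \<delta>)\<close> those of \<open>\<Gamma>\<^sub>m\<close>. The element \<open>f y\<^sub>\<delta>\<close> of the extended
  quantum torus is \<open>Poly_Mapping.single \<delta> f\<close>. The convolution product that the library
  provides on \<open>'m \<Rightarrow>\<^sub>0 'e mero\<close> is not the product \<open>q_times\<close> of the quantum torus.\<close>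

type_synonym ('e, 'm) qtorus = "'m \<Rightarrow>\<^sub>0 'e mero"

definition form_e :: "('e::ab_group_add \<times> 'm::ab_group_add) pairing \<Rightarrow> 'm \<Rightarrow> 'e cdual"
  where "form_e form \<delta> = Abs_cdual (\<lambda>x. of_int (form (0, \<delta>) (x, 0)))"

definition Z_e :: "('e::ab_group_add \<times> 'm::ab_group_add) charge \<Rightarrow> 'e cdual"
  where "Z_e Z = Abs_cdual (\<lambda>x. Z (x, 0))"

definition q_times :: "('e::free_abelian_group \<times> 'm::free_abelian_group) pairing \<Rightarrow>
    ('e, 'm) qtorus \<Rightarrow> ('e, 'm) qtorus \<Rightarrow> ('e, 'm) qtorus"
  where "q_times form a b = (\<Sum>\<delta>\<^sub>1\<in>Poly_Mapping.keys a. \<Sum>\<delta>\<^sub>2\<in>Poly_Mapping.keys b.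
    Poly_Mapping.single (\<delta>\<^sub>1 + \<delta>\<^sub>2) (Poly_Mapping.lookup a \<delta>\<^sub>1 * mero_shear 0 (form_e form \<delta>\<^sub>1) (Poly_Mapping.lookup b \<delta>\<^sub>2)))"

definition q_one :: "('e::free_abelian_group, 'm::free_abelian_group) qtorus"
  where "q_one = Poly_Mapping.single 0 1"

definition q_inverse :: "('e::free_abelian_group \<times> 'm::free_abelian_group) pairing \<Rightarrow>
    ('e, 'm) qtorus \<Rightarrow> ('e, 'm) qtorus"
  where "q_inverse form g = (THE h. q_times form g h = q_one \<and> q_times form h g = q_one)"

definition q_Ad :: "('e::free_abelian_group \<times> 'm::free_abelian_group) pairing \<Rightarrow>
    ('e, 'm) qtorus \<Rightarrow> ('e, 'm) qtorus \<Rightarrow> ('e, 'm) qtorus"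
  where "q_Ad form g a = q_times form (q_times form g a) (q_inverse form g)"

text \<open>Automorphisms as a \<open>\<complex>\<close>-algebra; \<open>\<complex>\<close>-linearity amounts to fixing the constants.\<close>

definition q_aut :: "('e::free_abelian_group \<times> 'm::free_abelian_group) pairing \<Rightarrow>
    (('e, 'm) qtorus \<Rightarrow> ('e, 'm) qtorus) \<Rightarrow> bool"
  where "q_aut form \<phi> \<longleftrightarrow> bij \<phi> \<and>
    (\<forall>a b. \<phi> (a + b) = \<phi> a + \<phi> b) \<and>
    (\<forall>a b. \<phi> (q_times form a b) = q_times form (\<phi> a) (\<phi> b)) \<and>
    (\<forall>c. \<phi> (Poly_Mapping.single 0 (mero_const c)) = Poly_Mapping.single 0 (mero_const c))"

definition eps_Z :: "('e::free_abelian_group \<times> 'm::free_abelian_group) charge \<Rightarrow> complex \<Rightarrow>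
    ('e, 'm) qtorus \<Rightarrow> ('e, 'm) qtorus"
  where "eps_Z Z t a = (\<Sum>\<delta>\<in>Poly_Mapping.keys a. Poly_Mapping.single \<delta>
    (mero_const (exp (Z (0, \<delta>) / t)) *
     mero_shear (scaleC (1 / (2 * of_real pi * \<i> * t)) (Z_e Z)) 0 (Poly_Mapping.lookup a \<delta>)))"


section \<open>Meromorphic families, limits and growth\<close>

text \<open>\<open>coeff_family D f F\<close>: the \<open>F \<delta>\<close> represent meromorphic functions \<open>f\<^sub>\<delta>(\<tau>, \<theta>, t)\<close> on
  \<open>\<H> \<times> V\<^sub>e \<times> D\<close>, almost all of them zero, such that \<open>f t = \<Sum>\<delta>. f\<^sub>\<delta>(_, _, t) y\<^sub>\<delta>\<close> for every \<open>t \<in> D\<close>. For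
  the right-hand side to make sense no slice \<open>\<H> \<times> V\<^sub>e \<times> {t}\<close> may lie in the polar set of \<open>f\<^sub>\<delta>\<close>.\<close>

definition coeff_family :: "complex set \<Rightarrow> (complex \<Rightarrow> ('e::free_abelian_group, 'm) qtorus) \<Rightarrow>
    ('m \<Rightarrow> complex \<times> 'e cdual \<times> complex \<Rightarrow> complex) \<Rightarrow> bool"
  where "coeff_family D f F \<longleftrightarrow>
    finite {\<delta>. F \<delta> \<noteq> (\<lambda>_. 0)} \<and>
    (\<forall>\<delta>. mero_on (upper_half_plane \<times> UNIV \<times> D) (F \<delta>)) \<and>
    (\<forall>t\<in>D. \<forall>\<delta>.
      (\<exists>\<tau>\<in>upper_half_plane. \<exists>\<theta>. regular_at (F \<delta>) (\<tau>, \<theta>, t)) \<and>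
      (\<forall>\<tau>\<in>upper_half_plane. \<forall>\<theta>. regular_at (F \<delta>) (\<tau>, \<theta>, t) \<longrightarrow>
        mero_regular (Poly_Mapping.lookup (f t) \<delta>) (\<tau>, \<theta>) \<and>
        mero_val (Poly_Mapping.lookup (f t) \<delta>) (\<tau>, \<theta>) = value_at (F \<delta>) (\<tau>, \<theta>, t)))"

definition meromorphic_map ::
    "complex set \<Rightarrow> (complex \<Rightarrow> ('e::free_abelian_group, 'm) qtorus) \<Rightarrow> bool"
  where "meromorphic_map D f \<longleftrightarrow> (\<exists>F. coeff_family D f F)"

text \<open>Convergence and growth bounds at \<open>(\<tau>, \<theta>)\<close> include that \<open>f\<^sub>\<delta>(\<tau>, \<theta>, t)\<close> is defined, i.e. has no
  pole, for the relevant \<open>t\<close>. The family \<open>F\<close> is determined by \<open>f\<close> as a family of meromorphic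
  functions, so that existentially quantifying over it is harmless.\<close>

definition map_tendsto :: "complex set \<Rightarrow> (complex \<Rightarrow> ('e::free_abelian_group, 'm) qtorus) \<Rightarrow>
    complex \<Rightarrow> ('e, 'm) qtorus \<Rightarrow> bool"
  where "map_tendsto D f t\<^sub>0 g \<longleftrightarrow> (\<exists>F. coeff_family D f F \<and>
    (\<forall>\<delta> \<tau> \<theta>. \<tau> \<in> upper_half_plane \<longrightarrow> mero_regular (Poly_Mapping.lookup g \<delta>) (\<tau>, \<theta>) \<longrightarrow>
      (\<forall>\<^sub>F t in at t\<^sub>0 within D. regular_at (F \<delta>) (\<tau>, \<theta>, t)) \<and>
      ((\<lambda>t. value_at (F \<delta>) (\<tau>, \<theta>, t)) \<longlongrightarrow> mero_val (Poly_Mapping.lookup g \<delta>) (\<tau>, \<theta>)) (at t\<^sub>0 within D)))"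

definition bounded_growth ::
    "complex set \<Rightarrow> (complex \<Rightarrow> ('e::free_abelian_group, 'm) qtorus) \<Rightarrow> bool"
  where "bounded_growth D f \<longleftrightarrow> (\<exists>F. coeff_family D f F \<and>
    (\<forall>\<delta> \<tau> \<theta>. \<tau> \<in> upper_half_plane \<longrightarrow>
      (\<exists>t\<in>D. regular_at (F \<delta>) (\<tau>, \<theta>, t) \<and> value_at (F \<delta>) (\<tau>, \<theta>, t) \<noteq> 0) \<longrightarrow>
      (\<exists>k>0. \<exists>R>0. \<forall>t\<in>D. cmod t > R \<longrightarrow> regular_at (F \<delta>) (\<tau>, \<theta>, t) \<and>
        cmod t powr (- k) < cmod (value_at (F \<delta>) (\<tau>, \<theta>, t)) \<and>
        cmod (value_at (F \<delta>) (\<tau>, \<theta>, t)) < cmod t powr k)))"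


section \<open>The quantum Riemann--Hilbert problem\<close>

definition sign_pow :: "int \<Rightarrow> int"
  where "sign_pow n = (if even n then 1 else - 1)"

definition E_q :: "complex \<Rightarrow> complex \<Rightarrow> complex"
  where "E_q q x = prodinf (\<lambda>k. 1 - q ^ k * x)"

text \<open>In the products below, \<open>n\<close> is restricted to the finite support of \<open>\<Omega>\<^sub>n(\<gamma>)\<close>, the other factors
  being \<open>1\<close>, and the integer \<open>\<Omega>\<^sub>n(\<gamma>)\<close> is written as \<open>\<lfloor>\<Omega>\<^sub>n(\<gamma>)\<rfloor>\<close>, for it to be an exponent. For
  \<open>x \<in> \<Gamma>\<^sub>e\<close>, \<open>y\<^sub>x = exp (2\<pi>i\<theta>(x))\<close> and \<open>q\<^bsup>1/2\<^esup> = exp (\<pi>i\<tau>)\<close>. The functions to which \<open>mero_of\<close> is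
  applied are meromorphic; their values at poles of \<open>Gamma\<close> and zeros of \<open>E_q\<close> are irrelevant.\<close>

definition DT_q :: "('e::free_abelian_group \<times> 'm::free_abelian_group) charge \<Rightarrow>
    ('e \<times> 'm) invariants \<Rightarrow> complex set \<Rightarrow> ('e, 'm) qtorus"
  where "DT_q Z \<Omega> l = Poly_Mapping.single 0 (mero_of (\<lambda>(\<tau>, \<theta>).
    \<Prod>x | \<Omega> (x, 0) \<noteq> 0 \<and> Z (x, 0) \<in> l. \<Prod>n\<in>Poly_Mapping.keys (\<Omega> (x, 0)).
      E_q (exp (2 * of_real pi * \<i> * \<tau>))
          ((- exp (of_real pi * \<i> * \<tau>)) powi (n + 1) * exp (2 * of_real pi * \<i> * cdual_apply \<theta> x))
        powi (sign_pow (n - 1) * \<lfloor>Poly_Mapping.lookup (\<Omega> (x, 0)) n\<rfloor>)))"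

definition S_q :: "('e::free_abelian_group \<times> 'm::free_abelian_group) pairing \<Rightarrow>
    ('e \<times> 'm) charge \<Rightarrow> ('e \<times> 'm) invariants \<Rightarrow> complex set \<Rightarrow> ('e, 'm) qtorus \<Rightarrow> ('e, 'm) qtorus"
  where "S_q form Z \<Omega> l = q_Ad form (DT_q Z \<Omega> l)"

text \<open>The sets \<open>\<kappa>(\<beta>, \<gamma>)\<close>; \<open>sgn\<close> stands for \<open>\<epsilon>(\<beta>, \<gamma>)\<close>, which is irrelevant if the pairing vanishes.\<close>

definition kappa :: "'g pairing \<Rightarrow> 'g \<Rightarrow> 'g \<Rightarrow> int set"
  where "kappa form \<beta> \<gamma> = (\<lambda>j. sgn (form \<beta> \<gamma>) * (2 * j + 1)) ` {0..<\<bar>form \<beta> \<gamma>\<bar>}"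

definition Lambda :: "complex \<Rightarrow> complex \<Rightarrow> complex"
  where "Lambda w \<eta> = Gamma (w + \<eta>) * exp w * (2 * of_real pi) powr (- 1 / 2) * w powr (1 / 2 - \<eta> - w)"

definition Psi_coeff :: "('e::free_abelian_group \<times> 'm::free_abelian_group) pairing \<Rightarrow>
    ('e \<times> 'm) charge \<Rightarrow> ('e \<times> 'm) invariants \<Rightarrow> complex set \<Rightarrow> complex \<Rightarrow> 'm \<Rightarrow> 'e mero"
  where "Psi_coeff form Z \<Omega> r t \<beta> = mero_of (\<lambda>(\<tau>, \<theta>).
    \<Prod>x | \<Omega> (x, 0) \<noteq> 0 \<and> Z (x, 0) \<in> (\<lambda>z. \<i> * z) ` half_plane r.
    \<Prod>\<nu>\<in>kappa form (0, \<beta>) (x, 0). \<Prod>n\<in>Poly_Mapping.keys (\<Omega> (x, 0)).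
      Lambda (Z (x, 0) / (2 * of_real pi * \<i> * t))
             ((1 + of_int n) / 2 - cdual_apply \<theta> x - (1 / 2) * (of_int \<nu> + of_int n) * \<tau>)
        powi (sign_pow n * \<lfloor>Poly_Mapping.lookup (\<Omega> (x, 0)) n\<rfloor> * sgn (form (0, \<beta>) (x, 0))))"

definition is_Psi :: "('e::free_abelian_group \<times> 'm::free_abelian_group) pairing \<Rightarrow>
    ('e \<times> 'm) charge \<Rightarrow> ('e \<times> 'm) invariants \<Rightarrow> complex set \<Rightarrow> complex \<Rightarrow>
    (('e, 'm) qtorus \<Rightarrow> ('e, 'm) qtorus) \<Rightarrow> bool"
  where "is_Psi form Z \<Omega> r t \<psi> \<longleftrightarrow> q_aut form \<psi> \<and>
    (\<forall>f. \<psi> (Poly_Mapping.single 0 f) = Poly_Mapping.single 0 f) \<and>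
    (\<forall>\<beta>. \<psi> (Poly_Mapping.single \<beta> 1) = Poly_Mapping.single \<beta> (Psi_coeff form Z \<Omega> r t \<beta>))"

definition Psi :: "('e::free_abelian_group \<times> 'm::free_abelian_group) pairing \<Rightarrow>
    ('e \<times> 'm) charge \<Rightarrow> ('e \<times> 'm) invariants \<Rightarrow> complex set \<Rightarrow> complex \<Rightarrow>
    ('e, 'm) qtorus \<Rightarrow> ('e, 'm) qtorus"
  where "Psi form Z \<Omega> r t = (THE \<psi>. is_Psi form Z \<Omega> r t \<psi>)"

definition solves_QRH :: "('e::free_abelian_group \<times> 'm::free_abelian_group) pairing \<Rightarrow>
    ('e \<times> 'm) charge \<Rightarrow> ('e \<times> 'm) invariants \<Rightarrow>
    (complex set \<Rightarrow> complex \<Rightarrow> ('e, 'm) qtorus \<Rightarrow> ('e, 'm) qtorus) \<Rightarrow> bool"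
  where "solves_QRH form Z \<Omega> \<Phi> \<longleftrightarrow>
    (\<forall>r. nonactive_ray Z \<Omega> r \<longrightarrow>
      (\<forall>t\<in>half_plane r. q_aut form (\<Phi> r t)) \<and>
      (\<forall>a. meromorphic_map (half_plane r) (\<lambda>t. \<Phi> r t a))) \<and>
    (\<forall>l. active_ray Z \<Omega> l \<longrightarrow>
      (\<exists>\<epsilon>\<^sub>0>0. \<forall>\<epsilon>\<^sub>1 \<epsilon>\<^sub>2. 0 < \<epsilon>\<^sub>1 \<and> \<epsilon>\<^sub>1 < \<epsilon>\<^sub>0 \<and> 0 < \<epsilon>\<^sub>2 \<and> \<epsilon>\<^sub>2 < \<epsilon>\<^sub>0 \<longrightarrow>
        (let r\<^sub>p = rotate_ray (- \<epsilon>\<^sub>1) l; r\<^sub>m = rotate_ray \<epsilon>\<^sub>2 l in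
          nonactive_ray Z \<Omega> r\<^sub>p \<and> nonactive_ray Z \<Omega> r\<^sub>m \<and>
          (\<forall>t\<in>half_plane r\<^sub>p \<inter> half_plane r\<^sub>m. \<Phi> r\<^sub>p t = \<Phi> r\<^sub>m t \<circ> S_q form Z \<Omega> l)))) \<and>
    (\<forall>r \<phi>. is_ray r \<and> 0 < \<phi> \<and> \<phi> < pi \<and>
        (\<forall>\<psi>\<in>{0..\<phi>}. nonactive_ray Z \<Omega> (rotate_ray \<psi> r)) \<longrightarrow>
      (\<forall>t\<in>half_plane r \<inter> half_plane (rotate_ray \<phi> r). \<Phi> r t = \<Phi> (rotate_ray \<phi> r) t)) \<and>
    (\<forall>r. nonactive_ray Z \<Omega> r \<longrightarrow>
      (\<forall>a. map_tendsto (half_plane r) (\<lambda>t. (\<Phi> r t \<circ> eps_Z Z t) a) 0 a)) \<and>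
    (\<forall>r. nonactive_ray Z \<Omega> r \<longrightarrow>
      (\<forall>a. bounded_growth (half_plane r) (\<lambda>t. \<Phi> r t a)))"

end

theory Submission
  imports Defs
begin

text \<open>
Every automorphism involved is diagonal: it acts on \<open>\<M> y\<^sub>\<beta>\<close> by a translation of \<open>\<theta>\<close> and multiplication
by a function of \<open>\<beta>\<close> satisfying a cocycle condition, so all claims reduce to identities and estimates
for these multipliers.

Across an active ray the half-plane \<open>\<i> \<H>\<^sub>r\<close> exchanges \<open>\<gamma>\<close> for \<open>- \<gamma>\<close>. Palindromicity pairs the two
\<open>\<Lambda>\<close>-factors, the reflection formula for \<open>Gamma\<close> turns each pair into \<open>1 / (1 - exp (2 \<pi> \<i> x))\<close>, and
the product over \<open>\<kappa>(\<beta>, \<gamma>)\<close> is the telescoping quotient of two values of \<open>E\<^sub>q\<close>. The limit at \<open>t \<rightarrow> 0\<close> is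
Stirling's formula in a sector.

For the growth at infinity, \<open>w + \<eta>(\<theta>) = \<eta>(\<theta> - Z / (2 \<pi> \<i> t))\<close>, so the solution applied to \<open>f y\<^sub>\<beta>\<close> is a
meromorphic function evaluated at \<open>\<theta> - Z / (2 \<pi> \<i> t)\<close>, times an elementary factor without zeros or
poles. It then suffices that a meromorphic function of several variables, restricted to a complex
line through a point, is near that point either singular everywhere or meromorphic in one variable.
\<close>

section \<open>Holomorphic functions on complex normed spaces\<close>

text \<open>Holomorphy in \<open>holo_on\<close> means a complex linear Frechet derivative, but
  uniform limits, circular means and derivatives in a fixed direction are visibly holomorphic only
  on complex lines. The passage from one notion to the other is therefore needed throughout.

  The obstacle in the growth condition is that the automorphism is applied to an arbitrary
  meromorphic coefficient. As t tends to infinity the evaluation point runs along a complex line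
  into (\<tau>, \<theta>), which may be a pole or a point of indeterminacy, and in a local
  presentation g / h the denominator may vanish on the whole line. Common factors are not cancelled
  by factoring germs. Instead the generic order d of vanishing of h transversally to the line is
  found, and the quotient of the d-th transversal derivatives of g and h gives the values on the
  line.

  Families depending on t must moreover restrict to every slice of fixed t, so denominators
  vanishing on a slice have to be excluded. Translations of \<theta> depending on t respect this,
  because they map each slice homeomorphically.\<close>

lemma scaleC_minus_left: "scaleC (- c) v = - scaleC c (v::'a::complex_normed_space)"
  using scaleC_add_left[of c "- c" v] by (simp add: eq_neg_iff_add_eq_0 add.commute)

lemmas continuous_on_scaleC_left [continuous_intros] =
  bounded_linear.continuous_on[OF bounded_linear_scaleC_left]

lemma continuous_on_line: "continuous_on A (\<lambda>z. x + scaleC z (v::'a::complex_normed_space))"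
  by (intro continuous_intros linear_continuous_on bounded_linear_scaleC_left)

lemma open_line: "open S \<Longrightarrow> open {z. x + scaleC z (v::'a::complex_normed_space) \<in> S}"
  using open_vimage[OF _ continuous_on_line[of UNIV x v], of S] by (simp add: vimage_def)

lemma holo_on_line:
  fixes f :: "'a::complex_normed_space \<Rightarrow> complex"
  assumes "holo_on S f"
  shows "(\<lambda>z. f (x + scaleC z v)) holomorphic_on {z. x + scaleC z v \<in> S}"
proof -
  have "holo_on {z. x + scaleC z v \<in> S} (\<lambda>z. f (x + scaleC z v))"
  proof (rule holo_on_comp[OF assms])
    show "open {z. x + scaleC z v \<in> S}" by (rule open_line[OF holo_on_open[OF assms]])
  next
    fix z
    have "((\<lambda>z. x + scaleC z v) has_derivative (\<lambda>z. 0 + scaleC z v)) (at z)"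
      by (intro has_derivative_add has_derivative_const bounded_linear_imp_has_derivative
          bounded_linear_scaleC_left)
    then show "\<exists>D. ((\<lambda>z. x + scaleC z v) has_derivative D) (at z) \<and> (\<forall>c w. D (scaleC c w) = scaleC c (D w))"
      by (intro exI[of _ "\<lambda>z. scaleC z v"]) (simp add: scaleC_complex_def scaleC_scaleC)
  qed auto
  then show ?thesis by (simp add: holo_on_complex)
qed

text \<open>The working notion for constructions: continuity and holomorphy on all complex lines
  survive uniform limits and parameter integrals by one-variable theorems. By
  \<open>gateaux_on_imp_holo\<close> it implies \<open>holo_on\<close>.\<close>

definition gateaux_on :: "'a::complex_normed_space set \<Rightarrow> ('a \<Rightarrow> complex) \<Rightarrow> bool"
  where "gateaux_on S f \<longleftrightarrow> open S \<and> continuous_on S f \<and>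
    (\<forall>x v. (\<lambda>z. f (x + scaleC z v)) holomorphic_on {z. x + scaleC z v \<in> S})"

definition ddir :: "'a::complex_normed_space \<Rightarrow> ('a \<Rightarrow> complex) \<Rightarrow> 'a \<Rightarrow> complex"
  where "ddir v f x = deriv (\<lambda>z. f (x + scaleC z v)) 0"

lemma holo_on_gateaux: "holo_on S f \<Longrightarrow> gateaux_on S f"
  by (simp add: gateaux_on_def holo_on_open holo_on_continuous holo_on_line)

lemma gateaux_on_has_ddir:
  assumes "gateaux_on S f" "x \<in> S"
  shows "((\<lambda>z. f (x + scaleC z v)) has_field_derivative ddir v f x) (at 0)"
  unfolding ddir_def
  by (rule holomorphic_derivI[of _ "{z. x + scaleC z v \<in> S}"])
     (use assms in \<open>auto simp: gateaux_on_def open_line\<close>)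

text \<open>Taylor's formula of order one on the line z -> x + z v, with Cauchy's inequality for the
  second derivative. The bound involves v only through its norm, which makes later limits uniform in
  the base point and yields Frechet differentiability.\<close>

lemma gateaux_on_quadratic:
  assumes f: "gateaux_on S f" and B: "ball x \<rho> \<subseteq> S" "\<And>y. y \<in> ball x \<rho> \<Longrightarrow> cmod (f y) \<le> M"
    and "\<rho> > 0" and v: "norm v \<le> \<rho> / 4"
  shows "cmod (f (x + v) - f x - ddir v f x) \<le> 32 * M * (norm v)\<^sup>2 / \<rho>\<^sup>2"
proof (cases "v = 0")
  case True
  then show ?thesis by (simp add: ddir_def)
next
  case False
  then have nv: "norm v > 0" by simp
  define \<phi> where "\<phi> = (\<lambda>z. f (x + scaleC z v))"
  \<comment> \<open>The line stays in the ball for |z| at most r. As r is at least 2, the disc of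
    radius r / 2 about a point of the closed unit disc lies in that range; Cauchy's bound 2 M / (r /
    2)^2 there is the source of the factor 32.\<close>
  define r where "r = \<rho> / (2 * norm v)"
  have r: "r \<ge> 2" using v nv by (simp add: r_def field_simps)
  have M: "M \<ge> 0" using order_trans[OF norm_ge_zero B(2)[of x]] \<open>\<rho> > 0\<close> by simp
  have inb: "x + scaleC z v \<in> ball x \<rho>" if "cmod z \<le> r" for z
  proof -
    have "cmod z * norm v \<le> r * norm v" using that nv by (intro mult_right_mono) auto
    also have "\<dots> = \<rho> / 2" using nv by (simp add: r_def)
    also have "\<dots> < \<rho>" using \<open>\<rho> > 0\<close> by simp
    finally show ?thesis by (simp add: dist_norm norm_scaleC)
  qed
  have hol0: "\<phi> holomorphic_on {z. x + scaleC z v \<in> S}"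
    using f by (simp add: gateaux_on_def \<phi>_def)
  have hol: "\<phi> holomorphic_on cball 0 r"
    by (rule holomorphic_on_subset[OF hol0]) (use inb B(1) in \<open>auto simp: dist_norm\<close>)
  have bound: "cmod (\<phi> z) \<le> M" if "cmod z \<le> r" for z
    unfolding \<phi>_def by (rule B(2)[OF inb[OF that]])
  have bd2: "cmod ((deriv ^^ 2) \<phi> w) \<le> 32 * M * (norm v)\<^sup>2 / \<rho>\<^sup>2" if w: "w \<in> cball 0 1" for w
  proof -
    have sub: "cball w (r / 2) \<subseteq> cball 0 r"
    proof
      fix y assume "y \<in> cball w (r / 2)"
      then have "cmod (y - w) \<le> r / 2" by (simp add: dist_norm norm_minus_commute)
      then have "cmod y \<le> r / 2 + cmod w" using norm_triangle_sub[of y w] by linarith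
      then show "y \<in> cball 0 r" using w r by simp
    qed
    have "cmod ((deriv ^^ 2) \<phi> w) \<le> fact 2 * M / (r / 2) ^ 2"
    proof (rule Cauchy_inequality)
      show "\<phi> holomorphic_on ball w (r / 2)"
        by (rule holomorphic_on_subset[OF hol]) (use sub ball_subset_cball in blast)
      show "continuous_on (cball w (r / 2)) \<phi>"
        by (rule holomorphic_on_imp_continuous_on[OF holomorphic_on_subset[OF hol sub]])
      show "r / 2 > 0" using r by simp
      fix y assume "cmod (w - y) = r / 2"
      then have "y \<in> cball w (r / 2)" by (simp add: dist_norm)
      with sub have "cmod y \<le> r" by auto
      then show "cmod (\<phi> y) \<le> M" by (rule bound)
    qed
    also have "\<dots> = 32 * M * (norm v)\<^sup>2 / \<rho>\<^sup>2"
      using nv \<open>\<rho> > 0\<close> by (simp add: r_def field_simps power2_eq_square)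
    finally show ?thesis .
  qed
  have "cmod ((deriv ^^ 0) \<phi> 1 - (\<Sum>i\<le>1. (deriv ^^ i) \<phi> 0 * (1 - 0) ^ i / fact i))
      \<le> (32 * M * (norm v)\<^sup>2 / \<rho>\<^sup>2) * cmod (1 - 0) ^ (Suc 1) / fact 1"
  proof (rule complex_Taylor[of "cball 0 1"])
    fix i x assume x: "x \<in> cball (0::complex) 1" "i \<le> (1::nat)"
    have "((deriv ^^ i) \<phi> has_field_derivative (deriv ^^ Suc i) \<phi> x) (at x)"
      by (rule has_field_derivative_higher_deriv[of _ "ball 0 r"])
         (use x r hol in \<open>auto intro: holomorphic_on_subset\<close>)
    then show "((deriv ^^ i) \<phi> has_field_derivative (deriv ^^ Suc i) \<phi> x) (at x within cball 0 1)"
      by (rule has_field_derivative_at_within)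
  next
    fix x :: complex assume "x \<in> cball 0 1"
    then show "cmod ((deriv ^^ Suc 1) \<phi> x) \<le> 32 * M * (norm v)\<^sup>2 / \<rho>\<^sup>2"
      using bd2[of x] by (simp add: numeral_2_eq_2)
  qed auto
  then show ?thesis by (simp add: \<phi>_def ddir_def algebra_simps)
qed

lemma gateaux_on_locally_bounded:
  assumes f: "gateaux_on S f" and x: "x \<in> S"
  obtains \<rho> M where "\<rho> > 0" "M > 0" "ball x (2 * \<rho>) \<subseteq> S"
    "\<And>y z. y \<in> ball x \<rho> \<Longrightarrow> z \<in> ball y \<rho> \<Longrightarrow> z \<in> S \<and> cmod (f z) \<le> M"
proof -
  have S: "open S" "continuous_on S f" using f by (auto simp: gateaux_on_def)
  obtain d where d: "d > 0" "\<And>y. y \<in> S \<Longrightarrow> dist y x < d \<Longrightarrow> dist (f y) (f x) < 1"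
    using S(2) x unfolding continuous_on_iff by (metis zero_less_one)
  obtain e where e: "e > 0" "ball x e \<subseteq> S" using S(1) x open_contains_ball by blast
  define \<rho> where "\<rho> = min d e / 2"
  have "ball x (2 * \<rho>) \<subseteq> ball x e" unfolding \<rho>_def by (rule subset_ball) linarith
  then have sub: "ball x (2 * \<rho>) \<subseteq> S" using e(2) by blast
  have *: "z \<in> S \<and> cmod (f z) \<le> cmod (f x) + 1" if "y \<in> ball x \<rho>" "z \<in> ball y \<rho>" for y z
  proof -
    have dz: "dist x z < 2 * \<rho>" using dist_triangle[of x z y] that by simp
    then have zS: "z \<in> S" using sub by auto
    have "2 * \<rho> \<le> d" by (simp add: \<rho>_def)
    then have "dist (f z) (f x) < 1" using d(2)[OF zS] dz by (simp add: dist_commute)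
    then have "cmod (f z) \<le> cmod (f x) + 1"
      using norm_triangle_sub[of "f z" "f x"] by (simp add: dist_norm)
    with zS show ?thesis by blast
  qed
  show ?thesis by (rule that[of \<rho> "cmod (f x) + 1"]) (use d(1) e(1) sub * in \<open>auto simp: \<rho>_def add_nonneg_pos\<close>)
qed

lemma ddir_scaleC:
  assumes f: "gateaux_on S f" and x: "x \<in> S"
  shows "ddir (scaleC c v) f x = c * ddir v f x"
proof -
  have "((\<lambda>z. (\<lambda>z. f (x + scaleC z v)) (z * c)) has_field_derivative ddir v f x * c) (at 0)"
    by (rule DERIV_chain2[of _ "ddir v f x"])
       (use gateaux_on_has_ddir[OF f x, of v] in \<open>auto intro!: derivative_eq_intros\<close>)
  then show ?thesis
    using DERIV_unique[OF gateaux_on_has_ddir[OF f x, of "scaleC c v"]]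
    by (simp add: scaleC_scaleC mult.commute)
qed

text \<open>At every y near x the quadratic estimate holds with the same radius and bound. For the
  step v / (n + 1) it is of order (n + 1)^-2, so a factor 1 / (n + 1) survives the division by the
  step. In this way continuity and holomorphy pass from f to \<open>ddir v f\<close>.\<close>

lemma gateaux_on_quotient_uniform_limit:
  assumes f: "gateaux_on S f" and x: "x \<in> S"
  obtains r N where "r > 0" "ball x r \<subseteq> S"
    "\<forall>n\<ge>N. \<forall>y\<in>ball x r. y + scaleC (1 / of_nat (Suc n)) v \<in> S"
    "uniform_limit (ball x r)
       (\<lambda>n y. of_nat (Suc n) * (f (y + scaleC (1 / of_nat (Suc n)) v) - f y)) (ddir v f) sequentially"
proof -
  obtain \<rho> M where \<rho>: "\<rho> > 0" "M > 0" "ball x (2 * \<rho>) \<subseteq> S"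
    "\<And>y z. y \<in> ball x \<rho> \<Longrightarrow> z \<in> ball y \<rho> \<Longrightarrow> z \<in> S \<and> cmod (f z) \<le> M"
    by (rule gateaux_on_locally_bounded[OF f x]) blast
  define w where "w = (\<lambda>n. scaleC (1 / of_nat (Suc n)) v)"
  have nw: "norm (w n) = norm v / real (Suc n)" for n
    unfolding w_def norm_scaleC norm_divide norm_one norm_of_nat by simp
  obtain N where N: "4 * norm v / \<rho> < real N" using reals_Archimedean2 by blast
  have small: "norm (w n) \<le> \<rho> / 4" if "n \<ge> N" for n
  proof -
    have "4 * norm v / \<rho> < real (Suc n)" using N that by linarith
    then show ?thesis using \<rho>(1) by (simp add: nw field_simps)
  qed
  have inS: "y + w n \<in> S" if "n \<ge> N" "y \<in> ball x \<rho>" for n y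
  proof -
    have "y + w n \<in> ball y \<rho>" using small[OF that(1)] \<rho>(1) by (simp add: dist_norm)
    then show ?thesis using \<rho>(4)[OF that(2)] by blast
  qed
  have est: "cmod (of_nat (Suc n) * (f (y + w n) - f y) - ddir v f y)
      \<le> (32 * M * (norm v)\<^sup>2 / \<rho>\<^sup>2) / real (Suc n)" if n: "n \<ge> N" and y: "y \<in> ball x \<rho>" for n y
  proof -
    have yS: "y \<in> S" using \<rho>(4)[OF y, of y] \<rho>(1) by simp
    have "cmod (f (y + w n) - f y - ddir (w n) f y) \<le> 32 * M * (norm (w n))\<^sup>2 / \<rho>\<^sup>2"
      by (rule gateaux_on_quadratic[OF f]) (use \<rho>(1,4) y small[OF n] in blast)+
    also have "ddir (w n) f y = ddir v f y / of_nat (Suc n)"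
      using ddir_scaleC[OF f yS, of "1 / of_nat (Suc n)" v] by (simp add: w_def)
    finally have *: "cmod (f (y + w n) - f y - ddir v f y / of_nat (Suc n)) \<le> 32 * M * (norm (w n))\<^sup>2 / \<rho>\<^sup>2" .
    have "of_nat (Suc n) * (f (y + w n) - f y) - ddir v f y
        = of_nat (Suc n) * (f (y + w n) - f y - ddir v f y / of_nat (Suc n))"
      by (simp add: right_diff_distrib del: of_nat_Suc)
    then have "cmod (of_nat (Suc n) * (f (y + w n) - f y) - ddir v f y)
        = real (Suc n) * cmod (f (y + w n) - f y - ddir v f y / of_nat (Suc n))"
      by (simp only: norm_mult norm_of_nat)
    also have "\<dots> \<le> real (Suc n) * (32 * M * (norm (w n))\<^sup>2 / \<rho>\<^sup>2)"
      by (rule mult_left_mono[OF *]) simp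
    also have "\<dots> = (32 * M * (norm v)\<^sup>2 / \<rho>\<^sup>2) / real (Suc n)"
      unfolding nw power_divide by (simp add: power2_eq_square mult_ac del: of_nat_Suc)
    finally show ?thesis .
  qed
  have ul: "uniform_limit (ball x \<rho>) (\<lambda>n y. of_nat (Suc n) * (f (y + w n) - f y)) (ddir v f) sequentially"
  proof (rule uniform_limitI)
    fix e :: real assume "e > 0"
    have "(\<lambda>n. (32 * M * (norm v)\<^sup>2 / \<rho>\<^sup>2) / real (Suc n)) \<longlonglongrightarrow> 0"
      by (rule LIMSEQ_Suc[OF lim_const_over_n])
    then have "\<forall>\<^sub>F n in sequentially. (32 * M * (norm v)\<^sup>2 / \<rho>\<^sup>2) / real (Suc n) < e"
      using \<open>e > 0\<close> by (rule order_tendstoD(2))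
    then show "\<forall>\<^sub>F n in sequentially. \<forall>y\<in>ball x \<rho>.
        dist (of_nat (Suc n) * (f (y + w n) - f y)) (ddir v f y) < e"
      using eventually_ge_at_top[of N]
    proof eventually_elim
      case (elim n)
      show ?case
        unfolding dist_norm by (intro ballI order_le_less_trans[OF est elim(1)]) (use elim in auto)
    qed
  qed
  show ?thesis
    by (rule that[of \<rho> N]) (use \<rho>(1,3) inS ul in \<open>auto simp: w_def\<close>)
qed

lemma gateaux_on_ddir_continuous:
  assumes f: "gateaux_on S f"
  shows "continuous_on S (ddir v f)"
proof (rule continuous_at_imp_continuous_on, rule ballI)
  fix x assume x: "x \<in> S"
  obtain r N where r: "r > 0" "ball x r \<subseteq> S"
    "\<forall>n\<ge>N. \<forall>y\<in>ball x r. y + scaleC (1 / of_nat (Suc n)) v \<in> S"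
    "uniform_limit (ball x r)
       (\<lambda>n y. of_nat (Suc n) * (f (y + scaleC (1 / of_nat (Suc n)) v) - f y)) (ddir v f) sequentially"
    by (rule gateaux_on_quotient_uniform_limit[OF f x, of v]) blast
  have fc: "continuous_on S f" using f by (simp add: gateaux_on_def)
  have "continuous_on (ball x r) (ddir v f)"
  proof (rule uniform_limit_theorem[OF _ r(4)])
    show "\<forall>\<^sub>F n in sequentially. continuous_on (ball x r)
        (\<lambda>y. of_nat (Suc n) * (f (y + scaleC (1 / of_nat (Suc n)) v) - f y))"
      using eventually_ge_at_top[of N]
    proof eventually_elim
      case (elim n)
      have "continuous_on (ball x r) (\<lambda>y. f (y + scaleC (1 / of_nat (Suc n)) v))"
        by (rule continuous_on_compose2[OF fc]) (use r(3) elim in \<open>auto intro!: continuous_intros simp del: of_nat_Suc\<close>)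
      then show ?case
        by (intro continuous_intros continuous_on_subset[OF fc r(2)])
    qed
  qed simp
  then show "isCont (ddir v f) x"
    using r(1) by (simp add: continuous_on_eq_continuous_at)
qed

text \<open>The increment along v + w is split into one along w from x and one along v from the
  moving point x + c w. The second converges although its base point moves, by uniform convergence
  of the quotients and continuity of \<open>ddir v f\<close>.\<close>

lemma gateaux_on_ddir_add:
  assumes f: "gateaux_on S f" and x: "x \<in> S"
  shows "ddir (v + w) f x = ddir v f x + ddir w f x"
proof -
  obtain r N where r: "r > 0" "ball x r \<subseteq> S"
    "\<forall>n\<ge>N. \<forall>y\<in>ball x r. y + scaleC (1 / of_nat (Suc n)) v \<in> S"
    "uniform_limit (ball x r)
       (\<lambda>n y. of_nat (Suc n) * (f (y + scaleC (1 / of_nat (Suc n)) v) - f y)) (ddir v f) sequentially"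
    by (rule gateaux_on_quotient_uniform_limit[OF f x, of v]) blast
  define c where "c = (\<lambda>n. 1 / of_nat (Suc n) :: complex)"
  have c0: "c \<longlonglongrightarrow> 0"
    unfolding c_def by (rule LIMSEQ_Suc[OF lim_1_over_n])
  have cne: "c n \<noteq> 0" for n unfolding c_def by (simp del: of_nat_Suc)
  have atc: "filterlim c (at 0) sequentially"
    by (rule filterlim_atI[OF c0]) (use cne in auto)
  define q where "q = (\<lambda>u n y. of_nat (Suc n) * (f (y + scaleC (c n) u) - f y))"
  have q_lim: "(\<lambda>n. q u n x) \<longlonglongrightarrow> ddir u f x" for u
  proof -
    have "((\<lambda>h. (f (x + scaleC h u) - f x) / h) \<longlongrightarrow> ddir u f x) (at 0)"
      using gateaux_on_has_ddir[OF f x, of u] by (simp add: DERIV_def)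
    from filterlim_compose[OF this atc] show ?thesis
      by (simp add: q_def c_def mult.commute del: of_nat_Suc)
  qed
  define y where "y = (\<lambda>n. x + scaleC (c n) w)"
  have ylim: "y \<longlonglongrightarrow> x"
  proof -
    have "isCont (\<lambda>z. x + scaleC z w) 0"
      using continuous_on_line[of UNIV x w] by (simp add: continuous_on_eq_continuous_at)
    from isCont_tendsto_compose[OF this c0] show ?thesis by (simp add: y_def)
  qed
  have "(\<lambda>n. q v n (y n)) \<longlonglongrightarrow> ddir v f x"
  proof (rule Lim_transform2)
    show "(\<lambda>n. ddir v f (y n)) \<longlonglongrightarrow> ddir v f x"
      by (rule continuous_on_tendsto_compose[OF gateaux_on_ddir_continuous[OF f] ylim x])
         (rule eventually_mono[OF topological_tendstoD[OF ylim, of "S"]],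
          use f x in \<open>auto simp: gateaux_on_def\<close>)
    show "(\<lambda>n. ddir v f (y n) - q v n (y n)) \<longlonglongrightarrow> 0"
    proof (rule tendstoI)
      fix e :: real assume "e > 0"
      have "\<forall>\<^sub>F n in sequentially. \<forall>z\<in>ball x r. dist (q v n z) (ddir v f z) < e"
        using uniform_limitD[OF r(4) \<open>e > 0\<close>] by (simp add: q_def c_def del: of_nat_Suc)
      moreover have "\<forall>\<^sub>F n in sequentially. y n \<in> ball x r"
        by (rule topological_tendstoD[OF ylim]) (use r(1) in auto)
      ultimately show "\<forall>\<^sub>F n in sequentially. dist (ddir v f (y n) - q v n (y n)) 0 < e"
        by eventually_elim (auto simp: dist_norm norm_minus_commute)
    qed
  qed
  from tendsto_add[OF this q_lim[of w]]
  have "(\<lambda>n. q v n (y n) + q w n x) \<longlonglongrightarrow> ddir v f x + ddir w f x" .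
  moreover have "q v n (y n) + q w n x = q (v + w) n x" for n
    by (simp add: q_def y_def scaleC_add_right algebra_simps)
  ultimately show ?thesis
    using LIMSEQ_unique[OF q_lim[of "v + w"]] by simp
qed

text \<open>Only finite additivity of the Gateaux derivative is at stake, and it follows from the
  continuity of the directional derivatives.\<close>

lemma gateaux_on_imp_holo:
  assumes f: "gateaux_on S f"
  shows "holo_on S f"
  unfolding holo_on_def
proof (intro conjI ballI)
  show "open S" using f by (simp add: gateaux_on_def)
  fix x assume x: "x \<in> S"
  obtain \<rho> M where \<rho>: "\<rho> > 0" "M > 0" "ball x (2 * \<rho>) \<subseteq> S"
    "\<And>y z. y \<in> ball x \<rho> \<Longrightarrow> z \<in> ball y \<rho> \<Longrightarrow> z \<in> S \<and> cmod (f z) \<le> M"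
    by (rule gateaux_on_locally_bounded[OF f x]) blast
  have b: "ball x \<rho> \<subseteq> S" "\<And>y. y \<in> ball x \<rho> \<Longrightarrow> cmod (f y) \<le> M"
    using \<rho>(4)[of x] \<rho>(1) by auto
  define D where "D = (\<lambda>v. ddir v f x)"
  have sc: "D (scaleC c v) = c * D v" for c v unfolding D_def by (rule ddir_scaleC[OF f x])
  have quad: "cmod (f (x + v) - f x - D v) \<le> (32 * M / \<rho>\<^sup>2) * (norm v)\<^sup>2" if "norm v \<le> \<rho> / 4" for v
    using gateaux_on_quadratic[OF f b \<rho>(1) that] by (simp add: D_def)
  have small: "cmod (D v) \<le> 4 * M" if "norm v \<le> \<rho> / 4" for v
  proof -
    have "x + v \<in> ball x \<rho>" "x \<in> ball x \<rho>" using that \<rho>(1) by (auto simp: dist_norm)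
    then have "cmod (f (x + v)) \<le> M" "cmod (f x) \<le> M" using b(2) by auto
    moreover have "(norm v)\<^sup>2 \<le> (\<rho> / 4)\<^sup>2" using that by (intro power_mono) auto
    then have "(32 * M / \<rho>\<^sup>2) * (norm v)\<^sup>2 \<le> (32 * M / \<rho>\<^sup>2) * (\<rho> / 4)\<^sup>2"
      using \<rho> by (intro mult_left_mono) auto
    then have "(32 * M / \<rho>\<^sup>2) * (norm v)\<^sup>2 \<le> 2 * M" using \<rho>(1) by (simp add: power2_eq_square)
    moreover have "cmod (D v) \<le> cmod (f (x + v) - f x - D v) + cmod (f (x + v)) + cmod (f x)"
      by (smt (verit, ccfv_threshold) norm_triangle_ineq4 norm_triangle_sub norm_minus_commute)
    ultimately show ?thesis using quad[OF that] by linarith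
  qed
  have bl: "bounded_linear D"
  \<comment> \<open>On vectors of norm at most \<rho> / 4 the quadratic error is at most 2 M and the
    two values of f at most M each, so |D v| is at most 4 M; rescaling to norm \<rho> / 4 gives this
    K.\<close>
  proof (rule bounded_linear_intro[where K = "16 * M / \<rho>"])
    show "D (v + w) = D v + D w" for v w unfolding D_def by (rule gateaux_on_ddir_add[OF f x])
    show "D (c *\<^sub>R v) = c *\<^sub>R D v" for c v
      using sc[of "of_real c" v] by (simp add: scaleC_of_real scaleR_conv_of_real)
    show "cmod (D v) \<le> norm v * (16 * M / \<rho>)" for v
    proof (cases "v = 0")
      case True
      then show ?thesis using sc[of 0 v] by simp
    next
      case False
      define a where "a = \<rho> / 4 / norm v"
      have a: "a > 0" using False \<rho>(1) by (simp add: a_def)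
      have "cmod (D (scaleC (of_real a) v)) \<le> 4 * M"
        by (rule small) (use False \<rho>(1) a in \<open>simp add: norm_scaleC a_def norm_divide norm_mult\<close>)
      then have "a * cmod (D v) \<le> 4 * M" using a by (simp add: sc norm_mult)
      then show ?thesis using False \<rho>(1) by (simp add: a_def field_simps)
    qed
  qed
  have "(f has_derivative D) (at x)"
    unfolding has_derivative_at
  proof
    show "(\<lambda>h. norm (f (x + h) - f x - D h) / norm h) \<midarrow>0\<rightarrow> 0"
    proof (rule Lim_null_comparison)
      show "\<forall>\<^sub>F h in at 0. norm (norm (f (x + h) - f x - D h) / norm h) \<le> (32 * M / \<rho>\<^sup>2) * norm h"
        unfolding eventually_at
      proof (intro exI[of _ "\<rho> / 4"] conjI ballI impI)
        fix h :: 'a assume h: "h \<noteq> 0 \<and> dist h 0 < \<rho> / 4"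
        have "norm (f (x + h) - f x - D h) / norm h \<le> (32 * M / \<rho>\<^sup>2) * (norm h)\<^sup>2 / norm h"
          using h by (intro divide_right_mono quad) auto
        then show "norm (norm (f (x + h) - f x - D h) / norm h) \<le> (32 * M / \<rho>\<^sup>2) * norm h"
          using h by (simp add: power2_eq_square)
      qed (use \<rho>(1) in simp)
      have "((\<lambda>h::'a. (32 * M / \<rho>\<^sup>2) * norm h) \<longlongrightarrow> (32 * M / \<rho>\<^sup>2) * norm (0::'a)) (at 0)"
        by (intro tendsto_mult tendsto_const tendsto_norm tendsto_ident_at)
      then show "((\<lambda>h. (32 * M / \<rho>\<^sup>2) * norm (h::'a)) \<longlongrightarrow> 0) (at 0)" by simp
    qed
  qed (rule bl)
  then show "\<exists>D. (f has_derivative D) (at x) \<and> (\<forall>c v. D (scaleC c v) = c * D v)"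
    using sc by blast
qed

text \<open>Weierstrass' theorem, reduced to one variable: the limit is continuous and on each
  complex line a locally uniform limit of holomorphic functions, so it is Gateaux
  holomorphic.\<close>

lemma holo_on_uniform_limit:
  fixes f :: "nat \<Rightarrow> 'a::complex_normed_space \<Rightarrow> complex"
  assumes "open S"
    and lim: "\<And>x. x \<in> S \<Longrightarrow> \<exists>r>0. ball x r \<subseteq> S \<and> (\<forall>\<^sub>F n in sequentially. holo_on (ball x r) (f n)) \<and>
      uniform_limit (ball x r) f g sequentially"
  shows "holo_on S g"
proof (rule gateaux_on_imp_holo, unfold gateaux_on_def, intro conjI allI)
  show "continuous_on S g"
  proof (rule continuous_at_imp_continuous_on, rule ballI)
    fix x assume "x \<in> S"
    then obtain r where r: "r > 0" "\<forall>\<^sub>F n in sequentially. holo_on (ball x r) (f n)"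
      "uniform_limit (ball x r) f g sequentially" using lim by blast
    have "continuous_on (ball x r) g"
      by (rule uniform_limit_theorem[OF _ r(3)]) (use r(2) in \<open>auto elim: eventually_mono intro: holo_on_continuous\<close>)
    then show "isCont g x" using r(1) by (simp add: continuous_on_eq_continuous_at)
  qed
next
  fix x v :: 'a
  let ?L = "{z. x + scaleC z v \<in> S}"
  show "(\<lambda>z. g (x + scaleC z v)) holomorphic_on ?L"
    unfolding holomorphic_on_def
  proof
    fix z0 assume "z0 \<in> ?L"
    then obtain r where r: "r > 0" "\<forall>\<^sub>F n in sequentially. holo_on (ball (x + scaleC z0 v) r) (f n)"
      "uniform_limit (ball (x + scaleC z0 v) r) f g sequentially" using lim by blast
    define W where "W = {z. x + scaleC z v \<in> ball (x + scaleC z0 v) r}"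
    have "open W" unfolding W_def by (rule open_line) simp
    moreover have "z0 \<in> W" using r(1) by (simp add: W_def)
    ultimately obtain e where e: "e > 0" "cball z0 e \<subseteq> W" using open_contains_cball by blast
    have W: "x + scaleC z v \<in> ball (x + scaleC z0 v) r" if "z \<in> cball z0 e" for z
      using e(2) that by (auto simp: W_def)
    have ul: "uniform_limit (cball z0 e) (\<lambda>n z. f n (x + scaleC z v)) (\<lambda>z. g (x + scaleC z v)) sequentially"
      by (rule uniform_limit_compose'[OF r(3)]) (use W in auto)
    have ev: "\<forall>\<^sub>F n in sequentially. continuous_on (cball z0 e) (\<lambda>z. f n (x + scaleC z v)) \<and>
        (\<lambda>z. f n (x + scaleC z v)) holomorphic_on ball z0 e"
      using r(2)
    proof eventually_elim
      case (elim n)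
      have h: "(\<lambda>z. f n (x + scaleC z v)) holomorphic_on cball z0 e"
        by (rule holomorphic_on_subset[OF holo_on_line[OF elim]]) (use W in auto)
      then show ?case
        using holomorphic_on_imp_continuous_on holomorphic_on_subset ball_subset_cball by blast
    qed
    obtain "(\<lambda>z. g (x + scaleC z v)) holomorphic_on ball z0 e"
      using holomorphic_uniform_limit[OF ev ul] by auto
    then have "(\<lambda>z. g (x + scaleC z v)) field_differentiable at z0"
      using e(1) by (simp add: holomorphic_on_imp_differentiable_at)
    then show "(\<lambda>z. g (x + scaleC z v)) field_differentiable at z0 within ?L"
      by (rule field_differentiable_at_within)
  qed
qed fact

lemma holo_on_translate:
  fixes f :: "'a::complex_normed_space \<Rightarrow> complex"
  assumes "holo_on S f" "open V" "\<And>y. y \<in> V \<Longrightarrow> y + a \<in> S"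
  shows "holo_on V (\<lambda>y. f (y + a))"
  by (rule holo_on_comp[OF assms(1,2), of "\<lambda>y. y + a"])
     (auto intro!: assms(3) exI[of _ "\<lambda>x. x"] derivative_eq_intros)

lemma holo_on_ddir:
  assumes f: "holo_on S f"
  shows "holo_on S (ddir v f)"
proof (rule holo_on_uniform_limit)
  show "open S" by (rule holo_on_open[OF f])
  fix x assume x: "x \<in> S"
  obtain r N where r: "r > 0" "ball x r \<subseteq> S"
    "\<forall>n\<ge>N. \<forall>y\<in>ball x r. y + scaleC (1 / of_nat (Suc n)) v \<in> S"
    "uniform_limit (ball x r)
       (\<lambda>n y. of_nat (Suc n) * (f (y + scaleC (1 / of_nat (Suc n)) v) - f y)) (ddir v f) sequentially"
    by (rule gateaux_on_quotient_uniform_limit[OF holo_on_gateaux[OF f] x, of v]) blast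
  have "\<forall>\<^sub>F n in sequentially. holo_on (ball x r)
      (\<lambda>y. of_nat (Suc n) * (f (y + scaleC (1 / of_nat (Suc n)) v) - f y))"
    using eventually_ge_at_top[of N]
  proof eventually_elim
    case (elim n)
    have "holo_on (ball x r) (\<lambda>y. of_nat (Suc n) * (f (y + scaleC (1 / of_nat (Suc n)) v) + (-1) * f y))"
      by (intro holo_on_mult holo_on_add holo_on_const open_ball holo_on_translate[OF f]
          holo_on_subset[OF f] r(2)) (use r(3) elim in auto)
    then show ?case by simp
  qed
  with r show "\<exists>r>0. ball x r \<subseteq> S \<and>
      (\<forall>\<^sub>F n in sequentially. holo_on (ball x r)
        (\<lambda>y. of_nat (Suc n) * (f (y + scaleC (1 / of_nat (Suc n)) v) - f y))) \<and>
      uniform_limit (ball x r)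
       (\<lambda>n y. of_nat (Suc n) * (f (y + scaleC (1 / of_nat (Suc n)) v) - f y)) (ddir v f) sequentially"
    by blast
qed

text \<open>Iterated derivatives along a line become functions on S that are again holomorphic, so
  the Taylor coefficients in a transversal direction can be studied while the base point moves. Both
  claims are proved together because the induction step differentiates the n-th derivative.\<close>

lemma higher_deriv_line:
  assumes f: "holo_on S f" and x: "x + scaleC z v \<in> S"
  shows "(deriv ^^ n) (\<lambda>z. f (x + scaleC z v)) z = (ddir v ^^ n) f (x + scaleC z v)
    \<and> holo_on S ((ddir v ^^ n) f)"
  using x
proof (induction n arbitrary: z)
  case 0
  then show ?case using f by simp
next
  case (Suc n)
  define L where "L = {z. x + scaleC z v \<in> S}"
  have L: "open L" "z \<in> L" using Suc.prems open_line[OF holo_on_open[OF f]] by (auto simp: L_def)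
  have h: "holo_on S ((ddir v ^^ n) f)" using Suc by blast
  have "(deriv ^^ Suc n) (\<lambda>z. f (x + scaleC z v)) z = deriv (\<lambda>z. (ddir v ^^ n) f (x + scaleC z v)) z"
    unfolding funpow.simps o_def
    by (rule deriv_cong_ev[OF eventually_mono[OF eventually_nhds_in_open[OF L]]])
       (use Suc.IH in \<open>auto simp: L_def\<close>)
  also have "\<dots> = ddir v ((ddir v ^^ n) f) (x + scaleC z v)"
  proof -
    have "((\<lambda>w. (ddir v ^^ n) f ((x + scaleC z v) + scaleC w v)) has_field_derivative
        ddir v ((ddir v ^^ n) f) (x + scaleC z v)) (at 0)"
      by (rule gateaux_on_has_ddir[OF holo_on_gateaux[OF h] Suc.prems])
    then have "((\<lambda>w. (ddir v ^^ n) f (x + scaleC (z + w) v)) has_field_derivative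
        ddir v ((ddir v ^^ n) f) (x + scaleC z v)) (at 0)"
      by (simp add: scaleC_add_left add.assoc)
    then show ?thesis
      by (intro DERIV_imp_deriv) (use DERIV_shift[of _ _ 0 z] in \<open>simp add: add.commute\<close>)
  qed
  finally show ?case using holo_on_ddir[OF h, of v] by simp
qed

section \<open>Closure properties of holomorphic functions\<close>

lemma holo_on_compose_complex:
  assumes f: "holo_on S f" and \<phi>: "\<phi> holomorphic_on A" "open A" "\<And>x. x \<in> S \<Longrightarrow> f x \<in> A"
  shows "holo_on S (\<lambda>x. \<phi> (f x))"
proof (rule holo_on_comp[where S = A and g = \<phi>])
  show "holo_on A \<phi>" using \<phi> by (simp add: holo_on_complex)
  fix x assume "x \<in> S"
  then show "\<exists>D. (f has_derivative D) (at x) \<and> (\<forall>c v. D (scaleC c v) = scaleC c (D v))"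
    using f unfolding holo_on_def scaleC_complex_def by blast
qed (use \<phi> holo_on_open[OF f] in auto)

lemma holo_on_inverse:
  assumes "holo_on S f" "\<And>x. x \<in> S \<Longrightarrow> f x \<noteq> 0"
  shows "holo_on S (\<lambda>x. inverse (f x))"
  by (rule holo_on_compose_complex[OF assms(1), of inverse "- {0}"])
     (use assms(2) in \<open>auto intro!: holomorphic_intros\<close>)

lemma holo_on_divide:
  assumes "holo_on S f" "holo_on S g" "\<And>x. x \<in> S \<Longrightarrow> g x \<noteq> 0"
  shows "holo_on S (\<lambda>x. f x / g x)"
  unfolding divide_inverse by (intro holo_on_mult holo_on_inverse assms)

lemma holo_on_uminus: "holo_on S f \<Longrightarrow> holo_on S (\<lambda>x. - f x)"
  using holo_on_mult[OF holo_on_const[of S "-1"]] holo_on_open by fastforce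

lemma holo_on_diff: "holo_on S f \<Longrightarrow> holo_on S g \<Longrightarrow> holo_on S (\<lambda>x. f x - g x)"
  using holo_on_add[OF _ holo_on_uminus, of S f g] by simp

lemma holo_on_cong:
  assumes "holo_on S f" "\<And>x. x \<in> S \<Longrightarrow> f x = g x"
  shows "holo_on S g"
  unfolding holo_on_def
proof (intro conjI ballI)
  show "open S" by (rule holo_on_open[OF assms(1)])
  fix x assume x: "x \<in> S"
  then obtain D where D: "(f has_derivative D) (at x)" "\<And>c v. D (scaleC c v) = c * D v"
    using assms(1) unfolding holo_on_def by blast
  have "(g has_derivative D) (at x)"
    by (rule has_derivative_transform_within_open[OF D(1) \<open>open S\<close> x assms(2)])
  with D(2) show "\<exists>D. (g has_derivative D) (at x) \<and> (\<forall>c v. D (scaleC c v) = c * D v)" by blast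
qed

lemma compact_subset_open_ball:
  fixes C :: "'a::metric_space set"
  assumes "compact C" "open U" "C \<subseteq> U"
  obtains \<delta> where "\<delta> > 0" "\<And>x. x \<in> C \<Longrightarrow> ball x \<delta> \<subseteq> U"
proof -
  have "\<exists>e>0. \<forall>x\<in>C. \<exists>G\<in>{U}. ball x e \<subseteq> G"
    using Heine_Borel_lemma[of C "{U}"] assms by (metis Union_upper insertI1 singletonD subset_trans)
  then show ?thesis using that by auto
qed

section \<open>Values of meromorphic functions\<close>

lemma continuous_eq_off_nowhere_dense:
  fixes f g :: "'a::topological_space \<Rightarrow> complex"
  assumes "open V" "continuous_on V f" "continuous_on V g"
    "nowhere_dense N" "\<And>x. x \<in> V \<Longrightarrow> x \<notin> N \<Longrightarrow> f x = g x" "x \<in> V"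
  shows "f x = g x"
proof -
  have "open (V \<inter> (\<lambda>x. f x - g x) -` (- {0}))"
    by (intro continuous_open_preimage continuous_intros assms)
  then have "V \<inter> (\<lambda>x. f x - g x) -` (- {0}) = {}"
    by (rule nowhere_dense_open[OF assms(4)]) (use assms(5) in force)
  then show ?thesis using \<open>x \<in> V\<close> by auto
qed

text \<open>Two holomorphic extensions agree off a nowhere dense set, hence by continuity also at p;
  this gives \<open>value_at\<close> its meaning.\<close>

lemma extends_at_unique:
  assumes "extends_at f p c" "extends_at f p c'"
  shows "c = c'"
proof -
  obtain U g where U: "p \<in> U" "holo_on U g" "nowhere_dense {x\<in>U. f x \<noteq> g x}" "g p = c"
    using assms(1) unfolding extends_at_def by blast
  obtain V k where V: "p \<in> V" "holo_on V k" "nowhere_dense {x\<in>V. f x \<noteq> k x}" "k p = c'"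
    using assms(2) unfolding extends_at_def by blast
  have o: "open (U \<inter> V)" using U(2) V(2) holo_on_open by blast
  have "g p = k p"
    by (rule continuous_eq_off_nowhere_dense[OF o _ _ nowhere_dense_Un[OF U(3) V(3)]])
       (use U V holo_on_continuous in \<open>auto intro: continuous_on_subset\<close>)
  then show ?thesis using U V by simp
qed

lemma value_atI: "extends_at f p c \<Longrightarrow> value_at f p = c"
  unfolding value_at_def by (blast intro: the_equality extends_at_unique)

lemma regular_atI: "extends_at f p c \<Longrightarrow> regular_at f p"
  unfolding regular_at_def by blast

lemma extends_at_value: "regular_at f p \<Longrightarrow> extends_at f p (value_at f p)"
  unfolding regular_at_def using value_atI by metis

lemma extends_at_holo: "holo_on U g \<Longrightarrow> p \<in> U \<Longrightarrow> extends_at g p (g p)"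
  unfolding extends_at_def by (intro exI[of _ U] exI[of _ g]) simp

definition quotient_on :: "'a::complex_normed_space set \<Rightarrow> ('a \<Rightarrow> complex) \<Rightarrow> ('a \<Rightarrow> complex) \<Rightarrow> ('a \<Rightarrow> complex) \<Rightarrow> bool"
  where "quotient_on U f g h \<longleftrightarrow> holo_on U g \<and> holo_on U h \<and> nowhere_dense {x\<in>U. h x = 0} \<and>
    (\<forall>x\<in>U. h x \<noteq> 0 \<longrightarrow> f x = g x / h x)"

lemma quotient_on_subset: "quotient_on U f g h \<Longrightarrow> open V \<Longrightarrow> V \<subseteq> U \<Longrightarrow> quotient_on V f g h"
  unfolding quotient_on_def
  by (auto intro: holo_on_subset nowhere_dense_subset[of "{x\<in>U. h x = 0}"])

lemma mero_on_quotientE: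
  assumes "mero_on S f" "p \<in> S"
  obtains r g h where "r > 0" "ball p r \<subseteq> S" "quotient_on (ball p r) f g h"
proof -
  obtain U g h where U: "p \<in> U" "U \<subseteq> S" "holo_on U g" "holo_on U h"
    "nowhere_dense {x\<in>U. h x = 0}" "\<And>x. x \<in> U \<Longrightarrow> h x \<noteq> 0 \<Longrightarrow> f x = g x / h x"
    by (rule mero_onE[OF assms]) (rule that)
  obtain r where r: "r > 0" "ball p r \<subseteq> U"
    using holo_on_open[OF U(3)] U(1) open_contains_ball by blast
  have "quotient_on U f g h" using U by (simp add: quotient_on_def)
  then have "quotient_on (ball p r) f g h" by (rule quotient_on_subset) (use r in auto)
  then show ?thesis using that r U(2) by blast
qed

lemma extends_at_quotientI:
  assumes q: "quotient_on U f g h" and V: "holo_on V k" "p \<in> V" "V \<subseteq> U"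
    and eq: "\<And>x. x \<in> V \<Longrightarrow> k x * h x = g x"
  shows "extends_at f p (k p)"
  unfolding extends_at_def
proof (intro exI conjI)
  show "nowhere_dense {x\<in>V. f x \<noteq> k x}"
  proof (rule nowhere_dense_subset)
    show "nowhere_dense {x\<in>U. h x = 0}" using q by (simp add: quotient_on_def)
    show "{x\<in>V. f x \<noteq> k x} \<subseteq> {x\<in>U. h x = 0}"
    proof clarify
      fix x assume x: "x \<in> V" "f x \<noteq> k x"
      then have "x \<in> U" using V(3) by blast
      moreover have "h x = 0"
      proof (rule ccontr)
        assume "h x \<noteq> 0"
        then have "f x = g x / h x" using q \<open>x \<in> U\<close> by (simp add: quotient_on_def)
        also have "\<dots> = k x" using eq[OF x(1)] \<open>h x \<noteq> 0\<close> by (simp add: field_simps)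
        finally show False using x by simp
      qed
      ultimately show "x \<in> U \<and> h x = 0" by simp
    qed
  qed
qed (use V in auto)

lemma extends_at_quotient_nonzero:
  assumes q: "quotient_on U f g h" and p: "p \<in> U" "h p \<noteq> 0"
  shows "extends_at f p (g p / h p)"
proof -
  have hol: "holo_on U g" "holo_on U h" and oU: "open U" using q holo_on_open by (auto simp: quotient_on_def)
  define V where "V = U \<inter> h -` (- {0})"
  have "open V"
    unfolding V_def by (intro continuous_open_preimage holo_on_continuous hol oU) auto
  then have "holo_on V (\<lambda>x. g x / h x)"
    by (intro holo_on_divide hol[THEN holo_on_subset]) (auto simp: V_def)
  from extends_at_quotientI[OF q this, of p] show ?thesis using p by (auto simp: V_def)
qed

text \<open>Regularity read as divisibility of g by h near p. The identity k h = g, clear off a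
  nowhere dense set, extends across the zeros of h by continuity; it is the usable form when h
  vanishes at p itself.\<close>

lemma extends_at_quotientE:
  assumes q: "quotient_on U f g h" and p: "p \<in> U" and e: "extends_at f p c"
  obtains r k where "r > 0" "ball p r \<subseteq> U" "holo_on (ball p r) k" "k p = c"
    "\<And>x. x \<in> ball p r \<Longrightarrow> k x * h x = g x"
proof -
  have hol: "holo_on U g" "holo_on U h" and oU: "open U" using q holo_on_open by (auto simp: quotient_on_def)
  obtain V k where V: "p \<in> V" "holo_on V k" "nowhere_dense {x\<in>V. f x \<noteq> k x}" "k p = c"
    using e unfolding extends_at_def by blast
  have "open (U \<inter> V)" using oU holo_on_open[OF V(2)] by blast
  then obtain r where r: "r > 0" "ball p r \<subseteq> U \<inter> V" using p V(1) open_contains_ball by blast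
  have k: "holo_on (ball p r) k" by (rule holo_on_subset[OF V(2)]) (use r in auto)
  have "k x * h x = g x" if x: "x \<in> ball p r" for x
  proof (rule continuous_eq_off_nowhere_dense[OF _ _ _ nowhere_dense_Un[OF V(3)] _ x])
    show "nowhere_dense {x\<in>U. h x = 0}" using q by (simp add: quotient_on_def)
    show "continuous_on (ball p r) (\<lambda>x. k x * h x)" "continuous_on (ball p r) g"
      using r(2) by (auto intro!: continuous_intros holo_on_continuous[OF k]
          continuous_on_subset[OF holo_on_continuous[OF hol(1)]] continuous_on_subset[OF holo_on_continuous[OF hol(2)]])
    fix y assume y: "y \<in> ball p r" "y \<notin> {x\<in>V. f x \<noteq> k x} \<union> {x\<in>U. h x = 0}"
    then have "y \<in> U" "y \<in> V" using r(2) by auto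
    then have "h y \<noteq> 0" "f y = k y" using y(2) by auto
    then show "k y * h y = g y" using q \<open>y \<in> U\<close> by (auto simp: quotient_on_def field_simps)
  qed simp
  then show ?thesis using that[of r k] r k V(4) by blast
qed

lemma open_regular: "open {x. regular_at f x}"
proof (subst open_subopen, intro ballI)
  fix p assume "p \<in> {x. regular_at f x}"
  then obtain U g where U: "p \<in> U" "holo_on U g" "nowhere_dense {x\<in>U. f x \<noteq> g x}"
    unfolding regular_at_def extends_at_def by blast
  have "regular_at f x" if "x \<in> U" for x
    unfolding regular_at_def extends_at_def using U that by blast
  then show "\<exists>T. open T \<and> p \<in> T \<and> T \<subseteq> {x. regular_at f x}"
    using U holo_on_open by blast
qed

section \<open>Restriction of a meromorphic function to a complex line\<close>

lemma holomorphic_mean_value: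
  assumes "continuous_on (cball 0 r) \<phi>" "\<phi> holomorphic_on ball 0 r" "r > 0"
  shows "integral {0..1} (\<lambda>t. \<phi> (of_real r * exp (2 * of_real pi * \<i> * of_real t))) = \<phi> 0"
proof -
  have "((\<lambda>u. \<phi> u / (u - 0)) has_contour_integral (2 * of_real pi * \<i>) * \<phi> 0) (circlepath 0 r)"
    by (rule Cauchy_integral_circlepath) (use assms in auto)
  then have "((\<lambda>x. \<phi> (circlepath 0 r x) / (circlepath 0 r x - 0) * vector_derivative (circlepath 0 r) (at x))
      has_integral (2 * of_real pi * \<i>) * \<phi> 0) {0..1}"
    by (simp add: has_contour_integral)
  then have "((\<lambda>x. 1 / (2 * of_real pi * \<i>) * (\<phi> (circlepath 0 r x) / (circlepath 0 r x - 0) * vector_derivative (circlepath 0 r) (at x)))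
      has_integral 1 / (2 * of_real pi * \<i>) * ((2 * of_real pi * \<i>) * \<phi> 0)) {0..1}"
    by (rule has_integral_mult_right)
  also have "(\<lambda>x. 1 / (2 * of_real pi * \<i>) * (\<phi> (circlepath 0 r x) / (circlepath 0 r x - 0) * vector_derivative (circlepath 0 r) (at x)))
      = (\<lambda>t. \<phi> (of_real r * exp (2 * of_real pi * \<i> * of_real t)))"
    unfolding vector_derivative_circlepath using assms(3) by (simp add: circlepath fun_eq_iff)
  finally show ?thesis by (simp add: integral_unique)
qed

lemma convex_line: "convex S \<Longrightarrow> convex {z. x + scaleC z (v::'a::complex_normed_space) \<in> S}"
proof -
  assume S: "convex S"
  have "convex ((\<lambda>z. scaleC z v) -` ((+) (- x) ` S))"
    by (intro convex_linear_vimage bounded_linear.linear bounded_linear_scaleC_left convex_translation S)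
  also have "(\<lambda>z. scaleC z v) -` ((+) (- x) ` S) = {z. x + scaleC z v \<in> S}"
    by (auto simp: image_iff algebra_simps intro!: bexI[of _ "x + scaleC _ v"])
  finally show ?thesis .
qed

text \<open>Only the circles have to lie in U, not the discs they bound. For U the set where a
  denominator is nonzero, the mean can therefore continue a quotient to points where the denominator
  vanishes. Holomorphy on lines is the Leibniz rule, the derivative of the integrand being a
  \<open>ddir\<close>.\<close>

lemma circle_mean_holo:
  fixes k :: "'a::complex_normed_space \<Rightarrow> complex"
  assumes k: "holo_on U k" and W: "open W" "convex W"
    and sub: "\<And>x t. x \<in> W \<Longrightarrow> t \<in> {0..1} \<Longrightarrow> x + scaleC (of_real r * exp (2 * of_real pi * \<i> * of_real t)) u \<in> U"
  shows "holo_on W (\<lambda>x. integral {0..1} (\<lambda>t. k (x + scaleC (of_real r * exp (2 * of_real pi * \<i> * of_real t)) u)))"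
proof -
  define e where "e = (\<lambda>t::real. scaleC (of_real r * exp (2 * of_real pi * \<i> * of_real t)) u)"
  have ec: "continuous_on A e" for A
    unfolding e_def by (intro continuous_intros)
  have kc: "continuous_on U k" by (rule holo_on_continuous[OF k])
  have sub': "x + e t \<in> U" if "x \<in> W" "t \<in> cbox 0 1" for x t using sub[of x t] that by (simp add: e_def)
  have "holo_on W (\<lambda>x. integral (cbox 0 1) (\<lambda>t. k (x + e t)))"
  proof (rule gateaux_on_imp_holo, unfold gateaux_on_def, intro conjI allI W)
    show "continuous_on W (\<lambda>x. integral (cbox 0 1) (\<lambda>t. k (x + e t)))"
    proof (rule integral_continuous_on_param)
      show "continuous_on (W \<times> cbox 0 1) (\<lambda>(x, t). k (x + e t))"
        unfolding split_beta
        by (rule continuous_on_compose2[OF kc])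
           (use sub' in \<open>auto intro!: continuous_intros continuous_on_compose2[OF ec[of UNIV]]\<close>)
    qed
  next
    fix x v
    show "(\<lambda>z. integral (cbox 0 1) (\<lambda>t. k (x + scaleC z v + e t))) holomorphic_on {z. x + scaleC z v \<in> W}"
    proof (rule leibniz_rule_holomorphic[where fx = "\<lambda>z t. ddir v k (x + scaleC z v + e t)"])
      fix z t assume z: "z \<in> {z. x + scaleC z v \<in> W}" and t: "t \<in> cbox (0::real) 1"
      have "((\<lambda>w. k ((x + scaleC z v + e t) + scaleC w v)) has_field_derivative
          ddir v k (x + scaleC z v + e t)) (at 0)"
        by (rule gateaux_on_has_ddir[OF holo_on_gateaux[OF k]]) (use z t sub' in auto)
      moreover have "(x + scaleC z v + e t) + scaleC w v = x + scaleC (w + z) v + e t" for w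
        by (simp add: scaleC_add_left algebra_simps)
      ultimately have "((\<lambda>z. k (x + scaleC z v + e t)) has_field_derivative
          ddir v k (x + scaleC z v + e t)) (at z)"
        using DERIV_shift[of "\<lambda>z. k (x + scaleC z v + e t)" _ 0 z] by simp
      then show "((\<lambda>z. k (x + scaleC z v + e t)) has_field_derivative
          ddir v k (x + scaleC z v + e t)) (at z within {z. x + scaleC z v \<in> W})"
        by (rule has_field_derivative_at_within)
    next
      fix z assume z: "z \<in> {z. x + scaleC z v \<in> W}"
      show "(\<lambda>t. k (x + scaleC z v + e t)) integrable_on cbox 0 1"
        by (rule integrable_continuous, rule continuous_on_compose2[OF kc])
           (use z sub' in \<open>auto intro!: continuous_intros ec\<close>)
    next
      have dc: "continuous_on U (ddir v k)" by (rule holo_on_continuous[OF holo_on_ddir[OF k]])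
      show "continuous_on ({z. x + scaleC z v \<in> W} \<times> cbox 0 1) (\<lambda>(z, t). ddir v k (x + scaleC z v + e t))"
        unfolding split_beta
        by (rule continuous_on_compose2[OF dc])
           (use sub' in \<open>auto intro!: continuous_intros continuous_on_compose2[OF ec[of UNIV]]\<close>)
    next
      show "convex {z. x + scaleC z v \<in> W}" by (rule convex_line[OF W(2)])
    qed
  qed
  then show ?thesis by (simp add: e_def)
qed

lemma holomorphic_ball_nonzero_or_zero:
  assumes "f holomorphic_on ball z r" "r > 0"
  obtains r' where "0 < r'" "r' \<le> r" "(\<forall>w\<in>ball z r. f w = 0) \<or> (\<forall>w\<in>ball z r' - {z}. f w \<noteq> 0)"
proof (cases "\<forall>w\<in>ball z r. f w = 0")
  case True
  then show ?thesis using assms(2) by (intro that[of r]) auto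
next
  case False
  then obtain b where "b \<in> ball z r" "f b \<noteq> 0" by blast
  then have "\<forall>\<^sub>F w in at z. f w \<noteq> 0 \<and> w \<in> ball z r"
    by (intro non_zero_neighbour_alt[OF assms(1)]) (use assms(2) in auto)
  then obtain d where d: "d > 0" "\<And>w. w \<noteq> z \<Longrightarrow> dist w z < d \<Longrightarrow> f w \<noteq> 0"
    by (auto simp: eventually_at)
  show ?thesis
    by (rule that[of "min d r"]) (use d assms(2) in \<open>auto simp: dist_commute\<close>)
qed

text \<open>If \<open>h\<close> vanishes along the line \<open>s \<mapsto> p + s v\<close> to the same order in the direction \<open>u\<close> near
  \<open>s\<^sub>0\<close>, the circular mean of \<open>g / h\<close> in the direction \<open>u\<close> is holomorphic near \<open>p + s\<^sub>0 v\<close>; it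
  agrees with \<open>f\<close> near any regular point and therefore extends \<open>f\<close>.\<close>

lemma regular_at_line_closed:
  fixes f :: "'a::complex_normed_space \<Rightarrow> complex"
  assumes q: "quotient_on U f g h" and \<kappa>: "\<kappa> > 0" "\<epsilon> > 0"
    and inU: "\<And>s \<xi>. s \<in> ball s\<^sub>0 \<kappa> \<Longrightarrow> cmod \<xi> \<le> \<epsilon> \<Longrightarrow> p + scaleC s v + scaleC \<xi> u \<in> U"
    and nz: "\<And>s \<xi>. s \<in> ball s\<^sub>0 \<kappa> \<Longrightarrow> \<xi> \<noteq> 0 \<Longrightarrow> cmod \<xi> \<le> \<epsilon> \<Longrightarrow> h (p + scaleC s v + scaleC \<xi> u) \<noteq> 0"
    and acc: "\<And>d. d > 0 \<Longrightarrow> \<exists>s\<in>ball s\<^sub>0 d. regular_at f (p + scaleC s v)"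
  shows "regular_at f (p + scaleC s\<^sub>0 v)"
proof -
  have hol: "holo_on U g" "holo_on U h" and oU: "open U" using q holo_on_open by (auto simp: quotient_on_def)
  define O' where "O' = U \<inter> h -` (- {0})"
  have oO: "open O'"
    unfolding O'_def by (intro continuous_open_preimage holo_on_continuous hol oU) auto
  define k where "k = (\<lambda>x. g x / h x)"
  have k: "holo_on O' k" unfolding k_def
    by (intro holo_on_divide hol[THEN holo_on_subset] oO) (auto simp: O'_def)
  define e where "e = (\<lambda>t::real. of_real \<epsilon> * exp (2 * of_real pi * \<i> * of_real t) :: complex)"
  have ne: "cmod (e t) = \<epsilon>" for t
  proof -
    have "exp (2 * of_real pi * \<i> * of_real t) = cis (2 * pi * t)" by (simp add: cis_conv_exp mult_ac)
    then show ?thesis using \<kappa>(2) by (simp add: e_def norm_mult)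
  qed
  define p2 where "p2 = p + scaleC s\<^sub>0 v"
  define C where "C = (\<lambda>t. p2 + scaleC (e t) u) ` {0..1}"
  have "compact C" unfolding C_def e_def
    by (intro compact_continuous_image continuous_intros) auto
  moreover have "C \<subseteq> O'"
    unfolding C_def O'_def p2_def using inU[of s\<^sub>0] nz[of s\<^sub>0] \<kappa> ne by force
  ultimately obtain \<delta>1 where \<delta>1: "\<delta>1 > 0" "\<And>x. x \<in> C \<Longrightarrow> ball x \<delta>1 \<subseteq> O'"
    using compact_subset_open_ball[OF _ oO] by blast
  have "p2 \<in> U" using inU[of s\<^sub>0 0] \<kappa> by (simp add: p2_def)
  then obtain \<delta>2 where \<delta>2: "\<delta>2 > 0" "ball p2 \<delta>2 \<subseteq> U" using oU open_contains_ball by blast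
  define W where "W = ball p2 (min \<delta>1 \<delta>2)"
  have W: "open W" "convex W" "W \<subseteq> U" "p2 \<in> W" using \<delta>1 \<delta>2 by (auto simp: W_def)
  have circ: "x + scaleC (e t) u \<in> O'" if "x \<in> W" "t \<in> {0..1}" for x t
  proof -
    have "x + scaleC (e t) u \<in> ball (p2 + scaleC (e t) u) \<delta>1"
      using that by (simp add: W_def dist_norm)
    then show ?thesis using \<delta>1(2)[of "p2 + scaleC (e t) u"] that by (auto simp: C_def)
  qed
  define Q where "Q = (\<lambda>x. integral {0..1} (\<lambda>t. k (x + scaleC (e t) u)))"
  have Q: "holo_on W Q"
    unfolding Q_def e_def by (rule circle_mean_holo[OF k W(1,2)]) (use circ in \<open>auto simp: e_def\<close>)
  \<comment> \<open>The mean Q extends f once Q h = g. By the identity theorem on the convex set W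
    it is enough to verify this near one regular point of the line.\<close>
  define D where "D = (\<lambda>x. Q x * h x - g x)"
  have D: "holo_on W D" unfolding D_def
    by (intro holo_on_diff holo_on_mult Q hol[THEN holo_on_subset] W)
  have "open {s. p + scaleC s v \<in> W}" "s\<^sub>0 \<in> {s. p + scaleC s v \<in> W}"
    using W by (auto intro!: open_line simp: p2_def)
  then obtain d where d: "d > 0" "ball s\<^sub>0 d \<subseteq> {s. p + scaleC s v \<in> W}"
    using open_contains_ball by blast
  obtain s where s: "s \<in> ball s\<^sub>0 (min d \<kappa>)" "regular_at f (p + scaleC s v)"
    using acc[of "min d \<kappa>"] d \<kappa> by auto
  define p3 where "p3 = p + scaleC s v"
  have p3: "p3 \<in> W" using s(1) d(2) by (auto simp: p3_def)
  then have p3U: "p3 \<in> U" using W by blast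
  obtain r G where G: "r > 0" "ball p3 r \<subseteq> U" "holo_on (ball p3 r) G"
    "\<And>x. x \<in> ball p3 r \<Longrightarrow> G x * h x = g x"
    by (rule extends_at_quotientE[OF q p3U extends_at_value[OF s(2)[folded p3_def]]]) (rule that)
  \<comment> \<open>G and g / h agree where both make sense. Together they are holomorphic near the
    full disc in the direction u about p3: its centre is covered by the ball, and h is nonzero on
    the rest. There the mean value property makes Q equal to G.\<close>
  define \<phi> where "\<phi> = (\<lambda>x. if x \<in> ball p3 r then G x else k x)"
  have \<phi>O: "\<phi> x = k x" if "x \<in> O'" for x
    using that G(4)[of x] by (auto simp: \<phi>_def k_def O'_def field_simps)
  have \<phi>: "holo_on (ball p3 r \<union> O') \<phi>"
    unfolding holo_on_def
  proof (intro conjI ballI)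
    show "open (ball p3 r \<union> O')" using oO by auto
    fix x assume "x \<in> ball p3 r \<union> O'"
    moreover have "holo_on (ball p3 r) \<phi>" by (rule holo_on_cong[OF G(3)]) (simp add: \<phi>_def)
    moreover have "holo_on O' \<phi>" by (rule holo_on_cong[OF k]) (simp add: \<phi>O)
    ultimately show "\<exists>D. (\<phi> has_derivative D) (at x) \<and> (\<forall>c v. D (scaleC c v) = c * D v)"
      unfolding holo_on_def by blast
  qed
  define C' where "C' = (\<lambda>\<xi>. p3 + scaleC \<xi> u) ` cball 0 \<epsilon>"
  have "compact C'" unfolding C'_def
    by (intro compact_continuous_image continuous_intros) auto
  moreover have "C' \<subseteq> ball p3 r \<union> O'"
  proof
    fix y assume "y \<in> C'"
    then obtain \<xi> where \<xi>: "y = p3 + scaleC \<xi> u" "cmod \<xi> \<le> \<epsilon>" by (auto simp: C'_def)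
    show "y \<in> ball p3 r \<union> O'"
      using \<xi> inU[of s \<xi>] nz[of s \<xi>] s(1) G(1)
      by (cases "\<xi> = 0") (auto simp: O'_def p3_def)
  qed
  ultimately obtain \<delta>3 where \<delta>3: "\<delta>3 > 0" "\<And>x. x \<in> C' \<Longrightarrow> ball x \<delta>3 \<subseteq> ball p3 r \<union> O'"
    using compact_subset_open_ball[of C' "ball p3 r \<union> O'"] oO by (metis open_Un open_ball)
  define W' where "W' = W \<inter> ball p3 (min \<delta>3 r)"
  have zero: "D x = 0" if x: "x \<in> W'" for x
  proof -
    have disc: "x + scaleC \<xi> u \<in> ball p3 r \<union> O'" if "\<xi> \<in> cball 0 \<epsilon>" for \<xi>
    proof -
      have "x + scaleC \<xi> u \<in> ball (p3 + scaleC \<xi> u) \<delta>3" using x by (simp add: W'_def dist_norm)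
      moreover have "p3 + scaleC \<xi> u \<in> C'" using that by (auto simp: C'_def)
      ultimately show ?thesis using \<delta>3(2) by blast
    qed
    have h: "(\<lambda>\<xi>. \<phi> (x + scaleC \<xi> u)) holomorphic_on cball 0 \<epsilon>"
      by (rule holomorphic_on_subset[OF holo_on_line[OF \<phi>]]) (use disc in blast)
    have "\<phi> (x + scaleC 0 u) = integral {0..1} (\<lambda>t. \<phi> (x + scaleC (e t) u))"
      unfolding e_def
      by (rule holomorphic_mean_value[symmetric])
         (use h \<kappa>(2) in \<open>auto intro: holomorphic_on_imp_continuous_on holomorphic_on_subset\<close>)
    also have "\<dots> = Q x"
      unfolding Q_def by (rule integral_cong) (use x circ \<phi>O in \<open>auto simp: W'_def\<close>)
    finally have "Q x = G x" using x by (simp add: W'_def \<phi>_def)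
    then show ?thesis using G(4)[of x] x by (simp add: D_def W'_def)
  qed
  have "D y = 0" if "y \<in> W" for y
  proof (rule holo_on_convex_identity[OF D W(2) _ _ _ zero that])
    have "p3 \<in> W'" using p3 \<delta>3(1) G(1) by (simp add: W'_def)
    then show "W' \<noteq> {}" by blast
  qed (use W in \<open>auto simp: W'_def\<close>)
  then have "extends_at f p2 (Q p2)"
    by (intro extends_at_quotientI[OF q Q W(4,3)]) (simp add: D_def)
  then show ?thesis unfolding p2_def by (rule regular_atI)
qed

lemma continuous_line2:
  "continuous_on UNIV (\<lambda>z::complex \<times> complex. p + scaleC (fst z) v + scaleC (snd z) (u::'a::complex_normed_space))"
proof -
  have "continuous_on UNIV (\<lambda>z::complex \<times> complex. scaleC (fst z) v)"
    "continuous_on UNIV (\<lambda>z::complex \<times> complex. scaleC (snd z) u)"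
    by (rule continuous_on_scaleC_left; intro continuous_intros)+
  then show ?thesis by (intro continuous_intros)
qed

text \<open>An isolated zero, uniformly along the line: in the direction u the derivatives of order
  less than d vanish near \<open>s\<^sub>0\<close>, the d-th stays above c in modulus, and the next
  one stays below B. A zero at \<xi> would force c < B |\<xi>|.\<close>

lemma constant_order_nonzero:
  fixes h :: "'a::complex_normed_space \<Rightarrow> complex"
  assumes h: "holo_on U h" and s\<^sub>0: "p + scaleC s\<^sub>0 v \<in> U" "r > 0"
    and low: "\<And>j s. j < d \<Longrightarrow> s \<in> ball s\<^sub>0 r \<Longrightarrow> (ddir u ^^ j) h (p + scaleC s v) = 0"
    and top: "(ddir u ^^ d) h (p + scaleC s\<^sub>0 v) \<noteq> 0"
  obtains \<kappa> \<epsilon> where "\<kappa> > 0" "\<epsilon> > 0"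
    "\<And>s \<xi>. s \<in> ball s\<^sub>0 \<kappa> \<Longrightarrow> cmod \<xi> \<le> \<epsilon> \<Longrightarrow> p + scaleC s v + scaleC \<xi> u \<in> U"
    "\<And>s \<xi>. s \<in> ball s\<^sub>0 \<kappa> \<Longrightarrow> \<xi> \<noteq> 0 \<Longrightarrow> cmod \<xi> \<le> \<epsilon> \<Longrightarrow> h (p + scaleC s v + scaleC \<xi> u) \<noteq> 0"
proof -
  define H where "H = (\<lambda>j. (ddir u ^^ j) h)"
  have H: "holo_on U (H j)" for j
    using higher_deriv_line[OF h, of "p + scaleC s\<^sub>0 v" 0 u j] s\<^sub>0 by (simp add: H_def)
  define p2 where "p2 = p + scaleC s\<^sub>0 v"
  define c where "c = cmod (H d p2) / 2"
  have c: "c > 0" "c < cmod (H d p2)" using top by (simp_all add: c_def H_def p2_def)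
  define B where "B = cmod (H (Suc d) p2) + 1"
  have B: "B > 0" "cmod (H (Suc d) p2) < B" by (simp_all add: B_def add_nonneg_pos)
  have oU: "open U" by (rule holo_on_open[OF h])
  have Hc: "continuous_on U (\<lambda>x. cmod (H j x))" for j by (intro continuous_intros holo_on_continuous[OF H])
  define V where "V = U \<inter> (\<lambda>x. cmod (H d x)) -` {c<..} \<inter> (U \<inter> (\<lambda>x. cmod (H (Suc d) x)) -` {..<B})"
  have "open V" unfolding V_def
    by (intro open_Int continuous_open_preimage Hc oU) auto
  moreover have "p2 \<in> V" using c B s\<^sub>0 by (simp add: V_def p2_def)
  ultimately have "open ((\<lambda>z. p + scaleC (fst z) v + scaleC (snd z) u) -` V)"
    "(s\<^sub>0, 0) \<in> (\<lambda>z. p + scaleC (fst z) v + scaleC (snd z) u) -` V"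
    using open_vimage[OF _ continuous_line2] by (auto simp: p2_def)
  then obtain e where e: "e > 0" "ball (s\<^sub>0, 0) e \<subseteq> (\<lambda>z. p + scaleC (fst z) v + scaleC (snd z) u) -` V"
    using open_contains_ball by blast
  have inV: "p + scaleC s v + scaleC \<xi> u \<in> V" if "s \<in> ball s\<^sub>0 (e / 2)" "cmod \<xi> < e / 2" for s \<xi>
  proof -
    have "dist (s\<^sub>0, 0) (s, \<xi>) \<le> dist s\<^sub>0 s + dist 0 \<xi>"
      unfolding dist_prod_def using sqrt_sum_squares_le_sum[of "dist s\<^sub>0 s" "dist 0 \<xi>"] by simp
    also have "\<dots> < e" using that by simp
    finally have "(s, \<xi>) \<in> ball (s\<^sub>0, 0) e" by simp
    then show ?thesis using e(2) by auto
  qed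
  define \<kappa> where "\<kappa> = min r (e / 2)"
  define \<epsilon> where "\<epsilon> = min (e / 4) (c / (2 * B))"
  show ?thesis
  proof (rule that)
    show "\<kappa> > 0" "\<epsilon> > 0" using e(1) s\<^sub>0(2) c B by (auto simp: \<kappa>_def \<epsilon>_def)
    fix s \<xi> assume s: "s \<in> ball s\<^sub>0 \<kappa>" and \<xi>: "cmod \<xi> \<le> \<epsilon>"
    have s': "s \<in> ball s\<^sub>0 (e / 2)" "s \<in> ball s\<^sub>0 r" using s by (auto simp: \<kappa>_def)
    have \<xi>': "cmod \<xi> < e / 2" "B * cmod \<xi> < c"
    proof -
      have "cmod \<xi> \<le> e / 4" "cmod \<xi> \<le> c / (2 * B)" using \<xi> by (auto simp: \<epsilon>_def)
      then have "cmod \<xi> < e / 2" "2 * (B * cmod \<xi>) \<le> c" using e(1) B(1) by (simp_all add: field_simps)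
      then show "cmod \<xi> < e / 2" "B * cmod \<xi> < c" using c(1) by linarith+
    qed
    show "p + scaleC s v + scaleC \<xi> u \<in> U" using inV[OF s'(1) \<xi>'(1)] by (simp add: V_def)
    show "h (p + scaleC s v + scaleC \<xi> u) \<noteq> 0" if "\<xi> \<noteq> 0"
    proof
      assume h0: "h (p + scaleC s v + scaleC \<xi> u) = 0"
      define F where "F = (\<lambda>j z. H j (p + scaleC s v + scaleC z u))"
      have "cmod (F 0 \<xi> - (\<Sum>i\<le>d. F i 0 * (\<xi> - 0) ^ i / fact i)) \<le> B * cmod (\<xi> - 0) ^ Suc d / fact d"
      proof (rule complex_Taylor[of "ball 0 (e / 2)"])
        fix i z assume z: "z \<in> ball (0::complex) (e / 2)"
        have y: "p + scaleC s v + scaleC z u \<in> U" using inV[OF s'(1), of z] z by (simp add: V_def)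
        have "((\<lambda>w. H i ((p + scaleC s v + scaleC z u) + scaleC w u)) has_field_derivative
            ddir u (H i) (p + scaleC s v + scaleC z u)) (at 0)"
          by (rule gateaux_on_has_ddir[OF holo_on_gateaux[OF H] y])
        moreover have "(p + scaleC s v + scaleC z u) + scaleC w u = p + scaleC s v + scaleC (w + z) u" for w
          by (simp add: scaleC_add_left algebra_simps)
        ultimately have "(F i has_field_derivative F (Suc i) z) (at z)"
          using DERIV_shift[of "F i" _ 0 z] by (simp add: F_def H_def)
        then show "(F i has_field_derivative F (Suc i) z) (at z within ball 0 (e / 2))"
          by (rule has_field_derivative_at_within)
      next
        fix z assume z: "z \<in> ball (0::complex) (e / 2)"
        show "cmod (F (Suc d) z) \<le> B"
          using inV[OF s'(1), of z] z by (simp add: V_def F_def)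
      qed (use e(1) \<xi>' in auto)
      moreover have "(\<Sum>i\<le>d. F i 0 * (\<xi> - 0) ^ i / fact i) = F d 0 * \<xi> ^ d / fact d"
      proof -
        have "(\<Sum>i\<le>d. F i 0 * (\<xi> - 0) ^ i / fact i) = (\<Sum>i\<in>{d}. F i 0 * (\<xi> - 0) ^ i / fact i)"
          by (rule sum.mono_neutral_right) (use low[OF _ s'(2)] in \<open>auto simp: F_def H_def\<close>)
        then show ?thesis by simp
      qed
      moreover have "F 0 \<xi> = 0" using h0 by (simp add: F_def H_def)
      ultimately have "cmod (F d 0) * cmod \<xi> ^ d / fact d \<le> B * cmod \<xi> ^ Suc d / fact d"
        by (simp add: norm_mult norm_divide norm_power)
      then have "cmod (F d 0) * cmod \<xi> ^ d \<le> (B * cmod \<xi>) * cmod \<xi> ^ d"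
        by (simp add: divide_le_cancel mult_ac)
      then have "cmod (F d 0) \<le> B * cmod \<xi>"
        using that by (simp add: mult_le_cancel_right)
      moreover have "cmod (F d 0) > c"
        using inV[OF s'(1), of 0] e(1) by (simp add: V_def F_def)
      ultimately show False using \<xi>'(2) by simp
    qed
  qed
qed

text \<open>The alternative \<open>G = 0\<close> on the punctured disc is kept apart from \<open>G \<noteq> 0\<close>: both are open
  conditions on \<open>s\<^sub>1\<close>, so the connectedness of the line propagates them.\<close>

lemma mero_on_line_cases:
  fixes f :: "'a::complex_normed_space \<Rightarrow> complex"
  assumes f: "mero_on S f" and s\<^sub>1: "p + scaleC s\<^sub>1 v \<in> S"
  obtains r G H where "r > 0" "G holomorphic_on ball s\<^sub>1 r" "H holomorphic_on ball s\<^sub>1 r"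
    "(\<forall>s\<in>ball s\<^sub>1 r. \<not> regular_at f (p + scaleC s v)) \<or>
     (\<forall>s\<in>ball s\<^sub>1 r - {s\<^sub>1}. H s \<noteq> 0 \<and> extends_at f (p + scaleC s v) (G s / H s))"
    "(\<forall>s\<in>ball s\<^sub>1 r - {s\<^sub>1}. G s = 0) \<or> (\<forall>s\<in>ball s\<^sub>1 r - {s\<^sub>1}. G s \<noteq> 0)"
proof -
  define L where "L = (\<lambda>s. p + scaleC s v)"
  have s\<^sub>1': "L s\<^sub>1 \<in> S" using s\<^sub>1 by (simp add: L_def)
  obtain \<rho> g h where \<rho>: "\<rho> > 0" "ball (L s\<^sub>1) \<rho> \<subseteq> S" "quotient_on (ball (L s\<^sub>1) \<rho>) f g h"
    by (rule mero_on_quotientE[OF f s\<^sub>1'])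
  define U where "U = ball (L s\<^sub>1) \<rho>"
  have q: "quotient_on U f g h" using \<rho>(3) by (simp add: U_def)
  have hol: "holo_on U g" "holo_on U h" and U: "open U" "convex U" "L s\<^sub>1 \<in> U"
    using q \<rho>(1) by (auto simp: quotient_on_def U_def)
  obtain q\<^sub>0 where q\<^sub>0: "q\<^sub>0 \<in> U" "h q\<^sub>0 \<noteq> 0"
    using nowhere_dense_open[of "{x\<in>U. h x = 0}" U] q U by (auto simp: quotient_on_def)
  \<comment> \<open>The line from \<open>L s\<^sub>1\<close> in this direction meets a point with h
    nonzero. So h does not vanish identically on it, and some derivative of h along u at
    \<open>L s\<^sub>1\<close> is nonzero.\<close>
  define u where "u = q\<^sub>0 - L s\<^sub>1"
  have Hol: "holo_on U ((ddir u ^^ j) k)" if "holo_on U k" for j k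
    using higher_deriv_line[OF that, of "L s\<^sub>1" 0 u j] U by simp
  have "\<exists>j. (ddir u ^^ j) h (L s\<^sub>1) \<noteq> 0"
  proof (rule ccontr)
    assume "\<nexists>j. (ddir u ^^ j) h (L s\<^sub>1) \<noteq> 0"
    then have z: "(deriv ^^ j) (\<lambda>\<xi>. h (L s\<^sub>1 + scaleC \<xi> u)) 0 = 0" for j
      using higher_deriv_line[OF hol(2), of "L s\<^sub>1" 0 u j] U by simp
    have "h (L s\<^sub>1 + scaleC 1 u) = 0"
      by (rule holomorphic_fun_eq_0_on_connected[OF holo_on_line[OF hol(2)] open_line[OF U(1)]
            convex_connected[OF convex_line[OF U(2)]] z])
         (use U q\<^sub>0 in \<open>auto simp: u_def\<close>)
    then show False using q\<^sub>0 by (simp add: u_def)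
  qed
  then obtain j\<^sub>0 where j\<^sub>0: "(ddir u ^^ j\<^sub>0) h (L s\<^sub>1) \<noteq> 0" by blast
  have "open {s. L s \<in> U}" "s\<^sub>1 \<in> {s. L s \<in> U}" using U by (auto simp: L_def intro: open_line)
  then obtain r\<^sub>0 where r\<^sub>0: "r\<^sub>0 > 0" "ball s\<^sub>1 r\<^sub>0 \<subseteq> {s. L s \<in> U}"
    using open_contains_ball by blast
  have LU: "L s \<in> U" if "s \<in> ball s\<^sub>1 r\<^sub>0" for s using that r\<^sub>0 by auto
  have line_hol: "(\<lambda>s. (ddir u ^^ j) k (L s)) holomorphic_on ball s\<^sub>1 r\<^sub>0" if "holo_on U k" for j k
    unfolding L_def
    by (rule holomorphic_on_subset[OF holo_on_line[OF Hol[OF that]]]) (use LU in \<open>auto simp: L_def\<close>)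
  define P where "P = (\<lambda>j. \<exists>s\<in>ball s\<^sub>1 r\<^sub>0. (ddir u ^^ j) h (L s) \<noteq> 0)"
  have "P j\<^sub>0" using j\<^sub>0 r\<^sub>0(1) by (auto simp: P_def intro!: bexI[of _ s\<^sub>1])
  \<comment> \<open>d is the order of h in the direction u at a generic point of the line; the order
    is larger only at the zeros of the function H below, which are isolated.\<close>
  define d where "d = (LEAST j. P j)"
  have Pd: "P d" unfolding d_def by (rule LeastI[of P, OF \<open>P j\<^sub>0\<close>])
  have low: "(ddir u ^^ j) h (L s) = 0" if "j < d" "s \<in> ball s\<^sub>1 r\<^sub>0" for j s
    using not_less_Least[of j P] that by (auto simp: d_def P_def)
  \<comment> \<open>Where f extends to k with k h = g, the Leibniz rule for d derivatives along u
    keeps a single term, as the lower derivatives of h vanish on the line: G = k H.\<close>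
  define H where "H = (\<lambda>s. (ddir u ^^ d) h (L s))"
  define G where "G = (\<lambda>s. (ddir u ^^ d) g (L s))"
  have HG: "H holomorphic_on ball s\<^sub>1 r\<^sub>0" "G holomorphic_on ball s\<^sub>1 r\<^sub>0"
    unfolding H_def G_def using line_hol hol by blast+
  obtain r\<^sub>1 where r\<^sub>1: "0 < r\<^sub>1" "r\<^sub>1 \<le> r\<^sub>0" "\<forall>s\<in>ball s\<^sub>1 r\<^sub>1 - {s\<^sub>1}. H s \<noteq> 0"
    by (rule holomorphic_ball_nonzero_or_zero[OF HG(1) r\<^sub>0(1)]) (use Pd in \<open>auto simp: P_def H_def\<close>)
  obtain r\<^sub>2 where r\<^sub>2: "0 < r\<^sub>2" "r\<^sub>2 \<le> r\<^sub>0" "(\<forall>w\<in>ball s\<^sub>1 r\<^sub>0. G w = 0) \<or> (\<forall>w\<in>ball s\<^sub>1 r\<^sub>2 - {s\<^sub>1}. G w \<noteq> 0)"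
    by (rule holomorphic_ball_nonzero_or_zero[OF HG(2) r\<^sub>0(1)])
  define r where "r = min r\<^sub>1 r\<^sub>2"
  have r: "r > 0" "r \<le> r\<^sub>0" "r \<le> r\<^sub>1" "r \<le> r\<^sub>2" using r\<^sub>1 r\<^sub>2 by (auto simp: r_def)
  define P' where "P' = ball s\<^sub>1 r - {s\<^sub>1}"
  have oP: "open P'" by (simp add: P'_def open_delete)
  have cP: "connected P'" unfolding P'_def by (rule connected_open_delete) auto
  have P'0: "s \<in> ball s\<^sub>1 r\<^sub>0" "H s \<noteq> 0" if "s \<in> P'" for s
    using that r r\<^sub>1(3) by (auto simp: P'_def)
  define R where "R = {s. regular_at f (L s)}"
  have "open R" using open_line[OF open_regular, of p v f] by (simp add: R_def L_def)
  have closed: "s \<in> R" if s: "s \<in> P'" and acc: "\<And>e. e > 0 \<Longrightarrow> \<exists>t\<in>ball s e. t \<in> R" for s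
  proof -
    obtain e where e: "e > 0" "ball s e \<subseteq> P'" using oP s open_contains_ball by blast
    obtain \<kappa> \<epsilon> where \<kappa>: "\<kappa> > 0" "\<epsilon> > 0"
      "\<And>t \<xi>. t \<in> ball s \<kappa> \<Longrightarrow> cmod \<xi> \<le> \<epsilon> \<Longrightarrow> p + scaleC t v + scaleC \<xi> u \<in> U"
      "\<And>t \<xi>. t \<in> ball s \<kappa> \<Longrightarrow> \<xi> \<noteq> 0 \<Longrightarrow> cmod \<xi> \<le> \<epsilon> \<Longrightarrow> h (p + scaleC t v + scaleC \<xi> u) \<noteq> 0"
    proof (rule constant_order_nonzero[OF hol(2), of p s v e d u])
      show "p + scaleC s v \<in> U" using LU[OF P'0(1)[OF s]] by (simp add: L_def)
      show "(ddir u ^^ d) h (p + scaleC s v) \<noteq> 0" using P'0(2)[OF s] by (simp add: H_def L_def)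
      show "(ddir u ^^ j) h (p + scaleC t v) = 0" if "j < d" "t \<in> ball s e" for j t
        using low[OF that(1) P'0(1)[of t]] that(2) e(2) by (auto simp: L_def)
    qed (use e in blast)+
    have "regular_at f (p + scaleC s v)"
      by (rule regular_at_line_closed[OF q \<kappa>]) (use acc in \<open>auto simp: R_def L_def\<close>)
    then show ?thesis by (simp add: R_def L_def)
  qed
  \<comment> \<open>Regularity is open, and it is closed in the punctured disc because the order of
    h along u is constant there; a punctured disc is connected.\<close>
  consider "P' \<inter> R = {}" | "P' \<subseteq> R"
  proof -
    define N where "N = {s\<in>P'. s \<notin> R}"
    have "open N"
    proof (subst open_subopen, intro ballI)
      fix s assume "s \<in> N"
      then obtain e where e: "e > 0" "\<And>t. t \<in> ball s e \<Longrightarrow> t \<notin> R" using closed by (force simp: N_def)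
      then show "\<exists>T. open T \<and> s \<in> T \<and> T \<subseteq> N"
        using oP \<open>s \<in> N\<close> by (intro exI[of _ "ball s e \<inter> P'"]) (auto simp: N_def)
    qed
    from connectedD[OF cP \<open>open N\<close> \<open>open R\<close>] have "P' \<inter> R = {} \<or> P' \<subseteq> R"
      by (auto simp: N_def)
    then show ?thesis using that by blast
  qed
  then have "(\<forall>s\<in>ball s\<^sub>1 r. \<not> regular_at f (p + scaleC s v)) \<or>
     (\<forall>s\<in>ball s\<^sub>1 r - {s\<^sub>1}. H s \<noteq> 0 \<and> extends_at f (p + scaleC s v) (G s / H s))"
  proof cases
    case 1
    have "s\<^sub>1 \<notin> R"
    proof
      assume "s\<^sub>1 \<in> R"
      with \<open>open R\<close> obtain e where e: "e > 0" "ball s\<^sub>1 e \<subseteq> R" using open_contains_ball by blast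
      have "s\<^sub>1 + of_real (min e r / 2) \<in> P' \<inter> R"
      proof
        have "dist s\<^sub>1 (s\<^sub>1 + of_real (min e r / 2)) = min e r / 2"
          using e(1) r(1) by (simp add: dist_norm norm_divide del: of_real_divide)
        then show "s\<^sub>1 + of_real (min e r / 2) \<in> P'" "s\<^sub>1 + of_real (min e r / 2) \<in> R"
          using e r(1) by (auto simp: P'_def)
      qed
      with 1 show False by blast
    qed
    with 1 have "s \<notin> R" if "s \<in> ball s\<^sub>1 r" for s using that by (auto simp: P'_def)
    then show ?thesis by (auto simp: R_def L_def)
  next
    case 2
    have "H s \<noteq> 0 \<and> extends_at f (L s) (G s / H s)" if s: "s \<in> P'" for s
    proof -
      have sR: "regular_at f (L s)" using 2 s by (auto simp: R_def)
      have sU: "L s \<in> U" by (rule LU[OF P'0(1)[OF s]])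
      obtain e k where k: "e > 0" "ball (L s) e \<subseteq> U" "holo_on (ball (L s) e) k" "k (L s) = value_at f (L s)"
        "\<And>x. x \<in> ball (L s) e \<Longrightarrow> k x * h x = g x"
        by (rule extends_at_quotientE[OF q sU extends_at_value[OF sR]]) (rule that, assumption+)
      define A where "A = {\<xi>. L s + scaleC \<xi> u \<in> ball (L s) e}"
      have A: "open A" "0 \<in> A"
        unfolding A_def using k(1) open_line[OF open_ball, of "L s" u "L s" e] by auto
      have kA: "(\<lambda>\<xi>. k (L s + scaleC \<xi> u)) holomorphic_on A"
        unfolding A_def by (rule holo_on_line[OF k(3)])
      have hA: "(\<lambda>\<xi>. h (L s + scaleC \<xi> u)) holomorphic_on A" "(\<lambda>\<xi>. g (L s + scaleC \<xi> u)) holomorphic_on A"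
        unfolding A_def
        by (rule holomorphic_on_subset[OF holo_on_line[OF hol(2)]], use k(2) in force,
            rule holomorphic_on_subset[OF holo_on_line[OF hol(1)]], use k(2) in force)
      have dh: "(deriv ^^ j) (\<lambda>\<xi>. h (L s + scaleC \<xi> u)) 0 = (ddir u ^^ j) h (L s)" for j
        using higher_deriv_line[OF hol(2), of "L s" 0 u j] sU by simp
      have "G s = (deriv ^^ d) (\<lambda>\<xi>. g (L s + scaleC \<xi> u)) 0"
        using higher_deriv_line[OF hol(1), of "L s" 0 u d] sU by (simp add: G_def)
      also have "\<dots> = (deriv ^^ d) (\<lambda>\<xi>. k (L s + scaleC \<xi> u) * h (L s + scaleC \<xi> u)) 0"
        by (rule higher_deriv_transform_within_open[OF hA(2) holomorphic_on_mult[OF kA hA(1)] A])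
           (use k(5) in \<open>simp add: A_def\<close>)
      also have "\<dots> = (\<Sum>i = 0..d. of_nat (d choose i) * (deriv ^^ i) (\<lambda>\<xi>. k (L s + scaleC \<xi> u)) 0 *
          (deriv ^^ (d - i)) (\<lambda>\<xi>. h (L s + scaleC \<xi> u)) 0)"
        by (rule higher_deriv_mult[OF kA hA(1) A])
      also have "\<dots> = (\<Sum>i\<in>{0}. of_nat (d choose i) * (deriv ^^ i) (\<lambda>\<xi>. k (L s + scaleC \<xi> u)) 0 *
          (deriv ^^ (d - i)) (\<lambda>\<xi>. h (L s + scaleC \<xi> u)) 0)"
        by (rule sum.mono_neutral_right) (use low[OF _ P'0(1)[OF s]] in \<open>auto simp: dh\<close>)
      also have "\<dots> = k (L s) * H s" by (simp add: dh H_def)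
      finally have "value_at f (L s) = G s / H s" using P'0(2)[OF s] k(4) by simp
      then show ?thesis using extends_at_value[OF sR] P'0(2)[OF s] by simp
    qed
    then show ?thesis by (auto simp: P'_def L_def)
  qed
  moreover have "(\<forall>s\<in>ball s\<^sub>1 r - {s\<^sub>1}. G s = 0) \<or> (\<forall>s\<in>ball s\<^sub>1 r - {s\<^sub>1}. G s \<noteq> 0)"
    using r\<^sub>2(3) r by auto
  ultimately show ?thesis
    using that[of r G H] r HG holomorphic_on_subset[OF _ subset_ball] by blast
qed

text \<open>Splitting off the zero of order n at 0 leaves a factor bounded above and away from
  0.\<close>

lemma holomorphic_punctured_bounds:
  assumes G: "G holomorphic_on ball 0 r" and r: "r > 0" and nz: "\<And>s. s \<in> ball 0 r - {0} \<Longrightarrow> G s \<noteq> 0"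
  obtains n c C e where "c > 0" "C > 0" "0 < e" "e \<le> r" "\<And>s. s \<in> ball 0 e - {0} \<Longrightarrow>
    c * cmod s ^ n \<le> cmod (G s) \<and> cmod (G s) \<le> C"
proof -
  obtain n k e where k: "0 < e" "ball (0::complex) e \<subseteq> ball 0 r" "k holomorphic_on ball 0 e"
    "\<And>s. s \<in> ball 0 e \<Longrightarrow> G s = s ^ n * k s" "k 0 \<noteq> 0"
  proof (cases "G 0 = 0")
    case True
    have b: "of_real (r / 2) \<in> ball (0::complex) r" "of_real (r / 2) \<noteq> (0::complex)" using r by auto
    have z: "0 \<in> ball (0::complex) r" using r by simp
    have nc: "\<not> G constant_on ball 0 r"
      using nz[of "of_real (r / 2)"] b z True unfolding constant_on_def by (metis DiffI singletonD)
    obtain g e n where g: "0 < e" "ball (0::complex) e \<subseteq> ball 0 r" "g holomorphic_on ball 0 e"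
      "\<And>w. w \<in> ball 0 e \<Longrightarrow> G w = (w - 0) ^ n * g w" "\<And>w. w \<in> ball 0 e \<Longrightarrow> g w \<noteq> 0"
      by (rule holomorphic_factor_zero_nonconstant[OF G open_ball connected_ball z True nc]) (rule that, assumption+)
    show ?thesis
      by (rule that[of e g n]) (use g in auto)
  next
    case False
    show ?thesis by (rule that[of r G 0]) (use False r G in auto)
  qed
  have "isCont k 0" using holomorphic_on_imp_continuous_on[OF k(3)] k(1)
    by (simp add: continuous_on_eq_continuous_at)
  then obtain e' where e': "e' > 0" "\<And>s. dist s 0 < e' \<Longrightarrow> dist (k s) (k 0) < cmod (k 0) / 2"
    using k(5) unfolding continuous_at_eps_delta by (metis half_gt_zero zero_less_norm_iff)
  show ?thesis
  proof (rule that[of "cmod (k 0) / 2" "2 * cmod (k 0)" "min (min e e') (min r 1)" n])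
    fix s :: complex assume s: "s \<in> ball 0 (min (min e e') (min r 1)) - {0}"
    have "cmod (k s - k 0) < cmod (k 0) / 2" using e'(2)[of s] s by (simp add: dist_norm)
    then have *: "cmod (k s) \<ge> cmod (k 0) / 2" "cmod (k s) \<le> 2 * cmod (k 0)"
      using norm_triangle_sub[of "k s" "k 0"] norm_triangle_sub[of "k 0" "k s"] by (auto simp: norm_minus_commute)
    have "cmod (G s) = cmod s ^ n * cmod (k s)" using k(4)[of s] s by (simp add: norm_mult norm_power)
    moreover have "cmod s ^ n \<le> 1" using s by (intro power_le_one) auto
    ultimately show "cmod (k 0) / 2 * cmod s ^ n \<le> cmod (G s) \<and> cmod (G s) \<le> 2 * cmod (k 0)"
      using * mult_mono[of "cmod s ^ n" 1 "cmod (k s)" "2 * cmod (k 0)"]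
      using mult_right_mono[OF *(1), of "cmod s ^ n"] by (auto simp: mult.commute[of "cmod s ^ n"])
  qed (use k(1,5) e'(1) r in auto)
qed

text \<open>The point p may be a pole or a point of indeterminacy; the information comes from
  \<open>s\<^sub>0\<close>. Each parameter has a punctured neighbourhood on which f is either
  regular with nonzero values throughout, or never so. Both conditions are open, so connectedness of
  the plane carries the first from \<open>s\<^sub>0\<close> to 0, near which f is a quotient of
  one-variable functions. The two final inequalities are symmetric in f and 1 / f.\<close>

theorem mero_on_line_growth:
  fixes f :: "'a::complex_normed_space \<Rightarrow> complex"
  assumes f: "mero_on S f" and S: "\<And>s. p + scaleC s v \<in> S"
    and reg: "extends_at f (p + scaleC s\<^sub>0 v) c\<^sub>0" and nz: "c\<^sub>0 \<noteq> 0"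
  obtains n c e where "c > 0" "e > 0" "e \<le> 1" "\<And>s. s \<in> ball 0 e - {0} \<Longrightarrow>
    regular_at f (p + scaleC s v) \<and>
    c * cmod s ^ n \<le> cmod (value_at f (p + scaleC s v)) \<and>
    cmod (value_at f (p + scaleC s v)) * (c * cmod s ^ n) \<le> 1"
proof -
  define good where "good = (\<lambda>s. \<exists>r>0. \<forall>t\<in>ball s r - {s}. regular_at f (p + scaleC t v) \<and> value_at f (p + scaleC t v) \<noteq> 0)"
  \<comment> \<open>This covers two situations at once: f singular along the line, and f vanishing
    on it.\<close>
  define bad where "bad = (\<lambda>s. \<exists>r>0. \<forall>t\<in>ball s r - {s}. regular_at f (p + scaleC t v) \<longrightarrow> value_at f (p + scaleC t v) = 0)"
  have alt: "good s \<or> bad s" for s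
  proof -
    obtain r G H where r: "r > 0" "G holomorphic_on ball s r" "H holomorphic_on ball s r"
      "(\<forall>t\<in>ball s r. \<not> regular_at f (p + scaleC t v)) \<or>
       (\<forall>t\<in>ball s r - {s}. H t \<noteq> 0 \<and> extends_at f (p + scaleC t v) (G t / H t))"
      "(\<forall>t\<in>ball s r - {s}. G t = 0) \<or> (\<forall>t\<in>ball s r - {s}. G t \<noteq> 0)"
      by (rule mero_on_line_cases[OF f S])
    from r(4) show ?thesis
    proof
      assume "\<forall>t\<in>ball s r. \<not> regular_at f (p + scaleC t v)"
      then show ?thesis using r(1) by (auto simp: bad_def)
    next
      assume *: "\<forall>t\<in>ball s r - {s}. H t \<noteq> 0 \<and> extends_at f (p + scaleC t v) (G t / H t)"
      then have "regular_at f (p + scaleC t v) \<and> value_at f (p + scaleC t v) = G t / H t \<and> H t \<noteq> 0"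
        if "t \<in> ball s r - {s}" for t
        using that regular_atI value_atI by blast
      then show ?thesis using r(1,5) unfolding good_def bad_def by (metis divide_eq_0_iff)
    qed
  qed
  have punct: "open {s. \<exists>r>0. \<forall>t\<in>ball s r - {s}. Q t}" for Q :: "complex \<Rightarrow> bool"
  proof (subst open_subopen, intro ballI)
    fix s assume "s \<in> {s. \<exists>r>0. \<forall>t\<in>ball s r - {s}. Q t}"
    then obtain r where r: "r > 0" "\<forall>t\<in>ball s r - {s}. Q t" by blast
    have "\<exists>r'>0. \<forall>x\<in>ball t r' - {t}. Q x" if t: "t \<in> ball s r" for t
    proof (cases "t = s")
      case False
      have "open (ball s r - {s})" by (simp add: open_delete)
      then obtain r' where "r' > 0" "ball t r' \<subseteq> ball s r - {s}"
        using False t open_contains_ball by (metis DiffI singletonD)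
      then show ?thesis using r(2) by blast
    qed (use r in blast)
    then show "\<exists>T. open T \<and> s \<in> T \<and> T \<subseteq> {s. \<exists>r>0. \<forall>t\<in>ball s r - {s}. Q t}"
      using r(1) by (intro exI[of _ "ball s r"]) auto
  qed
  have excl: "\<not> (good s \<and> bad s)" for s
  proof
    assume "good s \<and> bad s"
    then obtain r r' where r: "r > 0" "r' > 0"
      "\<forall>t\<in>ball s r - {s}. regular_at f (p + scaleC t v) \<and> value_at f (p + scaleC t v) \<noteq> 0"
      "\<forall>t\<in>ball s r' - {s}. regular_at f (p + scaleC t v) \<longrightarrow> value_at f (p + scaleC t v) = 0"
      unfolding good_def bad_def by blast
    define t where "t = s + of_real (min r r' / 2)"
    have "dist s t = min r r' / 2" using r by (simp add: t_def dist_norm norm_divide del: of_real_divide)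
    then have "t \<in> ball s r - {s}" "t \<in> ball s r' - {s}" using r(1,2) by auto
    with r(3,4) show False by blast
  qed
  have "good s\<^sub>0"
  proof -
    obtain U g where U: "p + scaleC s\<^sub>0 v \<in> U" "holo_on U g" "nowhere_dense {x\<in>U. f x \<noteq> g x}" "g (p + scaleC s\<^sub>0 v) = c\<^sub>0"
      using reg unfolding extends_at_def by blast
    have o: "open (U \<inter> g -` (- {0}))"
      by (intro continuous_open_preimage holo_on_continuous[OF U(2)] holo_on_open[OF U(2)]) auto
    have "open {s. p + scaleC s v \<in> U \<inter> g -` (- {0})}" "s\<^sub>0 \<in> {s. p + scaleC s v \<in> U \<inter> g -` (- {0})}"
      using open_line[OF o] U nz by auto
    then obtain r where r: "r > 0" "ball s\<^sub>0 r \<subseteq> {s. p + scaleC s v \<in> U \<inter> g -` (- {0})}"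
      using open_contains_ball by blast
    have "extends_at f x (g x)" if "x \<in> U" for x using U that unfolding extends_at_def by blast
    then have "regular_at f x \<and> value_at f x = g x" if "x \<in> U" for x using that regular_atI value_atI by blast
    then show ?thesis using r unfolding good_def by (intro exI[of _ r]) auto
  qed
  have "good 0"
  proof (rule ccontr)
    assume "\<not> good 0"
    then have "bad 0" using alt by blast
    have "{s. good s} \<inter> {s. bad s} \<inter> UNIV = {}" using excl by auto
    moreover have "UNIV \<subseteq> {s. good s} \<union> {s. bad s}" using alt by auto
    ultimately have "{s. good s} \<inter> UNIV = {} \<or> {s. bad s} \<inter> UNIV = {}"
      using connectedD[OF connected_UNIV, of "{s. good s}" "{s. bad s}"] punct by (simp add: good_def bad_def)
    then show False using \<open>good s\<^sub>0\<close> \<open>bad 0\<close> by blast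
  qed
  obtain r G H where r: "r > 0" "G holomorphic_on ball 0 r" "H holomorphic_on ball 0 r"
      "(\<forall>t\<in>ball 0 r. \<not> regular_at f (p + scaleC t v)) \<or>
       (\<forall>t\<in>ball 0 r - {0}. H t \<noteq> 0 \<and> extends_at f (p + scaleC t v) (G t / H t))"
      "(\<forall>t\<in>ball 0 r - {0}. G t = 0) \<or> (\<forall>t\<in>ball 0 r - {0}. G t \<noteq> 0)"
    by (rule mero_on_line_cases[OF f S])
  obtain r' where r': "r' > 0" "\<forall>t\<in>ball 0 r' - {0}. regular_at f (p + scaleC t v) \<and> value_at f (p + scaleC t v) \<noteq> 0"
    using \<open>good 0\<close> unfolding good_def by blast
  define t where "t = complex_of_real (min r r' / 2)"
  have "dist 0 t = min r r' / 2" using r r' by (simp add: t_def norm_divide del: of_real_divide)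
  then have t: "t \<in> ball 0 r - {0}" "t \<in> ball 0 r' - {0}" using r(1) r'(1) by auto
  have *: "\<forall>t\<in>ball 0 r - {0}. H t \<noteq> 0 \<and> extends_at f (p + scaleC t v) (G t / H t)"
    using r(4) t r'(2) by blast
  then have **: "\<forall>t\<in>ball 0 r - {0}. regular_at f (p + scaleC t v) \<and> value_at f (p + scaleC t v) = G t / H t"
    using regular_atI value_atI by blast
  then have Gnz: "\<forall>t\<in>ball 0 r - {0}. G t \<noteq> 0" using r(5) t r'(2) by (metis div_0)
  obtain n1 c1 C1 e1 where 1: "c1 > 0" "C1 > 0" "0 < e1" "e1 \<le> r" "\<And>s. s \<in> ball 0 e1 - {0} \<Longrightarrow>
    c1 * cmod s ^ n1 \<le> cmod (G s) \<and> cmod (G s) \<le> C1"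
    by (rule holomorphic_punctured_bounds[OF r(2,1)]) (use Gnz in blast)+
  obtain n2 c2 C2 e2 where 2: "c2 > 0" "C2 > 0" "0 < e2" "e2 \<le> r" "\<And>s. s \<in> ball 0 e2 - {0} \<Longrightarrow>
    c2 * cmod s ^ n2 \<le> cmod (H s) \<and> cmod (H s) \<le> C2"
    by (rule holomorphic_punctured_bounds[OF r(3,1)]) (use * in blast)+
  define c where "c = min (c1 / C2) (c2 / C1)"
  define n where "n = max n1 n2"
  show ?thesis
  proof (rule that[of c "min (min e1 e2) 1" n])
    show "c > 0" "min (min e1 e2) 1 > 0" using 1 2 by (auto simp: c_def)
    fix s :: complex assume s: "s \<in> ball 0 (min (min e1 e2) 1) - {0}"
    define x where "x = cmod s"
    have x: "0 < x" "x < 1" using s by (auto simp: x_def)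
    have bG: "c1 * x ^ n1 \<le> cmod (G s)" "cmod (G s) \<le> C1" and bH: "c2 * x ^ n2 \<le> cmod (H s)" "cmod (H s) \<le> C2"
      using 1(5)[of s] 2(5)[of s] s by (auto simp: x_def)
    have sr: "s \<in> ball 0 r - {0}" using s 1(4) by auto
    have val: "cmod (value_at f (p + scaleC s v)) = cmod (G s) / cmod (H s)"
      using ** sr by (simp add: norm_divide)
    have pos: "cmod (H s) > 0" "cmod (G s) > 0" using * Gnz sr by auto
    have pw: "x ^ n \<le> x ^ n1" "x ^ n \<le> x ^ n2" using x by (auto simp: n_def intro: power_decreasing)
    have "c * x ^ n \<le> (c1 / C2) * x ^ n1"
      using pw(1) x 1 2 by (intro mult_mono) (auto simp: c_def)
    also have "\<dots> = (c1 * x ^ n1) / C2" by simp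
    also have "\<dots> \<le> cmod (G s) / cmod (H s)"
      using bG bH pos 1 2 by (intro frac_le) auto
    finally have A: "c * x ^ n \<le> cmod (G s) / cmod (H s)" .
    have "c * x ^ n \<le> (c2 / C1) * x ^ n2"
      using pw(2) x 1 2 by (intro mult_mono) (auto simp: c_def)
    also have "\<dots> = (c2 * x ^ n2) / C1" by simp
    also have "\<dots> \<le> cmod (H s) / cmod (G s)"
      using bG bH pos 1 2 by (intro frac_le) auto
    finally have "c * x ^ n \<le> cmod (H s) / cmod (G s)" .
    then have "cmod (G s) / cmod (H s) * (c * x ^ n) \<le> cmod (G s) / cmod (H s) * (cmod (H s) / cmod (G s))"
      by (rule mult_left_mono) simp
    then have "cmod (G s) / cmod (H s) * (c * x ^ n) \<le> 1" using pos by simp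
    with A ** sr show "regular_at f (p + scaleC s v) \<and>
      c * cmod s ^ n \<le> cmod (value_at f (p + scaleC s v)) \<and>
      cmod (value_at f (p + scaleC s v)) * (c * cmod s ^ n) \<le> 1"
      unfolding val by (simp add: x_def)
  qed simp
qed

section \<open>Stirling's formula in sectors\<close>

text \<open>The imaginary parts of w and 1 / w have opposite signs, so the arguments of w and 1 + 1
  / w do not add up beyond the branch cut. On the positive axis both arguments vanish.\<close>

lemma Ln_add_one:
  assumes "w \<notin> \<real>\<^sub>\<le>\<^sub>0"
  shows "Ln (w + 1) = Ln w + Ln (1 + 1 / w)"
proof -
  have w: "w \<noteq> 0" using assms by auto
  have w1: "1 + 1 / w \<noteq> 0"
  proof
    assume "1 + 1 / w = 0"
    then have "w = -1" using w by (metis add_eq_0_iff2 divide_eq_minus_1_iff minus_minus nonzero_minus_divide_divide)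
    then show False using assms by simp
  qed
  have eq: "w + 1 = w * (1 + 1 / w)" using w by (simp add: field_simps)
  have im: "Im (1 / w) = - Im w / (cmod w)\<^sup>2"
    by (simp add: Im_divide cmod_power2)
  have "- pi < Im (Ln w) + Im (Ln (1 + 1 / w)) \<and> Im (Ln w) + Im (Ln (1 + 1 / w)) \<le> pi"
  proof (cases "Im w" "0::real" rule: linorder_cases)
    case less
    then have "Im (1 + 1 / w) > 0" using w by (simp add: im divide_neg_pos)
    then have "0 < Im (Ln (1 + 1 / w))" "Im (Ln (1 + 1 / w)) < pi"
      using Im_Ln_pos_lt_imp by blast+
    moreover have "Im (Ln w) < 0" using less Im_Ln_pos_le[OF w] mpi_less_Im_Ln[OF w] Im_Ln_le_pi[OF w] by linarith
    ultimately show ?thesis using mpi_less_Im_Ln[OF w] by linarith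
  next
    case equal
    then have "Re w > 0" using assms by (auto simp: complex_nonpos_Reals_iff)
    then have "Im (Ln w) = 0" using equal w by (simp add: Im_Ln_eq_0)
    then show ?thesis using mpi_less_Im_Ln[OF w1] Im_Ln_le_pi[OF w1] by simp
  next
    case greater
    then have "Im (1 + 1 / w) < 0" using w by (simp add: im divide_pos_pos)
    then have "Im (Ln (1 + 1 / w)) < 0"
      using Im_Ln_pos_le[OF w1] mpi_less_Im_Ln[OF w1] Im_Ln_le_pi[OF w1] by linarith
    moreover have "0 < Im (Ln w)" "Im (Ln w) < pi" using greater Im_Ln_pos_lt_imp by blast+
    ultimately show ?thesis using mpi_less_Im_Ln[OF w1] by linarith
  qed
  then show ?thesis unfolding eq using w w1 by (intro Ln_times_simple) auto
qed

text \<open>Taylor's formula of order two: on the disc of radius 1 / 2 the third derivative 2 / (1 +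
  u)^3 is at most 16, and 16 / 2! = 8.\<close>

lemma Ln_cubic_bound:
  assumes "cmod u \<le> 1 / 2"
  shows "cmod (Ln (1 + u) - (u - u\<^sup>2 / 2)) \<le> 8 * cmod u ^ 3"
proof -
  define F where "F = (\<lambda>i u::complex. if i = (0::nat) then Ln (1 + u) else if i = 1 then inverse (1 + u)
    else if i = 2 then - (inverse (1 + u))\<^sup>2 else 2 * inverse (1 + u) ^ 3)"
  have half: "cmod (1 + x) \<ge> 1 / 2" if "x \<in> cball 0 (1 / 2)" for x
    using norm_triangle_ineq2[of 1 "- x"] that by simp
  have nz: "1 + x \<noteq> 0" "1 + x \<notin> \<real>\<^sub>\<le>\<^sub>0" if "x \<in> cball 0 (1 / 2)" for x :: complex
  proof -
    show "1 + x \<noteq> 0" using half[OF that] by auto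
    have "Re (1 + x) \<ge> 1 / 2" using abs_Re_le_cmod[of x] that by simp
    then show "1 + x \<notin> \<real>\<^sub>\<le>\<^sub>0" by (auto simp: complex_nonpos_Reals_iff)
  qed
  have "cmod (F 0 u - (\<Sum>i\<le>2. F i 0 * (u - 0) ^ i / fact i)) \<le> 16 * cmod (u - 0) ^ Suc 2 / fact 2"
  proof (rule complex_Taylor[of "cball 0 (1 / 2)"])
    fix i and x :: complex assume x: "x \<in> cball 0 (1 / 2)" "i \<le> (2::nat)"
    consider "i = 0" | "i = 1" | "i = 2" using x(2) by linarith
    then show "(F i has_field_derivative F (Suc i) x) (at x within cball 0 (1 / 2))"
    proof cases
      case 1
      have "((\<lambda>u. Ln (1 + u)) has_field_derivative inverse (1 + x)) (at x within cball 0 (1 / 2))"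
        by (rule derivative_eq_intros refl nz x)+ (simp add: divide_inverse)
      then show ?thesis using 1 by (simp add: F_def[abs_def])
    next
      case 2
      have "((\<lambda>u. inverse (1 + u)) has_field_derivative - (inverse (1 + x))\<^sup>2) (at x within cball 0 (1 / 2))"
        by (rule derivative_eq_intros refl nz x)+ (simp add: power2_eq_square)
      then show ?thesis using 2 by (simp add: F_def[abs_def])
    next
      case 3
      have "((\<lambda>u. - (inverse (1 + u))\<^sup>2) has_field_derivative 2 * inverse (1 + x) ^ 3) (at x within cball 0 (1 / 2))"
        by (rule derivative_eq_intros refl nz x)+ (simp add: power3_eq_cube)
      then show ?thesis using 3 by (simp add: F_def[abs_def])
    qed
  next
    fix x :: complex assume "x \<in> cball 0 (1 / 2)"
    then have "(1 / 2) ^ 3 \<le> cmod (1 + x) ^ 3" by (intro power_mono half) auto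
    moreover have "cmod (1 + x) ^ 3 > 0"
      using half[OF \<open>x \<in> cball 0 (1 / 2)\<close>] by (intro zero_less_power) linarith
    ultimately have "2 / cmod (1 + x) ^ 3 \<le> 2 / (1 / 2) ^ 3"
      by (intro divide_left_mono) auto
    also have "2 / (1 / 2 :: real) ^ 3 = 16" by (simp add: power3_eq_cube)
    finally show "cmod (F (Suc 2) x) \<le> 16"
      by (simp add: F_def norm_mult norm_inverse norm_power norm_divide divide_simps)
  qed (use assms in auto)
  moreover have "{..2::nat} = {0, 1, 2}" by auto
  then have "(\<Sum>i\<le>2. F i 0 * (u - 0) ^ i / fact i) = u - u\<^sup>2 / 2" by (simp add: F_def fact_numeral)
  ultimately show ?thesis by (simp add: F_def fact_numeral)
qed

text \<open>A logarithm of \<open>Lambda w \<eta>\<close> / \<open>Lambda (w + 1) \<eta>\<close> for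
  large w off the cut, by \<open>Lambda_step\<close>.\<close>

definition Stirling_increment :: "complex \<Rightarrow> complex \<Rightarrow> complex"
  where "Stirling_increment \<eta> w = (w + \<eta> + 1 / 2) * Ln (1 + 1 / w) - 1 - Ln (1 + \<eta> / w)"

text \<open>A round upper bound for the constant 8 + 4 (|\<eta>| + 1) + (|\<eta>| + 1) / 2 + 2
  |\<eta>|^2 collected in \<open>Stirling_increment_bound\<close>.\<close>

definition Stirling_bound :: "complex \<Rightarrow> real"
  where "Stirling_bound \<eta> = 13 * (cmod \<eta> + 1) + 2 * (cmod \<eta>)\<^sup>2"

lemma Stirling_bound_pos: "Stirling_bound \<eta> > 0"
  unfolding Stirling_bound_def by (intro add_pos_nonneg mult_pos_pos add_nonneg_pos) auto

text \<open>In u = 1 / w the terms of order 0 and 1 cancel; the 1 / 2 in the exponent of w in Lambda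
  is what removes the remaining multiple of u. The quadratic decay makes the sum over w, w + 1, ...
  converge.\<close>

lemma Stirling_increment_bound:
  assumes w: "cmod w \<ge> 2 * (cmod \<eta> + 1)"
  shows "cmod (Stirling_increment \<eta> w) \<le> Stirling_bound \<eta> / (cmod w)\<^sup>2"
proof -
  define u where "u = 1 / w"
  have w0: "w \<noteq> 0" using w norm_ge_zero[of \<eta>] by force
  have u: "cmod u \<le> 1 / 2" "cmod (\<eta> * u) < 1 / 2"
  proof -
    have "cmod w \<ge> 2" "2 * cmod \<eta> < cmod w" using w norm_ge_zero[of \<eta>] unfolding distrib_left by linarith+
    then show "cmod u \<le> 1 / 2" "cmod (\<eta> * u) < 1 / 2"
      using w0 by (simp_all add: u_def norm_divide norm_mult divide_simps)
  qed
  define E1 where "E1 = Ln (1 + u) - (u - u\<^sup>2 / 2)"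
  define E2 where "E2 = Ln (1 + \<eta> * u) - \<eta> * u"
  have E1: "cmod E1 \<le> 8 * cmod u ^ 3" unfolding E1_def by (rule Ln_cubic_bound[OF u(1)])
  have "cmod E2 \<le> cmod (\<eta> * u) ^ 2 / (1 - cmod (\<eta> * u))"
    unfolding E2_def by (rule Ln_approx_linear) (use u in simp)
  also have "\<dots> \<le> cmod (\<eta> * u) ^ 2 / (1 / 2)"
    using u(2) by (intro divide_left_mono) auto
  finally have E2: "cmod E2 \<le> 2 * (cmod \<eta>)\<^sup>2 * (cmod u)\<^sup>2" by (simp add: norm_mult power_mult_distrib)
  have wu: "w * u = 1" using w0 by (simp add: u_def)
  have "Stirling_increment \<eta> w = (w + \<eta> + 1 / 2) * (u - u\<^sup>2 / 2 + E1) - 1 - (\<eta> * u + E2)"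
    by (simp add: Stirling_increment_def E1_def E2_def u_def)
  also have "\<dots> = (w * u) - (w * u) * u / 2 + w * E1 + (\<eta> + 1 / 2) * (u - u\<^sup>2 / 2 + E1) - 1 - (\<eta> * u + E2)"
    by (simp add: field_simps power2_eq_square)
  also have "\<dots> = (w + \<eta> + 1 / 2) * E1 - (\<eta> + 1 / 2) * u\<^sup>2 / 2 - E2"
    unfolding wu by (simp add: field_simps power2_eq_square)
  finally have D: "Stirling_increment \<eta> w = (w + \<eta> + 1 / 2) * E1 - (\<eta> + 1 / 2) * u\<^sup>2 / 2 - E2" .
  have a: "cmod (\<eta> + 1 / 2) \<le> cmod \<eta> + 1"
    using norm_triangle_ineq[of \<eta> "1 / 2"] by simp
  have "cmod ((w + \<eta> + 1 / 2) * E1) \<le> (cmod w + (cmod \<eta> + 1)) * (8 * cmod u ^ 3)"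
    unfolding norm_mult using norm_triangle_ineq[of w "\<eta> + 1 / 2"] a
    by (intro mult_mono E1) (auto simp: add.assoc)
  also have "\<dots> = 8 * (cmod (w * u) + (cmod \<eta> + 1) * cmod u) * (cmod u)\<^sup>2"
    by (simp add: norm_mult algebra_simps power2_eq_square power3_eq_cube)
  also have "\<dots> \<le> 8 * (1 + (cmod \<eta> + 1) * (1 / 2)) * (cmod u)\<^sup>2"
    using u(1) by (intro mult_right_mono mult_left_mono add_mono) (auto simp: wu)
  also have "8 * (1 + (cmod \<eta> + 1) * (1 / 2)) = 8 + 4 * (cmod \<eta> + 1)" by simp
  finally have 1: "cmod ((w + \<eta> + 1 / 2) * E1) \<le> (8 + 4 * (cmod \<eta> + 1)) * (cmod u)\<^sup>2" .
  have 2: "cmod ((\<eta> + 1 / 2) * u\<^sup>2 / 2) \<le> ((cmod \<eta> + 1) / 2) * (cmod u)\<^sup>2"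
    using mult_right_mono[OF a, of "(cmod u)\<^sup>2"] by (simp add: norm_mult norm_divide norm_power)
  have "cmod (Stirling_increment \<eta> w) \<le> cmod ((w + \<eta> + 1 / 2) * E1) + cmod ((\<eta> + 1 / 2) * u\<^sup>2 / 2) + cmod E2"
    unfolding D using norm_triangle_ineq4[of "(w + \<eta> + 1 / 2) * E1 - (\<eta> + 1 / 2) * u\<^sup>2 / 2" E2]
      norm_triangle_ineq4[of "(w + \<eta> + 1 / 2) * E1" "(\<eta> + 1 / 2) * u\<^sup>2 / 2"] by linarith
  also have "\<dots> \<le> (8 + 4 * (cmod \<eta> + 1)) * (cmod u)\<^sup>2 + ((cmod \<eta> + 1) / 2) * (cmod u)\<^sup>2
      + 2 * (cmod \<eta>)\<^sup>2 * (cmod u)\<^sup>2"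
    by (intro add_mono 1 2 E2)
  also have "\<dots> = ((8 + 4 * (cmod \<eta> + 1)) + (cmod \<eta> + 1) / 2 + 2 * (cmod \<eta>)\<^sup>2) * (cmod u)\<^sup>2"
    by (simp add: algebra_simps)
  also have "\<dots> \<le> Stirling_bound \<eta> * (cmod u)\<^sup>2"
    by (intro mult_right_mono) (auto simp: Stirling_bound_def)
  finally show ?thesis by (simp add: u_def norm_divide power_divide)
qed

lemma Lambda_step:
  assumes w: "w \<notin> \<real>\<^sub>\<le>\<^sub>0" "cmod w \<ge> 2 * (cmod \<eta> + 1)"
  shows "Lambda w \<eta> = exp (Stirling_increment \<eta> w) * Lambda (w + 1) \<eta>"
proof -
  have w0: "w \<noteq> 0" "w + 1 \<noteq> 0" using w by (auto simp: add_eq_0_iff minus_equation_iff)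
  have wn: "w + \<eta> \<noteq> 0"
  proof
    assume "w + \<eta> = 0"
    then have "cmod w = cmod \<eta>" by (metis add_eq_0_iff norm_minus_cancel)
    then show False using w(2) by (simp add: not_less[symmetric] add_nonneg_pos)
  qed
  have fac: "(w + \<eta>) / w = 1 + \<eta> / w" "1 + \<eta> / w \<noteq> 0" using w0 wn by (auto simp: field_simps)
  have G: "Gamma (w + 1 + \<eta>) = (w + \<eta>) * Gamma (w + \<eta>)"
  proof -
    have "(w + \<eta>) * Gamma (w + \<eta>) = (w + \<eta>) * inverse ((w + \<eta>) * rGamma (w + \<eta> + 1))"
      by (simp add: Gamma_def rGamma_plus1)
    also have "\<dots> = Gamma (w + \<eta> + 1)" using wn by (simp add: Gamma_def)
    finally show ?thesis by (simp add: add_ac)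
  qed
  have "exp (Stirling_increment \<eta> w) * ((w + 1) powr (1 / 2 - \<eta> - (w + 1)) * exp 1 * (w + \<eta>))
      = exp ((w + \<eta> + 1 / 2) * Ln (1 + 1 / w) + (1 / 2 - \<eta> - (w + 1)) * Ln (w + 1)) * ((w + \<eta>) / (1 + \<eta> / w))"
    using w0 fac(2) by (simp add: Stirling_increment_def powr_def exp_diff exp_add)
  also have "(w + \<eta>) / (1 + \<eta> / w) = w" using w0 wn by (simp add: field_simps)
  also have "(w + \<eta> + 1 / 2) * Ln (1 + 1 / w) + (1 / 2 - \<eta> - (w + 1)) * Ln (w + 1)
      = (1 / 2 - \<eta> - w) * Ln w - Ln w"
    unfolding Ln_add_one[OF w(1)] by (simp add: algebra_simps)
  also have "exp \<dots> * w = w powr (1 / 2 - \<eta> - w)"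
    using w0 by (simp add: exp_diff powr_def)
  finally show ?thesis
    unfolding Lambda_def G by (simp add: exp_add mult_ac)
qed

lemma exp_sum_times_Lambda:
  assumes "\<And>k. w + of_nat k \<notin> \<real>\<^sub>\<le>\<^sub>0" "\<And>k. cmod (w + of_nat k) \<ge> 2 * (cmod \<eta> + 1)"
  shows "Lambda w \<eta> = exp (\<Sum>k<N. Stirling_increment \<eta> (w + of_nat k)) * Lambda (w + of_nat N) \<eta>"
proof (induction N)
  case (Suc N)
  then show ?case
    using Lambda_step[OF assms(1,2), of N] by (simp add: exp_add add_ac mult_ac)
qed simp

section \<open>Convergence along the integer translates of w\<close>

lemma Ln_of_nat_scaled_limit: "(\<lambda>n. of_nat n * Ln (1 + v / of_nat n)) \<longlonglongrightarrow> v"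
proof (rule Lim_transform2[OF tendsto_const])
  have "(\<lambda>n. 2 * (cmod v)\<^sup>2 * (1 / real n)) \<longlonglongrightarrow> 2 * (cmod v)\<^sup>2 * 0"
    by (intro tendsto_intros lim_1_over_n)
  then have "(\<lambda>n. 2 * (cmod v)\<^sup>2 * (1 / real n)) \<longlonglongrightarrow> 0" by simp
  then show "(\<lambda>n. v - of_nat n * Ln (1 + v / of_nat n)) \<longlonglongrightarrow> 0"
  proof (rule Lim_null_comparison[rotated])
    have "\<forall>\<^sub>F n in sequentially. n > nat \<lceil>2 * cmod v\<rceil>" by (rule eventually_gt_at_top)
    then show "\<forall>\<^sub>F n in sequentially. norm (v - of_nat n * Ln (1 + v / of_nat n)) \<le> 2 * (cmod v)\<^sup>2 * (1 / real n)"
    proof eventually_elim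
      case (elim n)
      then have n: "real n > 2 * cmod v" "n > 0" by linarith+
      define u where "u = v / of_nat n"
      have u: "cmod u < 1 / 2" using n by (simp add: u_def norm_divide field_simps)
      have "cmod (Ln (1 + u) - u) \<le> (cmod u)\<^sup>2 / (1 - cmod u)" by (rule Ln_approx_linear) (use u in simp)
      also have "\<dots> \<le> (cmod u)\<^sup>2 / (1 / 2)" using u by (intro divide_left_mono) auto
      finally have *: "cmod (Ln (1 + u) - u) \<le> 2 * (cmod u)\<^sup>2" by simp
      have "v - of_nat n * Ln (1 + u) = - (of_nat n * (Ln (1 + u) - u))"
        using n by (simp add: u_def right_diff_distrib)
      then have "cmod (v - of_nat n * Ln (1 + u)) = real n * cmod (Ln (1 + u) - u)"
        by (simp add: norm_mult)
      also have "\<dots> \<le> real n * (2 * (cmod u)\<^sup>2)" by (intro mult_left_mono *) simp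
      also have "\<dots> = 2 * (cmod v)\<^sup>2 * (1 / real n)"
        using n by (simp add: u_def norm_divide power2_eq_square)
      finally show ?case by (simp add: u_def)
    qed
  qed
qed

text \<open>For positive n this is n! divided by Stirling's approximation sqrt(2 \<pi>) n^(n + 1/2)
  e^(-n).\<close>

definition Stirling_quotient :: "nat \<Rightarrow> real"
  where "Stirling_quotient n = fact n * exp (real n - (real n + 1 / 2) * ln (real n)) / sqrt (2 * pi)"

text \<open>From n = 1 on the sequence decreases: this amounts to (x + 1/2) (ln (x + 1) - ln x)
  being at least 1. The limit is identified in \<open>Stirling_constant\<close>.\<close>

lemma Stirling_quotient_convergent:
  obtains c where "c \<ge> 0" "Stirling_quotient \<longlonglongrightarrow> c"
proof -
  have "Stirling_quotient (Suc (Suc n)) \<le> Stirling_quotient (Suc n)" for n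
  proof -
    define x where "x = real (Suc n)"
    have x: "x > 0" by (simp add: x_def)
    have "ln (x + 1) - ln x \<ge> 2 * (x + 1 - x) / (x + (x + 1))"
      by (rule ln_inverse_approx_ge) (use x in auto)
    then have "(x + 1 / 2) * (ln (x + 1) - ln x) \<ge> (x + 1 / 2) * (2 * (x + 1 - x) / (x + (x + 1)))"
      using x by (intro mult_left_mono) auto
    also have "(x + 1 / 2) * (2 * (x + 1 - x) / (x + (x + 1))) = 1" using x by (simp add: field_simps)
    finally have *: "(x + 1 / 2) * ln (x + 1) \<ge> 1 + (x + 1 / 2) * ln x" by (simp add: algebra_simps)
    have "fact (Suc (Suc n)) * exp (x + 1 - (x + 1 + 1 / 2) * ln (x + 1))
        = fact (Suc n) * exp (ln (x + 1)) * exp (x + 1 - (x + 1 + 1 / 2) * ln (x + 1))"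
      using x by (simp add: x_def mult_ac)
    also have "\<dots> = fact (Suc n) * exp (ln (x + 1) + (x + 1 - (x + 1 + 1 / 2) * ln (x + 1)))"
      by (simp only: exp_add mult.assoc)
    also have "ln (x + 1) + (x + 1 - (x + 1 + 1 / 2) * ln (x + 1)) = x + 1 - (x + 1 / 2) * ln (x + 1)"
      by (simp add: algebra_simps)
    also have "fact (Suc n) * exp (x + 1 - (x + 1 / 2) * ln (x + 1)) \<le> fact (Suc n) * exp (x - (x + 1 / 2) * ln x)"
    proof (rule mult_left_mono)
      have "x + 1 - (x + 1 / 2) * ln (x + 1) \<le> x - (x + 1 / 2) * ln x" using * by linarith
      then show "exp (x + 1 - (x + 1 / 2) * ln (x + 1)) \<le> exp (x - (x + 1 / 2) * ln x)"
        by (simp only: exp_le_cancel_iff)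
    qed simp
    finally show ?thesis
      by (simp add: Stirling_quotient_def x_def divide_right_mono add_ac del: fact_Suc)
  qed
  then have "decseq (\<lambda>n. Stirling_quotient (Suc n))" by (rule decseq_SucI)
  moreover have nn: "Stirling_quotient (Suc n) \<ge> 0" for n by (simp add: Stirling_quotient_def)
  ultimately obtain c where c: "(\<lambda>n. Stirling_quotient (Suc n)) \<longlonglongrightarrow> c"
    using decseq_convergent[of "\<lambda>n. Stirling_quotient (Suc n)" 0] by metis
  moreover have "c \<ge> 0" by (rule LIMSEQ_le_const[OF c]) (use nn in blast)
  ultimately show ?thesis using that by (simp add: filterlim_sequentially_Suc)
qed

text \<open>Euler's limit formula expresses Gamma(z + n + 1) by n! n^z up to a factor
  \<open>r n\<close> tending to 1. The remaining powers and exponentials make up the Stirling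
  quotient and a factor \<open>E n\<close>, which tends to 1 because n Ln (1 + v / n) tends to
  v.\<close>

lemma Lambda_add_of_nat_limit:
  assumes c: "Stirling_quotient \<longlonglongrightarrow> c" and z: "w + \<eta> \<notin> \<int>\<^sub>\<le>\<^sub>0"
  shows "(\<lambda>n. Lambda (w + of_nat n) \<eta>) \<longlonglongrightarrow> of_real c"
proof -
  define z where "z = w + \<eta>"
  define v where "v = w + 1"
  define r where "r = (\<lambda>n. Gamma z / Gamma_series z n)"
  define E where "E = (\<lambda>n. exp (v - ((1 / 2 + z) * Ln (1 + v / of_nat n) + of_nat n * Ln (1 + v / of_nat n))))"
  have Gz: "Gamma z \<noteq> 0" using assms(2) by (simp add: z_def Gamma_eq_zero_iff)
  have r: "r \<longlonglongrightarrow> Gamma z / Gamma z"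
    unfolding r_def by (intro tendsto_intros Gz)
  have "(\<lambda>n. v / of_nat n) \<longlonglongrightarrow> 0" by (rule lim_const_over_n)
  from tendsto_Ln[OF tendsto_add[OF tendsto_const[of 1] this]]
  have "(\<lambda>n. Ln (1 + v / of_nat n)) \<longlonglongrightarrow> 0" by simp
  then have "E \<longlonglongrightarrow> exp (v - ((1 / 2 + z) * 0 + v))"
    unfolding E_def by (intro tendsto_intros Ln_of_nat_scaled_limit)
  then have E: "E \<longlonglongrightarrow> 1" by simp
  have "(\<lambda>n. r n * of_real (Stirling_quotient n) * E n) \<longlonglongrightarrow> (Gamma z / Gamma z) * of_real c * 1"
    by (intro tendsto_mult r E tendsto_of_real c)
  then have lim: "(\<lambda>n. r n * of_real (Stirling_quotient n) * E n) \<longlonglongrightarrow> of_real c" using Gz by simp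
  \<comment> \<open>The shift by one fits the n + 1 factors in the denominator of the Gamma
    series.\<close>
  have "(\<lambda>n. Lambda (w + of_nat (Suc n)) \<eta>) \<longlonglongrightarrow> of_real c"
  proof (rule Lim_transform_eventually[OF lim])
    have "\<forall>\<^sub>F n in sequentially. n > nat \<lceil>cmod v\<rceil>" by (rule eventually_gt_at_top)
    then show "\<forall>\<^sub>F n in sequentially. r n * of_real (Stirling_quotient n) * E n = Lambda (w + of_nat (Suc n)) \<eta>"
    proof eventually_elim
      case (elim n)
      then have n: "n > 0" "real n > cmod v" by linarith+
      define l where "l = complex_of_real (ln (real n))"
      have nz: "1 + v / of_nat n \<noteq> 0"
      proof
        assume "1 + v / of_nat n = 0"
        then have "v = - of_nat n" using n by (simp add: field_simps add_eq_0_iff)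
        then show False using n by simp
      qed
      have G: "Gamma (w + of_nat (Suc n) + \<eta>) = r n * fact n * exp (z * l)"
      proof -
        have "pochhammer z (Suc n) = Gamma (z + of_nat (Suc n)) / Gamma z"
          using assms(2) by (intro pochhammer_Gamma) (simp add: z_def)
        moreover have "r n = Gamma z * pochhammer z (Suc n) / (fact n * exp (z * l))"
          by (simp add: r_def Gamma_series_def l_def)
        ultimately show ?thesis using Gz by (simp add: z_def add_ac)
      qed
      have w: "w + of_nat (Suc n) = of_nat n * (1 + v / of_nat n)" using n by (simp add: v_def field_simps)
      have Lw: "Ln (w + of_nat (Suc n)) = l + Ln (1 + v / of_nat n)"
        unfolding w using nz n Ln_times_of_nat[of n "1 + v / of_nat n"] by (simp add: l_def)
      have w0: "w + of_nat (Suc n) \<noteq> 0" unfolding w using nz n by simp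
      have sq: "(2 * complex_of_real pi) powr (- 1 / 2) = of_real (1 / sqrt (2 * pi))"
      proof -
        have "(2 * complex_of_real pi) powr (- 1 / 2) = of_real (2 * pi) powr (of_real (- 1 / 2))" by simp
        also have "\<dots> = of_real ((2 * pi) powr (- 1 / 2))" by (rule powr_of_real) simp
        also have "(2 * pi) powr (- 1 / 2) = 1 / sqrt (2 * pi)"
          using powr_minus[of "2 * pi" "1 / 2"] by (simp add: powr_half_sqrt inverse_eq_divide)
        finally show ?thesis .
      qed
      have S: "complex_of_real (Stirling_quotient n)
          = fact n * exp (of_nat n - (of_nat n + 1 / 2) * l) * of_real (1 / sqrt (2 * pi))"
        by (simp add: Stirling_quotient_def l_def exp_of_real[symmetric])
      have eE: "exp (z * l) * (exp (w + of_nat (Suc n)) * exp ((1 / 2 - \<eta> - (w + of_nat (Suc n))) * (l + Ln (1 + v / of_nat n))))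
          = exp (of_nat n - (of_nat n + 1 / 2) * l) * E n"
        unfolding E_def exp_add[symmetric] by (rule arg_cong[of _ _ exp]) (simp add: z_def v_def algebra_simps)
      have "Lambda (w + of_nat (Suc n)) \<eta> = r n * fact n * of_real (1 / sqrt (2 * pi)) *
          (exp (z * l) * (exp (w + of_nat (Suc n)) * exp ((1 / 2 - \<eta> - (w + of_nat (Suc n))) * (l + Ln (1 + v / of_nat n)))))"
        unfolding Lambda_def G sq powr_def[of "w + _"] Lw if_not_P[OF w0] by (simp only: mult_ac)
      also have "\<dots> = r n * of_real (Stirling_quotient n) * E n"
        unfolding eE S by (simp only: mult_ac)
      finally show ?case ..
    qed
  qed
  then show ?thesis by (rule LIMSEQ_imp_Suc)
qed

text \<open>For 0 <= \<kappa> < 1 the condition is |arg w| <= arccos(-\<kappa>) < \<pi>: the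
  negative axis is avoided by a fixed angle.\<close>

definition sector :: "real \<Rightarrow> complex set"
  where "sector \<kappa> = {w. w \<noteq> 0 \<and> Re w \<ge> - \<kappa> * cmod w}"

text \<open>Uniformly in the sector, w + x is at least of the size of |w| + x. This compares the sum
  of |w + k|^-2 over k with that of (|w| + k)^-2.\<close>

lemma sector_add_norm:
  assumes w: "w \<in> sector \<kappa>" and \<kappa>: "0 \<le> \<kappa>" "\<kappa> < 1" and x: "x \<ge> 0"
  shows "(cmod (w + of_real x))\<^sup>2 \<ge> (1 - \<kappa>) / 2 * (cmod w + x)\<^sup>2"
proof -
  have "(cmod (w + of_real x))\<^sup>2 = (cmod w)\<^sup>2 + x\<^sup>2 + 2 * (x * Re w)"
    unfolding cmod_power2 by (simp add: power2_eq_square algebra_simps)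
  moreover have "x * Re w \<ge> x * (- \<kappa> * cmod w)" using w x by (intro mult_left_mono) (auto simp: sector_def)
  moreover have "\<kappa> * (2 * (x * cmod w)) \<le> \<kappa> * ((cmod w)\<^sup>2 + x\<^sup>2)"
    using sum_squares_bound[of x "cmod w"] \<kappa> by (intro mult_left_mono) (auto simp: algebra_simps)
  ultimately have "(cmod (w + of_real x))\<^sup>2 \<ge> (1 - \<kappa>) * ((cmod w)\<^sup>2 + x\<^sup>2)" by (simp add: algebra_simps)
  moreover have "(1 - \<kappa>) * ((cmod w)\<^sup>2 + x\<^sup>2) \<ge> (1 - \<kappa>) * ((cmod w + x)\<^sup>2 / 2)"
    using sum_squares_bound[of x "cmod w"] \<kappa> by (intro mult_left_mono) (auto simp: power2_eq_square algebra_simps)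
  ultimately show ?thesis by simp
qed

lemma sector_add:
  assumes w: "w \<in> sector \<kappa>" and \<kappa>: "0 \<le> \<kappa>" "\<kappa> < 1" and x: "x \<ge> 0"
  shows "w + of_real x \<in> sector \<kappa>"
proof -
  have w0: "cmod w > 0" using w by (simp add: sector_def)
  have "(1 - \<kappa>) / 2 * (cmod w + x)\<^sup>2 > 0"
    using \<kappa> add_pos_nonneg[OF w0 x] by (intro mult_pos_pos) auto
  then have "(cmod (w + of_real x))\<^sup>2 > 0" using sector_add_norm[OF assms] by linarith
  then have n0: "w + of_real x \<noteq> 0" by auto
  have "Re (w + of_real x) \<ge> - \<kappa> * cmod (w + of_real x)"
  proof (cases "Re w + x \<ge> 0")
    case True
    moreover have "\<kappa> * cmod (w + of_real x) \<ge> 0" using \<kappa> by (intro mult_nonneg_nonneg) auto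
    ultimately show ?thesis by simp
  next
    case False
    text \<open>Moving to the right decreases both \<open>\<bar>Re\<bar>\<close> and the ratio \<open>\<bar>Re\<bar> / \<bar>Im\<bar>\<close>.\<close>
    define a b where "a = - Re w" and "b = (Im w)\<^sup>2"
    have a: "a > 0" "0 < a - x" "a - x \<le> a" "b \<ge> 0" using False x by (auto simp: a_def b_def)
    have "a \<le> \<kappa> * cmod w" using w by (simp add: sector_def a_def)
    then have "a\<^sup>2 \<le> (\<kappa> * cmod w)\<^sup>2" using a by (intro power_mono) auto
    then have 1: "(1 - \<kappa>\<^sup>2) * a\<^sup>2 \<le> \<kappa>\<^sup>2 * b"
      by (simp add: power_mult_distrib cmod_power2 a_def b_def algebra_simps)
    have k1: "\<kappa>\<^sup>2 \<le> 1" using \<kappa> by (simp add: power_le_one)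
    have "(1 - \<kappa>\<^sup>2) * (a - x)\<^sup>2 \<le> (1 - \<kappa>\<^sup>2) * a\<^sup>2"
      using a k1 by (intro mult_left_mono power_mono) auto
    with 1 have "(1 - \<kappa>\<^sup>2) * (a - x)\<^sup>2 \<le> \<kappa>\<^sup>2 * b" by linarith
    then have "(a - x)\<^sup>2 \<le> (\<kappa> * cmod (w + of_real x))\<^sup>2"
      unfolding power_mult_distrib cmod_power2 a_def b_def by (simp add: power2_eq_square algebra_simps)
    then have "a - x \<le> \<kappa> * cmod (w + of_real x)"
      by (rule power2_le_imp_le) (use \<kappa> in auto)
    then show ?thesis by (simp add: a_def)
  qed
  with n0 show ?thesis by (simp add: sector_def)
qed

lemma sector_not_nonpos_Reals:
  assumes "w \<in> sector \<kappa>" "\<kappa> < 1" shows "w \<notin> \<real>\<^sub>\<le>\<^sub>0"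
proof
  assume "w \<in> \<real>\<^sub>\<le>\<^sub>0"
  then have "Im w = 0" "Re w \<le> 0" by (auto simp: complex_nonpos_Reals_iff)
  then have "Re w = - cmod w" by (simp add: cmod_eq_Re)
  moreover have "cmod w > 0" using assms by (simp add: sector_def)
  ultimately show False using mult_strict_right_mono[OF assms(2), of "cmod w"] assms(1) by (simp add: sector_def)
qed

lemma sum_inverse_squares_bound:
  assumes "(x::real) > 1"
  shows "(\<Sum>k<N. 1 / (x + real k)\<^sup>2) \<le> 1 / (x - 1)"
proof -
  have "(\<Sum>k<N. 1 / (x + real k)\<^sup>2) \<le> (\<Sum>k<N. 1 / (x - 1 + real k) - 1 / (x - 1 + real (Suc k)))"
  proof (rule sum_mono)
    fix k
    have p: "x - 1 + real k > 0" "x + real k > 0" using assms by linarith+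
    have "1 / (x + real k)\<^sup>2 \<le> 1 / ((x - 1 + real k) * (x + real k))"
      using p unfolding power2_eq_square by (intro divide_left_mono mult_right_mono) auto
    also have "\<dots> = 1 / (x - 1 + real k) - 1 / (x + real k)" using p by (simp add: field_simps)
    finally show "1 / (x + real k)\<^sup>2 \<le> 1 / (x - 1 + real k) - 1 / (x - 1 + real (Suc k))" by simp
  qed
  also have "\<dots> = 1 / (x - 1) - 1 / (x - 1 + real N)"
    by (subst sum_lessThan_telescope') simp
  also have "\<dots> \<le> 1 / (x - 1)" using assms by simp
  finally show ?thesis .
qed

text \<open>\<open>Lambda w \<eta>\<close> is the exponential of a partial sum of increments times
  the value at w + N. The partial sums are at most B / (|w| - 1) uniformly in N, and the values at w
  + N tend to c. The error is stated relative to c, whose value is found only afterwards with the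
  help of this lemma.\<close>

lemma Lambda_sector_limit_const:
  assumes c: "Stirling_quotient \<longlonglongrightarrow> c" and \<kappa>: "0 \<le> \<kappa>" "\<kappa> < 1" and e: "e > 0"
  obtains R where "R > 0" "\<And>w. w \<in> sector \<kappa> \<Longrightarrow> cmod w > R \<Longrightarrow> cmod (Lambda w \<eta> - of_real c) \<le> e * \<bar>c\<bar>"
proof -
  have "isCont exp (0::complex)" by simp
  then obtain d where d: "d > 0" "\<And>z::complex. cmod z < d \<Longrightarrow> cmod (exp z - 1) < e"
    using e unfolding continuous_at_eps_delta by (auto simp: dist_norm)
  define s where "s = (1 - \<kappa>) / 2"
  have s: "s > 0" using \<kappa> by (simp add: s_def)
  define M where "M = 2 * (cmod \<eta> + 1)"
  have M: "M \<ge> 2" by (simp add: M_def)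
  define B where "B = Stirling_bound \<eta> / s"
  have B: "B > 0" using s Stirling_bound_pos by (simp add: B_def)
  \<comment> \<open>The summands ensure |w| > 1, |w + k| >= M for all k, and a sum of increments
    below d.\<close>
  define R where "R = 2 + M / sqrt s + B / d"
  show ?thesis
  proof (rule that)
    have q: "M / sqrt s > 0" "B / d > 0" using s d B M by auto
    then show "R > 0" by (simp add: R_def)
    fix w assume w: "w \<in> sector \<kappa>" and R: "cmod w > R"
    have wR: "cmod w > 1" "cmod w > M / sqrt s" "cmod w - 1 > B / d" using R q by (auto simp: R_def)
    have sec: "w + of_nat k \<in> sector \<kappa>" for k using sector_add[OF w \<kappa>, of "real k"] by simp
    have nrm: "(cmod (w + of_nat k))\<^sup>2 \<ge> s * (cmod w + real k)\<^sup>2" for k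
      using sector_add_norm[OF w \<kappa>, of "real k"] by (simp add: s_def)
    have big: "cmod (w + of_nat k) \<ge> M" for k
    proof (rule power2_le_imp_le)
      have "M \<le> sqrt s * cmod w" using wR(2) s by (simp add: field_simps)
      also have "\<dots> \<le> sqrt s * (cmod w + real k)" using s by (intro mult_left_mono) auto
      finally have "M\<^sup>2 \<le> (sqrt s * (cmod w + real k))\<^sup>2" using M by (intro power_mono) auto
      also have "\<dots> = s * (cmod w + real k)\<^sup>2" using s by (simp add: power_mult_distrib)
      finally show "M\<^sup>2 \<le> (cmod (w + of_nat k))\<^sup>2" using nrm[of k] by linarith
    qed simp
    have nonpos: "w + \<eta> \<notin> \<int>\<^sub>\<le>\<^sub>0"
    proof
      assume "w + \<eta> \<in> \<int>\<^sub>\<le>\<^sub>0"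
      then obtain k where "w + \<eta> = - of_nat k" by (elim nonpos_Ints_cases')
      then have "w + of_nat k = - \<eta>" by (simp add: algebra_simps eq_neg_iff_add_eq_0)
      then have "cmod (w + of_nat k) = cmod \<eta>" by simp
      then show False using big[of k] norm_ge_zero[of \<eta>] unfolding M_def distrib_left by linarith
    qed
    define \<Sigma> where "\<Sigma> = (\<lambda>N. \<Sum>k<N. Stirling_increment \<eta> (w + of_nat k))"
    have rec: "Lambda w \<eta> = exp (\<Sigma> N) * Lambda (w + of_nat N) \<eta>" for N
      unfolding \<Sigma>_def
      by (rule exp_sum_times_Lambda) (use sector_not_nonpos_Reals[OF sec \<kappa>(2)] big in \<open>auto simp: M_def\<close>)
    have Sb: "cmod (\<Sigma> N) < d" for N
    proof -
      have "cmod (\<Sigma> N) \<le> (\<Sum>k<N. B * (1 / (cmod w + real k)\<^sup>2))"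
        unfolding \<Sigma>_def
      proof (rule sum_norm_le)
        fix k
        have p: "cmod w + real k > 0" using wR by linarith
        have "cmod (Stirling_increment \<eta> (w + of_nat k)) \<le> Stirling_bound \<eta> / (cmod (w + of_nat k))\<^sup>2"
          by (rule Stirling_increment_bound) (use big in \<open>simp add: M_def\<close>)
        also have "\<dots> \<le> Stirling_bound \<eta> / (s * (cmod w + real k)\<^sup>2)"
        proof (intro divide_left_mono mult_pos_pos)
          have "0 < s * (cmod w + real k)\<^sup>2" using s p by simp
          then show "0 < (cmod (w + of_nat k))\<^sup>2" using nrm[of k] by linarith
        qed (use nrm[of k] s p Stirling_bound_pos[of \<eta>] in auto)
        finally show "cmod (Stirling_increment \<eta> (w + of_nat k)) \<le> B * (1 / (cmod w + real k)\<^sup>2)"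
          by (simp add: B_def)
      qed
      also have "\<dots> \<le> B * (1 / (cmod w - 1))"
        unfolding sum_distrib_left[symmetric]
        using B by (intro mult_left_mono sum_inverse_squares_bound wR) auto
      also have "\<dots> < d" using wR d(1) by (simp add: field_simps)
      finally show ?thesis .
    qed
    have lim: "(\<lambda>N. Lambda (w + of_nat N) \<eta>) \<longlonglongrightarrow> of_real c"
      by (rule Lambda_add_of_nat_limit[OF c nonpos])
    have "cmod (Lambda w \<eta> - Lambda (w + of_nat N) \<eta>) \<le> e * cmod (Lambda (w + of_nat N) \<eta>)" for N
    proof -
      have "Lambda w \<eta> - Lambda (w + of_nat N) \<eta> = (exp (\<Sigma> N) - 1) * Lambda (w + of_nat N) \<eta>"
        unfolding rec[of N] by (simp add: algebra_simps)
      then show ?thesis using d(2)[OF Sb[of N]] by (simp add: norm_mult mult_right_mono)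
    qed
    then have "cmod (Lambda w \<eta> - of_real c) \<le> e * cmod (of_real c)"
      by (intro LIMSEQ_le[OF tendsto_norm[OF tendsto_diff[OF tendsto_const lim]] tendsto_mult[OF tendsto_const tendsto_norm[OF lim]]]) blast
    then show "cmod (Lambda w \<eta> - of_real c) \<le> e * \<bar>c\<bar>" by simp
  qed
qed

text \<open>Below the real axis \<open>Ln (- w)\<close> exceeds \<open>Ln w\<close> by \<i> \<pi>,
  so of the powers of w only exp(\<pi> \<i> (x - 1/2)) with x = w + \<eta> remains. It turns the 1 /
  (2 sin(\<pi> x)) of Euler's reflection formula into the right-hand side.\<close>

lemma Lambda_reflection:
  assumes "Im w < 0"
  shows "Lambda w \<eta> * Lambda (- w) (1 - \<eta>) = inverse (1 - exp (- 2 * of_real pi * \<i> * (w + \<eta>)))"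
proof -
  define x where "x = w + \<eta>"
  have w: "w \<noteq> 0" using assms by auto
  have lm: "Ln (- w) = Ln w + \<i> * pi" using Ln_minus[OF w] assms by simp
  have sq: "(2 * complex_of_real pi) powr (- 1 / 2) * (2 * complex_of_real pi) powr (- 1 / 2) = 1 / (2 * of_real pi)"
  proof -
    have "(2 * complex_of_real pi) powr (- 1 / 2) * (2 * complex_of_real pi) powr (- 1 / 2)
        = (2 * complex_of_real pi) powr (- 1)" by (simp add: powr_add[symmetric])
    also have "\<dots> = 1 / (2 * of_real pi)" by (simp add: powr_minus inverse_eq_divide)
    finally show ?thesis .
  qed
  have pw: "w powr (1 / 2 - \<eta> - w) * (- w) powr (1 / 2 - (1 - \<eta>) - (- w)) = exp (of_real pi * \<i> * (x - 1 / 2))"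
    using w unfolding powr_def lm by (simp add: exp_add[symmetric] x_def algebra_simps)
  have "Lambda w \<eta> * Lambda (- w) (1 - \<eta>)
      = (Gamma x * Gamma (1 - x)) * (exp w * exp (- w)) *
        ((2 * of_real pi) powr (- 1 / 2) * (2 * of_real pi) powr (- 1 / 2)) *
        (w powr (1 / 2 - \<eta> - w) * (- w) powr (1 / 2 - (1 - \<eta>) - (- w)))"
    by (simp add: Lambda_def x_def mult_ac algebra_simps)
  also have "\<dots> = (of_real pi / sin (of_real pi * x)) * (1 / (2 * of_real pi)) * exp (of_real pi * \<i> * (x - 1 / 2))"
    unfolding Gamma_reflection_complex sq pw by (simp add: exp_minus_inverse)
  also have "\<dots> = exp (of_real pi * \<i> * (x - 1 / 2)) * inverse (2 * sin (of_real pi * x))"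
    by (simp add: field_simps)
  also have "2 * sin (of_real pi * x) = exp (of_real pi * \<i> * (x - 1 / 2)) * (1 - exp (- 2 * of_real pi * \<i> * x))"
  proof -
    have e1: "exp (of_real pi * \<i> * (x - 1 / 2)) = exp (\<i> * (of_real pi * x)) * (- \<i>)"
    proof -
      have "of_real pi * \<i> * (x - 1 / 2) = \<i> * (of_real pi * x) + - (\<i> * (of_real pi / 2))"
        by (simp add: algebra_simps)
      moreover have "exp (\<i> * of_real (pi / 2)) = \<i>" unfolding cis_conv_exp[symmetric] by simp
      then have "exp (- (\<i> * (of_real pi / 2))) = - \<i>" by (simp add: exp_minus)
      ultimately show ?thesis by (simp only: exp_add)
    qed
    have e2: "exp (\<i> * (of_real pi * x)) * exp (- 2 * of_real pi * \<i> * x) = exp (- (\<i> * (of_real pi * x)))"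
      unfolding exp_add[symmetric] by (rule arg_cong[of _ _ exp]) (simp add: algebra_simps)
    have "exp (of_real pi * \<i> * (x - 1 / 2)) * (1 - exp (- 2 * of_real pi * \<i> * x))
        = - \<i> * (exp (\<i> * (of_real pi * x)) - exp (\<i> * (of_real pi * x)) * exp (- 2 * of_real pi * \<i> * x))"
      unfolding e1 by (simp add: algebra_simps)
    also have "\<dots> = 2 * sin (of_real pi * x)"
      unfolding e2 sin_exp_eq by (simp add: field_simps)
    finally show ?thesis ..
  qed
  also have "exp (of_real pi * \<i> * (x - 1 / 2)) * inverse (exp (of_real pi * \<i> * (x - 1 / 2)) * (1 - exp (- 2 * of_real pi * \<i> * x)))
      = inverse (1 - exp (- 2 * of_real pi * \<i> * x))"
    by (simp add: inverse_mult_distrib)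
  finally show ?thesis by (simp add: x_def)
qed

text \<open>The constant in Stirling's formula is found by letting \<open>w \<rightarrow> -\<i>\<infinity>\<close> in the reflection formula.\<close>

lemma Stirling_constant: "Stirling_quotient \<longlonglongrightarrow> 1"
proof -
  obtain c where c: "c \<ge> 0" "Stirling_quotient \<longlonglongrightarrow> c" by (rule Stirling_quotient_convergent)
  \<comment> \<open>On the imaginary axis w and - w both lie in the sector with \<kappa> = 0, and at
    \<eta> = 1 / 2 both factors of the reflection formula have the same parameter. Their product
    tends to c^2, the right-hand side to 1.\<close>
  define w where "w = (\<lambda>n. - \<i> * of_nat (Suc n))"
  have lim: "(\<lambda>n. Lambda (a * w n) (1 / 2)) \<longlonglongrightarrow> of_real c" if "a = 1 \<or> a = -1" for a
  proof (rule LIMSEQ_I)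
    fix e :: real assume "e > 0"
    define e' where "e' = e / (2 * (c + 1))"
    have e': "e' > 0" using \<open>e > 0\<close> c by (simp add: e'_def)
    obtain R where R: "R > 0" "\<And>w. w \<in> sector 0 \<Longrightarrow> cmod w > R \<Longrightarrow> cmod (Lambda w (1 / 2) - of_real c) \<le> e' * \<bar>c\<bar>"
      by (rule Lambda_sector_limit_const[OF c(2), of 0 e']) (use e' in auto)
    have "cmod (Lambda (a * w n) (1 / 2) - of_real c) < e" if "n \<ge> nat \<lceil>R\<rceil>" for n
    proof -
      have "cmod (a * w n) = real (Suc n)" using \<open>a = 1 \<or> a = -1\<close> by (auto simp: w_def norm_mult simp del: of_nat_Suc)
      moreover have "real (Suc n) > R" using that by linarith
      moreover have "a * w n \<in> sector 0" using \<open>a = 1 \<or> a = -1\<close> by (auto simp: sector_def w_def simp del: of_nat_Suc)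
      ultimately have "cmod (Lambda (a * w n) (1 / 2) - of_real c) \<le> e' * \<bar>c\<bar>" using R(2) by simp
      also have "\<dots> \<le> e' * (c + 1)" using c(1) e' by (intro mult_left_mono) auto
      also have "\<dots> = e / 2" using c(1) unfolding e'_def by (simp add: divide_simps)
      also have "\<dots> < e" using \<open>e > 0\<close> by simp
      finally show ?thesis .
    qed
    then show "\<exists>no. \<forall>n\<ge>no. cmod (Lambda (a * w n) (1 / 2) - of_real c) < e" by blast
  qed
  have "(\<lambda>n. Lambda (w n) (1 / 2) * Lambda (- w n) (1 / 2)) \<longlonglongrightarrow> of_real c * of_real c"
    using tendsto_mult[OF lim[of 1] lim[of "-1"]] by simp
  moreover have "(\<lambda>n. Lambda (w n) (1 / 2) * Lambda (- w n) (1 / 2)) \<longlonglongrightarrow> 1"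
  proof -
    have "Lambda (w n) (1 / 2) * Lambda (- w n) (1 / 2) = of_real (inverse (1 + exp (- 2 * pi * real (Suc n))))" for n
    proof -
      have "Lambda (w n) (1 / 2) * Lambda (- w n) (1 / 2) = inverse (1 - exp (- 2 * of_real pi * \<i> * (w n + 1 / 2)))"
        using Lambda_reflection[of "w n" "1 / 2"] by (simp add: w_def)
      also have "- 2 * of_real pi * \<i> * (w n + 1 / 2) = of_real (- 2 * pi * real (Suc n)) - \<i> * of_real pi"
        by (simp add: w_def algebra_simps)
      also have "exp \<dots> = - of_real (exp (- 2 * pi * real (Suc n)))"
        by (simp only: exp_diff exp_of_real exp_pi_i') simp
      finally show ?thesis by simp
    qed
    moreover have "(\<lambda>n. inverse (1 + exp (- 2 * pi * real (Suc n)))) \<longlonglongrightarrow> inverse (1 + 0)"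
    proof (intro tendsto_inverse tendsto_add tendsto_const)
      have "(\<lambda>n. exp (- 2 * pi) ^ Suc n) \<longlonglongrightarrow> 0"
        by (rule LIMSEQ_Suc[OF LIMSEQ_realpow_zero]) auto
      then show "(\<lambda>n. exp (- 2 * pi * real (Suc n))) \<longlonglongrightarrow> 0"
        by (simp add: exp_of_nat_mult[symmetric] mult_ac del: of_nat_Suc power_Suc)
    qed simp
    then have "(\<lambda>n. complex_of_real (inverse (1 + exp (- 2 * pi * real (Suc n))))) \<longlonglongrightarrow> of_real (inverse (1 + 0))"
      by (rule tendsto_of_real)
    ultimately show ?thesis by simp
  qed
  ultimately have "of_real c * of_real c = (1::complex)" by (rule LIMSEQ_unique)
  then have "c * c = 1" by (metis of_real_mult of_real_eq_1_iff)
  then have "c = 1" using c(1) by (simp add: square_eq_1_iff)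
  with c show ?thesis by simp
qed

theorem Lambda_sector_limit:
  assumes "0 \<le> \<kappa>" "\<kappa> < 1" "e > 0"
  obtains R where "R > 0" "\<And>w. w \<in> sector \<kappa> \<Longrightarrow> cmod w > R \<Longrightarrow> cmod (Lambda w \<eta> - 1) \<le> e"
  using Lambda_sector_limit_const[OF Stirling_constant assms, of \<eta>] by auto

section \<open>The field of meromorphic functions\<close>

lemma mero_cases:
  obtains f where "m = mero_of f" "mero_on mero_dom f"
proof -
  have "mero_eq (rep_mero m) (rep_mero m)" "mero_of (rep_mero m) = m"
    using Quotient3_mero by (auto simp: Quotient3_def)
  then show ?thesis using that mero_eqD(1) by metis
qed

lemma mero_of_eqI:
  assumes "mero_on mero_dom f" "mero_on mero_dom g" "nowhere_dense {p\<in>mero_dom. f p \<noteq> g p}"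
  shows "mero_of f = mero_of g"
  using Quotient3_rel[OF Quotient3_mero, of f g] assms by (auto simp: mero_eq_def)

lemma mero_of_eqD:
  assumes "mero_on mero_dom f" "mero_on mero_dom g" "mero_of f = mero_of g"
  shows "nowhere_dense {p\<in>mero_dom. f p \<noteq> g p}"
  using Quotient3_rel[OF Quotient3_mero, of f g] assms mero_eq_refl by (auto simp: mero_eq_def)

lemma mero_of_add: "mero_on mero_dom f \<Longrightarrow> mero_on mero_dom g \<Longrightarrow> mero_of f + mero_of g = mero_of (\<lambda>p. f p + g p)"
  by (rule plus_mero.abs_eq) (auto intro: mero_eq_refl)

lemma mero_of_mult: "mero_on mero_dom f \<Longrightarrow> mero_on mero_dom g \<Longrightarrow> mero_of f * mero_of g = mero_of (\<lambda>p. f p * g p)"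
  by (rule times_mero.abs_eq) (auto intro: mero_eq_refl)

lemma mero_of_inverse: "mero_on mero_dom f \<Longrightarrow> inverse (mero_of f) = mero_of (\<lambda>p. inverse (f p))"
  by (rule inverse_mero.abs_eq) (auto intro: mero_eq_refl)

lemma mero_of_shear: "mero_on mero_dom f \<Longrightarrow> mero_shear u v (mero_of f) = mero_of (\<lambda>p. f (shear u v p))"
  by (rule mero_shear.abs_eq) (auto intro: mero_eq_refl)

lemma mero_of_const: "mero_const c = mero_of (\<lambda>p. c)"
  by (simp add: mero_const.abs_eq)

lemma mero_of_zero: "0 = mero_of (\<lambda>p. 0)"
  by (simp add: zero_mero.abs_eq)

lemma mero_of_one: "1 = mero_of (\<lambda>p. 1)"
  by (simp add: one_mero.abs_eq)

lemma mero_of_nonzero: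
  assumes "mero_on mero_dom f" "nowhere_dense {p\<in>mero_dom. f p = 0}"
  shows "mero_of f \<noteq> 0"
proof
  assume "mero_of f = 0"
  then have "nowhere_dense {p\<in>mero_dom. f p \<noteq> 0}"
    unfolding mero_of_zero by (intro mero_of_eqD assms mero_on_const open_mero_dom)
  then have "nowhere_dense (mero_dom :: (complex \<times> 'a cdual) set)"
    by (rule nowhere_dense_subset[OF nowhere_dense_Un[OF assms(2)]]) auto
  then show False using mero_dom_not_nowhere_dense by blast
qed

lemma mero_on_prod:
  assumes "open S" "\<And>i. i \<in> A \<Longrightarrow> mero_on S (f i)"
  shows "mero_on S (\<lambda>p. \<Prod>i\<in>A. f i p)"
  using assms(2)
  by (induction A rule: infinite_finite_induct) (auto intro: mero_on_const mero_on_mult assms(1))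

lemma mero_on_power:
  assumes "open S" "mero_on S f" shows "mero_on S (\<lambda>p. f p ^ n)"
  by (induction n) (auto intro: mero_on_const mero_on_mult assms)

lemma mero_on_power_int:
  assumes "open S" "connected S" "mero_on S f" shows "mero_on S (\<lambda>p. f p powi k)"
proof (cases "k \<ge> 0")
  case True
  then show ?thesis using mero_on_power[OF assms(1,3)] by (simp add: power_int_def)
next
  case False
  have "mero_on S (\<lambda>p. inverse (f p) ^ nat (- k))" by (intro mero_on_power mero_on_inverse assms)
  then show ?thesis using False by (simp add: power_int_def)
qed

lemma mero_on_dom_inverse: "mero_on mero_dom f \<Longrightarrow> mero_on mero_dom (\<lambda>p. inverse (f p))"
  by (rule mero_on_inverse[OF _ open_mero_dom connected_mero_dom])

lemma mero_of_prod:
  assumes "\<And>i. i \<in> A \<Longrightarrow> mero_on mero_dom (f i)"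
  shows "mero_of (\<lambda>p. \<Prod>i\<in>A. f i p) = (\<Prod>i\<in>A. mero_of (f i))"
  using assms
proof (induction A rule: infinite_finite_induct)
  case (insert x F)
  then show ?case using mero_of_mult[of "f x" "\<lambda>p. \<Prod>i\<in>F. f i p"] mero_on_prod[OF open_mero_dom, of F f] by simp
qed (simp_all add: mero_of_one)

lemma mero_of_power:
  assumes "mero_on mero_dom f" shows "mero_of (\<lambda>p. f p ^ n) = mero_of f ^ n"
  by (induction n)
     (simp_all add: mero_of_one mero_of_mult[symmetric] assms mero_on_power open_mero_dom)

lemma mero_of_power_int:
  assumes "mero_on mero_dom f" shows "mero_of (\<lambda>p. f p powi k) = mero_of f powi k"
proof (cases "k \<ge> 0")
  case True
  then show ?thesis using mero_of_power[OF assms] by (simp add: power_int_def)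
next
  case False
  have "mero_of (\<lambda>p. inverse (f p) ^ nat (- k)) = inverse (mero_of f) ^ nat (- k)"
    using mero_of_power[OF mero_on_inverse[OF assms open_mero_dom connected_mero_dom]]
    by (simp add: mero_of_inverse assms)
  then show ?thesis using False by (simp add: power_int_def)
qed

section \<open>Translations as automorphisms of the field\<close>

lemma shear_shear: "shear u v (shear u' v' p) = shear (u + u') (v + v') p"
  by (simp add: shear_def scaleC_add_right algebra_simps)

lemma shear_zero: "shear 0 0 p = p"
  by (simp add: shear_def)

lemma mero_shear_add: "mero_shear u v (f + g) = mero_shear u v f + mero_shear u v g"
  by (cases f rule: mero_cases, cases g rule: mero_cases)
     (simp add: mero_of_add mero_of_shear mero_on_add mero_on_shear)

lemma mero_shear_mult: "mero_shear u v (f * g) = mero_shear u v f * mero_shear u v g"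
  by (cases f rule: mero_cases, cases g rule: mero_cases)
     (simp add: mero_of_mult mero_of_shear mero_on_mult mero_on_shear)

lemma mero_shear_inverse: "mero_shear u v (inverse f) = inverse (mero_shear u v f)"
  by (cases f rule: mero_cases)
     (simp add: mero_of_inverse mero_of_shear mero_on_dom_inverse mero_on_shear)

lemma mero_shear_const [simp]: "mero_shear u v (mero_const c) = mero_const c"
  by (simp add: mero_of_const mero_of_shear mero_on_const open_mero_dom)

lemma mero_shear_zero [simp]: "mero_shear u v 0 = 0"
  by (simp add: mero_of_zero mero_of_shear mero_on_const open_mero_dom)

lemma mero_shear_one [simp]: "mero_shear u v 1 = 1"
  by (simp add: mero_of_one mero_of_shear mero_on_const open_mero_dom)

lemma mero_shear_shear: "mero_shear u v (mero_shear u' v' f) = mero_shear (u + u') (v + v') f"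
  by (cases f rule: mero_cases) (simp add: mero_of_shear mero_on_shear shear_shear add.commute)

lemma mero_shear_id [simp]: "mero_shear 0 0 f = f"
  by (cases f rule: mero_cases) (simp add: mero_of_shear shear_zero)

lemma mero_shear_eq_0_iff [simp]: "mero_shear u v f = 0 \<longleftrightarrow> f = 0"
proof
  assume "mero_shear u v f = 0"
  then have "mero_shear (- u) (- v) (mero_shear u v f) = 0" by simp
  then show "f = 0" by (simp add: mero_shear_shear)
qed simp

lemma mero_shear_prod: "mero_shear u v (\<Prod>i\<in>A. f i) = (\<Prod>i\<in>A. mero_shear u v (f i))"
  by (induction A rule: infinite_finite_induct) (simp_all add: mero_shear_mult)

lemma mero_shear_sum: "mero_shear u v (\<Sum>i\<in>A. f i) = (\<Sum>i\<in>A. mero_shear u v (f i))"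
  by (induction A rule: infinite_finite_induct) (simp_all add: mero_shear_add)

lemma mero_shear_power: "mero_shear u v (f ^ n) = mero_shear u v f ^ n"
  by (induction n) (simp_all add: mero_shear_mult)

lemma mero_shear_power_int: "mero_shear u v (f powi k) = mero_shear u v f powi k"
  by (simp add: power_int_def mero_shear_power mero_shear_inverse)

lemma mero_const_mult: "mero_const (a * b) = mero_const a * mero_const b"
  by (simp add: mero_of_const mero_of_mult mero_on_const open_mero_dom)

lemma mero_const_1: "mero_const 1 = 1"
  by (simp add: mero_of_const mero_of_one)

lemma mero_const_eq_0_iff [simp]: "mero_const c = 0 \<longleftrightarrow> c = 0"
proof
  assume *: "mero_const c = (0 :: 'a mero)"
  show "c = 0"
  proof (rule ccontr)
    assume "c \<noteq> 0"
    then have "mero_const (c * inverse c) = (1 :: 'a mero)" by (simp add: mero_const_1)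
    with * show False by (simp add: mero_const_mult)
  qed
qed (simp add: mero_of_const mero_of_zero)

section \<open>Diagonal maps of the extended quantum torus\<close>

text \<open>All automorphisms in the theorem act on each graded piece by a translation of \<open>\<theta>\<close> followed by a
  multiplication; they are multiplicative iff the multipliers form a cocycle.\<close>

definition qdiag :: "('m \<Rightarrow> 'e::free_abelian_group mero) \<Rightarrow> 'e cdual \<Rightarrow> ('m \<Rightarrow>\<^sub>0 'e mero) \<Rightarrow> ('m \<Rightarrow>\<^sub>0 'e mero)"
  where "qdiag c u = Poly_Mapping.mapp (\<lambda>\<delta> f. c \<delta> * mero_shear u 0 f)"

lemma lookup_qdiag: "Poly_Mapping.lookup (qdiag c u a) \<delta> = c \<delta> * mero_shear u 0 (Poly_Mapping.lookup a \<delta>)"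
  by (simp add: qdiag_def lookup_mapp in_keys_iff when_def)

lemma qdiag_comp: "qdiag c u \<circ> qdiag c' u' = qdiag (\<lambda>\<delta>. c \<delta> * mero_shear u 0 (c' \<delta>)) (u + u')"
  by (rule ext, rule poly_mapping_eqI)
     (simp add: lookup_qdiag mero_shear_mult mero_shear_shear mult.assoc)

lemma qdiag_id: "qdiag (\<lambda>\<delta>. 1) 0 = id"
  by (rule ext, rule poly_mapping_eqI) (simp add: lookup_qdiag)

lemma qdiag_single: "qdiag c u (Poly_Mapping.single \<delta> f) = Poly_Mapping.single \<delta> (c \<delta> * mero_shear u 0 f)"
  by (rule poly_mapping_eqI) (auto simp: lookup_qdiag lookup_single when_def)

lemma qdiag_add: "qdiag c u (a + b) = qdiag c u a + qdiag c u b"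
  by (rule poly_mapping_eqI) (simp add: lookup_qdiag lookup_add mero_shear_add distrib_left)

lemma qdiag_inverse:
  assumes "\<And>\<delta>. c \<delta> \<noteq> 0"
  shows "qdiag (\<lambda>\<delta>. mero_shear (- u) 0 (inverse (c \<delta>))) (- u) \<circ> qdiag c u = id"
    "qdiag c u \<circ> qdiag (\<lambda>\<delta>. mero_shear (- u) 0 (inverse (c \<delta>))) (- u) = id"
  using assms
  by (simp_all add: qdiag_comp mero_shear_shear mero_shear_mult[symmetric] flip: qdiag_id)

lemma bij_qdiag: "(\<And>\<delta>. c \<delta> \<noteq> 0) \<Longrightarrow> bij (qdiag c u)"
  by (rule o_bij[OF qdiag_inverse])

lemma inv_qdiag:
  assumes "\<And>\<delta>. c \<delta> \<noteq> 0"
  shows "inv (qdiag c u) = qdiag (\<lambda>\<delta>. mero_shear (- u) 0 (inverse (c \<delta>))) (- u)"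
  using qdiag_inverse[OF assms] by (intro inv_unique_comp)

section \<open>The product of the quantum torus in coefficients\<close>

lemma poly_mapping_sum_singles:
  "a = (\<Sum>\<delta>\<in>Poly_Mapping.keys a. Poly_Mapping.single \<delta> (Poly_Mapping.lookup a \<delta>))"
  by (rule poly_mapping_eqI) (simp add: lookup_sum lookup_single when_def in_keys_iff)

lemma additive_sum_singles:
  fixes \<psi> :: "('m \<Rightarrow>\<^sub>0 'b::ab_group_add) \<Rightarrow> ('m \<Rightarrow>\<^sub>0 'b)"
  assumes "\<And>a b. \<psi> (a + b) = \<psi> a + \<psi> b"
  shows "\<psi> a = (\<Sum>\<delta>\<in>Poly_Mapping.keys a. \<psi> (Poly_Mapping.single \<delta> (Poly_Mapping.lookup a \<delta>)))"
proof -
  interpret additive \<psi> by (rule additive.intro) (rule assms)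
  show ?thesis by (subst (1) poly_mapping_sum_singles[of a]) (rule sum)
qed

text \<open>The sum may run over any finite set containing the support: a product and its image
  under a diagonal map are then summed over the same set, although the supports may differ.\<close>

lemma lookup_q_times:
  assumes "finite A" "Poly_Mapping.keys a \<subseteq> A"
  shows "Poly_Mapping.lookup (q_times form a b) \<gamma> =
    (\<Sum>\<delta>\<in>A. Poly_Mapping.lookup a \<delta> * mero_shear 0 (form_e form \<delta>) (Poly_Mapping.lookup b (\<gamma> - \<delta>)))"
proof -
  have "Poly_Mapping.lookup (q_times form a b) \<gamma> = (\<Sum>\<delta>\<in>Poly_Mapping.keys a. \<Sum>\<delta>'\<in>Poly_Mapping.keys b.
      if \<delta>' = \<gamma> - \<delta> then Poly_Mapping.lookup a \<delta> * mero_shear 0 (form_e form \<delta>) (Poly_Mapping.lookup b \<delta>') else 0)"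
    unfolding q_times_def lookup_sum lookup_single when_def
    by (intro sum.cong refl if_cong) (auto simp: algebra_simps)
  also have "\<dots> = (\<Sum>\<delta>\<in>Poly_Mapping.keys a. Poly_Mapping.lookup a \<delta> * mero_shear 0 (form_e form \<delta>) (Poly_Mapping.lookup b (\<gamma> - \<delta>)))"
    by (intro sum.cong refl) (auto simp: in_keys_iff sum.delta)
  also have "\<dots> = (\<Sum>\<delta>\<in>A. Poly_Mapping.lookup a \<delta> * mero_shear 0 (form_e form \<delta>) (Poly_Mapping.lookup b (\<gamma> - \<delta>)))"
    by (rule sum.mono_neutral_left) (use assms in \<open>auto simp: in_keys_iff\<close>)
  finally show ?thesis .
qed

lemma lookup_q_times_single:
  "Poly_Mapping.lookup (q_times form (Poly_Mapping.single \<delta> f) b) \<gamma> =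
    f * mero_shear 0 (form_e form \<delta>) (Poly_Mapping.lookup b (\<gamma> - \<delta>))"
  by (subst lookup_q_times[of "{\<delta>}"]) (auto simp: in_keys_iff lookup_single)

text \<open>The product translates the second factor by a multiple of \<tau>, hence also the
  multiplier of its degree; the cocycle condition absorbs precisely this translation.\<close>

lemma qdiag_q_times:
  assumes "\<And>\<delta> \<delta>'. c (\<delta> + \<delta>') = c \<delta> * mero_shear 0 (form_e form \<delta>) (c \<delta>')"
  shows "qdiag c u (q_times form a b) = q_times form (qdiag c u a) (qdiag c u b)"
proof (rule poly_mapping_eqI)
  fix \<gamma>
  have "c \<gamma> = c \<delta> * mero_shear 0 (form_e form \<delta>) (c (\<gamma> - \<delta>))" for \<delta>
    using assms[of \<delta> "\<gamma> - \<delta>"] by simp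
  then have *: "c \<gamma> * (mero_shear u 0 x * mero_shear u (form_e form \<delta>) y) =
      c \<delta> * mero_shear u 0 x * (mero_shear 0 (form_e form \<delta>) (c (\<gamma> - \<delta>)) * mero_shear u (form_e form \<delta>) y)" for x y \<delta>
    by (metis (no_types) mult.assoc mult.left_commute)
  have "Poly_Mapping.keys (qdiag c u a) \<subseteq> Poly_Mapping.keys a"
    unfolding qdiag_def by (rule keys_mapp_subset)
  then show "Poly_Mapping.lookup (qdiag c u (q_times form a b)) \<gamma> = Poly_Mapping.lookup (q_times form (qdiag c u a) (qdiag c u b)) \<gamma>"
    by (simp add: lookup_qdiag lookup_q_times[of "Poly_Mapping.keys a"] mero_shear_sum sum_distrib_left
        mero_shear_mult mero_shear_shear *)
qed

lemma q_aut_qdiag: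
  assumes "\<And>\<delta>. c \<delta> \<noteq> 0" "form_e form 0 = 0"
    and "\<And>\<delta> \<delta>'. c (\<delta> + \<delta>') = c \<delta> * mero_shear 0 (form_e form \<delta>) (c \<delta>')"
  shows "q_aut form (qdiag c u)"
proof -
  \<comment> \<open>The cocycle condition at (0, 0) makes the nonzero element \<open>c 0\<close>
    idempotent; hence the constants are fixed.\<close>
  have "c 0 = 1" using assms(3)[of 0 0] assms(1)[of 0] by (simp add: assms(2))
  then show ?thesis
    using assms by (simp add: q_aut_def bij_qdiag qdiag_add qdiag_q_times qdiag_single)
qed

section \<open>The automorphisms of the problem as diagonal maps\<close>

lemma inverse_mero_const_exp: "inverse (mero_const (exp z)) = mero_const (exp (- z))"
proof (rule inverse_unique)
  show "mero_const (exp z) * mero_const (exp (- z)) = 1"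
    by (simp add: mero_const_mult[symmetric] exp_minus_inverse mero_const_1)
qed

lemma eps_Z_qdiag:
  "eps_Z Z t = qdiag (\<lambda>\<delta>. mero_const (exp (Z (0, \<delta>) / t))) (scaleC (1 / (2 * of_real pi * \<i> * t)) (Z_e Z))"
proof (rule ext, rule poly_mapping_eqI)
  fix a \<gamma>
  show "Poly_Mapping.lookup (eps_Z Z t a) \<gamma> = Poly_Mapping.lookup (qdiag (\<lambda>\<delta>. mero_const (exp (Z (0, \<delta>) / t)))
      (scaleC (1 / (2 * of_real pi * \<i> * t)) (Z_e Z)) a) \<gamma>"
    unfolding eps_Z_def lookup_sum lookup_single lookup_qdiag when_def
    by (auto simp: in_keys_iff)
qed

lemma inv_eps_Z:
  "inv (eps_Z Z t) = qdiag (\<lambda>\<delta>. mero_const (exp (- Z (0, \<delta>) / t))) (- scaleC (1 / (2 * of_real pi * \<i> * t)) (Z_e Z))"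
  unfolding eps_Z_qdiag by (subst inv_qdiag) (simp_all add: inverse_mero_const_exp)

lemma single_q_times:
  assumes "form_e form 0 = 0"
  shows "q_times form (Poly_Mapping.single 0 f) (Poly_Mapping.single \<delta> 1) = Poly_Mapping.single \<delta> f"
  by (rule poly_mapping_eqI) (simp add: lookup_q_times_single assms lookup_single when_def del: single_one)

lemma q_inverse_single:
  assumes "form_e form 0 = 0" "g \<noteq> 0"
  shows "q_inverse form (Poly_Mapping.single 0 g) = Poly_Mapping.single 0 (inverse g)"
  unfolding q_inverse_def
proof (rule the_equality)
  show "q_times form (Poly_Mapping.single 0 g) (Poly_Mapping.single 0 (inverse g)) = q_one \<and>
    q_times form (Poly_Mapping.single 0 (inverse g)) (Poly_Mapping.single 0 g) = q_one"
    using assms(2) by (intro conjI poly_mapping_eqI)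
      (auto simp: lookup_q_times_single assms(1) lookup_single when_def q_one_def simp del: single_one)
next
  fix h assume "q_times form (Poly_Mapping.single 0 g) h = q_one \<and> q_times form h (Poly_Mapping.single 0 g) = q_one"
  then have "g * Poly_Mapping.lookup h \<delta> = (1 when 0 = \<delta>)" for \<delta>
    using lookup_q_times_single[of form 0 g h \<delta>] by (simp add: assms(1) q_one_def lookup_single del: single_one)
  then have "Poly_Mapping.lookup h \<delta> = (inverse g when 0 = \<delta>)" for \<delta>
    using assms(2) by (metis (no_types) inverse_unique mult_eq_0_iff when_def)
  then show "h = Poly_Mapping.single 0 (inverse g)"
    by (intro poly_mapping_eqI) (simp add: lookup_single)
qed

text \<open>An element of degree 0 preserves the grading under conjugation. Only its commutation
  with the generator of degree \<delta> matters, and the resulting multiplier is a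
  coboundary.\<close>

lemma q_Ad_single:
  assumes "form_e form 0 = 0" "g \<noteq> 0"
  shows "q_Ad form (Poly_Mapping.single 0 g) =
    qdiag (\<lambda>\<delta>. g * inverse (mero_shear 0 (form_e form \<delta>) g)) 0"
proof (rule ext, rule poly_mapping_eqI)
  fix a \<gamma>
  have l: "Poly_Mapping.lookup (q_times form (Poly_Mapping.single 0 g) a) \<delta> = g * Poly_Mapping.lookup a \<delta>" for \<delta>
    by (simp add: lookup_q_times_single assms(1))
  \<comment> \<open>\<gamma> is added to the support so that the sum with a single nonzero term is
    evaluated without a case distinction.\<close>
  define A where "A = insert \<gamma> (Poly_Mapping.keys (q_times form (Poly_Mapping.single 0 g) a))"
  have "Poly_Mapping.lookup (q_Ad form (Poly_Mapping.single 0 g) a) \<gamma> =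
      (\<Sum>\<delta>\<in>A. g * Poly_Mapping.lookup a \<delta> * mero_shear 0 (form_e form \<delta>) (inverse g when 0 = \<gamma> - \<delta>))"
    unfolding q_Ad_def q_inverse_single[OF assms]
    by (subst lookup_q_times[of A]) (auto simp: A_def l lookup_single)
  also have "\<dots> = (\<Sum>\<delta>\<in>A. if \<delta> = \<gamma> then g * Poly_Mapping.lookup a \<delta> * mero_shear 0 (form_e form \<delta>) (inverse g) else 0)"
    by (intro sum.cong) (auto simp: when_def)
  also have "\<dots> = g * Poly_Mapping.lookup a \<gamma> * mero_shear 0 (form_e form \<gamma>) (inverse g)"
    by (subst sum.delta) (auto simp: A_def)
  finally show "Poly_Mapping.lookup (q_Ad form (Poly_Mapping.single 0 g) a) \<gamma> =
      Poly_Mapping.lookup (qdiag (\<lambda>\<delta>. g * inverse (mero_shear 0 (form_e form \<delta>) g)) 0 a) \<gamma>"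
    by (simp add: lookup_qdiag mero_shear_inverse mult_ac)
qed

text \<open>The prescribed values determine \<psi>: f in degree \<delta> is the product of f in
  degree 0 with the generator of degree \<delta>, and \<psi> is multiplicative and additive.
  Conversely the cocycle condition makes the diagonal map an automorphism.\<close>

lemma is_Psi_iff:
  assumes "\<And>\<delta>. Psi_coeff form Z \<Omega> r t \<delta> \<noteq> 0" "form_e form 0 = 0"
    and "\<And>\<delta> \<delta>'. Psi_coeff form Z \<Omega> r t (\<delta> + \<delta>') =
      Psi_coeff form Z \<Omega> r t \<delta> * mero_shear 0 (form_e form \<delta>) (Psi_coeff form Z \<Omega> r t \<delta>')"
  shows "is_Psi form Z \<Omega> r t \<psi> \<longleftrightarrow> \<psi> = qdiag (Psi_coeff form Z \<Omega> r t) 0"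
proof
  assume \<psi>: "is_Psi form Z \<Omega> r t \<psi>"
  have single: "\<psi> (Poly_Mapping.single \<delta> f) = Poly_Mapping.single \<delta> (Psi_coeff form Z \<Omega> r t \<delta> * f)" for \<delta> f
  proof -
    have "\<psi> (Poly_Mapping.single \<delta> f) = \<psi> (q_times form (Poly_Mapping.single 0 f) (Poly_Mapping.single \<delta> 1))"
      by (simp add: single_q_times assms(2))
    also have "\<dots> = q_times form (\<psi> (Poly_Mapping.single 0 f)) (\<psi> (Poly_Mapping.single \<delta> 1))"
      using \<psi> unfolding is_Psi_def q_aut_def by blast
    also have "\<dots> = q_times form (Poly_Mapping.single 0 f) (Poly_Mapping.single \<delta> (Psi_coeff form Z \<Omega> r t \<delta>))"
      using \<psi> unfolding is_Psi_def by simp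
    also have "\<dots> = Poly_Mapping.single \<delta> (Psi_coeff form Z \<Omega> r t \<delta> * f)"
      by (rule poly_mapping_eqI) (auto simp: lookup_q_times_single assms(2) lookup_single when_def)
    finally show ?thesis .
  qed
  have add: "\<psi> (a + b) = \<psi> a + \<psi> b" for a b using \<psi> unfolding is_Psi_def q_aut_def by blast
  show "\<psi> = qdiag (Psi_coeff form Z \<Omega> r t) 0"
  proof (rule ext)
    fix a
    show "\<psi> a = qdiag (Psi_coeff form Z \<Omega> r t) 0 a"
      using additive_sum_singles[of \<psi> a, OF add] additive_sum_singles[of "qdiag (Psi_coeff form Z \<Omega> r t) 0" a, OF qdiag_add]
      by (simp add: single qdiag_single)
  qed
next
  have "Psi_coeff form Z \<Omega> r t 0 = 1" using assms(3)[of 0 0] assms(1)[of 0] by (simp add: assms(2))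
  moreover have "q_aut form (qdiag (Psi_coeff form Z \<Omega> r t) 0)" by (rule q_aut_qdiag[OF assms])
  moreover assume "\<psi> = qdiag (Psi_coeff form Z \<Omega> r t) 0"
  ultimately show "is_Psi form Z \<Omega> r t \<psi>" by (simp add: is_Psi_def qdiag_single)
qed

section \<open>Meromorphic families\<close>

lemma holo_on_linear:
  assumes "bounded_linear f" "\<And>c v. f (scaleC c v) = c * f v" "open S"
  shows "holo_on S f"
  unfolding holo_on_def using assms by (blast intro: bounded_linear_imp_has_derivative)

lemma holo_on_prod:
  assumes "open S" "\<And>i. i \<in> A \<Longrightarrow> holo_on S (f i)"
  shows "holo_on S (\<lambda>p. \<Prod>i\<in>A. f i p)"
  using assms(2)
  by (induction A rule: infinite_finite_induct) (auto intro: holo_on_const holo_on_mult assms(1))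

lemma holo_on_power: "holo_on S f \<Longrightarrow> holo_on S (\<lambda>p. f p ^ n)"
  by (induction n) (auto intro: holo_on_const holo_on_mult holo_on_open)

lemma holo_on_power_int:
  assumes "holo_on S f" "\<And>x. x \<in> S \<Longrightarrow> f x \<noteq> 0"
  shows "holo_on S (\<lambda>p. f p powi k)"
  by (cases "k \<ge> 0") (auto simp: power_int_def intro!: holo_on_power holo_on_inverse assms)

lemma holo_on_mero_on:
  assumes "holo_on S f" shows "mero_on S f"
proof (rule mero_onI)
  fix p assume "p \<in> S"
  then show "\<exists>U g h. p \<in> U \<and> U \<subseteq> S \<and> holo_on U g \<and> holo_on U h \<and>
    nowhere_dense {x\<in>U. h x = 0} \<and> (\<forall>x\<in>U. h x \<noteq> 0 \<longrightarrow> f x = g x / h x)"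
    using assms by (intro exI[of _ S] exI[of _ f] exI[of _ "\<lambda>x. 1"]) (auto intro: holo_on_const holo_on_open)
qed

lemma extends_at_mult_holo:
  assumes "extends_at f p c" "holo_on U k" "p \<in> U"
  shows "extends_at (\<lambda>x. f x * k x) p (c * k p)"
proof -
  obtain V g where V: "p \<in> V" "holo_on V g" "nowhere_dense {x\<in>V. f x \<noteq> g x}" "g p = c"
    using assms(1) unfolding extends_at_def by blast
  have o: "open (U \<inter> V)" using holo_on_open assms V by blast
  have "holo_on (U \<inter> V) (\<lambda>x. g x * k x)"
    by (intro holo_on_mult holo_on_subset[OF V(2) o] holo_on_subset[OF assms(2) o]) auto
  moreover have "nowhere_dense {x\<in>U \<inter> V. f x * k x \<noteq> g x * k x}"
    by (rule nowhere_dense_subset[OF V(3)]) auto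
  ultimately show ?thesis
    using V assms(3) unfolding extends_at_def by (intro exI[of _ "U \<inter> V"] exI[of _ "\<lambda>x. g x * k x"]) auto
qed

lemma extends_at_transform:
  assumes "extends_at f p c" "open U" "p \<in> U" "\<And>x. x \<in> U \<Longrightarrow> f x = g x"
  shows "extends_at g p c"
  proof (rule extends_at_cong[OF _ assms(2,3,1)])
  have "{x\<in>U. f x \<noteq> g x} = {}" using assms(4) by blast
  then show "nowhere_dense {x\<in>U. f x \<noteq> g x}" by (simp only: nowhere_dense_empty)
qed

lemma extends_at_shear:
  assumes "extends_at f (shear u v p) c"
  shows "extends_at (\<lambda>p. f (shear u v p)) p c"
proof -
  obtain V g where V: "shear u v p \<in> V" "holo_on V g" "nowhere_dense {x\<in>V. f x \<noteq> g x}" "g (shear u v p) = c"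
    using assms unfolding extends_at_def by blast
  have "nowhere_dense {x \<in> shear u v -` V. f (shear u v x) \<noteq> g (shear u v x)}"
    by (rule nowhere_dense_subset[OF nowhere_dense_shear[OF V(3)]]) auto
  then show ?thesis
    unfolding extends_at_def using V holo_on_shear[OF V(2), of u v]
    by (intro exI[of _ "shear u v -` V"] exI[of _ "\<lambda>p. g (shear u v p)"]) auto
qed

lemma extends_at_shear_iff:
  "extends_at (\<lambda>p. f (shear u v p)) p c \<longleftrightarrow> extends_at f (shear u v p) c"
proof
  assume "extends_at (\<lambda>p. f (shear u v p)) p c"
  then have "extends_at (\<lambda>p. f (shear u v p)) (shear (- u) (- v) (shear u v p)) c"
    by (simp add: shear_inverse)
  from extends_at_shear[OF this] show "extends_at f (shear u v p) c"
    by (simp add: shear_inverse)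
qed (rule extends_at_shear)

section \<open>Families over a domain of t and their slices\<close>

abbreviation fam_dom :: "complex set \<Rightarrow> (complex \<times> 'e::free_abelian_group cdual \<times> complex) set"
  where "fam_dom D \<equiv> upper_half_plane \<times> UNIV \<times> D"

definition slice_map :: "complex \<Rightarrow> complex \<times> 'e \<Rightarrow> complex \<times> 'e \<times> complex"
  where "slice_map t p = (fst p, snd p, t)"

lemma slice_map_pair [simp]: "slice_map t (\<tau>, \<theta>) = (\<tau>, \<theta>, t)"
  by (simp add: slice_map_def)

lemma continuous_slice_map: "continuous_on UNIV (slice_map t :: _ \<Rightarrow> complex \<times> 'e::topological_space \<times> complex)"
  unfolding slice_map_def by (intro continuous_intros)

lemma holo_on_slice:
  fixes g :: "complex \<times> 'e::complex_normed_space \<times> complex \<Rightarrow> complex"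
  assumes "holo_on U g" shows "holo_on (slice_map t -` U) (\<lambda>p. g (slice_map t p))"
proof (rule holo_on_comp[OF assms])
  show "open (slice_map t -` U)"
    by (rule open_vimage[OF holo_on_open[OF assms] continuous_slice_map])
  fix p :: "complex \<times> 'e"
  have "(slice_map t has_derivative (\<lambda>d. (fst d, snd d, 0))) (at p)"
    unfolding slice_map_def by (auto intro!: derivative_eq_intros)
  then show "\<exists>D. (slice_map t has_derivative D) (at p) \<and> (\<forall>c v. D (scaleC c v) = scaleC c (D v))"
    by (intro exI[of _ "\<lambda>d. (fst d, snd d, 0)"]) (simp add: scaleC_prod_def)
qed simp

text \<open>The denominators are required not to vanish identically on any slice \<open>t = const\<close>, so that
  such families can be restricted to slices.\<close>

definition fam :: "complex set \<Rightarrow> (complex \<times> 'e::free_abelian_group cdual \<times> complex \<Rightarrow> complex) \<Rightarrow> bool"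
  where "fam D F \<longleftrightarrow> (\<forall>p\<in>fam_dom D. \<exists>U g h. p \<in> U \<and> U \<subseteq> fam_dom D \<and> quotient_on U F g h \<and>
    (\<forall>t. nowhere_dense {x \<in> slice_map t -` U. h (slice_map t x) = 0}))"

lemma famE:
  fixes F :: "complex \<times> 'e::free_abelian_group cdual \<times> complex \<Rightarrow> complex"
  assumes "fam D F" "p \<in> fam_dom D"
  obtains U g h where "p \<in> U" "U \<subseteq> fam_dom D" "quotient_on U F g h"
    "\<And>t. nowhere_dense {x \<in> slice_map t -` U. h (slice_map t x) = 0}"
  using assms(1)[unfolded fam_def, rule_format, OF assms(2)] by (elim exE conjE) (rule that, auto)

lemma fam_mero_on: "fam D F \<Longrightarrow> mero_on (fam_dom D) F"
  by (rule mero_onI) (erule (1) famE, unfold quotient_on_def, blast)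

lemma fam_mult:
  fixes F F' :: "complex \<times> 'e::free_abelian_group cdual \<times> complex \<Rightarrow> complex"
  assumes "fam D F" "fam D F'" shows "fam D (\<lambda>p. F p * F' p)"
  unfolding fam_def
proof
  fix p :: "complex \<times> 'e cdual \<times> complex" assume p: "p \<in> fam_dom D"
  obtain U g h where U: "p \<in> U" "U \<subseteq> fam_dom D" "quotient_on U F g h"
    "\<And>t. nowhere_dense {x \<in> slice_map t -` U. h (slice_map t x) = 0}"
    by (rule famE[OF assms(1) p]) (rule that)
  obtain U' g' h' where U': "p \<in> U'" "U' \<subseteq> fam_dom D" "quotient_on U' F' g' h'"
    "\<And>t. nowhere_dense {x \<in> slice_map t -` U'. h' (slice_map t x) = 0}"
    by (rule famE[OF assms(2) p]) (rule that)
  define W where "W = U \<inter> U'"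
  have o: "open W" using U(3) U'(3) holo_on_open unfolding quotient_on_def W_def by blast
  have q: "quotient_on W F g h" "quotient_on W F' g' h'"
    using quotient_on_subset[OF U(3) o] quotient_on_subset[OF U'(3) o] by (auto simp: W_def)
  have "nowhere_dense {x\<in>W. h x * h' x = 0}"
    by (rule nowhere_dense_subset[OF nowhere_dense_Un[of "{x\<in>W. h x = 0}" "{x\<in>W. h' x = 0}"]])
       (use q in \<open>auto simp: quotient_on_def\<close>)
  then have "quotient_on W (\<lambda>p. F p * F' p) (\<lambda>p. g p * g' p) (\<lambda>p. h p * h' p)"
    using q by (auto simp: quotient_on_def intro: holo_on_mult)
  moreover have "nowhere_dense {x \<in> slice_map t -` W. h (slice_map t x) * h' (slice_map t x) = 0}" for t
    by (rule nowhere_dense_subset[OF nowhere_dense_Un[OF U(4) U'(4)]]) (auto simp: W_def)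
  ultimately show "\<exists>U g h. p \<in> U \<and> U \<subseteq> fam_dom D \<and> quotient_on U (\<lambda>p. F p * F' p) g h \<and>
    (\<forall>t. nowhere_dense {x \<in> slice_map t -` U. h (slice_map t x) = 0})"
    using U U' by (intro exI[of _ W] exI[of _ "\<lambda>p. g p * g' p"] exI[of _ "\<lambda>p. h p * h' p"]) (auto simp: W_def)
qed

lemma fam_holo:
  assumes "holo_on (fam_dom D) F" shows "fam D F"
  unfolding fam_def quotient_on_def
  by (intro ballI exI[of _ "fam_dom D"] exI[of _ F] exI[of _ "\<lambda>p. 1"])
     (use assms in \<open>auto intro: holo_on_const holo_on_open\<close>)

text \<open>On a slice of fixed t this is a shear, hence a homeomorphism. For c(t) = -1 / (2 \<pi>
  \<i> t) and v = \<open>Z_e Z\<close> it is the translation in the inverse of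
  \<open>eps_Z Z t\<close>.\<close>

definition shift_map :: "(complex \<Rightarrow> complex) \<Rightarrow> 'e::free_abelian_group cdual \<Rightarrow> complex \<times> 'e cdual \<times> complex \<Rightarrow> complex \<times> 'e cdual"
  where "shift_map c v p = (fst p, fst (snd p) + scaleC (c (snd (snd p))) v)"

lemma shift_map_slice: "shift_map c v (slice_map t p) = shear (scaleC (c t) v) 0 p"
  by (simp add: shift_map_def slice_map_def shear_def)

lemma shift_map_has_derivative:
  assumes "open D" "c holomorphic_on D" "snd (snd p) \<in> D"
  shows "\<exists>L. (shift_map c v has_derivative L) (at p) \<and> (\<forall>a w. L (scaleC a w) = scaleC a (L w))"
proof -
  obtain c' where c': "(c has_field_derivative c') (at (snd (snd p)))"
    using assms by (meson holomorphic_on_imp_differentiable_at field_differentiable_def)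
  have 1: "((\<lambda>p. c (snd (snd p))) has_derivative (\<lambda>d. c' * snd (snd d))) (at p)"
    by (rule has_derivative_compose[of "\<lambda>p. snd (snd p)" "\<lambda>d. snd (snd d)" p UNIV c "\<lambda>x. c' * x"])
       (use c' in \<open>auto simp: has_field_derivative_def intro!: derivative_eq_intros\<close>)
  have "((\<lambda>p. scaleC (c (snd (snd p))) v) has_derivative (\<lambda>d. scaleC (c' * snd (snd d)) v)) (at p)"
    by (rule bounded_linear.has_derivative[OF bounded_linear_scaleC_left 1])
  then have "((\<lambda>p. fst (snd p) + scaleC (c (snd (snd p))) v) has_derivative
      (\<lambda>d. fst (snd d) + scaleC (c' * snd (snd d)) v)) (at p)"
    by (auto intro!: derivative_eq_intros)
  then have "(shift_map c v has_derivative (\<lambda>d. (fst d, fst (snd d) + scaleC (c' * snd (snd d)) v))) (at p)"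
    unfolding shift_map_def by (intro has_derivative_Pair) (auto intro!: derivative_eq_intros)
  then show ?thesis
    by (intro exI conjI, assumption)
       (simp add: scaleC_prod_def scaleC_complex_def scaleC_add_right scaleC_scaleC mult_ac)
qed

lemma shift_map_continuous:
  assumes "open D" "c holomorphic_on D" shows "continuous_on (fam_dom D) (shift_map c v)"
  by (rule continuous_at_imp_continuous_on)
     (use shift_map_has_derivative[OF assms] has_derivative_continuous in fastforce)

lemma open_fam_dom: "open D \<Longrightarrow> open (fam_dom D)"
  unfolding upper_half_plane_def by (intro open_Times open_halfspace_Im_gt open_UNIV)

lemma shift_map_open_preimage:
  assumes "open D" "c holomorphic_on D" "open U"
  shows "open (fam_dom D \<inter> shift_map c v -` U)"
  by (intro continuous_open_preimage shift_map_continuous assms open_fam_dom)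

lemma holo_on_shift:
  assumes "open D" "c holomorphic_on D" "holo_on U g"
  shows "holo_on (fam_dom D \<inter> shift_map c v -` U) (\<lambda>p. g (shift_map c v p))"
  by (rule holo_on_comp[OF assms(3)])
     (use shift_map_has_derivative[OF assms(1,2)] shift_map_open_preimage[OF assms(1,2) holo_on_open[OF assms(3)]] in auto)

text \<open>On slices the zeros of h are pulled back by a shear and stay nowhere dense. Nowhere
  density in all variables follows: otherwise the pulled back h would vanish on a ball, hence on an
  open part of the slice through its centre.\<close>

lemma quotient_on_shift:
  fixes f :: "complex \<times> 'e::free_abelian_group cdual \<Rightarrow> complex"
  assumes D: "open D" "c holomorphic_on D" and q: "quotient_on (ball p r) f g h" and r: "r > 0"
    and W: "open W" "W \<subseteq> fam_dom D \<inter> shift_map c v -` ball p r"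
  shows "quotient_on W (\<lambda>p. f (shift_map c v p)) (\<lambda>p. g (shift_map c v p)) (\<lambda>p. h (shift_map c v p))"
    "nowhere_dense {x \<in> slice_map t -` W. h (shift_map c v (slice_map t x)) = 0}"
proof -
  have hol: "holo_on (ball p r) g" "holo_on (ball p r) h" and nd: "nowhere_dense {x\<in>ball p r. h x = 0}"
    using q by (auto simp: quotient_on_def)
  have slice: "nowhere_dense {x \<in> slice_map t -` W. h (shift_map c v (slice_map t x)) = 0}" for t
    unfolding shift_map_slice
    by (rule nowhere_dense_subset[OF nowhere_dense_shear[OF nd, of "scaleC (c t) v" 0]])
       (use W(2) in \<open>auto simp: shift_map_slice[symmetric]\<close>)
  then show "nowhere_dense {x \<in> slice_map t -` W. h (shift_map c v (slice_map t x)) = 0}" .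
  have hW: "holo_on W (\<lambda>p. g (shift_map c v p))" "holo_on W (\<lambda>p. h (shift_map c v p))"
    using holo_on_shift[OF D hol(1), of v] holo_on_shift[OF D hol(2), of v] W holo_on_subset by blast+
  have "nowhere_dense {x\<in>W. h (shift_map c v x) = 0}"
  proof (rule nowhere_dense_local)
    fix y assume "y \<in> {x\<in>W. h (shift_map c v x) = 0}"
    then obtain e where e: "e > 0" "ball y e \<subseteq> W" using W(1) open_contains_ball by blast
    have hb: "holo_on (ball y e) (\<lambda>p. h (shift_map c v p))" by (rule holo_on_subset[OF hW(2)]) (use e in auto)
    have "\<not> (\<forall>x\<in>ball y e. h (shift_map c v x) = 0)"
    proof
      assume z: "\<forall>x\<in>ball y e. h (shift_map c v x) = 0"
      have "open (slice_map (snd (snd y)) -` ball y e)" by (rule open_vimage[OF open_ball continuous_slice_map])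
      then have "slice_map (snd (snd y)) -` ball y e = {}"
        by (rule nowhere_dense_open[OF slice[of "snd (snd y)"]]) (use e z in auto)
      moreover have "(fst y, fst (snd y)) \<in> slice_map (snd (snd y)) -` ball y e" using e(1) by simp
      ultimately show False by blast
    qed
    then have "nowhere_dense {x\<in>ball y e. h (shift_map c v x) = 0}"
      using holo_on_ball_dichotomy[OF hb convex_ball] by blast
    moreover have "{x\<in>W. h (shift_map c v x) = 0} \<inter> ball y e = {x\<in>ball y e. h (shift_map c v x) = 0}"
      using e by auto
    ultimately show "\<exists>U. open U \<and> y \<in> U \<and> nowhere_dense ({x\<in>W. h (shift_map c v x) = 0} \<inter> U)"
      using e(1) by (intro exI[of _ "ball y e"]) auto
  qed
  then show "quotient_on W (\<lambda>p. f (shift_map c v p)) (\<lambda>p. g (shift_map c v p)) (\<lambda>p. h (shift_map c v p))"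
    using q hW W(2) by (auto simp: quotient_on_def)
qed

lemma fam_shift:
  fixes f :: "complex \<times> 'e::free_abelian_group cdual \<Rightarrow> complex"
  assumes D: "open D" "c holomorphic_on D" and f: "mero_on mero_dom f"
  shows "fam D (\<lambda>p. f (shift_map c v p))"
  unfolding fam_def
proof
  fix p :: "complex \<times> 'e cdual \<times> complex" assume p: "p \<in> fam_dom D"
  then have "shift_map c v p \<in> mero_dom" by (auto simp: shift_map_def)
  then obtain r g h where r: "r > 0" "ball (shift_map c v p) r \<subseteq> mero_dom" "quotient_on (ball (shift_map c v p) r) f g h"
    by (rule mero_on_quotientE[OF f])
  define W where "W = fam_dom D \<inter> shift_map c v -` ball (shift_map c v p) r"
  have "open W" unfolding W_def by (rule shift_map_open_preimage[OF D open_ball])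
  moreover have "p \<in> W" using p r(1) by (simp add: W_def)
  ultimately have W: "open W" "p \<in> W" by blast+
  from quotient_on_shift[OF D r(3,1) W(1)] W
  show "\<exists>U g h. p \<in> U \<and> U \<subseteq> fam_dom D \<and> quotient_on U (\<lambda>p. f (shift_map c v p)) g h \<and>
    (\<forall>t. nowhere_dense {x \<in> slice_map t -` U. h (slice_map t x) = 0})"
    by (intro exI[of _ W] exI[of _ "\<lambda>p. g (shift_map c v p)"] exI[of _ "\<lambda>p. h (shift_map c v p)"]) (auto simp: W_def)
qed

lemma extends_at_shift:
  fixes f :: "complex \<times> 'e::free_abelian_group cdual \<Rightarrow> complex"
  assumes D: "open D" "c holomorphic_on D" and f: "mero_on mero_dom f"
    and p: "p \<in> fam_dom D" and e: "extends_at f (shift_map c v p) b"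
  shows "extends_at (\<lambda>p. f (shift_map c v p)) p b"
proof -
  have dom: "shift_map c v p \<in> mero_dom" using p by (auto simp: shift_map_def)
  obtain r g h where r: "r > 0" "ball (shift_map c v p) r \<subseteq> mero_dom" "quotient_on (ball (shift_map c v p) r) f g h"
    by (rule mero_on_quotientE[OF f dom])
  have "shift_map c v p \<in> ball (shift_map c v p) r" using r(1) by simp
  then obtain r' k where k: "r' > 0" "ball (shift_map c v p) r' \<subseteq> ball (shift_map c v p) r"
    "holo_on (ball (shift_map c v p) r') k" "k (shift_map c v p) = b"
    "\<And>x. x \<in> ball (shift_map c v p) r' \<Longrightarrow> k x * h x = g x"
    by (rule extends_at_quotientE[OF r(3) _ e]) (rule that, assumption+)
  define W where "W = fam_dom D \<inter> shift_map c v -` ball (shift_map c v p) r'"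
  have "open W" unfolding W_def by (rule shift_map_open_preimage[OF D open_ball])
  moreover have "p \<in> W" using p k(1) by (simp add: W_def)
  moreover have "W \<subseteq> fam_dom D \<inter> shift_map c v -` ball (shift_map c v p) r" using k(2) by (auto simp: W_def)
  ultimately have W: "open W" "p \<in> W" "W \<subseteq> fam_dom D \<inter> shift_map c v -` ball (shift_map c v p) r" by blast+
  have "extends_at (\<lambda>p. f (shift_map c v p)) p (k (shift_map c v p))"
    by (rule extends_at_quotientI[OF quotient_on_shift(1)[OF D r(3,1) W(1,3)] _ W(2) order_refl, of "\<lambda>x. k (shift_map c v x)"])
       (use holo_on_shift[OF D k(3), of v] k(5) in \<open>auto simp: W_def\<close>)
  then show ?thesis by (simp add: k(4))
qed

text \<open>The denominator does not vanish identically near any point of the slice, so it remains a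
  denominator after restriction, and a point where it is nonzero is regular. For the last claim the
  identity k h = g is restricted to the slice.\<close>

lemma fam_slice:
  fixes F :: "complex \<times> 'e::free_abelian_group cdual \<times> complex \<Rightarrow> complex"
  assumes F: "fam D F" and t: "t \<in> D"
  shows "mero_on mero_dom (\<lambda>p. F (slice_map t p))"
    and "\<exists>\<tau>\<in>upper_half_plane. \<exists>\<theta>. regular_at F (\<tau>, \<theta>, t)"
    and "extends_at F (slice_map t p) c \<Longrightarrow> p \<in> mero_dom \<Longrightarrow> extends_at (\<lambda>p. F (slice_map t p)) p c"
proof -
  have loc: "\<exists>U g h. slice_map t p \<in> U \<and> quotient_on U F g h \<and>
      quotient_on (slice_map t -` U) (\<lambda>p. F (slice_map t p)) (\<lambda>p. g (slice_map t p)) (\<lambda>p. h (slice_map t p)) \<and>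
      slice_map t -` U \<subseteq> mero_dom"
    if p: "p \<in> mero_dom" for p
  proof -
    have sp: "slice_map t p \<in> fam_dom D" using p t by (auto simp: slice_map_def)
    obtain U g h where U: "slice_map t p \<in> U" "U \<subseteq> fam_dom D" "quotient_on U F g h"
      "\<And>s. nowhere_dense {x \<in> slice_map s -` U. h (slice_map s x) = 0}"
      by (rule famE[OF F sp]) (rule that)
    have "quotient_on (slice_map t -` U) (\<lambda>p. F (slice_map t p)) (\<lambda>p. g (slice_map t p)) (\<lambda>p. h (slice_map t p))"
      using U(3,4) holo_on_slice[of U g t] holo_on_slice[of U h t] unfolding quotient_on_def by blast
    moreover have "slice_map t -` U \<subseteq> mero_dom" using U(2) by (auto simp: slice_map_def)
    ultimately show ?thesis using U by blast
  qed
  show "mero_on mero_dom (\<lambda>p. F (slice_map t p))"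
  proof (rule mero_onI)
    fix p :: "complex \<times> 'e cdual" assume "p \<in> mero_dom"
    from loc[OF this] obtain U g h where "slice_map t p \<in> U"
      "quotient_on (slice_map t -` U) (\<lambda>p. F (slice_map t p)) (\<lambda>p. g (slice_map t p)) (\<lambda>p. h (slice_map t p))"
      "slice_map t -` U \<subseteq> mero_dom" by blast
    then show "\<exists>U g h. p \<in> U \<and> U \<subseteq> mero_dom \<and> holo_on U g \<and> holo_on U h \<and>
      nowhere_dense {x\<in>U. h x = 0} \<and> (\<forall>x\<in>U. h x \<noteq> 0 \<longrightarrow> F (slice_map t x) = g x / h x)"
      unfolding quotient_on_def
      by (intro exI[of _ "slice_map t -` U"] exI[of _ "\<lambda>p. g (slice_map t p)"] exI[of _ "\<lambda>p. h (slice_map t p)"]) simp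
  qed
  show "\<exists>\<tau>\<in>upper_half_plane. \<exists>\<theta>. regular_at F (\<tau>, \<theta>, t)"
  proof -
    have "(\<i>, 0 :: 'e cdual) \<in> mero_dom" by (simp add: upper_half_plane_def)
    from loc[OF this] obtain U g h where U: "slice_map t (\<i>, 0 :: 'e cdual) \<in> U" "quotient_on U F g h"
      "quotient_on (slice_map t -` U) (\<lambda>p. F (slice_map t p)) (\<lambda>p. g (slice_map t p)) (\<lambda>p. h (slice_map t p))"
      "slice_map t -` U \<subseteq> mero_dom" by blast
    have "\<exists>x \<in> slice_map t -` U. h (slice_map t x) \<noteq> 0"
    proof (rule ccontr)
      assume "\<not> (\<exists>x \<in> slice_map t -` U. h (slice_map t x) \<noteq> 0)"
      then have "slice_map t -` U = {}"
        using U(3) holo_on_open unfolding quotient_on_def by (intro nowhere_dense_open[of "{x \<in> slice_map t -` U. h (slice_map t x) = 0}"]) auto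
      then show False using U(1) by (metis empty_iff vimageI)
    qed
    then obtain x where x: "x \<in> slice_map t -` U" "h (slice_map t x) \<noteq> 0" by blast
    then have "regular_at F (slice_map t x)"
      using extends_at_quotient_nonzero[OF U(2)] regular_atI by blast
    moreover have "x \<in> mero_dom" using x U(4) by blast
    ultimately show ?thesis by (cases x) auto
  qed
  show "extends_at (\<lambda>p. F (slice_map t p)) p c" if e: "extends_at F (slice_map t p) c" and p: "p \<in> mero_dom"
  proof -
    from loc[OF p] obtain U g h where U: "slice_map t p \<in> U" "quotient_on U F g h"
      "quotient_on (slice_map t -` U) (\<lambda>p. F (slice_map t p)) (\<lambda>p. g (slice_map t p)) (\<lambda>p. h (slice_map t p))" by blast
    obtain r k where k: "r > 0" "ball (slice_map t p) r \<subseteq> U" "holo_on (ball (slice_map t p) r) k" "k (slice_map t p) = c"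
      "\<And>x. x \<in> ball (slice_map t p) r \<Longrightarrow> k x * h x = g x"
      by (rule extends_at_quotientE[OF U(2,1) e]) (rule that, assumption+)
    have "extends_at (\<lambda>p. F (slice_map t p)) p (k (slice_map t p))"
      by (rule extends_at_quotientI[OF U(3) holo_on_slice[OF k(3)]]) (use k in auto)
    then show ?thesis by (simp add: k(4))
  qed
qed

lemma mero_regular_of: "mero_on mero_dom f \<Longrightarrow> mero_regular (mero_of f) p \<longleftrightarrow> p \<in> mero_dom \<and> regular_at f p"
  by (simp add: mero_regular.abs_eq mero_eq_refl)

lemma mero_val_of: "mero_on mero_dom f \<Longrightarrow> mero_val (mero_of f) p = (if p \<in> mero_dom then value_at f p else 0)"
  by (simp add: mero_val.abs_eq mero_eq_refl)

text \<open>Reduces a coefficient family to an equality in the field of meromorphic functions for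
  each t; values at regular points are then compared by \<open>fam_slice\<close>.\<close>

lemma coeff_familyI:
  fixes F :: "'m \<Rightarrow> complex \<times> 'e::free_abelian_group cdual \<times> complex \<Rightarrow> complex"
  assumes "finite {\<delta>. F \<delta> \<noteq> (\<lambda>_. 0)}" "\<And>\<delta>. fam D (F \<delta>)"
    and "\<And>t \<delta>. t \<in> D \<Longrightarrow> Poly_Mapping.lookup (f t) \<delta> = mero_of (\<lambda>p. F \<delta> (slice_map t p))"
  shows "coeff_family D f F"
  unfolding coeff_family_def
proof (intro conjI allI ballI impI)
  fix t \<delta> assume t: "t \<in> D"
  show "\<exists>\<tau>\<in>upper_half_plane. \<exists>\<theta>. regular_at (F \<delta>) (\<tau>, \<theta>, t)" by (rule fam_slice(2)[OF assms(2) t])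
  fix \<tau> \<theta> assume \<tau>: "\<tau> \<in> upper_half_plane" and reg: "regular_at (F \<delta>) (\<tau>, \<theta>, t)"
  have m: "mero_on mero_dom (\<lambda>p. F \<delta> (slice_map t p))" by (rule fam_slice(1)[OF assms(2) t])
  have "extends_at (\<lambda>p. F \<delta> (slice_map t p)) (\<tau>, \<theta>) (value_at (F \<delta>) (\<tau>, \<theta>, t))"
    by (rule fam_slice(3)[OF assms(2) t]) (use extends_at_value[OF reg] \<tau> in simp_all)
  then show "mero_regular (Poly_Mapping.lookup (f t) \<delta>) (\<tau>, \<theta>)"
    "mero_val (Poly_Mapping.lookup (f t) \<delta>) (\<tau>, \<theta>) = value_at (F \<delta>) (\<tau>, \<theta>, t)"
    using \<tau> unfolding assms(3)[OF t] mero_regular_of[OF m] mero_val_of[OF m] by (auto intro: regular_atI value_atI)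
next
  show "mero_on (fam_dom D) (F \<delta>)" for \<delta> by (rule fam_mero_on[OF assms(2)])
qed (fact assms(1))

section \<open>Signed products over \<open>\<kappa>(\<beta>, \<gamma>)\<close>\<close>

definition odd_range :: "int \<Rightarrow> int set"
  where "odd_range m = (\<lambda>j. sgn m * (2 * j + 1)) ` {0..<\<bar>m\<bar>}"

text \<open>A discrete integral of G: thanks to the sign in the exponent, S(m + 1) = S(m) G(2 m + 1)
  holds for all integers m if G has no zeros, and with S(0) = 1 it determines S. The cocycle
  property and the telescoping of \<open>E_q\<close> rest on this uniqueness.\<close>

definition sigprod :: "(int \<Rightarrow> 'a::field) \<Rightarrow> int \<Rightarrow> 'a"
  where "sigprod G m = (\<Prod>\<nu>\<in>odd_range m. G \<nu>) powi sgn m"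

lemma kappa_odd_range: "kappa form \<beta> \<gamma> = odd_range (form \<beta> \<gamma>)"
  by (simp add: kappa_def odd_range_def)

lemma finite_odd_range [simp]: "finite (odd_range m)"
  by (simp add: odd_range_def)

lemma odd_range_Suc:
  assumes "m \<ge> 0" shows "odd_range (m + 1) = insert (2 * m + 1) (odd_range m)" "2 * m + 1 \<notin> odd_range m"
proof -
  have "{0..<m + 1} = insert m {0..<m}" using assms by auto
  then show "odd_range (m + 1) = insert (2 * m + 1) (odd_range m)"
    using assms by (cases "m = 0") (auto simp: odd_range_def)
qed (use assms in \<open>auto simp: odd_range_def sgn_if\<close>)

lemma odd_range_pred:
  assumes "m < 0" shows "odd_range m = insert (2 * m + 1) (odd_range (m + 1))" "2 * m + 1 \<notin> odd_range (m + 1)"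
proof -
  have "{0..<- m} = insert (- m - 1) {0..<- (m + 1)}" using assms by auto
  then show "odd_range m = insert (2 * m + 1) (odd_range (m + 1))"
    using assms by (cases "m = -1") (auto simp: odd_range_def)
qed (use assms in \<open>auto simp: odd_range_def sgn_if\<close>)

lemma sigprod_0 [simp]: "sigprod G 0 = 1"
  by (simp add: sigprod_def)

lemma sigprod_succ:
  assumes "\<And>\<nu>. G \<nu> \<noteq> 0"
  shows "sigprod G (m + 1) = sigprod G m * G (2 * m + 1)"
proof (cases "m \<ge> 0")
  case True
  then show ?thesis
    using odd_range_Suc[OF True] by (cases "m = 0") (auto simp: sigprod_def odd_range_def sgn_if mult.commute)
next
  case False
  have nz: "(\<Prod>\<nu>\<in>odd_range (m + 1). G \<nu>) \<noteq> 0" using assms by simp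
  have "sigprod G m = inverse (G (2 * m + 1)) * inverse (\<Prod>\<nu>\<in>odd_range (m + 1). G \<nu>)"
    using False odd_range_pred[of m] by (simp add: sigprod_def)
  moreover have "sigprod G (m + 1) = inverse (\<Prod>\<nu>\<in>odd_range (m + 1). G \<nu>)"
    using False by (cases "m = -1") (auto simp: sigprod_def odd_range_def)
  ultimately show ?thesis using assms nz by simp
qed

lemma sigprod_unique:
  fixes T :: "int \<Rightarrow> 'a::field"
  assumes "\<And>\<nu>. G \<nu> \<noteq> 0" "T 0 = 1" "\<And>m. T (m + 1) = T m * G (2 * m + 1)"
  shows "T m = sigprod G m"
proof (induction m rule: int_induct[where k = 0])
  case base
  then show ?case by (simp add: assms(2))
next
  case (step1 i)
  then show ?case using assms(3)[of i] sigprod_succ[of G i, OF assms(1)] by simp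
next
  case (step2 i)
  have "T (i - 1) * G (2 * (i - 1) + 1) = sigprod G (i - 1) * G (2 * (i - 1) + 1)"
    using step2 assms(3)[of "i - 1"] sigprod_succ[of G "i - 1", OF assms(1)] by simp
  then show ?case using assms(1) by simp
qed

lemma sigprod_nonzero: "(\<And>\<nu>. G \<nu> \<noteq> 0) \<Longrightarrow> sigprod G m \<noteq> 0"
  by (simp add: sigprod_def)

text \<open>Divided by \<open>sigprod G a\<close>, the left-hand side satisfies in b the recursion
  for G translated by 2 a.\<close>

lemma sigprod_cocycle:
  assumes "\<And>\<nu>. G \<nu> \<noteq> 0"
  shows "sigprod G (a + b) = sigprod G a * sigprod (\<lambda>\<nu>. G (\<nu> + 2 * a)) b"
proof -
  have nz: "sigprod G a \<noteq> 0" by (rule sigprod_nonzero[OF assms])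
  have "sigprod G (a + b) / sigprod G a = sigprod (\<lambda>\<nu>. G (\<nu> + 2 * a)) b"
  proof (rule sigprod_unique[where T = "\<lambda>b. sigprod G (a + b) / sigprod G a"])
    fix m
    show "sigprod G (a + (m + 1)) / sigprod G a = sigprod G (a + m) / sigprod G a * G (2 * m + 1 + 2 * a)"
      using sigprod_succ[of G "a + m", OF assms] by (simp add: algebra_simps)
  qed (use assms nz in auto)
  then show ?thesis using nz by (simp add: field_simps)
qed

lemma sigprod_mult: "sigprod (\<lambda>\<nu>. G \<nu> * H \<nu>) m = sigprod G m * sigprod H m"
  by (simp add: sigprod_def prod.distrib power_int_mult_distrib)

lemma power_int_prod: "(\<Prod>i\<in>A. f i :: 'a::field) powi k = (\<Prod>i\<in>A. f i powi k)"
  by (induction A rule: infinite_finite_induct) (simp_all add: power_int_mult_distrib)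

lemma sigprod_prod: "sigprod (\<lambda>\<nu>. \<Prod>n\<in>A. G n \<nu>) m = (\<Prod>n\<in>A. sigprod (G n) m)"
  unfolding sigprod_def by (subst prod.swap) (simp add: power_int_prod)

lemma sigprod_power_int: "sigprod (\<lambda>\<nu>. G \<nu> powi k) m = sigprod G m powi k"
  by (simp add: sigprod_def power_int_prod[symmetric] power_int_mult[symmetric] mult.commute)

lemma sigprod_uminus: "sigprod G (- m) = inverse (sigprod (\<lambda>\<nu>. G (- \<nu>)) m)"
proof -
  have "odd_range (- m) = uminus ` odd_range m"
    by (auto simp: odd_range_def image_image sgn_minus)
  then have "(\<Prod>\<nu>\<in>odd_range (- m). G \<nu>) = (\<Prod>\<nu>\<in>odd_range m. G (- \<nu>))"
    by (simp add: prod.reindex)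
  then show ?thesis by (simp add: sigprod_def sgn_minus power_int_minus)
qed

section \<open>The arguments of the factors\<close>

definition Eta :: "'e::free_abelian_group \<Rightarrow> int \<Rightarrow> int \<Rightarrow> complex \<times> 'e cdual \<Rightarrow> complex"
  where "Eta x n \<nu> p = (1 + of_int n) / 2 - cdual_apply (snd p) x - (1 / 2) * (of_int \<nu> + of_int n) * fst p"

lemma cdual_apply_simps [simp]:
  "cdual_apply (\<theta> + \<eta>) x = cdual_apply \<theta> x + cdual_apply \<eta> x"
  "cdual_apply (- \<theta>) x = - cdual_apply \<theta> x"
  "cdual_apply (\<theta> - \<eta>) x = cdual_apply \<theta> x - cdual_apply \<eta> x"
  "cdual_apply (scaleC c \<theta>) x = c * cdual_apply \<theta> x"
  "cdual_apply 0 x = 0"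
  "cdual_apply (r *\<^sub>R \<theta>) x = of_real r * cdual_apply \<theta> x"
  by (simp_all add: plus_cdual.rep_eq uminus_cdual.rep_eq minus_cdual.rep_eq scaleC_cdual.rep_eq
      zero_cdual.rep_eq scaleR_cdual.rep_eq)

lemma cdual_apply_zero_right [simp]: "cdual_apply \<theta> 0 = 0"
  using cdual_apply_add[of \<theta> 0 0] by simp

lemma cdual_apply_uminus_right [simp]: "cdual_apply \<theta> (- x) = - cdual_apply \<theta> x"
  using cdual_apply_add[of \<theta> x "- x"] by (simp add: eq_neg_iff_add_eq_0 add.commute)

lemma Eta_shear: "Eta x n \<nu> (shear u v p) = Eta x n \<nu> p - cdual_apply u x - fst p * cdual_apply v x"
  by (simp add: Eta_def shear_def)

text \<open>The parameter 1 - \<eta> in the reflection formula for Lambda thus belongs to the class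
  - x, with n and \<nu> negated as well.\<close>

lemma Eta_reflect: "Eta (- x) (- n) (- \<nu>) p = 1 - Eta x n \<nu> p"
  by (simp add: Eta_def field_simps)

text \<open>The norm of \<open>cdual\<close> only sees the values on the standard basis. Expanding x
  in that basis bounds the value at x, with a constant given by the coordinates of x.\<close>

lemma bounded_linear_cdual_apply: "bounded_linear (\<lambda>\<theta>. cdual_apply \<theta> (x::'e::free_abelian_group))"
proof -
  define ix where "ix = (\<lambda>b::'e. SOME i. std_coords b = (\<lambda>j. if j = i then 1 else 0))"
  have ix: "std_coords b = (\<lambda>j. if j = ix b then 1 else 0)" if b: "b \<in> std_basis" for b
  proof -
    have "\<exists>i. std_coords b = (\<lambda>j. if j = i then 1 else 0)" using b by (simp add: std_basis_def)
    then show ?thesis unfolding ix_def by (rule someI_ex)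
  qed
  have ix_eq: "std_coords b (ix b') = (if b = b' then 1 else 0)" if b: "b \<in> std_basis" "b' \<in> std_basis" for b b'
  proof (cases "ix b' = ix b")
    case True
    then have "std_coords b = std_coords b'" using ix[OF b(1)] ix[OF b(2)] by simp
    then have "b = b'" by (rule std_coords_inj)
    then show ?thesis using fun_cong[OF ix[OF b(1)], of "ix b"] by simp
  next
    case False
    then show ?thesis using fun_cong[OF ix[OF b(1)], of "ix b'"] by auto
  qed
  define K where "K = (\<Sum>b\<in>(std_basis :: 'e set). real_of_int \<bar>std_coords x (ix b)\<bar>)"
  have fin: "finite (std_basis :: 'e set)" by (rule finite_std_basis)
  have rep: "cdual_apply \<theta> x = (\<Sum>b\<in>std_basis. of_int (std_coords x (ix b)) * cdual_apply \<theta> b)" for \<theta>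
  proof -
    define f where "f = (\<lambda>x. cdual_apply \<theta> x - (\<Sum>b\<in>std_basis. of_int (std_coords x (ix b)) * cdual_apply \<theta> b))"
    have "f x = 0"
    proof (rule additive_eq_zero)
      show "f (x + y) = f x + f y" for x y
        by (simp add: f_def cdual_apply_add std_coords_add distrib_right sum.distrib)
      fix b :: 'e assume b: "b \<in> std_basis"
      have "(\<Sum>b'\<in>std_basis. of_int (std_coords b (ix b')) * cdual_apply \<theta> b')
          = (\<Sum>b'\<in>std_basis. if b = b' then cdual_apply \<theta> b' else 0)"
        by (rule sum.cong) (simp_all add: ix_eq[OF b])
      also have "\<dots> = cdual_apply \<theta> b" using b fin by simp
      finally show "f b = 0" by (simp add: f_def)
    qed
    then show ?thesis by (simp add: f_def)
  qed
  show ?thesis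
  proof (rule bounded_linear_intro)
    fix \<theta> :: "'e cdual"
    have "cmod (cdual_apply \<theta> x) \<le> (\<Sum>b\<in>std_basis. real_of_int \<bar>std_coords x (ix b)\<bar> * cmod (cdual_apply \<theta> b))"
      unfolding rep[of \<theta>] by (rule sum_norm_le) (simp add: norm_mult)
    also have "\<dots> \<le> (\<Sum>b\<in>std_basis. K * cmod (cdual_apply \<theta> b))"
      unfolding K_def
      by (intro sum_mono mult_right_mono member_le_sum[where f = "\<lambda>b. real_of_int \<bar>std_coords x (ix b)\<bar>"] fin) auto
    also have "\<dots> = norm \<theta> * K" by (simp add: norm_cdual_def sum_distrib_left[symmetric] mult.commute)
    finally show "norm (cdual_apply \<theta> x) \<le> norm \<theta> * K" .
  qed (simp_all add: scaleR_conv_of_real)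
qed

lemma holo_on_fst: "open S \<Longrightarrow> holo_on S (\<lambda>p::complex \<times> 'a::complex_normed_space. fst p)"
  by (rule holo_on_linear[OF bounded_linear_fst]) (simp_all add: scaleC_prod_def scaleC_complex_def)

lemma holo_on_Eta: "open S \<Longrightarrow> holo_on S (Eta x n \<nu>)"
proof -
  assume S: "open S"
  have "holo_on S (\<lambda>p::complex \<times> 'a cdual. cdual_apply (snd p) x)"
    by (rule holo_on_linear[OF bounded_linear_compose[OF bounded_linear_cdual_apply bounded_linear_snd] _ S])
       (simp add: scaleC_prod_def)
  then have "holo_on S (\<lambda>p. (1 + of_int n) / 2 - cdual_apply (snd p) x - (1 / 2) * (of_int \<nu> + of_int n) * fst p)"
    by (intro holo_on_diff holo_on_mult holo_on_const holo_on_fst S)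
  then show ?thesis by (simp add: Eta_def[abs_def])
qed

section \<open>Factors that do not vanish identically\<close>

lemma ex_cdual_nonzero:
  assumes "x \<noteq> (0::'e::free_abelian_group)"
  obtains \<theta> where "cdual_apply \<theta> x \<noteq> 0"
proof -
  obtain i where i: "std_coords x i \<noteq> 0" using assms std_coords_inj[of x 0] by (metis ext std_coords_zero)
  have "cdual_apply (Abs_cdual (\<lambda>y. of_int (std_coords y i))) x = of_int (std_coords x i)"
    by (subst Abs_cdual_inverse) (auto simp: std_coords_add)
  then show ?thesis using that i by (metis of_int_eq_0_iff)
qed

lemma Eta_surj:
  assumes "x \<noteq> 0"
  obtains \<theta> where "Eta x n \<nu> (\<tau>, \<theta>) = z"
proof -
  obtain \<theta>\<^sub>0 where \<theta>\<^sub>0: "cdual_apply \<theta>\<^sub>0 x \<noteq> 0" by (rule ex_cdual_nonzero[OF assms])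
  define \<theta> where "\<theta> = scaleC (((1 + of_int n) / 2 - (1 / 2) * (of_int \<nu> + of_int n) * \<tau> - z) / cdual_apply \<theta>\<^sub>0 x) \<theta>\<^sub>0"
  show ?thesis by (rule that[of \<theta>]) (use \<theta>\<^sub>0 in \<open>simp add: Eta_def \<theta>_def\<close>)
qed

lemma convex_mero_dom: "convex mero_dom"
  unfolding upper_half_plane_def by (intro convex_Times convex_halfspace_Im_gt convex_UNIV)

lemma nowhere_dense_zeros:
  assumes "holo_on mero_dom f" "p \<in> mero_dom" "f p \<noteq> 0"
  shows "nowhere_dense {p\<in>mero_dom. f p = 0}"
  using holo_on_ball_dichotomy[OF assms(1) convex_mero_dom] assms by blast

lemma nowhere_dense_zeros_Eta:
  assumes "\<phi> holomorphic_on UNIV" "\<phi> z \<noteq> 0" "x \<noteq> 0"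
  shows "nowhere_dense {p\<in>mero_dom. \<phi> (Eta x n \<nu> p) = 0}"
proof -
  obtain \<theta> where \<theta>: "Eta x n \<nu> (\<i>, \<theta>) = z" by (rule Eta_surj[OF assms(3)])
  show ?thesis
    by (rule nowhere_dense_zeros[of _ "(\<i>, \<theta>)"])
       (use \<theta> assms in \<open>auto simp: upper_half_plane_def intro: holo_on_compose_complex holo_on_Eta open_mero_dom[unfolded upper_half_plane_def]\<close>)
qed

text \<open>The elementary part of Lambda: for w nonzero it is entire in \<eta> without zeros, so
  all poles in \<eta> come from Gamma.\<close>

definition Lexp :: "complex \<Rightarrow> complex \<Rightarrow> complex"
  where "Lexp w \<eta> = exp w * (2 * of_real pi) powr (- 1 / 2) * w powr (1 / 2 - \<eta> - w)"

lemma Lambda_Gamma_Lexp: "Lambda w \<eta> = Gamma (w + \<eta>) * Lexp w \<eta>"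
  by (simp add: Lambda_def Lexp_def mult_ac)

lemma Lexp_nonzero: "w \<noteq> 0 \<Longrightarrow> Lexp w \<eta> \<noteq> 0"
  by (simp add: Lexp_def)

lemma mero_on_Gamma_Eta: "mero_on mero_dom (\<lambda>p. Gamma (w + Eta x n \<nu> p))"
proof -
  have "holo_on mero_dom (\<lambda>p. rGamma (w + Eta x n \<nu> p))"
    by (rule holo_on_compose_complex[of _ "\<lambda>p. w + Eta x n \<nu> p" rGamma UNIV])
       (auto intro!: holo_on_add holo_on_const holo_on_Eta open_mero_dom holomorphic_intros)
  from mero_on_dom_inverse[OF holo_on_mero_on[OF this]]
  show ?thesis by (simp add: Gamma_def)
qed

lemma mero_on_Lambda_Eta: "w \<noteq> 0 \<Longrightarrow> mero_on mero_dom (\<lambda>p. Lambda w (Eta x n \<nu> p))"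
proof -
  assume w: "w \<noteq> 0"
  have "holo_on mero_dom (\<lambda>p. Lexp w (Eta x n \<nu> p))"
    by (rule holo_on_compose_complex[of _ "Eta x n \<nu>" "Lexp w" UNIV])
       (use w in \<open>auto simp: Lexp_def[abs_def] powr_def intro!: holo_on_Eta open_mero_dom holomorphic_intros\<close>)
  then show ?thesis
    unfolding Lambda_Gamma_Lexp by (intro mero_on_mult mero_on_Gamma_Eta holo_on_mero_on)
qed

definition Lam :: "complex \<Rightarrow> 'e::free_abelian_group \<Rightarrow> int \<Rightarrow> int \<Rightarrow> 'e mero"
  where "Lam w x n \<nu> = mero_of (\<lambda>p. Lambda w (Eta x n \<nu> p))"

lemma Lam_nonzero:
  assumes "w \<noteq> 0" "x \<noteq> 0" shows "Lam w x n \<nu> \<noteq> 0"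
  unfolding Lam_def
proof (rule mero_of_nonzero[OF mero_on_Lambda_Eta[OF assms(1)]])
  \<comment> \<open>The witness is the value 1 - w of \<open>Eta\<close>, where the argument of
    \<open>rGamma\<close> is 1. As a total function, \<open>Gamma\<close> vanishes only where
    \<open>rGamma\<close> does.\<close>
  have "nowhere_dense {p\<in>mero_dom. rGamma (w + Eta x n \<nu> p) = 0}"
    by (rule nowhere_dense_zeros_Eta[of "\<lambda>z. rGamma (w + z)" "1 - w"])
       (use assms in \<open>auto intro!: holomorphic_intros\<close>)
  then show "nowhere_dense {p\<in>mero_dom. Lambda w (Eta x n \<nu> p) = 0}"
    by (rule nowhere_dense_subset) (use assms(1) in \<open>auto simp: Lambda_Gamma_Lexp Lexp_nonzero Gamma_def\<close>)
qed

section \<open>The infinite product \<open>E_q\<close>\<close>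

lemma E_q_LIMSEQ:
  assumes "cmod q < 1"
  shows "(\<lambda>N. \<Prod>k<N. 1 + - (q ^ k * x)) \<longlonglongrightarrow> E_q q x"
proof -
  have "summable (\<lambda>k. norm (- (q ^ k * x)))"
    using assms by (auto simp: norm_mult norm_power intro!: summable_mult2 summable_geometric)
  then have "abs_convergent_prod (\<lambda>k. 1 + - (q ^ k * x))"
    by (simp add: abs_convergent_prod_conv_summable)
  then have "convergent_prod (\<lambda>k. 1 + - (q ^ k * x))"
    by (rule abs_convergent_prod_imp_convergent_prod)
  from convergent_prod_LIMSEQ[OF this]
  have "(\<lambda>N. \<Prod>k<Suc N. 1 + - (q ^ k * x)) \<longlonglongrightarrow> E_q q x"
    by (simp add: E_q_def lessThan_Suc_atMost)
  then show ?thesis by (rule LIMSEQ_imp_Suc)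
qed

lemma E_q_step:
  assumes "cmod q < 1" shows "E_q q x = (1 - x) * E_q q (q * x)"
proof (rule LIMSEQ_unique)
  show "(\<lambda>N. \<Prod>k<Suc N. 1 + - (q ^ k * x)) \<longlonglongrightarrow> E_q q x" by (rule LIMSEQ_Suc[OF E_q_LIMSEQ[OF assms]])
  have "(\<Prod>k<Suc N. 1 + - (q ^ k * x)) = (1 - x) * (\<Prod>k<N. 1 + - (q ^ k * (q * x)))" for N
    by (subst prod.lessThan_Suc_shift) (simp add: mult_ac)
  then show "(\<lambda>N. \<Prod>k<Suc N. 1 + - (q ^ k * x)) \<longlonglongrightarrow> (1 - x) * E_q q (q * x)"
    using tendsto_mult[OF tendsto_const[of "1 - x"] E_q_LIMSEQ[OF assms, of "q * x"]] by simp
qed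

lemma E_q_0: "cmod q < 1 \<Longrightarrow> E_q q 0 = 1"
  using E_q_LIMSEQ[of q 0] LIMSEQ_unique[OF _ tendsto_const] by fastforce

text \<open>Joint holomorphy in q and x: on |q| <= \<rho> < 1, |x| <= X the product converges
  uniformly by the M-test with the geometric series \<rho>^k X, and the partial products are
  polynomials.\<close>

lemma holo_on_E_q: "holo_on (ball 0 1 \<times> UNIV) (\<lambda>p. E_q (fst p) (snd p))"
proof (rule holo_on_uniform_limit)
  define f where "f = (\<lambda>N (p::complex \<times> complex). \<Prod>k<N. 1 + - (fst p ^ k * snd p))"
  show "open (ball (0::complex) 1 \<times> (UNIV :: complex set))" by (intro open_Times) auto
  fix p :: "complex \<times> complex" assume p: "p \<in> ball 0 1 \<times> UNIV"
  define \<rho> where "\<rho> = (1 + cmod (fst p)) / 2"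
  have \<rho>: "0 < \<rho>" "\<rho> < 1" "cmod (fst p) < \<rho>" using p by (auto simp: \<rho>_def add_pos_nonneg)
  define X where "X = cmod (snd p) + 1"
  define A where "A = cball (0::complex) \<rho> \<times> cball (0::complex) X"
  have A: "compact A" unfolding A_def by (intro compact_Times compact_cball)
  have "uniformly_convergent_on A f"
    unfolding f_def
  proof (rule uniformly_convergent_on_prod[OF _ A])
    show "uniformly_convergent_on A (\<lambda>N p. \<Sum>n<N. norm (- (fst p ^ n * snd p)))"
    proof (rule Weierstrass_m_test'[of A _ "\<lambda>n. \<rho> ^ n * X"])
      show "summable (\<lambda>n. \<rho> ^ n * X)" using \<rho> by (intro summable_mult2 summable_geometric) auto
      fix n p assume "p \<in> A"
      then show "norm (norm (- (fst p ^ n * snd p))) \<le> \<rho> ^ n * X"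
        using \<rho>(1) by (auto simp: A_def norm_mult norm_power intro!: mult_mono power_mono)
    qed
  qed (intro continuous_intros)
  then have ul: "uniform_limit A f (\<lambda>x. lim (\<lambda>n. f n x)) sequentially"
    by (simp add: uniformly_convergent_uniform_limit_iff)
  have "lim (\<lambda>n. f n x) = E_q (fst x) (snd x)" if "x \<in> A" for x
    unfolding f_def by (rule limI[OF E_q_LIMSEQ]) (use that \<rho> in \<open>auto simp: A_def\<close>)
  then have ul': "uniform_limit A f (\<lambda>p. E_q (fst p) (snd p)) sequentially"
    using uniform_limit_cong'[of A f f "\<lambda>x. lim (\<lambda>n. f n x)" "\<lambda>p. E_q (fst p) (snd p)" sequentially] ul by simp
  have "p \<in> ball 0 \<rho> \<times> ball 0 X" using \<rho>(3) by (cases p) (auto simp: X_def)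
  moreover have "open (ball (0::complex) \<rho> \<times> ball (0::complex) X)" by (intro open_Times) auto
  ultimately obtain r where r: "r > 0" "ball p r \<subseteq> ball 0 \<rho> \<times> ball 0 X" using open_contains_ball by blast
  have "ball 0 \<rho> \<times> ball 0 X \<subseteq> A" "ball (0::complex) \<rho> \<times> ball (0::complex) X \<subseteq> ball 0 1 \<times> UNIV"
    using \<rho>(2) by (auto simp: A_def)
  then have sub: "ball p r \<subseteq> A" "ball p r \<subseteq> ball 0 1 \<times> UNIV" using r(2) by blast+
  have snd: "holo_on S (\<lambda>p::complex \<times> complex. snd p)" if "open S" for S
    by (rule holo_on_linear[OF bounded_linear_snd _ that]) (simp add: scaleC_prod_def scaleC_complex_def)
  have "holo_on (ball p r) (\<lambda>p. \<Prod>k<N. 1 - fst p ^ k * snd p)" for N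
    by (intro holo_on_prod holo_on_diff holo_on_const holo_on_mult holo_on_power holo_on_fst snd open_ball)
  then have "holo_on (ball p r) (f N)" for N by (simp add: f_def)
  with r(1) sub uniform_limit_on_subset[OF ul' sub(1)]
  show "\<exists>r>0. ball p r \<subseteq> ball 0 1 \<times> UNIV \<and> (\<forall>\<^sub>F N in sequentially. holo_on (ball p r) (f N)) \<and>
    uniform_limit (ball p r) f (\<lambda>p. E_q (fst p) (snd p)) sequentially"
    by (intro exI[of _ r]) auto
qed

lemma norm_exp_upper_half_plane: "\<tau> \<in> upper_half_plane \<Longrightarrow> cmod (exp (2 * of_real pi * \<i> * \<tau>)) < 1"
  by (simp add: upper_half_plane_def)

text \<open>For m = 0 the second argument is the (-q^(1/2))^(n+1) y_x of the DT product, see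
  \<open>DT_q_eq\<close>. Raising m by one multiplies it by q, which is the effect of a translation
  of \<theta> by \<tau> times a form with value 1 at x.\<close>

definition Eel :: "'e::free_abelian_group \<Rightarrow> int \<Rightarrow> int \<Rightarrow> complex \<times> 'e cdual \<Rightarrow> complex"
  where "Eel x n m p = E_q (exp (2 * of_real pi * \<i> * fst p)) (exp (- 2 * of_real pi * \<i> * Eta x n (2 * m + 1) p))"

lemma holo_on_Eel: "holo_on mero_dom (Eel x n m)"
proof -
  define T where "T = (\<lambda>p. (exp (2 * of_real pi * \<i> * fst p), exp (- 2 * of_real pi * \<i> * Eta x n (2 * m + 1) p)))"
  have h: "holo_on mero_dom (\<lambda>p::complex \<times> 'a cdual. exp (2 * of_real pi * \<i> * fst p))"
    "holo_on mero_dom (\<lambda>p. exp (- 2 * of_real pi * \<i> * Eta x n (2 * m + 1) p))"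
    by (rule holo_on_compose_complex[of _ _ exp UNIV];
        intro holo_on_mult holo_on_const holo_on_fst holo_on_Eta open_mero_dom holomorphic_on_exp open_UNIV UNIV_I)+
  have "holo_on mero_dom (\<lambda>p. E_q (fst (T p)) (snd (T p)))"
  proof (rule holo_on_comp[OF holo_on_E_q open_mero_dom])
    fix p :: "complex \<times> 'a cdual" assume p: "p \<in> mero_dom"
    show "T p \<in> ball 0 1 \<times> UNIV"
      using p norm_exp_upper_half_plane[of "fst p"] by (auto simp: T_def)
    obtain D1 D2 where "((\<lambda>p. exp (2 * of_real pi * \<i> * fst p)) has_derivative D1) (at p)" "\<forall>c v. D1 (scaleC c v) = c * D1 v"
      "((\<lambda>p. exp (- 2 * of_real pi * \<i> * Eta x n (2 * m + 1) p)) has_derivative D2) (at p)" "\<forall>c v. D2 (scaleC c v) = c * D2 v"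
      using h p unfolding holo_on_def by meson
    then show "\<exists>D. (T has_derivative D) (at p) \<and> (\<forall>c v. D (scaleC c v) = scaleC c (D v))"
      unfolding T_def by (intro exI[of _ "\<lambda>v. (D1 v, D2 v)"]) (auto intro!: has_derivative_Pair simp: scaleC_prod_def scaleC_complex_def)
  qed
  then show ?thesis by (simp add: T_def Eel_def[abs_def])
qed

lemma nowhere_dense_Eel:
  assumes "x \<noteq> 0" shows "nowhere_dense {p\<in>mero_dom. Eel x n m p = 0}"
proof -
  define q where "q = exp (2 * of_real pi * \<i> * \<i>)"
  have q: "cmod q < 1" unfolding q_def by (rule norm_exp_upper_half_plane) (simp add: upper_half_plane_def)
  have "isCont (\<lambda>p. E_q (fst p) (snd p)) (q, 0)"
    using holo_on_continuous[OF holo_on_E_q] holo_on_open[OF holo_on_E_q] q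
    by (simp add: continuous_on_eq_continuous_at)
  then obtain d where d: "d > 0" "\<And>y. dist y (q, 0) < d \<Longrightarrow> dist (E_q (fst y) (snd y)) 1 < 1"
    using E_q_0[OF q] unfolding continuous_at_eps_delta by (metis fst_conv snd_conv zero_less_one)
  \<comment> \<open>\<open>E_q\<close> is close to 1 when its second argument is near 0. The choice
    of y and \<theta> makes that argument exp(-(y + 2 \<pi>)), which is below the radius d of the
    neighbourhood.\<close>
  define y where "y = max 0 (- ln d)"
  obtain \<theta> where \<theta>: "Eta x n (2 * m + 1) (\<i>, \<theta>) = - \<i> * of_real (y / (2 * pi) + 1)"
    by (rule Eta_surj[OF assms])
  have a: "- 2 * of_real pi * \<i> * (- \<i> * of_real (y / (2 * pi) + 1)) = complex_of_real (- (y + 2 * pi))"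
    by (simp add: field_simps)
  have e: "exp (- 2 * of_real pi * \<i> * Eta x n (2 * m + 1) (\<i>, \<theta>)) = of_real (exp (- (y + 2 * pi)))"
    unfolding \<theta> a exp_of_real ..
  have "exp (- (y + 2 * pi)) < exp (ln d)" unfolding exp_less_cancel_iff y_def using pi_gt_zero by linarith
  then have "exp (- (y + 2 * pi)) < d" using d(1) by simp
  then have "dist (q, complex_of_real (exp (- (y + 2 * pi)))) (q, 0) < d" by (simp add: dist_Pair_Pair dist_norm)
  then have "dist (E_q q (of_real (exp (- (y + 2 * pi))))) 1 < 1" using d(2) by fastforce
  then have "E_q q (of_real (exp (- (y + 2 * pi)))) \<noteq> 0" by auto
  then have "Eel x n m (\<i>, \<theta>) \<noteq> 0" unfolding Eel_def e by (simp add: q_def)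
  then show ?thesis
    by (intro nowhere_dense_zeros[OF holo_on_Eel, of "(\<i>, \<theta>)"]) (simp_all add: upper_half_plane_def)
qed

definition One :: "'e::free_abelian_group \<Rightarrow> int \<Rightarrow> int \<Rightarrow> complex \<times> 'e cdual \<Rightarrow> complex"
  where "One x n \<nu> p = 1 - exp (- 2 * of_real pi * \<i> * Eta x n \<nu> p)"

lemma holo_on_One: "holo_on mero_dom (One x n \<nu>)"
proof -
  have "holo_on mero_dom (\<lambda>p. 1 - exp (- 2 * of_real pi * \<i> * Eta x n \<nu> p))"
    by (intro holo_on_diff holo_on_const open_mero_dom holo_on_compose_complex[of _ _ exp UNIV]
        holo_on_mult holo_on_Eta holomorphic_on_exp open_UNIV UNIV_I)
  then show ?thesis by (simp add: One_def[abs_def])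
qed

lemma Eel_step:
  assumes "p \<in> mero_dom" shows "Eel x n m p = One x n (2 * m + 1) p * Eel x n (m + 1) p"
proof -
  have "exp (2 * of_real pi * \<i> * fst p) * exp (- 2 * of_real pi * \<i> * Eta x n (2 * m + 1) p)
      = exp (- 2 * of_real pi * \<i> * Eta x n (2 * (m + 1) + 1) p)"
    unfolding exp_add[symmetric] by (rule arg_cong[of _ _ exp]) (simp add: Eta_def field_simps)
  moreover have "cmod (exp (2 * of_real pi * \<i> * fst p)) < 1"
    using assms by (intro norm_exp_upper_half_plane) auto
  ultimately show ?thesis unfolding Eel_def One_def by (subst E_q_step) auto
qed

lemma mero_on_cong:
  assumes "mero_on S f" "\<And>p. p \<in> S \<Longrightarrow> f p = g p" shows "mero_on S g"
proof (rule mero_onI)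
  fix p assume "p \<in> S"
  from assms(1)[unfolded mero_on_def, rule_format, OF this]
  obtain U g' h where U: "p \<in> U" "U \<subseteq> S" "holo_on U g'" "holo_on U h"
    "nowhere_dense {x\<in>U. h x = 0}" "\<forall>x\<in>U. h x \<noteq> 0 \<longrightarrow> f x = g' x / h x"
    by (elim exE conjE) (rule that)
  have "\<forall>x\<in>U. h x \<noteq> 0 \<longrightarrow> g x = g' x / h x"
    using U(2,6) assms(2) by (metis subsetD)
  with U show "\<exists>U g' h. p \<in> U \<and> U \<subseteq> S \<and> holo_on U g' \<and> holo_on U h \<and>
    nowhere_dense {x\<in>U. h x = 0} \<and> (\<forall>x\<in>U. h x \<noteq> 0 \<longrightarrow> g x = g' x / h x)" by blast
qed

lemma mero_of_cong:
  assumes "mero_on mero_dom f" "\<And>p. p \<in> mero_dom \<Longrightarrow> f p = g p" shows "mero_of f = mero_of g"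
proof (rule mero_of_eqI[OF assms(1) mero_on_cong[OF assms]])
  have "{p\<in>mero_dom. f p \<noteq> g p} = {}" using assms(2) by blast
  then show "nowhere_dense {p\<in>mero_dom. f p \<noteq> g p}" by (simp only: nowhere_dense_empty)
qed

lemma mero_shear_sigprod: "mero_shear u v (sigprod G m) = sigprod (\<lambda>\<nu>. mero_shear u v (G \<nu>)) m"
  by (simp add: sigprod_def mero_shear_power_int mero_shear_prod)

definition Onem :: "'e::free_abelian_group \<Rightarrow> int \<Rightarrow> int \<Rightarrow> 'e mero"
  where "Onem x n \<nu> = mero_of (One x n \<nu>)"

definition Em :: "'e::free_abelian_group \<Rightarrow> int \<Rightarrow> int \<Rightarrow> 'e mero"
  where "Em x n m = mero_of (Eel x n m)"

lemma Onem_nonzero: "x \<noteq> 0 \<Longrightarrow> Onem x n \<nu> \<noteq> 0"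
  unfolding Onem_def
proof (rule mero_of_nonzero[OF holo_on_mero_on[OF holo_on_One]])
  assume "x \<noteq> 0"
  have "exp (- 2 * of_real pi * \<i> * (1 / 2)) = (-1 :: complex)"
    by (simp add: exp_minus)
  then show "nowhere_dense {p\<in>mero_dom. One x n \<nu> p = 0}"
    unfolding One_def
    by (intro nowhere_dense_zeros_Eta[of "\<lambda>z. 1 - exp (- 2 * of_real pi * \<i> * z)" "1 / 2"])
       (use \<open>x \<noteq> 0\<close> in \<open>auto intro!: holomorphic_intros\<close>)
qed

lemma Em_nonzero: "x \<noteq> 0 \<Longrightarrow> Em x n m \<noteq> 0"
  unfolding Em_def by (intro mero_of_nonzero holo_on_mero_on holo_on_Eel nowhere_dense_Eel)

text \<open>The functional equation E_q(x) = (1 - x) E_q(q x) telescopes;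
  \<open>sigprod_unique\<close> covers both signs of m.\<close>

lemma Em_quotient:
  assumes "x \<noteq> 0"
  shows "Em x n 0 / Em x n m = sigprod (Onem x n) m"
proof (rule sigprod_unique[where T = "\<lambda>m. Em x n 0 / Em x n m"])
  fix m
  have "Em x n m = mero_of (\<lambda>p. One x n (2 * m + 1) p * Eel x n (m + 1) p)"
    unfolding Em_def by (rule mero_of_cong[OF holo_on_mero_on[OF holo_on_Eel] Eel_step])
  then have "Em x n m = Onem x n (2 * m + 1) * Em x n (m + 1)"
    unfolding Em_def Onem_def by (simp add: mero_of_mult holo_on_mero_on holo_on_One holo_on_Eel)
  then show "Em x n 0 / Em x n (m + 1) = Em x n 0 / Em x n m * Onem x n (2 * m + 1)"
    using Em_nonzero[OF assms] Onem_nonzero[OF assms] by (simp add: field_simps)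
qed (use Em_nonzero[OF assms] Onem_nonzero[OF assms] in simp_all)

text \<open>Translation by \<tau> times the pairing changes \<nu> by an even number. This matches
  the spacing 2 in \<kappa>(\<beta>, \<gamma>) and leads to the cocycle property.\<close>

lemma mero_shear_Lam:
  assumes "w \<noteq> 0" "cdual_apply v x = of_int m"
  shows "mero_shear 0 v (Lam w x n \<nu>) = Lam w x n (\<nu> + 2 * m)"
proof -
  have "Eta x n \<nu> (shear 0 v p) = Eta x n (\<nu> + 2 * m) p" for p
    unfolding Eta_shear assms(2) by (simp add: Eta_def field_simps)
  then show ?thesis unfolding Lam_def by (simp add: mero_of_shear mero_on_Lambda_Eta assms(1))
qed

lemma mero_shear_Em:
  assumes "cdual_apply v x = of_int m"
  shows "mero_shear 0 v (Em x n k) = Em x n (k + m)"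
proof -
  have "Eel x n k (shear 0 v p) = Eel x n (k + m) p" for p
  proof -
    have "Eta x n (2 * k + 1) (shear 0 v p) = Eta x n (2 * (k + m) + 1) p"
      unfolding Eta_shear assms by (simp add: Eta_def field_simps)
    then show ?thesis by (simp add: Eel_def shear_def)
  qed
  then show ?thesis unfolding Em_def by (simp add: mero_of_shear holo_on_mero_on holo_on_Eel)
qed

text \<open>The reflection formula holds at every point: at integral arguments both sides are \<open>0\<close>, as
  \<open>Gamma\<close> is \<open>0\<close> at its poles and \<open>inverse 0 = 0\<close>.\<close>

lemma Lam_reflection:
  assumes "Im w < 0" "cdual_apply u x = w"
  shows "Lam w x n \<nu> * Lam (- w) (- x) (- n) (- \<nu>) = inverse (mero_shear (- u) 0 (Onem x n \<nu>))"
proof -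
  have w: "w \<noteq> 0" "- w \<noteq> 0" using assms(1) by auto
  have "Lambda w (Eta x n \<nu> p) * Lambda (- w) (Eta (- x) (- n) (- \<nu>) p) = inverse (One x n \<nu> (shear (- u) 0 p))" for p
    unfolding Eta_reflect Lambda_reflection[OF assms(1)] One_def Eta_shear by (simp add: assms(2) add.commute)
  moreover have "mero_on mero_dom (\<lambda>p. One x n \<nu> (shear (- u) 0 p))"
    by (intro mero_on_shear holo_on_mero_on holo_on_One)
  ultimately show ?thesis
    unfolding Lam_def Onem_def
    by (simp add: mero_of_mult mero_on_Lambda_Eta w mero_of_shear holo_on_mero_on holo_on_One mero_of_inverse)
qed

section \<open>Rays\<close>

definition ray :: "complex \<Rightarrow> complex set"
  where "ray c = {complex_of_real x * c | x. x > 0}"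

lemma is_ray_iff: "is_ray r \<longleftrightarrow> (\<exists>c. c \<noteq> 0 \<and> r = ray c)"
  by (simp add: is_ray_def ray_def)

lemma ray_scale: "y > 0 \<Longrightarrow> ray (of_real y * c) = ray c"
proof (intro equalityI subsetI)
  assume y: "y > 0"
  fix z assume "z \<in> ray c"
  then obtain x where x: "x > 0" "z = of_real x * c" by (auto simp: ray_def)
  then have "z = of_real (x / y) * (of_real y * c)" "x / y > 0" using y by auto
  then show "z \<in> ray (of_real y * c)" unfolding ray_def by blast
next
  assume y: "y > 0"
  fix z assume "z \<in> ray (of_real y * c)"
  then obtain x where x: "x > 0" "z = of_real x * (of_real y * c)" by (auto simp: ray_def)
  then have "z = of_real (x * y) * c" "x * y > 0" using y by auto
  then show "z \<in> ray c" unfolding ray_def by blast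
qed

lemma rotate_ray_ray: "rotate_ray \<phi> (ray c) = ray (cis \<phi> * c)"
  unfolding rotate_ray_def ray_def by (auto simp: mult_ac)

lemma Re_div_cnj: "c \<noteq> 0 \<Longrightarrow> Re (t / c) > 0 \<longleftrightarrow> Re (t * cnj c) > 0"
  by (simp add: complex_div_cnj[of t c] zero_less_divide_iff flip: of_real_power)

lemma half_plane_ray:
  assumes "c \<noteq> 0" shows "t \<in> half_plane (ray c) \<longleftrightarrow> Re (t * cnj c) > 0"
proof
  assume "t \<in> half_plane (ray c)"
  then obtain x where x: "x > 0" "Re (t / (of_real x * c)) > 0" by (auto simp: half_plane_def ray_def)
  then have "Re (t * cnj (of_real x * c)) > 0" using assms by (subst Re_div_cnj[symmetric]) auto
  also have "t * cnj (of_real x * c) = of_real x * (t * cnj c)" by simp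
  finally show "Re (t * cnj c) > 0" using x(1) by (simp add: zero_less_mult_iff)
next
  assume "Re (t * cnj c) > 0"
  then have "Re (t / c) > 0" using Re_div_cnj[OF assms] by simp
  then show "t \<in> half_plane (ray c)" unfolding half_plane_def ray_def
    by (intro CollectI bexI[of _ c]) (auto intro!: exI[of _ "1::real"])
qed

lemma half_plane_nonzero: "t \<in> half_plane r \<Longrightarrow> t \<noteq> 0"
  by (auto simp: half_plane_def)

lemma i_half_plane_ray:
  assumes "c \<noteq> 0" shows "z \<in> (\<lambda>z. \<i> * z) ` half_plane (ray c) \<longleftrightarrow> Im (z * cnj c) > 0"
proof -
  have "z \<in> (\<lambda>z. \<i> * z) ` half_plane (ray c) \<longleftrightarrow> - \<i> * z \<in> half_plane (ray c)"
  proof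
    assume "- \<i> * z \<in> half_plane (ray c)"
    then show "z \<in> (\<lambda>z. \<i> * z) ` half_plane (ray c)" by (intro image_eqI[of _ _ "- \<i> * z"]) auto
  qed auto
  also have "\<dots> \<longleftrightarrow> Im (z * cnj c) > 0" unfolding half_plane_ray[OF assms] by simp
  finally show ?thesis .
qed

lemma ray_eq_ray:
  assumes "z \<noteq> 0" "c \<noteq> 0" "Im (z * cnj c) = 0" "Re (z * cnj c) > 0"
  shows "ray z = ray c"
proof -
  define y where "y = Re (z * cnj c) / (cmod c)\<^sup>2"
  have "z * cnj c = of_real (Re (z * cnj c))" using assms(3) by (simp add: complex_eq_iff)
  then have "z * (cnj c * c) = of_real (Re (z * cnj c)) * c" by (metis mult.assoc)
  then have "z * of_real ((cmod c)\<^sup>2) = of_real (Re (z * cnj c)) * c"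
    by (metis complex_norm_square mult.commute of_real_power)
  then have "z = of_real y * c" using assms(2) by (simp add: y_def field_simps)
  moreover have "y > 0" using assms by (simp add: y_def)
  ultimately show ?thesis using ray_scale by simp
qed

lemma ray_memD:
  assumes "z \<in> ray c" "c \<noteq> 0"
  shows "Im (z * cnj c) = 0" "Re (z * cnj c) > 0"
proof -
  obtain x where x: "x > 0" "z = of_real x * c" using assms by (auto simp: ray_def)
  have "z * cnj c = of_real (x * (cmod c)\<^sup>2)" unfolding x(2) by (simp add: mult.assoc complex_norm_square[symmetric])
  then show "Im (z * cnj c) = 0" "Re (z * cnj c) > 0" using x(1) assms(2) by auto
qed

lemma ray_self: "c \<in> ray c"
  unfolding ray_def by (auto intro!: exI[of _ "1::real"])

lemma mem_ray_iff:
  assumes "z \<noteq> 0" "c \<noteq> 0" shows "z \<in> ray c \<longleftrightarrow> Im (z * cnj c) = 0 \<and> Re (z * cnj c) > 0"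
  using ray_memD[of z c] ray_eq_ray[of z c] ray_self[of z] assms by auto

section \<open>The multipliers of \<open>\<Psi>\<close>\<close>

locale electric_BPS =
  fixes form :: "('e::free_abelian_group \<times> 'm::free_abelian_group) pairing"
    and Z :: "('e \<times> 'm) charge" and \<Omega> :: "('e \<times> 'm) invariants"
  assumes bps: "refined_BPS_structure form Z \<Omega>" and fin: "BPS_finite \<Omega>"
    and palindromic: "BPS_palindromic \<Omega>"
    and electric: "\<And>x \<delta>. \<delta> \<noteq> 0 \<Longrightarrow> \<Omega> (x, \<delta>) = 0"
begin

definition active :: "'e set"
  where "active = {x. \<Omega> (x, 0) \<noteq> 0}"

definition expo :: "'e \<Rightarrow> int \<Rightarrow> int"
  where "expo x n = sign_pow n * \<lfloor>Poly_Mapping.lookup (\<Omega> (x, 0)) n\<rfloor>"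

abbreviation degs :: "'e \<Rightarrow> int set"
  where "degs x \<equiv> Poly_Mapping.keys (\<Omega> (x, 0))"

abbreviation pair :: "'m \<Rightarrow> 'e \<Rightarrow> int"
  where "pair \<beta> x \<equiv> form (0, \<beta>) (x, 0)"

definition wgt :: "'e \<Rightarrow> complex \<Rightarrow> complex"
  where "wgt x t = Z (x, 0) / (2 * of_real pi * \<i> * t)"

definition fac :: "'e \<Rightarrow> complex \<Rightarrow> int \<Rightarrow> 'e mero"
  where "fac x t \<nu> = (\<Prod>n\<in>degs x. Lam (wgt x t) x n \<nu> powi expo x n)"

text \<open>The active classes with central charge to the left of the line oriented by r.\<close>

definition left_classes :: "complex set \<Rightarrow> 'e set"
  where "left_classes r = {x\<in>active. Z (x, 0) \<in> (\<lambda>z. \<i> * z) ` half_plane r}"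

lemma left_classes_active: "x \<in> left_classes r \<Longrightarrow> x \<in> active"
  by (simp add: left_classes_def)

section \<open>Consequences of the axioms of a BPS structure\<close>

lemma form_add: "form (x + y) z = form x z + form y z" "form x (y + z) = form x y + form x z"
  using bps unfolding refined_BPS_structure_def by blast+

lemma form_zero: "form 0 z = 0" "form z 0 = 0"
  using form_add(1)[of 0 0 z] form_add(2)[of z 0 0] by auto

lemma form_uminus_right: "form z (- x) = - form z x"
  using form_add(2)[of z x "- x"] form_zero by simp

lemma Z_add: "Z (x + y) = Z x + Z y"
  using bps unfolding refined_BPS_structure_def by blast+

lemma Z_uminus: "Z (- x) = - Z x"
  using Z_add[of x "- x"] Z_add[of 0 0] by (simp add: eq_neg_iff_add_eq_0 add.commute)

lemma Omega_uminus: "\<Omega> (- x) = \<Omega> x"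
  using bps unfolding refined_BPS_structure_def by blast+

lemma pair_add: "pair (\<beta> + \<beta>') x = pair \<beta> x + pair \<beta>' x"
  using form_add(1)[of "(0, \<beta>)" "(0, \<beta>')"] by simp

lemma pair_uminus: "pair \<beta> (- x) = - pair \<beta> x"
  using form_uminus_right[of "(0, \<beta>)" "(x, 0)"] by simp

lemma form_e_apply: "cdual_apply (form_e form \<beta>) x = of_int (pair \<beta> x)"
proof -
  have "pair \<beta> (x + y) = pair \<beta> x + pair \<beta> y" for x y
    using form_add(2)[of "(0, \<beta>)" "(x, 0)" "(y, 0)"] by simp
  then show ?thesis unfolding form_e_def by (subst Abs_cdual_inverse) simp_all
qed

lemma form_e_zero: "form_e form 0 = 0"
  by (rule cdual_eqI) (simp add: form_e_apply form_zero(1)[unfolded zero_prod_def])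

lemma Z_e_apply: "cdual_apply (Z_e Z) x = Z (x, 0)"
proof -
  have "Z (x + y, 0) = Z (x, 0) + Z (y, 0)" for x y using Z_add[of "(x, 0)" "(y, 0)"] by simp
  then show ?thesis unfolding Z_e_def by (subst Abs_cdual_inverse) simp_all
qed

lemma finite_active: "finite active"
proof -
  have "(\<lambda>x. (x, 0)) ` active \<subseteq> {\<gamma>. \<Omega> \<gamma> \<noteq> 0}" by (auto simp: active_def)
  then have "finite ((\<lambda>x. (x, 0::'m)) ` active)" using fin finite_subset by (auto simp: BPS_finite_def)
  then show ?thesis by (rule finite_imageD) (auto intro: inj_onI)
qed

lemma finite_left_classes: "finite (left_classes r)"
  using finite_active by (simp add: left_classes_def)

lemma active_nonzero: "x \<in> active \<Longrightarrow> x \<noteq> 0"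
proof
  assume "x \<in> active" "x = 0"
  then have "\<Omega> 0 \<noteq> 0" by (simp add: active_def zero_prod_def)
  then show False using bps unfolding refined_BPS_structure_def by blast
qed

text \<open>The support property bounds |Z| strictly from below by a nonnegative number.\<close>

lemma Z_nonzero: "x \<in> active \<Longrightarrow> Z (x, 0) \<noteq> 0"
proof -
  assume x: "x \<in> active"
  obtain C where C: "C > 0" "\<And>\<gamma>. \<Omega> \<gamma> \<noteq> 0 \<Longrightarrow> cmod (Z \<gamma>) > C * lattice_norm \<gamma>"
    using bps unfolding refined_BPS_structure_def by blast+
  have "lattice_norm (x, 0 :: 'm) \<ge> 0" by (simp add: lattice_norm_def sum_nonneg)
  then have "0 \<le> C * lattice_norm (x, 0 :: 'm)" using C(1) by simp
  also have "\<dots> < cmod (Z (x, 0))" using x by (intro C(2)) (simp add: active_def)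
  finally show ?thesis by auto
qed

lemma uminus_active: "x \<in> active \<Longrightarrow> - x \<in> active"
  using Omega_uminus[of "(x, 0)"] by (simp add: active_def)

lemma degs_uminus: "degs (- x) = degs x" and expo_uminus: "expo (- x) n = expo x n"
  and Z_uminus_e: "Z (- x, 0) = - Z (x, 0)"
  using Omega_uminus[of "(x, 0)"] Z_uminus[of "(x, 0)"] by (simp_all add: expo_def)

lemma palin: "Poly_Mapping.lookup (\<Omega> \<gamma>) (- n) = Poly_Mapping.lookup (\<Omega> \<gamma>) n"
  using palindromic unfolding BPS_palindromic_def by metis

lemma expo_neg: "expo x (- n) = expo x n"
  by (simp add: expo_def palin sign_pow_def)

lemma degs_neg: "uminus ` degs x = degs x"
  using palin by (auto simp: in_keys_iff image_iff intro!: bexI[of _ "- _"])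

lemma wgt_nonzero: "x \<in> active \<Longrightarrow> t \<noteq> 0 \<Longrightarrow> wgt x t \<noteq> 0"
  using Z_nonzero by (simp add: wgt_def)

lemma wgt_uminus: "wgt (- x) t = - wgt x t"
  by (simp add: wgt_def Z_uminus_e)

lemma fac_nonzero: "x \<in> active \<Longrightarrow> t \<noteq> 0 \<Longrightarrow> fac x t \<nu> \<noteq> 0"
  using Lam_nonzero[OF wgt_nonzero active_nonzero] by (auto simp: fac_def)

definition Psi_fun :: "complex set \<Rightarrow> 'm \<Rightarrow> complex \<Rightarrow> complex \<times> 'e cdual \<Rightarrow> complex"
  where "Psi_fun r \<beta> t p = (\<Prod>x\<in>left_classes r. \<Prod>\<nu>\<in>odd_range (pair \<beta> x). \<Prod>n\<in>degs x.
    Lambda (wgt x t) (Eta x n \<nu> p) powi (expo x n * sgn (pair \<beta> x)))"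

lemma Psi_coeff_eq: "Psi_coeff form Z \<Omega> r t \<beta> = mero_of (Psi_fun r \<beta> t)"
  unfolding Psi_coeff_def Psi_fun_def[abs_def] left_classes_def active_def
  by (rule arg_cong[of _ _ mero_of])
     (auto simp: fun_eq_iff Eta_def wgt_def expo_def kappa_odd_range)

lemma mero_on_Psi_fun_factor:
  assumes "x \<in> left_classes r" "t \<noteq> 0"
  shows "mero_on mero_dom (\<lambda>p. Lambda (wgt x t) (Eta x n \<nu> p) powi k)"
  by (intro mero_on_power_int mero_on_Lambda_Eta wgt_nonzero open_mero_dom connected_mero_dom)
     (use assms left_classes_active in blast)+

lemma mero_on_Psi_fun: "t \<noteq> 0 \<Longrightarrow> mero_on mero_dom (Psi_fun r \<beta> t)"
  unfolding Psi_fun_def[abs_def] by (intro mero_on_prod open_mero_dom mero_on_Psi_fun_factor)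

lemma Psi_coeff_sigprod:
  assumes t: "t \<noteq> 0"
  shows "Psi_coeff form Z \<Omega> r t \<beta> = (\<Prod>x\<in>left_classes r. sigprod (fac x t) (pair \<beta> x))"
proof -
  have "Psi_coeff form Z \<Omega> r t \<beta> = (\<Prod>x\<in>left_classes r. mero_of (\<lambda>p. \<Prod>\<nu>\<in>odd_range (pair \<beta> x). \<Prod>n\<in>degs x.
      Lambda (wgt x t) (Eta x n \<nu> p) powi (expo x n * sgn (pair \<beta> x))))"
    unfolding Psi_coeff_eq Psi_fun_def[abs_def]
    by (rule mero_of_prod) (intro mero_on_prod open_mero_dom mero_on_Psi_fun_factor t)
  also have "\<dots> = (\<Prod>x\<in>left_classes r. sigprod (fac x t) (pair \<beta> x))"
  proof (rule prod.cong[OF refl])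
    fix x assume x: "x \<in> left_classes r"
    have w: "wgt x t \<noteq> 0" by (rule wgt_nonzero[OF left_classes_active[OF x] t])
    have "mero_of (\<lambda>p. \<Prod>\<nu>\<in>odd_range (pair \<beta> x). \<Prod>n\<in>degs x. Lambda (wgt x t) (Eta x n \<nu> p) powi (expo x n * sgn (pair \<beta> x)))
        = (\<Prod>\<nu>\<in>odd_range (pair \<beta> x). mero_of (\<lambda>p. \<Prod>n\<in>degs x. Lambda (wgt x t) (Eta x n \<nu> p) powi (expo x n * sgn (pair \<beta> x))))"
      by (rule mero_of_prod) (intro mero_on_prod open_mero_dom mero_on_Psi_fun_factor[OF x] t)
    also have "\<dots> = (\<Prod>\<nu>\<in>odd_range (pair \<beta> x). \<Prod>n\<in>degs x. Lam (wgt x t) x n \<nu> powi (expo x n * sgn (pair \<beta> x)))"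
      unfolding Lam_def
      by (intro prod.cong refl, subst mero_of_prod)
         (auto intro!: mero_on_Psi_fun_factor[OF x] t prod.cong mero_of_power_int mero_on_Lambda_Eta w)
    also have "\<dots> = sigprod (fac x t) (pair \<beta> x)"
      by (simp add: sigprod_def fac_def power_int_mult power_int_prod)
    finally show "mero_of (\<lambda>p. \<Prod>\<nu>\<in>odd_range (pair \<beta> x). \<Prod>n\<in>degs x. Lambda (wgt x t) (Eta x n \<nu> p) powi (expo x n * sgn (pair \<beta> x)))
      = sigprod (fac x t) (pair \<beta> x)" .
  qed
  finally show ?thesis .
qed

lemma Psi_coeff_nonzero: "t \<noteq> 0 \<Longrightarrow> Psi_coeff form Z \<Omega> r t \<beta> \<noteq> 0"
  unfolding Psi_coeff_sigprod
  using finite_left_classes[of r] sigprod_nonzero[OF fac_nonzero[OF left_classes_active]]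
  by (simp add: prod_zero_iff)

lemma mero_shear_fac:
  assumes "x \<in> active" "t \<noteq> 0"
  shows "mero_shear 0 (form_e form \<beta>) (fac x t \<nu>) = fac x t (\<nu> + 2 * pair \<beta> x)"
  by (simp add: fac_def mero_shear_prod mero_shear_power_int
      mero_shear_Lam[OF wgt_nonzero[OF assms] form_e_apply])

text \<open>The translation attached to \<beta> moves \<nu> by twice the pairing with x, which is
  the translation in \<open>sigprod_cocycle\<close>, class by class.\<close>

lemma Psi_coeff_cocycle:
  assumes t: "t \<noteq> 0"
  shows "Psi_coeff form Z \<Omega> r t (\<beta> + \<beta>') =
    Psi_coeff form Z \<Omega> r t \<beta> * mero_shear 0 (form_e form \<beta>) (Psi_coeff form Z \<Omega> r t \<beta>')"
  unfolding Psi_coeff_sigprod[OF t] mero_shear_prod prod.distrib[symmetric]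
proof (rule prod.cong[OF refl])
  fix x assume "x \<in> left_classes r"
  then have x: "x \<in> active" by (simp add: left_classes_def)
  show "sigprod (fac x t) (pair (\<beta> + \<beta>') x) =
      sigprod (fac x t) (pair \<beta> x) * mero_shear 0 (form_e form \<beta>) (sigprod (fac x t) (pair \<beta>' x))"
    unfolding pair_add mero_shear_sigprod mero_shear_fac[OF x t]
    by (rule sigprod_cocycle) (rule fac_nonzero[OF x t])
qed

lemmas is_Psi_char = is_Psi_iff[OF Psi_coeff_nonzero form_e_zero Psi_coeff_cocycle]

lemma ex1_Psi: "t \<noteq> 0 \<Longrightarrow> \<exists>!\<psi>. is_Psi form Z \<Omega> r t \<psi>"
  by (simp add: is_Psi_char)

lemma Psi_eq: "t \<noteq> 0 \<Longrightarrow> Psi form Z \<Omega> r t = qdiag (Psi_coeff form Z \<Omega> r t) 0"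
  by (simp add: Psi_def is_Psi_char)

section \<open>The solution as a diagonal map\<close>

definition charge_shift :: "complex \<Rightarrow> 'e cdual"
  where "charge_shift t = scaleC (1 / (2 * of_real pi * \<i> * t)) (Z_e Z)"

lemma charge_shift_apply: "cdual_apply (charge_shift t) x = wgt x t"
  by (simp add: charge_shift_def wgt_def Z_e_apply)

abbreviation Phi :: "complex set \<Rightarrow> complex \<Rightarrow> ('e, 'm) qtorus \<Rightarrow> ('e, 'm) qtorus"
  where "Phi r t \<equiv> Psi form Z \<Omega> r t \<circ> inv (eps_Z Z t)"

lemma Phi_eq:
  assumes "t \<noteq> 0"
  shows "Phi r t = qdiag (\<lambda>\<beta>. Psi_coeff form Z \<Omega> r t \<beta> * mero_const (exp (- Z (0, \<beta>) / t))) (- charge_shift t)"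
  unfolding Psi_eq[OF assms] inv_eps_Z qdiag_comp by (simp add: charge_shift_def)

lemma Phi_eps: "t \<noteq> 0 \<Longrightarrow> Phi r t \<circ> eps_Z Z t = qdiag (Psi_coeff form Z \<Omega> r t) 0"
proof -
  assume t: "t \<noteq> 0"
  have "inv (eps_Z Z t) \<circ> eps_Z Z t = id"
    unfolding eps_Z_qdiag by (intro inv_o_cancel bij_is_inj bij_qdiag) simp
  then show ?thesis unfolding Psi_eq[OF t] comp_assoc by simp
qed

lemma q_aut_Phi: assumes t: "t \<noteq> 0" shows "q_aut form (Phi r t)"
  unfolding Phi_eq[OF t]
proof (rule q_aut_qdiag[OF _ form_e_zero])
  fix \<beta> \<beta>'
  show "Psi_coeff form Z \<Omega> r t \<beta> * mero_const (exp (- Z (0, \<beta>) / t)) \<noteq> 0"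
    using Psi_coeff_nonzero[OF t] by simp
  have "mero_const (exp (- Z (0, \<beta> + \<beta>') / t)) = mero_const (exp (- Z (0, \<beta>) / t)) * mero_const (exp (- Z (0, \<beta>') / t))"
    using Z_add[of "(0, \<beta>)" "(0, \<beta>')"]
    by (simp add: mero_const_mult[symmetric] exp_add[symmetric] diff_divide_distrib)
  note e = this
  show "Psi_coeff form Z \<Omega> r t (\<beta> + \<beta>') * mero_const (exp (- Z (0, \<beta> + \<beta>') / t)) =
      Psi_coeff form Z \<Omega> r t \<beta> * mero_const (exp (- Z (0, \<beta>) / t)) *
      mero_shear 0 (form_e form \<beta>) (Psi_coeff form Z \<Omega> r t \<beta>' * mero_const (exp (- Z (0, \<beta>') / t)))"
    unfolding Psi_coeff_cocycle[OF t] e mero_shear_mult mero_shear_const by (simp only: mult_ac)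
qed

section \<open>Wall-crossing\<close>

definition ray_classes :: "complex set \<Rightarrow> 'e set"
  where "ray_classes l = {x\<in>active. Z (x, 0) \<in> l}"

definition DT_elt :: "complex set \<Rightarrow> 'e mero"
  where "DT_elt l = (\<Prod>x\<in>ray_classes l. \<Prod>n\<in>degs x. Em x n 0 powi (- expo x n))"

lemma DT_q_eq: "DT_q Z \<Omega> l = Poly_Mapping.single 0 (DT_elt l)"
proof -
  have e: "(- exp (of_real pi * \<i> * \<tau>)) powi (n + 1) * exp (2 * of_real pi * \<i> * cdual_apply \<theta> x)
      = exp (- 2 * of_real pi * \<i> * Eta x n 1 (\<tau>, \<theta>))" for \<tau> n \<theta> and x :: 'e
  proof -
    \<comment> \<open>Writing -q^(1/2) as exp(\<pi> \<i> (\<tau> - 1)) makes the power an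
      exponential with exponent linear in n; the shift by 1 produces the (1 + n) / 2 in
      \<open>Eta\<close>.\<close>
    have "- exp (of_real pi * \<i> * \<tau>) = exp (of_real pi * \<i> * \<tau> - of_real pi * \<i>)"
      by (simp add: exp_diff)
    then have "(- exp (of_real pi * \<i> * \<tau>)) powi (n + 1) * exp (2 * of_real pi * \<i> * cdual_apply \<theta> x)
        = exp (of_int (n + 1) * (of_real pi * \<i> * \<tau> - of_real pi * \<i>) + 2 * of_real pi * \<i> * cdual_apply \<theta> x)"
      by (simp only: exp_power_int exp_add)
    also have "of_int (n + 1) * (of_real pi * \<i> * \<tau> - of_real pi * \<i>) + 2 * of_real pi * \<i> * cdual_apply \<theta> x
        = - 2 * of_real pi * \<i> * Eta x n 1 (\<tau>, \<theta>)"
      by (simp add: Eta_def field_simps)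
    finally show ?thesis .
  qed
  have s: "sign_pow (n - 1) = - sign_pow n" for n by (simp add: sign_pow_def)
  have "DT_q Z \<Omega> l = Poly_Mapping.single 0 (mero_of (\<lambda>p. \<Prod>x\<in>ray_classes l. \<Prod>n\<in>degs x. Eel x n 0 p powi (- expo x n)))"
    unfolding DT_q_def e s ray_classes_def active_def
    by (rule arg_cong[of _ _ "\<lambda>f. Poly_Mapping.single 0 (mero_of f)"])
       (auto simp: fun_eq_iff Eel_def expo_def)
  also have "mero_of (\<lambda>p. \<Prod>x\<in>ray_classes l. \<Prod>n\<in>degs x. Eel x n 0 p powi (- expo x n)) = DT_elt l"
  proof -
    have m: "mero_on mero_dom (\<lambda>p. Eel x n 0 p powi k)" for n k and x :: 'e
      by (intro mero_on_power_int open_mero_dom connected_mero_dom holo_on_mero_on holo_on_Eel)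
    show ?thesis
      unfolding DT_elt_def Em_def
      by (simp only: mero_of_prod[OF mero_on_prod[OF open_mero_dom m]] mero_of_prod[OF m]
          mero_of_power_int[OF holo_on_mero_on[OF holo_on_Eel]])
  qed
  finally show ?thesis .
qed

lemma DT_elt_nonzero: "DT_elt l \<noteq> 0"
proof -
  have "finite (ray_classes l)" using finite_active by (simp add: ray_classes_def)
  moreover have "Em x n 0 powi k \<noteq> 0" if "x \<in> ray_classes l" for x n k
    using Em_nonzero[OF active_nonzero] that by (auto simp: ray_classes_def)
  ultimately show ?thesis by (simp add: DT_elt_def prod_zero_iff)
qed

text \<open>This is the multiplier of \<open>S_q\<close>: translation by the pairing turns
  \<open>Em x n 0\<close> into \<open>Em x n (pair \<beta> x)\<close>, and the quotient
  telescopes.\<close>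

lemma DT_elt_quotient:
  "DT_elt l * inverse (mero_shear 0 (form_e form \<beta>) (DT_elt l)) =
    (\<Prod>x\<in>ray_classes l. sigprod (\<lambda>\<nu>. \<Prod>n\<in>degs x. Onem x n \<nu> powi (- expo x n)) (pair \<beta> x))"
proof -
  have "DT_elt l * inverse (mero_shear 0 (form_e form \<beta>) (DT_elt l)) =
      (\<Prod>x\<in>ray_classes l. \<Prod>n\<in>degs x. Em x n 0 powi (- expo x n) * inverse (Em x n (pair \<beta> x) powi (- expo x n)))"
    unfolding DT_elt_def mero_shear_prod mero_shear_power_int mero_shear_Em[OF form_e_apply]
    by (simp add: prod.distrib prod_inversef[symmetric])
  also have "\<dots> = (\<Prod>x\<in>ray_classes l. \<Prod>n\<in>degs x. sigprod (Onem x n) (pair \<beta> x) powi (- expo x n))"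
  proof (intro prod.cong refl)
    fix x n assume "x \<in> ray_classes l"
    then have "x \<noteq> 0" using active_nonzero by (simp add: ray_classes_def)
    from Em_quotient[OF this, of n "pair \<beta> x"]
    show "Em x n 0 powi (- expo x n) * inverse (Em x n (pair \<beta> x) powi (- expo x n)) = sigprod (Onem x n) (pair \<beta> x) powi (- expo x n)"
      by (simp add: power_int_divide_distrib[symmetric] divide_inverse[symmetric] del: power_int_minus)
  qed
  finally show ?thesis by (simp only: sigprod_prod sigprod_power_int)
qed

lemma S_q_eq: "S_q form Z \<Omega> l = qdiag (\<lambda>\<beta>. DT_elt l * inverse (mero_shear 0 (form_e form \<beta>) (DT_elt l))) 0"
  unfolding S_q_def DT_q_eq by (rule q_Ad_single[OF form_e_zero DT_elt_nonzero])

text \<open>The reflection formula pairs the factor for (x, n, \<nu>) with that for (- x, - n, -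
  \<nu>); palindromicity gives both the same exponent. The translation accounts for the w in w +
  \<eta>.\<close>

lemma fac_reflection:
  assumes "Im (wgt x t) < 0"
  shows "fac x t \<nu> * fac (- x) t (- \<nu>) = mero_shear (- charge_shift t) 0 (\<Prod>n\<in>degs x. Onem x n \<nu> powi (- expo x n))"
proof -
  have "fac (- x) t (- \<nu>) = (\<Prod>n\<in>uminus ` degs x. Lam (- wgt x t) (- x) n (- \<nu>) powi expo x n)"
    by (simp add: fac_def degs_uminus expo_uminus wgt_uminus degs_neg)
  also have "\<dots> = (\<Prod>n\<in>degs x. Lam (- wgt x t) (- x) (- n) (- \<nu>) powi expo x n)"
    by (simp add: prod.reindex expo_neg)
  finally have "fac x t \<nu> * fac (- x) t (- \<nu>) =
      (\<Prod>n\<in>degs x. (Lam (wgt x t) x n \<nu> * Lam (- wgt x t) (- x) (- n) (- \<nu>)) powi expo x n)"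
    by (simp add: fac_def prod.distrib power_int_mult_distrib)
  also have "\<dots> = (\<Prod>n\<in>degs x. mero_shear (- charge_shift t) 0 (Onem x n \<nu>) powi (- expo x n))"
    unfolding Lam_reflection[OF assms charge_shift_apply] by (simp add: power_int_minus power_int_inverse)
  finally show ?thesis by (simp add: mero_shear_prod mero_shear_power_int del: power_int_minus)
qed

text \<open>The sets of left classes differ by the exchange of x for - x. The pairing with - x has
  the opposite sign, so its signed product is an inverse, and the quotient of the two contributions
  is the signed product of the factors in \<open>fac_reflection\<close>. The DT multiplier appears
  translated because the solution, composed with \<open>S_q\<close>, translates it.\<close>

lemma Psi_coeff_jump:
  assumes t: "t \<noteq> 0" and J: "\<And>x. x \<in> ray_classes l \<Longrightarrow> Im (wgt x t) < 0"
    and p: "left_classes r\<^sub>p = C \<union> ray_classes l" "C \<inter> ray_classes l = {}"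
    and m: "left_classes r\<^sub>m = C \<union> uminus ` ray_classes l" "C \<inter> uminus ` ray_classes l = {}"
  shows "Psi_coeff form Z \<Omega> r\<^sub>p t \<beta> = Psi_coeff form Z \<Omega> r\<^sub>m t \<beta> *
    mero_shear (- charge_shift t) 0 (DT_elt l * inverse (mero_shear 0 (form_e form \<beta>) (DT_elt l)))"
proof -
  define f where "f = (\<lambda>x. sigprod (fac x t) (pair \<beta> x))"
  have fin: "finite (ray_classes l)" "finite C"
    using finite_active finite_left_classes[of r\<^sub>p] p(1) by (auto simp: ray_classes_def)
  have "f x = f (- x) * mero_shear (- charge_shift t) 0 (sigprod (\<lambda>\<nu>. \<Prod>n\<in>degs x. Onem x n \<nu> powi (- expo x n)) (pair \<beta> x))"
    if x: "x \<in> ray_classes l" for x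
  proof -
    have act: "- x \<in> active" using x uminus_active by (simp add: ray_classes_def)
    have "f (- x) = inverse (sigprod (\<lambda>\<nu>. fac (- x) t (- \<nu>)) (pair \<beta> x))"
      unfolding f_def pair_uminus sigprod_uminus ..
    moreover have "sigprod (\<lambda>\<nu>. fac (- x) t (- \<nu>)) (pair \<beta> x) \<noteq> 0"
      by (rule sigprod_nonzero) (rule fac_nonzero[OF act t])
    moreover have "mero_shear (- charge_shift t) 0 (sigprod (\<lambda>\<nu>. \<Prod>n\<in>degs x. Onem x n \<nu> powi (- expo x n)) (pair \<beta> x))
        = f x * sigprod (\<lambda>\<nu>. fac (- x) t (- \<nu>)) (pair \<beta> x)"
      unfolding mero_shear_sigprod fac_reflection[OF J[OF x], symmetric] sigprod_mult f_def ..
    ultimately show ?thesis by simp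
  qed
  then have *: "(\<Prod>x\<in>ray_classes l. f x) = (\<Prod>x\<in>ray_classes l. f (- x)) *
      mero_shear (- charge_shift t) 0 (DT_elt l * inverse (mero_shear 0 (form_e form \<beta>) (DT_elt l)))"
    unfolding DT_elt_quotient mero_shear_prod prod.distrib[symmetric] by (rule prod.cong[OF refl])
  have "(\<Prod>x\<in>uminus ` ray_classes l. f x) = (\<Prod>x\<in>ray_classes l. f (- x))"
    by (simp add: prod.reindex)
  then show ?thesis
    unfolding Psi_coeff_sigprod[OF t] f_def[symmetric] p(1) m(1) using fin p(2) m(2)
    by (simp add: prod.union_disjoint * mult.assoc)
qed

lemma Phi_jump:
  assumes t: "t \<noteq> 0" and J: "\<And>x. x \<in> ray_classes l \<Longrightarrow> Im (wgt x t) < 0"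
    and p: "left_classes r\<^sub>p = C \<union> ray_classes l" "C \<inter> ray_classes l = {}"
    and m: "left_classes r\<^sub>m = C \<union> uminus ` ray_classes l" "C \<inter> uminus ` ray_classes l = {}"
  shows "Phi r\<^sub>p t = Phi r\<^sub>m t \<circ> S_q form Z \<Omega> l"
proof -
  have "Psi_coeff form Z \<Omega> r\<^sub>p t \<beta> = Psi_coeff form Z \<Omega> r\<^sub>m t \<beta> *
      mero_shear (- charge_shift t) 0 (DT_elt l * inverse (mero_shear 0 (form_e form \<beta>) (DT_elt l)))" for \<beta>
    by (rule Psi_coeff_jump[OF t J p m])
  then show ?thesis unfolding Phi_eq[OF t] S_q_eq qdiag_comp by (simp add: mult_ac)
qed

section \<open>Active rays, chambers and walls\<close>

lemma active_rayE:
  assumes "active_ray Z \<Omega> r"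
  obtains x where "x \<in> active" "r = ray (Z (x, 0))"
proof -
  obtain \<gamma> where \<gamma>: "\<Omega> \<gamma> \<noteq> 0" "r = ray (Z \<gamma>)" using assms by (auto simp: active_ray_def ray_def)
  obtain x \<delta> where x: "\<gamma> = (x, \<delta>)" by (cases \<gamma>)
  have "\<delta> = 0" using \<gamma>(1) electric x by blast
  then show ?thesis using that[of x] \<gamma> x by (simp add: active_def)
qed

lemma nonactive_rayI:
  assumes "c \<noteq> 0" "\<And>x. x \<in> active \<Longrightarrow> Im (Z (x, 0) * cnj c) \<noteq> 0"
  shows "nonactive_ray Z \<Omega> (ray c)"
proof -
  have "\<not> active_ray Z \<Omega> (ray c)"
  proof
    assume "active_ray Z \<Omega> (ray c)"
    then obtain x where x: "x \<in> active" "ray c = ray (Z (x, 0))" by (rule active_rayE)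
    then have "Z (x, 0) \<in> ray c" using ray_self by simp
    then show False using ray_memD(1) assms x(1) by blast
  qed
  then show ?thesis using assms(1) by (auto simp: nonactive_ray_def is_ray_iff)
qed

text \<open>A vanishing imaginary part puts the charge of x on the ray or on its opposite; in the
  second case the charge of - x, which is active as well, lies on the ray.\<close>

lemma nonactive_rayD:
  assumes "nonactive_ray Z \<Omega> (ray c)" "c \<noteq> 0" "x \<in> active"
  shows "Im (Z (x, 0) * cnj c) \<noteq> 0"
proof
  assume im: "Im (Z (x, 0) * cnj c) = 0"
  have "Z (x, 0) * cnj c \<noteq> 0" using Z_nonzero[OF assms(3)] assms(2) by simp
  then have "Re (Z (x, 0) * cnj c) \<noteq> 0" using im complex_eq_iff[of "Z (x, 0) * cnj c" 0] by auto
  then consider "Re (Z (x, 0) * cnj c) > 0" | "Re (Z (- x, 0) * cnj c) > 0"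
    by (fastforce simp: Z_uminus_e)
  then obtain y where y: "y \<in> active" "Re (Z (y, 0) * cnj c) > 0" "Im (Z (y, 0) * cnj c) = 0"
  proof cases
    case 1
    then show ?thesis using that assms(3) im by blast
  next
    case 2
    then show ?thesis using that[of "- x"] uminus_active[OF assms(3)] im by (simp add: Z_uminus_e)
  qed
  have "ray (Z (y, 0)) = ray c" by (rule ray_eq_ray[OF Z_nonzero[OF y(1)] assms(2) y(3,2)])
  moreover have "is_ray (ray c)" using assms(2) by (auto simp: is_ray_iff)
  ultimately have "active_ray Z \<Omega> (ray c)"
    using y(1) by (auto simp: active_ray_def ray_def[symmetric] active_def intro!: exI[of _ "y"] exI[of _ "0::'m"])
  then show False using assms(1) by (simp add: nonactive_ray_def)
qed

lemma left_classes_ray: "c \<noteq> 0 \<Longrightarrow> left_classes (ray c) = {x\<in>active. Im (Z (x, 0) * cnj c) > 0}"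
  by (simp add: left_classes_def i_half_plane_ray)

text \<open>The charge of a class that leaves the half-plane during the rotation lies, by the
  intermediate value theorem, on the line of some intermediate ray, against
  \<open>nonactive_rayD\<close>. Applied to - x the same argument shows that no class
  enters.\<close>

lemma Phi_const_on_chamber:
  assumes r: "is_ray r" and \<phi>: "0 < \<phi>" "\<phi> < pi" and na: "\<And>\<psi>. \<psi> \<in> {0..\<phi>} \<Longrightarrow> nonactive_ray Z \<Omega> (rotate_ray \<psi> r)"
    and t: "t \<noteq> 0"
  shows "Phi r t = Phi (rotate_ray \<phi> r) t"
proof -
  obtain c where c: "c \<noteq> 0" "r = ray c" using r by (auto simp: is_ray_iff)
  have im: "Im (z * cnj (cis \<psi> * c)) = Im (cis (- \<psi>) * (z * cnj c))" for z \<psi>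
    by (simp add: cis_cnj[symmetric] mult_ac)
  have pos: "Im (Z (x, 0) * cnj (cis \<phi> * c)) > 0" if x: "x \<in> active" "Im (Z (x, 0) * cnj c) > 0" for x
  proof (rule ccontr)
    assume "\<not> ?thesis"
    then have neg: "Im (cis (- \<phi>) * (Z (x, 0) * cnj c)) \<le> 0" unfolding im by simp
    define a where "a = Z (x, 0) * cnj c"
    have "continuous_on {0..\<phi>} (\<lambda>\<psi>. Im (cis (- \<psi>) * a))" by (intro continuous_intros)
    then obtain \<psi> where \<psi>: "0 \<le> \<psi>" "\<psi> \<le> \<phi>" "Im (cis (- \<psi>) * a) = 0"
      using IVT2'[of "\<lambda>\<psi>. Im (cis (- \<psi>) * a)" \<phi> 0 0] neg x(2) \<phi> by (auto simp: a_def)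
    have "cis \<psi> * c \<noteq> 0" using c by simp
    moreover have "nonactive_ray Z \<Omega> (ray (cis \<psi> * c))"
      using na[of \<psi>] \<psi> unfolding c(2) rotate_ray_ray by simp
    ultimately have "Im (Z (x, 0) * cnj (cis \<psi> * c)) \<noteq> 0" using nonactive_rayD x(1) by blast
    then show False using \<psi>(3) unfolding im a_def by simp
  qed
  have "Im (Z (x, 0) * cnj c) > 0 \<longleftrightarrow> Im (Z (x, 0) * cnj (cis \<phi> * c)) > 0" if x: "x \<in> active" for x
  proof
    assume "Im (Z (x, 0) * cnj (cis \<phi> * c)) > 0"
    moreover have "Im (Z (x, 0) * cnj c) \<noteq> 0"
      by (rule nonactive_rayD[OF _ c(1) x]) (use na[of 0] \<phi> in \<open>simp add: c(2) rotate_ray_ray\<close>)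
    ultimately show "Im (Z (x, 0) * cnj c) > 0"
      using pos[OF uminus_active[OF x]] by (force simp: Z_uminus_e not_less)
  qed (rule pos[OF x])
  then have "left_classes r = left_classes (rotate_ray \<phi> r)"
    using c by (auto simp: c(2) rotate_ray_ray left_classes_ray)
  then show ?thesis unfolding Phi_eq[OF t] Psi_coeff_sigprod[OF t] by simp
qed

text \<open>By finiteness a small rotation does not change the sides of charges off the line of l.
  Charges on l come to lie left of the clockwise perturbation, those on the opposite ray left of the
  anticlockwise one; this is the exchange required by \<open>Phi_jump\<close>.\<close>

lemma wall_crossing:
  assumes l: "active_ray Z \<Omega> l"
  obtains \<epsilon>\<^sub>0 where "\<epsilon>\<^sub>0 > 0" "\<And>\<epsilon>\<^sub>1 \<epsilon>\<^sub>2. 0 < \<epsilon>\<^sub>1 \<Longrightarrow> \<epsilon>\<^sub>1 < \<epsilon>\<^sub>0 \<Longrightarrow> 0 < \<epsilon>\<^sub>2 \<Longrightarrow> \<epsilon>\<^sub>2 < \<epsilon>\<^sub>0 \<Longrightarrow>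
    nonactive_ray Z \<Omega> (rotate_ray (- \<epsilon>\<^sub>1) l) \<and> nonactive_ray Z \<Omega> (rotate_ray \<epsilon>\<^sub>2 l) \<and>
    (\<forall>t\<in>half_plane (rotate_ray (- \<epsilon>\<^sub>1) l) \<inter> half_plane (rotate_ray \<epsilon>\<^sub>2 l).
      Phi (rotate_ray (- \<epsilon>\<^sub>1) l) t = Phi (rotate_ray \<epsilon>\<^sub>2 l) t \<circ> S_q form Z \<Omega> l)"
proof -
  obtain c where c: "c \<noteq> 0" "l = ray c" using l by (auto simp: active_ray_def is_ray_iff)
  define A where "A = (\<lambda>x. Z (x, 0) * cnj c)"
  define s where "s = (\<lambda>x \<epsilon>. sin \<epsilon> * Re (A x) + cos \<epsilon> * Im (A x))"
  have A0: "A x \<noteq> 0" if "x \<in> active" for x using Z_nonzero[OF that] c(1) by (simp add: A_def)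
  have im: "Im (Z (x, 0) * cnj (cis \<epsilon> * c)) = s x (- \<epsilon>)" for x \<epsilon>
    by (simp add: s_def A_def algebra_simps)
  have "\<forall>\<^sub>F \<epsilon> in nhds 0. \<forall>x\<in>active. Im (A x) \<noteq> 0 \<longrightarrow> s x \<epsilon> * Im (A x) > 0"
  proof (rule eventually_ball_finite[OF finite_active], rule ballI)
    fix x assume "x \<in> active"
    show "\<forall>\<^sub>F \<epsilon> in nhds 0. Im (A x) \<noteq> 0 \<longrightarrow> s x \<epsilon> * Im (A x) > 0"
    proof (cases "Im (A x) = 0")
      case False
      have "((\<lambda>\<epsilon>. s x \<epsilon> * Im (A x)) \<longlongrightarrow> (sin 0 * Re (A x) + cos 0 * Im (A x)) * Im (A x)) (nhds 0)"
        unfolding s_def by (intro tendsto_intros filterlim_ident)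
      then have "\<forall>\<^sub>F \<epsilon> in nhds 0. s x \<epsilon> * Im (A x) > 0"
        by (rule order_tendstoD(1)) (use False in \<open>auto simp: zero_less_mult_iff linorder_neq_iff\<close>)
      then show ?thesis by (rule eventually_mono) simp
    qed simp
  qed
  then obtain d where d: "d > 0" "\<And>\<epsilon> x. \<bar>\<epsilon>\<bar> < d \<Longrightarrow> x \<in> active \<Longrightarrow> Im (A x) \<noteq> 0 \<Longrightarrow> s x \<epsilon> * Im (A x) > 0"
    unfolding eventually_nhds_metric by (auto simp: dist_real_def)
  \<comment> \<open>With \<pi> / 2 the sum of two admissible angles is below \<pi> and has positive
    sine, which is used below for the common half-plane.\<close>
  define \<epsilon>\<^sub>0 where "\<epsilon>\<^sub>0 = min d (pi / 2)"
  show ?thesis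
  proof (rule that[of \<epsilon>\<^sub>0])
    show "\<epsilon>\<^sub>0 > 0" using d(1) by (simp add: \<epsilon>\<^sub>0_def)
    fix \<epsilon>\<^sub>1 \<epsilon>\<^sub>2 assume \<epsilon>: "0 < \<epsilon>\<^sub>1" "\<epsilon>\<^sub>1 < \<epsilon>\<^sub>0" "0 < \<epsilon>\<^sub>2" "\<epsilon>\<^sub>2 < \<epsilon>\<^sub>0"
    define c1 c2 where "c1 = cis (- \<epsilon>\<^sub>1) * c" and "c2 = cis \<epsilon>\<^sub>2 * c"
    have cc: "c1 \<noteq> 0" "c2 \<noteq> 0" using c by (auto simp: c1_def c2_def)
    have r: "rotate_ray (- \<epsilon>\<^sub>1) l = ray c1" "rotate_ray \<epsilon>\<^sub>2 l = ray c2"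
      by (simp_all add: c(2) rotate_ray_ray c1_def c2_def)
    have im1: "Im (Z (x, 0) * cnj c1) = s x \<epsilon>\<^sub>1" and im2: "Im (Z (x, 0) * cnj c2) = s x (- \<epsilon>\<^sub>2)" for x
      unfolding c1_def c2_def im by simp_all
    have sin: "sin \<epsilon>\<^sub>1 > 0" "sin \<epsilon>\<^sub>2 > 0" using \<epsilon> by (auto simp: \<epsilon>\<^sub>0_def intro!: sin_gt_zero)
    have off: "s x \<epsilon>\<^sub>1 * Im (A x) > 0" "s x (- \<epsilon>\<^sub>2) * Im (A x) > 0" if "x \<in> active" "Im (A x) \<noteq> 0" for x
      using d(2)[of \<epsilon>\<^sub>1 x] d(2)[of "- \<epsilon>\<^sub>2" x] that \<epsilon> by (auto simp: \<epsilon>\<^sub>0_def)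
    have on: "s x \<epsilon>\<^sub>1 = sin \<epsilon>\<^sub>1 * Re (A x)" "s x (- \<epsilon>\<^sub>2) = - (sin \<epsilon>\<^sub>2 * Re (A x))" if "Im (A x) = 0" for x
      using that by (simp_all add: s_def)
    have Re0: "Re (A x) \<noteq> 0" if "x \<in> active" "Im (A x) = 0" for x
      using A0[OF that(1)] that(2) by (auto simp: complex_eq_iff)
    have nz: "s x \<epsilon>\<^sub>1 \<noteq> 0 \<and> s x (- \<epsilon>\<^sub>2) \<noteq> 0" if "x \<in> active" for x
    proof (cases "Im (A x) = 0")
      case True
      then show ?thesis using on[OF True] Re0[OF that True] sin by simp
    next
      case False
      then show ?thesis using off[OF that False] by auto
    qed
    have na: "nonactive_ray Z \<Omega> (ray c1)" "nonactive_ray Z \<Omega> (ray c2)"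
      by (rule nonactive_rayI[OF cc(1)], unfold im1, use nz in blast,
          rule nonactive_rayI[OF cc(2)], unfold im2, use nz in blast)
    have J: "ray_classes l = {x\<in>active. Im (A x) = 0 \<and> Re (A x) > 0}"
      using mem_ray_iff[OF Z_nonzero c(1)] by (auto simp: ray_classes_def c(2) A_def)
    have J': "uminus ` ray_classes l = {x\<in>active. Im (A x) = 0 \<and> Re (A x) < 0}"
    proof (intro equalityI subsetI)
      fix x assume "x \<in> uminus ` ray_classes l"
      then obtain y where "x = - y" "y \<in> active" "Im (A y) = 0" "Re (A y) > 0" by (auto simp: J)
      then show "x \<in> {x\<in>active. Im (A x) = 0 \<and> Re (A x) < 0}"
        using uminus_active by (simp add: A_def Z_uminus_e)
    next
      fix x assume "x \<in> {x\<in>active. Im (A x) = 0 \<and> Re (A x) < 0}"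
      then have "- x \<in> ray_classes l" using uminus_active by (simp add: J A_def Z_uminus_e)
      then show "x \<in> uminus ` ray_classes l" by (metis add.inverse_inverse image_eqI)
    qed
    define C where "C = {x\<in>active. Im (A x) > 0}"
    have s1: "s x \<epsilon>\<^sub>1 > 0 \<longleftrightarrow> Im (A x) > 0 \<or> Im (A x) = 0 \<and> Re (A x) > 0" if "x \<in> active" for x
      using off(1)[OF that] on(1)[of x] sin by (cases "Im (A x) = 0") (auto simp: zero_less_mult_iff)
    have s2: "s x (- \<epsilon>\<^sub>2) > 0 \<longleftrightarrow> Im (A x) > 0 \<or> Im (A x) = 0 \<and> Re (A x) < 0" if "x \<in> active" for x
      using off(2)[OF that] on(2)[of x] sin by (cases "Im (A x) = 0") (auto simp: zero_less_mult_iff mult_less_0_iff)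
    have p: "left_classes (ray c1) = C \<union> ray_classes l" "C \<inter> ray_classes l = {}"
      unfolding left_classes_ray[OF cc(1)] im1 J C_def using s1 by auto
    have m: "left_classes (ray c2) = C \<union> uminus ` ray_classes l" "C \<inter> uminus ` ray_classes l = {}"
      unfolding left_classes_ray[OF cc(2)] im2 J' C_def using s2 by auto
    have "Phi (ray c1) t = Phi (ray c2) t \<circ> S_q form Z \<Omega> l" if t: "t \<in> half_plane (ray c1) \<inter> half_plane (ray c2)" for t
    proof (rule Phi_jump[OF _ _ p m])
      show t0: "t \<noteq> 0" using t half_plane_nonzero by blast
      define b where "b = t * cnj c"
      have "Re (t * cnj c1) = cos \<epsilon>\<^sub>1 * Re b - sin \<epsilon>\<^sub>1 * Im b" "Re (t * cnj c2) = cos \<epsilon>\<^sub>2 * Re b + sin \<epsilon>\<^sub>2 * Im b"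
        by (simp_all add: c1_def c2_def b_def algebra_simps)
      moreover have "Re (t * cnj c1) > 0" "Re (t * cnj c2) > 0"
        using t half_plane_ray[OF cc(1), of t] half_plane_ray[OF cc(2), of t] by blast+
      ultimately have b: "cos \<epsilon>\<^sub>1 * Re b - sin \<epsilon>\<^sub>1 * Im b > 0" "cos \<epsilon>\<^sub>2 * Re b + sin \<epsilon>\<^sub>2 * Im b > 0"
        by (simp_all only:)
      \<comment> \<open>This combination eliminates Im b: t lies in the half-plane centred on l,
        whence the weights of charges on l have negative imaginary part.\<close>
      have "sin (\<epsilon>\<^sub>1 + \<epsilon>\<^sub>2) * Re b = sin \<epsilon>\<^sub>2 * (cos \<epsilon>\<^sub>1 * Re b - sin \<epsilon>\<^sub>1 * Im b) + sin \<epsilon>\<^sub>1 * (cos \<epsilon>\<^sub>2 * Re b + sin \<epsilon>\<^sub>2 * Im b)"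
        by (simp add: sin_add algebra_simps)
      then have "sin (\<epsilon>\<^sub>1 + \<epsilon>\<^sub>2) * Re b > 0"
        using mult_pos_pos[OF sin(2) b(1)] mult_pos_pos[OF sin(1) b(2)] by linarith
      moreover have "sin (\<epsilon>\<^sub>1 + \<epsilon>\<^sub>2) > 0" using \<epsilon> by (intro sin_gt_zero) (auto simp: \<epsilon>\<^sub>0_def)
      ultimately have Reb: "Re b > 0" by (simp add: zero_less_mult_iff)
      fix x assume "x \<in> ray_classes l"
      then obtain y where y: "y > 0" "Z (x, 0) = of_real y * c" by (auto simp: ray_classes_def c(2) ray_def)
      have "Re (c / t) > 0"
        using Reb t0 by (simp add: Re_div_cnj b_def algebra_simps)
      have w: "wgt x t = - (\<i> * (of_real (y / (2 * pi)) * (c / t)))"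
        using t0 by (simp add: wgt_def y(2) field_simps)
      have "Im (- (\<i> * (complex_of_real a * z))) = - a * Re z" for a z by simp
      from this[of "y / (2 * pi)" "c / t"] have "Im (wgt x t) = - (y / (2 * pi)) * Re (c / t)"
        unfolding w .
      then show "Im (wgt x t) < 0" using y(1) \<open>Re (c / t) > 0\<close> by (simp add: mult_pos_pos divide_pos_pos)
    qed
    then show "nonactive_ray Z \<Omega> (rotate_ray (- \<epsilon>\<^sub>1) l) \<and> nonactive_ray Z \<Omega> (rotate_ray \<epsilon>\<^sub>2 l) \<and>
      (\<forall>t\<in>half_plane (rotate_ray (- \<epsilon>\<^sub>1) l) \<inter> half_plane (rotate_ray \<epsilon>\<^sub>2 l).
        Phi (rotate_ray (- \<epsilon>\<^sub>1) l) t = Phi (rotate_ray \<epsilon>\<^sub>2 l) t \<circ> S_q form Z \<Omega> l)"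
      unfolding r using na by blast
  qed
qed

end

section \<open>Polynomial growth\<close>

text \<open>The two-sided bound in logarithmic form, stable under products and inverses by the
  triangle inequality. R at least 1 keeps ln |t| positive.\<close>

definition pbound :: "complex set \<Rightarrow> (complex \<Rightarrow> complex) \<Rightarrow> bool"
  where "pbound D f \<longleftrightarrow> (\<exists>k\<ge>0. \<exists>R\<ge>1. \<forall>t\<in>D. cmod t > R \<longrightarrow> f t \<noteq> 0 \<and> \<bar>ln (cmod (f t))\<bar> \<le> k * ln (cmod t))"

text \<open>An additive constant is absorbed for |t| > e, where ln |t| is at least 1.\<close>

lemma pboundI:
  assumes "\<And>t. t \<in> D \<Longrightarrow> cmod t > R \<Longrightarrow> f t \<noteq> 0 \<and> \<bar>ln (cmod (f t))\<bar> \<le> k * ln (cmod t) + l"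
  shows "pbound D f"
  unfolding pbound_def
proof (rule exI[of _ "\<bar>k\<bar> + \<bar>l\<bar>"], rule conjI, simp, rule exI[of _ "max R (exp 1)"], intro conjI ballI impI)
  fix t assume t: "t \<in> D" "max R (exp 1) < cmod t"
  have l: "ln (cmod t) \<ge> 1" using t(2) by (subst ln_ge_iff) (auto intro: order_less_trans[OF exp_gt_zero])
  have "\<bar>ln (cmod (f t))\<bar> \<le> k * ln (cmod t) + l" using assms[OF t(1)] t(2) by simp
  also have "\<dots> \<le> \<bar>k\<bar> * ln (cmod t) + \<bar>l\<bar> * ln (cmod t)"
    using l mult_left_mono[OF l, of "\<bar>l\<bar>"] by (intro add_mono mult_right_mono) auto
  finally show "\<bar>ln (cmod (f t))\<bar> \<le> (\<bar>k\<bar> + \<bar>l\<bar>) * ln (cmod t)" by (simp add: distrib_right)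
  show "f t \<noteq> 0" using assms[OF t(1)] t(2) by simp
qed (simp add: le_max_iff_disj)

lemma pbound_mult:
  assumes "pbound D f" "pbound D g" shows "pbound D (\<lambda>t. f t * g t)"
proof -
  obtain k R where k: "R \<ge> 1" "\<And>t. t \<in> D \<Longrightarrow> cmod t > R \<Longrightarrow> f t \<noteq> 0 \<and> \<bar>ln (cmod (f t))\<bar> \<le> k * ln (cmod t)"
    using assms(1) unfolding pbound_def by blast
  obtain k' R' where k': "R' \<ge> 1" "\<And>t. t \<in> D \<Longrightarrow> cmod t > R' \<Longrightarrow> g t \<noteq> 0 \<and> \<bar>ln (cmod (g t))\<bar> \<le> k' * ln (cmod t)"
    using assms(2) unfolding pbound_def by blast
  show ?thesis
  proof (rule pboundI[of D "max R R'" _ "k + k'" 0])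
    fix t assume t: "t \<in> D" "max R R' < cmod t"
    then have "f t \<noteq> 0 \<and> \<bar>ln (cmod (f t))\<bar> \<le> k * ln (cmod t)" "g t \<noteq> 0 \<and> \<bar>ln (cmod (g t))\<bar> \<le> k' * ln (cmod t)"
      using k(2) k'(2) by auto
    then show "f t * g t \<noteq> 0 \<and> \<bar>ln (cmod (f t * g t))\<bar> \<le> (k + k') * ln (cmod t) + 0"
      using abs_triangle_ineq[of "ln (cmod (f t))" "ln (cmod (g t))"]
      by (auto simp: norm_mult ln_mult distrib_right)
  qed
qed

lemma pbound_inverse: "pbound D f \<Longrightarrow> pbound D (\<lambda>t. inverse (f t))"
  unfolding pbound_def by (auto simp: norm_inverse ln_inverse)

lemma pbound_const: "c \<noteq> 0 \<Longrightarrow> pbound D (\<lambda>t. c)"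
  by (rule pboundI[of D 1 _ 0 "\<bar>ln (cmod c)\<bar>"]) auto

lemma pbound_power_int: "pbound D f \<Longrightarrow> pbound D (\<lambda>t. f t powi k)"
proof -
  have pow: "pbound D (\<lambda>t. g t ^ n)" if "pbound D g" for g n
    by (induction n) (auto intro: pbound_const pbound_mult that)
  assume "pbound D f"
  then show ?thesis by (cases "k \<ge> 0") (auto simp: power_int_def intro: pow pbound_inverse)
qed

lemma pbound_prod: "(\<And>i. i \<in> A \<Longrightarrow> pbound D (f i)) \<Longrightarrow> pbound D (\<lambda>t. \<Prod>i\<in>A. f i t)"
  by (induction A rule: infinite_finite_induct) (auto intro: pbound_const pbound_mult)

lemma pbound_exp_div: "pbound D (\<lambda>t. exp (a / t))"
proof (rule pboundI[of D 1 _ 0 "cmod a"])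
  fix t :: complex assume "t \<in> D" "1 < cmod t"
  then have "cmod (a / t) \<le> cmod a" by (simp add: norm_divide divide_le_eq mult_left_mono[of 1 "cmod t", simplified])
  then show "exp (a / t) \<noteq> 0 \<and> \<bar>ln (cmod (exp (a / t)))\<bar> \<le> 0 * ln (cmod t) + cmod a"
    using abs_Re_le_cmod[of "a / t"] by simp
qed

text \<open>In the power w^(1/2 - \<eta> - w) with w = a / t the exponent is bounded for |t| > 1,
  and |Ln w| is at most ln |t| plus a constant.\<close>

lemma pbound_Lexp:
  assumes a: "a \<noteq> 0"
  shows "pbound D (\<lambda>t. Lexp (a / t) \<eta>)"
proof -
  define K where "K = cmod (1 / 2 - \<eta>) + cmod a"
  have "pbound D (\<lambda>t. (a / t) powr (1 / 2 - \<eta> - a / t))"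
  proof (rule pboundI[of D 1 _ K "K * (\<bar>ln (cmod a)\<bar> + pi)"])
    fix t :: complex assume t: "t \<in> D" "1 < cmod t"
    define w where "w = a / t"
    have t0: "t \<noteq> 0" using t(2) by auto
    then have w0: "w \<noteq> 0" using a by (simp add: w_def)
    have "cmod w \<le> cmod a" using t(2) by (simp add: w_def norm_divide divide_le_eq mult_left_mono[of 1 "cmod t", simplified])
    then have wK: "cmod (1 / 2 - \<eta> - w) \<le> K"
      using norm_triangle_ineq4[of "1 / 2 - \<eta>" w] by (simp add: K_def)
    have "cmod (Ln w) \<le> \<bar>Re (Ln w)\<bar> + \<bar>Im (Ln w)\<bar>" by (rule cmod_le)
    also have "\<bar>Re (Ln w)\<bar> = \<bar>ln (cmod a) - ln (cmod t)\<bar>" using w0 a t0 by (simp add: w_def norm_divide ln_div)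
    also have "\<dots> \<le> \<bar>ln (cmod a)\<bar> + ln (cmod t)"
      using abs_triangle_ineq4[of "ln (cmod a)" "ln (cmod t)"] ln_gt_zero[OF t(2)] by simp
    also have "\<bar>Im (Ln w)\<bar> \<le> pi" using mpi_less_Im_Ln[OF w0] Im_Ln_le_pi[OF w0] by (simp add: abs_if)
    finally have L: "cmod (Ln w) \<le> \<bar>ln (cmod a)\<bar> + ln (cmod t) + pi" by simp
    have "\<bar>Re ((1 / 2 - \<eta> - w) * Ln w)\<bar> \<le> cmod (1 / 2 - \<eta> - w) * cmod (Ln w)"
      using abs_Re_le_cmod[of "(1 / 2 - \<eta> - w) * Ln w"] by (simp only: norm_mult)
    also have "\<dots> \<le> K * (\<bar>ln (cmod a)\<bar> + ln (cmod t) + pi)"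
      using wK L by (intro mult_mono) (auto simp: K_def)
    finally have "\<bar>Re ((1 / 2 - \<eta> - w) * Ln w)\<bar> \<le> K * ln (cmod t) + K * (\<bar>ln (cmod a)\<bar> + pi)"
      by (simp add: algebra_simps)
    then have "w powr (1 / 2 - \<eta> - w) \<noteq> 0 \<and> \<bar>ln (cmod (w powr (1 / 2 - \<eta> - w)))\<bar> \<le> K * ln (cmod t) + K * (\<bar>ln (cmod a)\<bar> + pi)"
      using w0 unfolding powr_def by simp
    then show "(a / t) powr (1 / 2 - \<eta> - a / t) \<noteq> 0 \<and> \<bar>ln (cmod ((a / t) powr (1 / 2 - \<eta> - a / t)))\<bar>
        \<le> K * ln (cmod t) + K * (\<bar>ln (cmod a)\<bar> + pi)" unfolding w_def .
  qed
  then show ?thesis unfolding Lexp_def by (intro pbound_mult pbound_exp_div pbound_const) simp_all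
qed

lemma pbound_of_line_growth:
  assumes c: "c > 0" and e: "e > 0" and \<alpha>: "\<alpha> \<noteq> 0"
    and b: "\<And>s. s \<in> ball 0 e - {0} \<Longrightarrow> c * cmod s ^ n \<le> cmod (b s) \<and> cmod (b s) * (c * cmod s ^ n) \<le> 1"
  shows "pbound D (\<lambda>t. b (\<alpha> / t))"
proof (rule pboundI[of D "max 1 (cmod \<alpha> / e)" _ "real n" "\<bar>ln c\<bar> + real n * \<bar>ln (cmod \<alpha>)\<bar>"])
  fix t assume "t \<in> D" "max 1 (cmod \<alpha> / e) < cmod t"
  then have t: "cmod t > 1" "cmod \<alpha> / e < cmod t" by auto
  then have t0: "t \<noteq> 0" by auto
  define y where "y = c * cmod (\<alpha> / t) ^ n"
  have y: "y > 0" using c \<alpha> t0 by (simp add: y_def)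
  have "\<alpha> / t \<in> ball 0 e - {0}" using t(2) \<alpha> t0 e by (simp add: norm_divide field_simps)
  then have yb: "y \<le> cmod (b (\<alpha> / t))" "cmod (b (\<alpha> / t)) * y \<le> 1" using b unfolding y_def by blast+
  then have bp: "cmod (b (\<alpha> / t)) > 0" using y by linarith
  have "ln y = ln c + real n * (ln (cmod \<alpha>) - ln (cmod t))"
    using c \<alpha> t0 by (simp add: y_def ln_mult ln_realpow norm_divide ln_div)
  moreover have "\<bar>real n * (ln (cmod \<alpha>) - ln (cmod t))\<bar> \<le> real n * (\<bar>ln (cmod \<alpha>)\<bar> + ln (cmod t))"
    unfolding abs_mult using abs_triangle_ineq4[of "ln (cmod \<alpha>)" "ln (cmod t)"] ln_gt_zero[OF t(1)]
    by (intro mult_mono) auto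
  ultimately have ly: "\<bar>ln y\<bar> \<le> real n * ln (cmod t) + (\<bar>ln c\<bar> + real n * \<bar>ln (cmod \<alpha>)\<bar>)"
    by (simp add: algebra_simps)
  have "ln y \<le> ln (cmod (b (\<alpha> / t)))" using yb(1) y bp by simp
  moreover have "ln (cmod (b (\<alpha> / t)) * y) \<le> ln 1" using yb(2) y bp by (subst ln_le_cancel_iff) auto
  then have "ln (cmod (b (\<alpha> / t))) + ln y \<le> 0" using y bp by (simp add: ln_mult)
  ultimately have "\<bar>ln (cmod (b (\<alpha> / t)))\<bar> \<le> \<bar>ln y\<bar>" by linarith
  with ly bp show "b (\<alpha> / t) \<noteq> 0 \<and> \<bar>ln (cmod (b (\<alpha> / t)))\<bar> \<le> real n * ln (cmod t) + (\<bar>ln c\<bar> + real n * \<bar>ln (cmod \<alpha>)\<bar>)"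
    by auto
qed

lemma pbound_powr:
  assumes "pbound D f"
  obtains k R where "k > 0" "R > 0" "\<forall>t\<in>D. cmod t > R \<longrightarrow>
    cmod t powr (- k) < cmod (f t) \<and> cmod (f t) < cmod t powr k"
proof -
  obtain k R where k: "k \<ge> 0" "R \<ge> 1" "\<And>t. t \<in> D \<Longrightarrow> cmod t > R \<Longrightarrow> f t \<noteq> 0 \<and> \<bar>ln (cmod (f t))\<bar> \<le> k * ln (cmod t)"
    using assms unfolding pbound_def by blast
  show ?thesis
  \<comment> \<open>The extra 1 makes the exponent positive and, as ln |t| > 0, the inequalities
    strict.\<close>
  proof (rule that[of "k + 1" R], simp add: k(1) add_nonneg_pos, use k(2) in simp, intro ballI impI)
    fix t assume t: "t \<in> D" "cmod t > R"
    have f: "cmod (f t) > 0" "\<bar>ln (cmod (f t))\<bar> \<le> k * ln (cmod t)" using k(3)[OF t] by auto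
    have t1: "cmod t > 1" using t k(2) by linarith
    then have "ln (cmod t) > 0" by (rule ln_gt_zero)
    then have "\<bar>ln (cmod (f t))\<bar> < (k + 1) * ln (cmod t)" using f(2) by (simp add: distrib_right)
    then have "- ((k + 1) * ln (cmod t)) < ln (cmod (f t))" "ln (cmod (f t)) < (k + 1) * ln (cmod t)"
      by linarith+
    then have "- (k + 1) * ln (cmod t) < ln (cmod (f t))" "ln (cmod (f t)) < (k + 1) * ln (cmod t)"
      unfolding mult_minus_left .
    moreover have "cmod t powr a = exp (a * ln (cmod t))" for a using t1 by (auto simp: powr_def)
    moreover have "cmod (f t) = exp (ln (cmod (f t)))" using f(1) by simp
    ultimately show "cmod t powr (- (k + 1)) < cmod (f t) \<and> cmod (f t) < cmod t powr (k + 1)"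
      by (metis exp_less_cancel_iff)
  qed
qed

section \<open>Limits and growth of the solution\<close>

text \<open>As t runs through the open right half-plane, |arg(a / t)| stays below \<pi> / 2 + |arg
  a| < \<pi>. One sector thus serves for all t, including tangential approach to 0; the parameter
  |Im a| / |a| is sin |arg a|.\<close>

lemma quotient_sector:
  assumes a: "Re a > 0" and t: "Re t > 0"
  shows "a / t \<in> sector (\<bar>Im a\<bar> / cmod a)"
proof -
  have a0: "cmod a > 0" and t0: "cmod t > 0" using a t by auto
  have "\<bar>Im a * Im t\<bar> \<le> \<bar>Im a\<bar> * cmod t"
    unfolding abs_mult by (intro mult_left_mono abs_Im_le_cmod) auto
  then have "Im a * Im t \<ge> - (\<bar>Im a\<bar> * cmod t)" by linarith
  moreover have "Re a * Re t > 0" using a t by simp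
  ultimately have "Re (a * cnj t) \<ge> - (\<bar>Im a\<bar> * cmod t)" by simp
  then have "Re (a * cnj t) / (cmod t)\<^sup>2 \<ge> - (\<bar>Im a\<bar> * cmod t) / (cmod t)\<^sup>2"
    by (intro divide_right_mono) auto
  also have "Re (a * cnj t) / (cmod t)\<^sup>2 = Re (a / t)"
    by (simp add: complex_div_cnj[of a t] flip: of_real_power)
  finally show ?thesis
    using a0 t0 by (auto simp: sector_def norm_divide power2_eq_square)
qed

lemma tendsto_power_int_1:
  fixes f :: "'a \<Rightarrow> complex"
  assumes "(f \<longlongrightarrow> 1) F" shows "((\<lambda>x. f x powi k) \<longlongrightarrow> 1) F"
proof -
  have "((\<lambda>x. f x powi k) \<longlongrightarrow> 1 powi k) F" by (intro tendsto_intros assms) simp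
  then show ?thesis by simp
qed

lemma tendsto_prod_1:
  fixes f :: "'i \<Rightarrow> 'a \<Rightarrow> complex"
  assumes "\<And>i. i \<in> A \<Longrightarrow> (f i \<longlongrightarrow> 1) F" shows "((\<lambda>x. \<Prod>i\<in>A. f i x) \<longlongrightarrow> 1) F"
proof -
  have "((\<lambda>x. \<Prod>i\<in>A. f i x) \<longlongrightarrow> (\<Prod>i\<in>A. 1)) F" by (intro tendsto_prod assms)
  then show ?thesis by simp
qed

context electric_BPS
begin

definition gam_fun :: "complex set \<Rightarrow> 'm \<Rightarrow> complex \<times> 'e cdual \<Rightarrow> complex"
  where "gam_fun r \<beta> p = (\<Prod>x\<in>left_classes r. \<Prod>\<nu>\<in>odd_range (pair \<beta> x). \<Prod>n\<in>degs x.
    Gamma (Eta x n \<nu> p) powi (expo x n * sgn (pair \<beta> x)))"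

definition elem_fun :: "complex set \<Rightarrow> 'm \<Rightarrow> complex \<times> 'e cdual \<times> complex \<Rightarrow> complex"
  where "elem_fun r \<beta> q = (\<Prod>x\<in>left_classes r. \<Prod>\<nu>\<in>odd_range (pair \<beta> x). \<Prod>n\<in>degs x.
    Lexp (wgt x (snd (snd q))) (Eta x n \<nu> (fst q, fst (snd q))) powi (expo x n * sgn (pair \<beta> x)))"

text \<open>The parameter s on the line through (\<tau>, \<theta>) in the direction
  \<open>(0, Z_e Z)\<close>; t at infinity corresponds to s = 0.\<close>

definition slope :: "complex \<Rightarrow> complex"
  where "slope t = (- 1 / (2 * of_real pi * \<i>)) / t"

abbreviation sh :: "complex \<times> 'e cdual \<times> complex \<Rightarrow> complex \<times> 'e cdual"
  where "sh \<equiv> shift_map slope (Z_e Z)"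

lemma Eta_sh: "Eta x n \<nu> (sh q) = wgt x (snd (snd q)) + Eta x n \<nu> (fst q, fst (snd q))"
  by (simp add: Eta_def shift_map_def Z_e_apply wgt_def slope_def)

text \<open>The arguments of the \<open>Gamma\<close> factors depend on \<open>t\<close> only through the translation of \<open>\<theta>\<close> that also
  occurs in \<open>\<epsilon>\<^sub>Z(t)\<close>; the remaining factor has neither zeros nor poles.\<close>

lemma Psi_fun_split: "Psi_fun r \<beta> t p = gam_fun r \<beta> (sh (slice_map t p)) * elem_fun r \<beta> (slice_map t p)"
  unfolding Psi_fun_def gam_fun_def elem_fun_def Eta_sh prod.distrib[symmetric] power_int_mult_distrib[symmetric]
  by (simp add: Lambda_Gamma_Lexp slice_map_def)

lemma sh_slice: "sh (slice_map t p) = shear (- charge_shift t) 0 p"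
  unfolding shift_map_slice charge_shift_def scaleC_minus_left[symmetric] by (simp add: slope_def)

lemma mero_on_gam_fun: "mero_on mero_dom (gam_fun r \<beta>)"
  unfolding gam_fun_def[abs_def]
  using mero_on_Gamma_Eta[of 0]
  by (intro mero_on_prod open_mero_dom mero_on_power_int connected_mero_dom) simp

text \<open>Multiplying by the conjugate of a direction of r reduces to the right half-plane; a
  class to the left of r gives Re a > 0.\<close>

lemma wgt_sector:
  assumes r: "is_ray r" and x: "x \<in> left_classes r"
  obtains \<kappa> where "0 \<le> \<kappa>" "\<kappa> < 1" "\<forall>t\<in>half_plane r. wgt x t \<in> sector \<kappa>"
proof -
  obtain c where c: "c \<noteq> 0" "r = ray c" using r by (auto simp: is_ray_iff)
  define a where "a = of_real (1 / (2 * pi)) * (- \<i> * (Z (x, 0) * cnj c))"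
  have "Im (Z (x, 0) * cnj c) > 0" using x unfolding c(2) left_classes_ray[OF c(1)] by simp
  moreover have "Re (complex_of_real k * (- \<i> * z)) = k * Im z" for k z by simp
  then have "Re a = 1 / (2 * pi) * Im (Z (x, 0) * cnj c)" unfolding a_def .
  ultimately have a: "Re a > 0" by simp
  show ?thesis
  proof (rule that)
    show "0 \<le> \<bar>Im a\<bar> / cmod a" by simp
    have "(Im a)\<^sup>2 < (cmod a)\<^sup>2" using a by (simp add: cmod_power2)
    then have "\<bar>Im a\<bar> < cmod a" by (metis abs_le_square_iff abs_norm_cancel not_less)
    then show "\<bar>Im a\<bar> / cmod a < 1" using a by (auto simp: divide_less_eq)
    show "\<forall>t\<in>half_plane r. wgt x t \<in> sector (\<bar>Im a\<bar> / cmod a)"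
    proof
      fix t assume t: "t \<in> half_plane r"
      then have "Re (t * cnj c) > 0" using half_plane_ray[OF c(1), of t] c(2) by blast
      from quotient_sector[OF a this]
      have "a / (t * cnj c) \<in> sector (\<bar>Im a\<bar> / cmod a)" .
      also have "a / (t * cnj c) = wgt x t"
        using c(1) half_plane_nonzero[OF t] by (simp add: a_def wgt_def field_simps)
      finally show "wgt x t \<in> sector (\<bar>Im a\<bar> / cmod a)" .
    qed
  qed
qed

lemma open_half_plane: "is_ray r \<Longrightarrow> open (half_plane r)"
proof -
  assume "is_ray r"
  then obtain c where c: "c \<noteq> 0" "r = ray c" by (auto simp: is_ray_iff)
  have "half_plane r = {t. 0 < Re (t * cnj c)}" using half_plane_ray[OF c(1)] c(2) by auto
  also have "open \<dots>" by (intro open_Collect_less continuous_intros)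
  finally show ?thesis .
qed

lemma slope_holo: "slope holomorphic_on half_plane r"
  unfolding slope_def[abs_def]
  using half_plane_nonzero by (intro holomorphic_intros) auto

lemma holo_on_t: "open S \<Longrightarrow> holo_on S (\<lambda>q::complex \<times> 'e cdual \<times> complex. snd (snd q))"
  by (rule holo_on_linear[OF bounded_linear_compose[OF bounded_linear_snd bounded_linear_snd]])
     (simp_all add: scaleC_prod_def scaleC_complex_def)

lemma fam_half_plane_t:
  assumes r: "is_ray r" and \<phi>: "\<phi> holomorphic_on half_plane r"
  shows "holo_on (fam_dom (half_plane r)) (\<lambda>q::complex \<times> 'e cdual \<times> complex. \<phi> (snd (snd q)))"
  by (rule holo_on_compose_complex[OF holo_on_t \<phi>])
     (use open_half_plane[OF r] open_fam_dom in auto)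

text \<open>By \<open>wgt_sector\<close> the weights avoid the branch cut for all t in the
  half-plane, so the principal powers are holomorphic in t.\<close>

lemma holo_on_elem_fun:
  assumes r: "is_ray r" shows "holo_on (fam_dom (half_plane r)) (elem_fun r \<beta>)"
proof -
  have op: "open (fam_dom (half_plane r) :: (complex \<times> 'e cdual \<times> complex) set)"
    by (rule open_fam_dom[OF open_half_plane[OF r]])
  have "holo_on (fam_dom (half_plane r)) (\<lambda>q::complex \<times> 'e cdual \<times> complex.
      Lexp (wgt x (snd (snd q))) (Eta x n \<nu> (fst q, fst (snd q))))"
    if x: "x \<in> left_classes r" for x n \<nu>
  proof -
    obtain \<kappa> where \<kappa>: "0 \<le> \<kappa>" "\<kappa> < 1" "\<forall>t\<in>half_plane r. wgt x t \<in> sector \<kappa>"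
      by (rule wgt_sector[OF r x])
    have np: "wgt x t \<notin> \<real>\<^sub>\<le>\<^sub>0" if "t \<in> half_plane r" for t
      by (rule sector_not_nonpos_Reals[OF \<kappa>(3)[rule_format, OF that] \<kappa>(2)])
    have wh: "wgt x holomorphic_on half_plane r"
      unfolding wgt_def[abs_def] using half_plane_nonzero by (intro holomorphic_intros) auto
    have "(\<lambda>t. Ln (wgt x t)) holomorphic_on half_plane r"
      using np by (intro holomorphic_on_Ln' wh) auto
    note L = fam_half_plane_t[OF r this] and W = fam_half_plane_t[OF r wh]
    have E: "holo_on (fam_dom (half_plane r)) (\<lambda>q. Eta x n \<nu> (fst q, fst (snd q)))"
    proof (rule holo_on_comp[OF holo_on_Eta[OF open_UNIV] op])
      fix q :: "complex \<times> 'e cdual \<times> complex"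
      have "((\<lambda>q::complex \<times> 'e cdual \<times> complex. (fst q, fst (snd q))) has_derivative (\<lambda>q. (fst q, fst (snd q)))) (at q)"
        by (auto intro!: derivative_eq_intros)
      then show "\<exists>D. ((\<lambda>q::complex \<times> 'e cdual \<times> complex. (fst q, fst (snd q))) has_derivative D) (at q) \<and>
          (\<forall>c v. D (scaleC c v) = scaleC c (D v))"
        by (intro exI[of _ "\<lambda>q. (fst q, fst (snd q))"]) (simp add: scaleC_prod_def)
    qed simp
    have "holo_on (fam_dom (half_plane r)) (\<lambda>q::complex \<times> 'e cdual \<times> complex.
        exp (wgt x (snd (snd q))) * (2 * of_real pi) powr (- 1 / 2) *
        exp ((1 / 2 - Eta x n \<nu> (fst q, fst (snd q)) - wgt x (snd (snd q))) * Ln (wgt x (snd (snd q)))))"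
      by (intro holo_on_mult holo_on_const op holo_on_compose_complex[of _ _ exp UNIV] W holomorphic_on_exp
          open_UNIV UNIV_I holo_on_diff E L)
    then show ?thesis
    proof (rule holo_on_cong)
      fix q :: "complex \<times> 'e cdual \<times> complex" assume "q \<in> fam_dom (half_plane r)"
      then have "wgt x (snd (snd q)) \<noteq> 0" using np[of "snd (snd q)"] by auto
      then show "exp (wgt x (snd (snd q))) * (2 * of_real pi) powr (- 1 / 2) *
          exp ((1 / 2 - Eta x n \<nu> (fst q, fst (snd q)) - wgt x (snd (snd q))) * Ln (wgt x (snd (snd q))))
          = Lexp (wgt x (snd (snd q))) (Eta x n \<nu> (fst q, fst (snd q)))"
        unfolding Lexp_def powr_def[of "wgt _ _"] by simp
    qed
  qed
  moreover have "Lexp (wgt x (snd (snd q))) \<eta> \<noteq> 0"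
    if "x \<in> left_classes r" "q \<in> fam_dom (half_plane r)" for x \<eta> and q :: "complex \<times> 'e cdual \<times> complex"
    using wgt_nonzero[OF left_classes_active[OF that(1)] half_plane_nonzero[of "snd (snd q)" r]] that(2)
    by (intro Lexp_nonzero) auto
  ultimately show ?thesis
    unfolding elem_fun_def[abs_def] by (intro holo_on_prod op holo_on_power_int)
qed

lemma elem_fun_nonzero:
  assumes "t \<in> half_plane r" shows "elem_fun r \<beta> (\<tau>, \<theta>, t) \<noteq> 0"
  unfolding elem_fun_def using finite_left_classes half_plane_nonzero[OF assms]
  by (auto simp: prod_zero_iff intro: Lexp_nonzero wgt_nonzero left_classes_active dest: Lexp_nonzero[OF wgt_nonzero[OF left_classes_active]])

text \<open>Coefficient families consist of total functions, so one representative of each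
  coefficient is fixed.\<close>

definition rep :: "('e, 'm) qtorus \<Rightarrow> 'm \<Rightarrow> complex \<times> 'e cdual \<Rightarrow> complex"
  where "rep a \<delta> = (SOME f. mero_on mero_dom f \<and> mero_of f = Poly_Mapping.lookup a \<delta>)"

lemma rep: "mero_on mero_dom (rep a \<delta>)" "mero_of (rep a \<delta>) = Poly_Mapping.lookup a \<delta>"
proof -
  have "\<exists>f. mero_on mero_dom f \<and> mero_of f = Poly_Mapping.lookup a \<delta>"
    by (rule mero_cases[of "Poly_Mapping.lookup a \<delta>"]) auto
  from someI_ex[OF this] show "mero_on mero_dom (rep a \<delta>)" "mero_of (rep a \<delta>) = Poly_Mapping.lookup a \<delta>"
    by (auto simp: rep_def)
qed

text \<open>Off the support of a the family is literally the zero function, as the finiteness in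
  \<open>coeff_family\<close> concerns functions, not their classes. The trivial
  \<open>shift_map\<close> regards \<open>rep a \<delta>\<close> as independent of t, in a form to
  which \<open>fam_shift\<close> applies.\<close>

definition lim_fam :: "complex set \<Rightarrow> ('e, 'm) qtorus \<Rightarrow> 'm \<Rightarrow> complex \<times> 'e cdual \<times> complex \<Rightarrow> complex"
  where "lim_fam r a \<delta> = (if \<delta> \<in> Poly_Mapping.keys a then
    (\<lambda>q. rep a \<delta> (shift_map (\<lambda>t. 0) 0 q) * (gam_fun r \<delta> (sh q) * elem_fun r \<delta> q)) else (\<lambda>_. 0))"

definition sol_fam :: "complex set \<Rightarrow> ('e, 'm) qtorus \<Rightarrow> 'm \<Rightarrow> complex \<times> 'e cdual \<times> complex \<Rightarrow> complex"
  where "sol_fam r a \<delta> = (if \<delta> \<in> Poly_Mapping.keys a then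
    (\<lambda>q. (rep a \<delta> (sh q) * gam_fun r \<delta> (sh q)) * (exp (- Z (0, \<delta>) / snd (snd q)) * elem_fun r \<delta> q)) else (\<lambda>_. 0))"

lemma coeff_family_lim:
  assumes r: "is_ray r"
  shows "coeff_family (half_plane r) (\<lambda>t. (Phi r t \<circ> eps_Z Z t) a) (lim_fam r a)"
proof (rule coeff_familyI)
  show "finite {\<delta>. lim_fam r a \<delta> \<noteq> (\<lambda>_. 0)}"
    by (rule finite_subset[OF _ finite_keys[of a]]) (auto simp: lim_fam_def)
  have zero: "fam (half_plane r) (\<lambda>_::complex \<times> 'e cdual \<times> complex. 0)"
    by (rule fam_holo[OF holo_on_const[OF open_fam_dom[OF open_half_plane[OF r]]]])
  show "fam (half_plane r) (lim_fam r a \<delta>)" for \<delta>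
    using fam_mult[OF fam_shift[OF open_half_plane[OF r] holomorphic_on_const rep(1)]
        fam_mult[OF fam_shift[OF open_half_plane[OF r] slope_holo mero_on_gam_fun] fam_holo[OF holo_on_elem_fun[OF r]]]]
      zero
    by (simp add: lim_fam_def)
  fix t \<delta> assume "t \<in> half_plane r"
  then have t: "t \<noteq> 0" by (rule half_plane_nonzero)
  have "Poly_Mapping.lookup ((Phi r t \<circ> eps_Z Z t) a) \<delta> = mero_of (\<lambda>p. Psi_fun r \<delta> t p * rep a \<delta> p)"
    unfolding Phi_eps[OF t] lookup_qdiag Psi_coeff_eq mero_shear_id rep(2)[of a, symmetric]
    by (rule mero_of_mult[OF mero_on_Psi_fun[OF t] rep(1)])
  also have "\<dots> = mero_of (\<lambda>p. lim_fam r a \<delta> (slice_map t p))"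
  proof (cases "\<delta> \<in> Poly_Mapping.keys a")
    case True
    then show ?thesis by (simp add: lim_fam_def Psi_fun_split shift_map_slice shear_zero mult_ac)
  next
    case False
    then have "mero_of (rep a \<delta>) = 0" by (simp add: rep(2) in_keys_iff)
    then have "mero_of (Psi_fun r \<delta> t) * mero_of (rep a \<delta>) = 0" by simp
    then show ?thesis
      using False by (simp add: lim_fam_def mero_of_mult[OF mero_on_Psi_fun[OF t] rep(1)] mero_of_zero)
  qed
  finally show "Poly_Mapping.lookup ((Phi r t \<circ> eps_Z Z t) a) \<delta> = mero_of (\<lambda>p. lim_fam r a \<delta> (slice_map t p))" .
qed

lemma coeff_family_sol:
  assumes r: "is_ray r"
  shows "coeff_family (half_plane r) (\<lambda>t. Phi r t a) (sol_fam r a)"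
proof (rule coeff_familyI)
  show "finite {\<delta>. sol_fam r a \<delta> \<noteq> (\<lambda>_. 0)}"
    by (rule finite_subset[OF _ finite_keys[of a]]) (auto simp: sol_fam_def)
  have "(\<lambda>t. exp (- Z (0, \<delta>) / t)) holomorphic_on half_plane r" for \<delta>
    using half_plane_nonzero by (intro holomorphic_intros) auto
  from fam_half_plane_t[OF r this]
  have e: "holo_on (fam_dom (half_plane r)) (\<lambda>q::complex \<times> 'e cdual \<times> complex. exp (- Z (0, \<delta>) / snd (snd q)))" for \<delta> .
  have zero: "fam (half_plane r) (\<lambda>_::complex \<times> 'e cdual \<times> complex. 0)"
    by (rule fam_holo[OF holo_on_const[OF open_fam_dom[OF open_half_plane[OF r]]]])
  show "fam (half_plane r) (sol_fam r a \<delta>)" for \<delta>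
    using fam_mult[OF fam_mult[OF fam_shift[OF open_half_plane[OF r] slope_holo rep(1)]
          fam_shift[OF open_half_plane[OF r] slope_holo mero_on_gam_fun]]
        fam_holo[OF holo_on_mult[OF e holo_on_elem_fun[OF r]]]]
      zero
    by (simp add: sol_fam_def)
  fix t \<delta> assume "t \<in> half_plane r"
  then have t: "t \<noteq> 0" by (rule half_plane_nonzero)
  have m: "mero_on mero_dom (\<lambda>p. rep a \<delta> (shear (- charge_shift t) 0 p))" by (rule mero_on_shear[OF rep(1)])
  have mp: "mero_on mero_dom (\<lambda>p. Psi_fun r \<delta> t p * exp (- Z (0, \<delta>) / t))"
    by (intro mero_on_mult mero_on_Psi_fun[OF t] mero_on_const open_mero_dom)
  have lk: "Poly_Mapping.lookup (Phi r t a) \<delta> = mero_of (\<lambda>p. Psi_fun r \<delta> t p * exp (- Z (0, \<delta>) / t)) *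
      mero_of (\<lambda>p. rep a \<delta> (shear (- charge_shift t) 0 p))"
    unfolding Phi_eq[OF t] lookup_qdiag Psi_coeff_eq rep(2)[of a, symmetric] mero_of_shear[OF rep(1)] mero_of_const
    by (simp only: mero_of_mult[OF mero_on_Psi_fun[OF t] mero_on_const[OF open_mero_dom]])
  show "Poly_Mapping.lookup (Phi r t a) \<delta> = mero_of (\<lambda>p. sol_fam r a \<delta> (slice_map t p))"
  proof (cases "\<delta> \<in> Poly_Mapping.keys a")
    case True
    then show ?thesis unfolding lk mero_of_mult[OF mp m]
      by (simp add: sol_fam_def Psi_fun_split sh_slice[unfolded slice_map_def] slice_map_def mult_ac)
  next
    case False
    then have "mero_of (rep a \<delta>) = 0" by (simp add: rep(2) in_keys_iff)
    then have "mero_of (\<lambda>p. rep a \<delta> (shear (- charge_shift t) 0 p)) = 0"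
      using mero_of_shear[OF rep(1), of "- charge_shift t" 0 a \<delta>] by simp
    then show ?thesis using False unfolding lk by (simp add: sol_fam_def mero_of_zero[symmetric])
  qed
qed

section \<open>Behaviour as t tends to 0\<close>

lemma Lambda_wgt_limit:
  assumes r: "is_ray r" and x: "x \<in> left_classes r"
  shows "((\<lambda>t. Lambda (wgt x t) \<eta>) \<longlongrightarrow> 1) (at 0 within half_plane r)"
proof (rule tendstoI)
  fix e :: real assume e: "e > 0"
  obtain \<kappa> where \<kappa>: "0 \<le> \<kappa>" "\<kappa> < 1" "\<forall>t\<in>half_plane r. wgt x t \<in> sector \<kappa>"
    by (rule wgt_sector[OF r x])
  obtain R where R: "R > 0" "\<And>w. w \<in> sector \<kappa> \<Longrightarrow> cmod w > R \<Longrightarrow> cmod (Lambda w \<eta> - 1) \<le> e / 2"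
    by (rule Lambda_sector_limit[OF \<kappa>(1,2), of "e / 2" \<eta>]) (use e in auto)
  have Z0: "Z (x, 0) \<noteq> 0" by (rule Z_nonzero[OF left_classes_active[OF x]])
  show "\<forall>\<^sub>F t in at 0 within half_plane r. dist (Lambda (wgt x t) \<eta>) 1 < e"
    unfolding eventually_at
  proof (intro exI[of _ "cmod (Z (x, 0)) / (2 * pi * R)"] conjI ballI impI)
    show "0 < cmod (Z (x, 0)) / (2 * pi * R)" using Z0 R(1) by simp
    fix t assume t: "t \<in> half_plane r" "t \<noteq> 0 \<and> dist t 0 < cmod (Z (x, 0)) / (2 * pi * R)"
    have "cmod (wgt x t) = cmod (Z (x, 0)) / (2 * pi * cmod t)" by (simp add: wgt_def norm_divide norm_mult)
    moreover have "R < cmod (Z (x, 0)) / (2 * pi * cmod t)" using t(2) R(1) by (simp add: field_simps)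
    ultimately have "cmod (Lambda (wgt x t) \<eta> - 1) \<le> e / 2" by (intro R(2) \<kappa>(3)[rule_format] t(1)) simp
    then show "dist (Lambda (wgt x t) \<eta>) 1 < e" using e by (simp add: dist_norm)
  qed
qed

lemma Psi_fun_limit:
  assumes r: "is_ray r"
  shows "((\<lambda>t. Psi_fun r \<beta> t p) \<longlongrightarrow> 1) (at 0 within half_plane r)"
  unfolding Psi_fun_def by (intro tendsto_prod_1 tendsto_power_int_1 Lambda_wgt_limit r)

text \<open>A holomorphic function that vanishes where some Gamma factor has a pole, whatever the
  sign of its exponent; off its zeros \<open>gam_fun\<close> is holomorphic.\<close>

definition rgam_fun :: "complex set \<Rightarrow> 'm \<Rightarrow> complex \<times> 'e cdual \<Rightarrow> complex"
  where "rgam_fun r \<beta> p = (\<Prod>x\<in>left_classes r. \<Prod>\<nu>\<in>odd_range (pair \<beta> x). \<Prod>n\<in>degs x. rGamma (Eta x n \<nu> p))"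

lemma rgam_fun_eq_0_iff:
  "rgam_fun r \<beta> p = 0 \<longleftrightarrow> (\<exists>x\<in>left_classes r. \<exists>\<nu>\<in>odd_range (pair \<beta> x). \<exists>n\<in>degs x. rGamma (Eta x n \<nu> p) = 0)"
  by (simp add: rgam_fun_def prod_zero_iff finite_left_classes)

lemma gam_fun_holo:
  obtains V where "V = {p\<in>mero_dom. rgam_fun r \<beta> p \<noteq> 0}" "holo_on V (gam_fun r \<beta>)"
proof -
  define V where "V = {p\<in>mero_dom. rgam_fun r \<beta> p \<noteq> 0}"
  have rh: "holo_on S (\<lambda>p. rGamma (Eta x n \<nu> p))" if "open S" for S x n \<nu>
    by (rule holo_on_compose_complex[of _ "Eta x n \<nu>" rGamma UNIV])
       (auto intro!: holo_on_Eta that holomorphic_intros)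
  have "holo_on mero_dom (rgam_fun r \<beta>)"
    unfolding rgam_fun_def[abs_def] by (intro holo_on_prod open_mero_dom rh)
  then have "open (mero_dom \<inter> rgam_fun r \<beta> -` (- {0}))"
    by (intro continuous_open_preimage holo_on_continuous open_mero_dom) auto
  also have "mero_dom \<inter> rgam_fun r \<beta> -` (- {0}) = V" by (auto simp: V_def)
  finally have V: "open V" .
  have nz: "rGamma (Eta x n \<nu> p) \<noteq> 0"
    if "p \<in> V" "x \<in> left_classes r" "\<nu> \<in> odd_range (pair \<beta> x)" "n \<in> degs x" for p x n \<nu>
    using that unfolding V_def mem_Collect_eq rgam_fun_eq_0_iff by blast
  have "holo_on V (gam_fun r \<beta>)"
    unfolding gam_fun_def[abs_def] Gamma_def
    by (intro holo_on_prod holo_on_power_int holo_on_inverse rh V) (use nz in auto)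
  then show ?thesis using that V_def by blast
qed

lemma Phi_eps_tendsto_id:
  assumes r: "is_ray r"
  shows "map_tendsto (half_plane r) (\<lambda>t. (Phi r t \<circ> eps_Z Z t) a) 0 a"
  unfolding map_tendsto_def
proof (intro exI[of _ "lim_fam r a"] conjI allI impI coeff_family_lim[OF r])
  fix \<delta> \<tau> \<theta> assume \<tau>: "\<tau> \<in> upper_half_plane" and reg: "mero_regular (Poly_Mapping.lookup a \<delta>) (\<tau>, \<theta>)"
  let ?F = "at 0 within half_plane r"
  have oD: "open (half_plane r)" by (rule open_half_plane[OF r])
  have "\<exists>v. (\<forall>\<^sub>F t in ?F. extends_at (lim_fam r a \<delta>) (\<tau>, \<theta>, t) (v t)) \<and>
      (v \<longlongrightarrow> mero_val (Poly_Mapping.lookup a \<delta>) (\<tau>, \<theta>)) ?F"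
  proof (cases "\<delta> \<in> Poly_Mapping.keys a")
    case False
    have "extends_at (\<lambda>_. 0) (\<tau>, \<theta>, t) 0" for t :: complex by (rule extends_at_holo[of UNIV "\<lambda>_. 0"]) (auto intro: holo_on_const)
    moreover have "value_at (\<lambda>_. 0) (\<tau>, \<theta>) = 0"
      by (rule value_atI, rule extends_at_holo[of UNIV "\<lambda>_. 0"]) (auto intro: holo_on_const)
    then have "mero_val 0 (\<tau>, \<theta>) = 0"
      unfolding mero_of_zero mero_val_of[OF mero_on_const[OF open_mero_dom]] by simp
    ultimately show ?thesis using False by (intro exI[of _ "\<lambda>t. 0"]) (simp add: lim_fam_def in_keys_iff)
  next
    case True
    define A where "A = value_at (rep a \<delta>) (\<tau>, \<theta>)"
    have reg': "regular_at (rep a \<delta>) (\<tau>, \<theta>)" and val: "mero_val (Poly_Mapping.lookup a \<delta>) (\<tau>, \<theta>) = A"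
      using reg \<tau> unfolding rep(2)[symmetric] by (auto simp: mero_regular_of[OF rep(1)] mero_val_of[OF rep(1)] A_def)
    have ext: "extends_at (lim_fam r a \<delta>) (\<tau>, \<theta>, t) (A * Psi_fun r \<delta> t (\<tau>, \<theta>))"
      if t: "t \<in> half_plane r" and nz: "rgam_fun r \<delta> (sh (\<tau>, \<theta>, t)) \<noteq> 0" for t
    proof -
      obtain V where V: "V = {p\<in>mero_dom. rgam_fun r \<delta> p \<noteq> 0}" "holo_on V (gam_fun r \<delta>)" by (rule gam_fun_holo)
      define U where "U = fam_dom (half_plane r) \<inter> sh -` V"
      have hU: "holo_on U (\<lambda>q. gam_fun r \<delta> (sh q))"
        unfolding U_def by (rule holo_on_shift[OF oD slope_holo V(2)])
      have "holo_on U (\<lambda>q. gam_fun r \<delta> (sh q) * elem_fun r \<delta> q)"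
        by (intro holo_on_mult hU holo_on_subset[OF holo_on_elem_fun[OF r] holo_on_open[OF hU]]) (auto simp: U_def)
      moreover have "(\<tau>, \<theta>, t) \<in> U" using t \<tau> nz by (simp add: U_def V(1)) (simp add: shift_map_def)
      moreover have "extends_at (\<lambda>q. rep a \<delta> (shift_map (\<lambda>t. 0) 0 q)) (\<tau>, \<theta>, t) A"
        by (rule extends_at_shift[OF oD _ rep(1)])
           (use t \<tau> extends_at_value[OF reg'] in \<open>auto simp: shift_map_def A_def\<close>)
      ultimately have "extends_at (\<lambda>q. rep a \<delta> (shift_map (\<lambda>t. 0) 0 q) * (gam_fun r \<delta> (sh q) * elem_fun r \<delta> q)) (\<tau>, \<theta>, t)
          (A * (gam_fun r \<delta> (sh (\<tau>, \<theta>, t)) * elem_fun r \<delta> (\<tau>, \<theta>, t)))"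
        by (intro extends_at_mult_holo)
      then show ?thesis using True by (simp add: lim_fam_def Psi_fun_split)
    qed
    have "\<forall>\<^sub>F t in ?F. \<forall>x\<in>left_classes r. \<forall>\<nu>\<in>odd_range (pair \<delta> x). \<forall>n\<in>degs x. Lambda (wgt x t) (Eta x n \<nu> (\<tau>, \<theta>)) \<noteq> 0"
      by (intro eventually_ball_finite ballI finite_left_classes finite_odd_range finite_keys
          tendsto_imp_eventually_ne[OF Lambda_wgt_limit[OF r]]) auto
    \<comment> \<open>\<open>Gamma\<close> takes the value 0 at its poles, so a nonzero value of
      Lambda certifies that the argument is not a pole.\<close>
    then have "\<forall>\<^sub>F t in ?F. rgam_fun r \<delta> (sh (\<tau>, \<theta>, t)) \<noteq> 0"
      by (rule eventually_mono) (unfold rgam_fun_eq_0_iff Eta_sh Lambda_Gamma_Lexp Gamma_def, auto)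
    moreover have "\<forall>\<^sub>F t in ?F. t \<in> half_plane r" by (auto simp: eventually_at intro: exI[of _ 1])
    ultimately have "\<forall>\<^sub>F t in ?F. extends_at (lim_fam r a \<delta>) (\<tau>, \<theta>, t) (A * Psi_fun r \<delta> t (\<tau>, \<theta>))"
      by eventually_elim (rule ext)
    moreover have "((\<lambda>t. A * Psi_fun r \<delta> t (\<tau>, \<theta>)) \<longlongrightarrow> A * 1) ?F"
      by (intro tendsto_intros Psi_fun_limit r)
    ultimately show ?thesis unfolding val by (intro exI[of _ "\<lambda>t. A * Psi_fun r \<delta> t (\<tau>, \<theta>)"]) simp
  qed
  then obtain v where v: "\<forall>\<^sub>F t in ?F. extends_at (lim_fam r a \<delta>) (\<tau>, \<theta>, t) (v t)"
    "(v \<longlongrightarrow> mero_val (Poly_Mapping.lookup a \<delta>) (\<tau>, \<theta>)) ?F" by blast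
  show "\<forall>\<^sub>F t in ?F. regular_at (lim_fam r a \<delta>) (\<tau>, \<theta>, t)"
    using v(1) by (rule eventually_mono) (rule regular_atI)
  have "\<forall>\<^sub>F t in ?F. v t = value_at (lim_fam r a \<delta>) (\<tau>, \<theta>, t)"
    using v(1) by (rule eventually_mono) (simp add: value_atI)
  then show "((\<lambda>t. value_at (lim_fam r a \<delta>) (\<tau>, \<theta>, t)) \<longlongrightarrow> mero_val (Poly_Mapping.lookup a \<delta>) (\<tau>, \<theta>)) ?F"
    by (rule Lim_transform_eventually[OF v(2)])
qed

section \<open>Growth as t tends to infinity\<close>

lemma pbound_elem_fun: "pbound (half_plane r) (\<lambda>t. elem_fun r \<beta> (\<tau>, \<theta>, t))"
  unfolding elem_fun_def
proof (intro pbound_prod pbound_power_int)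
  fix x n \<nu> assume "x \<in> left_classes r"
  then have "Z (x, 0) / (2 * of_real pi * \<i>) \<noteq> 0" using Z_nonzero left_classes_active by simp
  from pbound_Lexp[OF this, of "half_plane r" "Eta x n \<nu> (\<tau>, \<theta>)"]
  show "pbound (half_plane r) (\<lambda>t. Lexp (wgt x (snd (snd (\<tau>, \<theta>, t)))) (Eta x n \<nu> (fst (\<tau>, \<theta>, t), fst (snd (\<tau>, \<theta>, t)))))"
    by (simp add: wgt_def)
qed

text \<open>The given \<open>t\<^sub>0\<close> with a nonzero value supplies, through
  \<open>slope t\<^sub>0\<close>, the regular point on the line from which
  \<open>mero_on_line_growth\<close> starts.\<close>

lemma Phi_bounded_growth:
  assumes r: "is_ray r"
  shows "bounded_growth (half_plane r) (\<lambda>t. Phi r t a)"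
  unfolding bounded_growth_def
proof (intro exI[of _ "sol_fam r a"] conjI allI impI coeff_family_sol[OF r])
  fix \<delta> \<tau> \<theta> assume \<tau>: "\<tau> \<in> upper_half_plane"
    and ex: "\<exists>t\<in>half_plane r. regular_at (sol_fam r a \<delta>) (\<tau>, \<theta>, t) \<and> value_at (sol_fam r a \<delta>) (\<tau>, \<theta>, t) \<noteq> 0"
  have oD: "open (half_plane r)" by (rule open_half_plane[OF r])
  obtain t\<^sub>0 where t\<^sub>0: "t\<^sub>0 \<in> half_plane r" "regular_at (sol_fam r a \<delta>) (\<tau>, \<theta>, t\<^sub>0)" "value_at (sol_fam r a \<delta>) (\<tau>, \<theta>, t\<^sub>0) \<noteq> 0"
    using ex by blast
  have key: "\<delta> \<in> Poly_Mapping.keys a"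
  proof (rule ccontr)
    assume "\<delta> \<notin> Poly_Mapping.keys a"
    then have "sol_fam r a \<delta> = (\<lambda>_. 0)" by (simp add: sol_fam_def)
    moreover have "value_at (\<lambda>_. 0) (\<tau>, \<theta>, t\<^sub>0) = 0"
      by (rule value_atI, rule extends_at_holo[of UNIV "\<lambda>_. 0"]) (auto intro: holo_on_const)
    ultimately show False using t\<^sub>0(3) by simp
  qed
  define B where "B = (\<lambda>p. rep a \<delta> p * gam_fun r \<delta> p)"
  define K where "K = (\<lambda>q. exp (- Z (0, \<delta>) / snd (snd q)) * elem_fun r \<delta> q)"
  have Bm: "mero_on mero_dom B" unfolding B_def by (intro mero_on_mult rep(1) mero_on_gam_fun)
  have "(\<lambda>t. exp (- Z (0, \<delta>) / t)) holomorphic_on half_plane r"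
    using half_plane_nonzero by (intro holomorphic_intros) auto
  from fam_half_plane_t[OF r this] have Kh: "holo_on (fam_dom (half_plane r)) K"
    unfolding K_def by (intro holo_on_mult holo_on_elem_fun r)
  have K0: "K (\<tau>, \<theta>, t) \<noteq> 0" if "t \<in> half_plane r" for t and \<tau> \<theta>
    using elem_fun_nonzero[OF that] by (simp add: K_def)
  have F: "sol_fam r a \<delta> = (\<lambda>q. B (sh q) * K q)" using key by (simp add: sol_fam_def B_def K_def)
  have line: "sh (\<tau>, \<theta>, t) = (\<tau>, \<theta>) + scaleC (slope t) (0, Z_e Z)" for t
    by (simp add: shift_map_def scaleC_prod_def)
  have fam: "fam (half_plane r) (sol_fam r a \<delta>)"
    unfolding F using fam_mult[OF fam_shift[OF oD slope_holo Bm] fam_holo[OF Kh]] .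
  have dom: "(\<tau>, \<theta>) + scaleC s (0, Z_e Z) \<in> mero_dom" for s using \<tau> by (simp add: scaleC_prod_def)
  define c where "c = value_at (sol_fam r a \<delta>) (\<tau>, \<theta>, t\<^sub>0)"
  \<comment> \<open>Regularity of the family in (\<tau>, \<theta>, t) is restricted to the slice
    \<open>t\<^sub>0\<close>, freed of the nonvanishing factor K and transported by the translation;
    this yields regularity of B at a point of the line.\<close>
  have "extends_at (\<lambda>p. sol_fam r a \<delta> (slice_map t\<^sub>0 p)) (\<tau>, \<theta>) c"
    by (rule fam_slice(3)[OF fam t\<^sub>0(1)]) (use extends_at_value[OF t\<^sub>0(2)] \<tau> in \<open>simp_all add: c_def\<close>)
  moreover have sub: "mero_dom \<subseteq> slice_map t\<^sub>0 -` fam_dom (half_plane r)"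
    using t\<^sub>0(1) by (auto simp: slice_map_def)
  have Kinv: "holo_on mero_dom (\<lambda>p. inverse (K (slice_map t\<^sub>0 p)))"
    by (rule holo_on_inverse[OF holo_on_subset[OF holo_on_slice[OF Kh] open_mero_dom sub]])
       (use K0[OF t\<^sub>0(1)] in \<open>auto simp: slice_map_def\<close>)
  ultimately have "extends_at (\<lambda>p. sol_fam r a \<delta> (slice_map t\<^sub>0 p) * inverse (K (slice_map t\<^sub>0 p))) (\<tau>, \<theta>)
      (c * inverse (K (slice_map t\<^sub>0 (\<tau>, \<theta>))))"
    using \<tau> by (intro extends_at_mult_holo[OF _ Kinv]) simp_all
  then have "extends_at (\<lambda>p. B (shear (- charge_shift t\<^sub>0) 0 p)) (\<tau>, \<theta>) (c * inverse (K (slice_map t\<^sub>0 (\<tau>, \<theta>))))"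
  proof (rule extends_at_transform[OF _ open_mero_dom])
    show "sol_fam r a \<delta> (slice_map t\<^sub>0 p) * inverse (K (slice_map t\<^sub>0 p)) = B (shear (- charge_shift t\<^sub>0) 0 p)" for p
      using K0[OF t\<^sub>0(1), of "fst p" "snd p"] by (simp add: F sh_slice slice_map_def)
         (simp add: sh_slice[unfolded slice_map_def])
  qed (use \<tau> in simp)
  then have "extends_at B (sh (\<tau>, \<theta>, t\<^sub>0)) (c * inverse (K (\<tau>, \<theta>, t\<^sub>0)))"
    using sh_slice[of t\<^sub>0 "(\<tau>, \<theta>)"] by (simp add: extends_at_shear_iff)
  moreover have "c * inverse (K (\<tau>, \<theta>, t\<^sub>0)) \<noteq> 0" using t\<^sub>0(3) K0[OF t\<^sub>0(1)] by (simp add: c_def)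
  ultimately obtain n c' e where g: "c' > 0" "e > 0" "e \<le> 1" "\<And>s. s \<in> ball 0 e - {0} \<Longrightarrow>
      regular_at B ((\<tau>, \<theta>) + scaleC s (0, Z_e Z)) \<and>
      c' * cmod s ^ n \<le> cmod (value_at B ((\<tau>, \<theta>) + scaleC s (0, Z_e Z))) \<and>
      cmod (value_at B ((\<tau>, \<theta>) + scaleC s (0, Z_e Z))) * (c' * cmod s ^ n) \<le> 1"
    unfolding line by (rule mero_on_line_growth[OF Bm dom]) (rule that, assumption+)
  define b where "b = (\<lambda>s. value_at B ((\<tau>, \<theta>) + scaleC s (0, Z_e Z)))"
  have "pbound (half_plane r) (\<lambda>t. b (slope t) * K (\<tau>, \<theta>, t))"
  proof (rule pbound_mult)
    show "pbound (half_plane r) (\<lambda>t. b (slope t))"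
      unfolding slope_def by (rule pbound_of_line_growth[OF g(1,2), of _ n]) (use g(4) in \<open>auto simp: b_def\<close>)
    show "pbound (half_plane r) (\<lambda>t. K (\<tau>, \<theta>, t))"
      using pbound_mult[OF pbound_exp_div[of _ "- Z (0, \<delta>)"] pbound_elem_fun] by (simp add: K_def)
  qed
  then obtain k R where k: "k > 0" "R > 0" "\<forall>t\<in>half_plane r. cmod t > R \<longrightarrow>
      cmod t powr (- k) < cmod (b (slope t) * K (\<tau>, \<theta>, t)) \<and> cmod (b (slope t) * K (\<tau>, \<theta>, t)) < cmod t powr k"
    by (rule pbound_powr)
  have ext: "extends_at (sol_fam r a \<delta>) (\<tau>, \<theta>, t) (b (slope t) * K (\<tau>, \<theta>, t))"
    if t: "t \<in> half_plane r" "cmod t > 1 / e" for t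
  proof -
    have t0: "t \<noteq> 0" by (rule half_plane_nonzero[OF t(1)])
    have "cmod (slope t) = 1 / (2 * pi * cmod t)" by (simp add: slope_def norm_divide norm_mult)
    also have "\<dots> < 1 / cmod t"
      using t0 pi_gt_zero pi_ge_two by (intro divide_strict_left_mono) auto
    also have "\<dots> < e" using t(2) t0 g(2) by (simp add: field_simps)
    finally have "slope t \<in> ball 0 e - {0}" using t0 by (simp add: slope_def)
    then have "extends_at B (sh (\<tau>, \<theta>, t)) (b (slope t))"
      unfolding line b_def using g(4) extends_at_value by blast
    then have "extends_at (\<lambda>q. B (sh q)) (\<tau>, \<theta>, t) (b (slope t))"
      by (intro extends_at_shift[OF oD slope_holo Bm]) (use t \<tau> in auto)
    from extends_at_mult_holo[OF this Kh] show ?thesis using t \<tau> by (simp add: F)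
  qed
  show "\<exists>k>0. \<exists>R>0. \<forall>t\<in>half_plane r. cmod t > R \<longrightarrow> regular_at (sol_fam r a \<delta>) (\<tau>, \<theta>, t) \<and>
      cmod t powr (- k) < cmod (value_at (sol_fam r a \<delta>) (\<tau>, \<theta>, t)) \<and>
      cmod (value_at (sol_fam r a \<delta>) (\<tau>, \<theta>, t)) < cmod t powr k"
  proof (rule exI[of _ k], rule conjI[OF k(1)], rule exI[of _ "max R (1 / e)"], intro conjI ballI impI)
    show "max R (1 / e) > 0" using k by auto
    fix t assume t: "t \<in> half_plane r" "cmod t > max R (1 / e)"
    from t have e: "extends_at (sol_fam r a \<delta>) (\<tau>, \<theta>, t) (b (slope t) * K (\<tau>, \<theta>, t))" by (intro ext) auto
    show "regular_at (sol_fam r a \<delta>) (\<tau>, \<theta>, t)" by (rule regular_atI[OF e])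
    show "cmod t powr (- k) < cmod (value_at (sol_fam r a \<delta>) (\<tau>, \<theta>, t))"
      "cmod (value_at (sol_fam r a \<delta>) (\<tau>, \<theta>, t)) < cmod t powr k"
      unfolding value_atI[OF e] using k(3) t by auto
  qed
qed

theorem Phi_solves_QRH: "solves_QRH form Z \<Omega> Phi"
  unfolding solves_QRH_def Let_def
proof (intro conjI allI impI ballI)
  fix r t assume "t \<in> half_plane r"
  then show "q_aut form (Phi r t)" by (rule q_aut_Phi[OF half_plane_nonzero])
next
  fix r a assume "nonactive_ray Z \<Omega> r"
  then have r: "is_ray r" by (simp add: nonactive_ray_def)
  show "meromorphic_map (half_plane r) (\<lambda>t. Phi r t a)"
    unfolding meromorphic_map_def using coeff_family_sol[OF r] by blast
  show "map_tendsto (half_plane r) (\<lambda>t. (Phi r t \<circ> eps_Z Z t) a) 0 a" by (rule Phi_eps_tendsto_id[OF r])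
  show "bounded_growth (half_plane r) (\<lambda>t. Phi r t a)" by (rule Phi_bounded_growth[OF r])
next
  fix l assume "active_ray Z \<Omega> l"
  then obtain \<epsilon>\<^sub>0 where "\<epsilon>\<^sub>0 > 0" "\<And>\<epsilon>\<^sub>1 \<epsilon>\<^sub>2. 0 < \<epsilon>\<^sub>1 \<Longrightarrow> \<epsilon>\<^sub>1 < \<epsilon>\<^sub>0 \<Longrightarrow> 0 < \<epsilon>\<^sub>2 \<Longrightarrow> \<epsilon>\<^sub>2 < \<epsilon>\<^sub>0 \<Longrightarrow>
    nonactive_ray Z \<Omega> (rotate_ray (- \<epsilon>\<^sub>1) l) \<and> nonactive_ray Z \<Omega> (rotate_ray \<epsilon>\<^sub>2 l) \<and>
    (\<forall>t\<in>half_plane (rotate_ray (- \<epsilon>\<^sub>1) l) \<inter> half_plane (rotate_ray \<epsilon>\<^sub>2 l).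
      Phi (rotate_ray (- \<epsilon>\<^sub>1) l) t = Phi (rotate_ray \<epsilon>\<^sub>2 l) t \<circ> S_q form Z \<Omega> l)"
    by (rule wall_crossing) (rule that, assumption+)
  then show "\<exists>\<epsilon>\<^sub>0>0. \<forall>\<epsilon>\<^sub>1 \<epsilon>\<^sub>2. 0 < \<epsilon>\<^sub>1 \<and> \<epsilon>\<^sub>1 < \<epsilon>\<^sub>0 \<and> 0 < \<epsilon>\<^sub>2 \<and> \<epsilon>\<^sub>2 < \<epsilon>\<^sub>0 \<longrightarrow>
    nonactive_ray Z \<Omega> (rotate_ray (- \<epsilon>\<^sub>1) l) \<and> nonactive_ray Z \<Omega> (rotate_ray \<epsilon>\<^sub>2 l) \<and>
    (\<forall>t\<in>half_plane (rotate_ray (- \<epsilon>\<^sub>1) l) \<inter> half_plane (rotate_ray \<epsilon>\<^sub>2 l).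
      Phi (rotate_ray (- \<epsilon>\<^sub>1) l) t = Phi (rotate_ray \<epsilon>\<^sub>2 l) t \<circ> S_q form Z \<Omega> l)"
    by blast
next
  fix r \<phi> t
  assume "is_ray r \<and> 0 < \<phi> \<and> \<phi> < pi \<and> (\<forall>\<psi>\<in>{0..\<phi>}. nonactive_ray Z \<Omega> (rotate_ray \<psi> r))"
    "t \<in> half_plane r \<inter> half_plane (rotate_ray \<phi> r)"
  then show "Phi r t = Phi (rotate_ray \<phi> r) t"
    by (intro Phi_const_on_chamber half_plane_nonzero) auto
qed

end

theorem theorem5p1:
  fixes form :: "('e::free_abelian_group \<times> 'm::free_abelian_group) \<Rightarrow> 'e \<times> 'm \<Rightarrow> int"
    and Z :: "'e \<times> 'm \<Rightarrow> complex"
    and \<Omega> :: "'e \<times> 'm \<Rightarrow> (int \<Rightarrow>\<^sub>0 rat)"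
    and \<sigma> :: "'e \<times> 'm \<Rightarrow> int"
  assumes "refined_BPS_structure form Z \<Omega>"
    and "BPS_finite \<Omega>" and "BPS_uncoupled form \<Omega>" and "BPS_palindromic \<Omega>" and "BPS_integral \<Omega>"
    and "quadratic_refinement form \<sigma>"
    and "\<And>\<gamma> n. Poly_Mapping.lookup (\<Omega> \<gamma>) n \<noteq> 0 \<Longrightarrow> \<sigma> \<gamma> = sign_pow (n + 1)"
    and "\<And>x \<delta>. \<delta> \<noteq> 0 \<Longrightarrow> \<Omega> (x, \<delta>) = 0"
    and "\<And>x x'. form (x, 0) (x', 0) = 0"
    and "\<And>\<delta> \<delta>'. form (0, \<delta>) (0, \<delta>') = 0"
  shows "(\<forall>r t. nonactive_ray Z \<Omega> r \<and> t \<in> half_plane r \<longrightarrow> (\<exists>!\<psi>. is_Psi form Z \<Omega> r t \<psi>)) \<and>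
    solves_QRH form Z \<Omega> (\<lambda>r t. Psi form Z \<Omega> r t \<circ> inv (eps_Z Z t))"
proof -
  interpret electric_BPS form Z \<Omega>
    using assms by unfold_locales
  show ?thesis using ex1_Psi half_plane_nonzero Phi_solves_QRH by blast
qed

end
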